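(* Let $1<p<2$, $\epsilon,\tau>0$ with $\epsilon+\tau\le1$, and let $N$ be a positive integer. Let $\mathcal{J}(\Omega_{(\epsilon,\tau)})$ be a quadratic iso-parametric triangulation of the ring $\Omega_{(\epsilon,\tau)}=\{\boldsymbol{x}\in\mathbb{R}^2:\epsilon\le|\boldsymbol{x}|\le\epsilon+\tau\}$ consisting either of one layer of evenly distributed elements of types A and B, or of one layer of evenly distributed elements of types A, C and D, with $N$ evenly spaced nodes (element vertices) on the outer circle, and let $\Omega^{\mathcal{J}}_{(\epsilon,\tau)}=\bigcup_{T\in\mathcal{J}(\Omega_{(\epsilon,\tau)})}T$. Let $\boldsymbol{u}(\boldsymbol{x})=\frac{r(|\boldsymbol{x}|)}{|\boldsymbol{x}|}\boldsymbol{x}$ be a cavity deformation and $\Pi\boldsymbol{u}$ its elementwise quadratic iso-parametric interpolation function. Then the elastic energies satisfy $$E_1(\Pi\boldsymbol{u};\Omega^{\mathcal{J}}_{(\epsilon,\tau)})=E_1(\boldsymbol{u};\Omega^{\mathcal{J}}_{(\epsilon,\tau)})\Big(1+O\big(\tau^2+N^{-2}+\tfrac{\epsilon}{\tau}N^{-4}\big)\Big),$$ $$E_2(\Pi\boldsymbol{u};\Omega^{\mathcal{J}}_{(\epsilon,\tau)})=E_2(\boldsymbol{u};\Omega^{\mathcal{J}}_{(\epsilon,\tau)})+O\big(\tau^3+(\epsilon+\tau)\tau N^{-2}+N^{-4}\big),$$ $$E(\Pi\boldsymbol{u};\Omega^{\mathcal{J}}_{(\epsilon,\tau)})=E(\boldsymbol{u};\Omega^{\mathcal{J}}_{(\epsilon,\tau)})\Big(1+O\big(\tau^2+N^{-2}+\tfrac{N^{-4}}{\tau}\big)\Big),$$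 $$E(\boldsymbol{u};\Omega^{\mathcal{J}}_{(\epsilon,\tau)})=E(\boldsymbol{u};\Omega_{(\epsilon,\tau)})\Big(1+O\big(\tau^2+N^{-2}+\tfrac{\epsilon}{\tau}N^{-4}\big)\Big)\sim A(\epsilon,\tau),$$ where $A(\epsilon,\tau)=(2-p)\int_\epsilon^{\epsilon+\tau}t^{1-p}\,dt=(\epsilon+\tau)^{2-p}-\epsilon^{2-p}$.
   Context: Energy: $W(F)=\omega|F|^p+g(\det F)$ for $2\times2$ matrices $F$ with $\det F>0$, where $\omega>0$, $1<p<2$, and $g:(0,\infty)\to(0,\infty)$ is continuously differentiable and strictly convex with $g(d)\to+\infty$ as $d\to0$ and $g(d)/d\to+\infty$ as $d\to+\infty$; $|F|$ is the Frobenius norm. For $S\subset\mathbb{R}^2$: $E_1(\boldsymbol{v};S)=\omega\int_S|\nabla\boldsymbol{v}|^p\,d\boldsymbol{x}$, $E_2(\boldsymbol{v};S)=\int_S g(\det\nabla\boldsymbol{v})\,d\boldsymbol{x}$, $E(\boldsymbol{v};S)=E_1(\boldsymbol{v};S)+E_2(\boldsymbol{v};S)$. Energies are considered for deformations that are orientation preserving ($\det\nabla\boldsymbol{v}>0$ a.e.), so that $g(\det\nabla\boldsymbol{v})$ is defined. Cavity deformation: $\boldsymbol{u}(\boldsymbol{x})=\frac{r(|\boldsymbol{x}|)}{|\boldsymbol{x}|}\boldsymbol{x}$ on $\mathbb{R}^2$ points with $0<|\boldsymbol{x}|\le1$, where $r$ is defined on $(0,1]$ and is smooth, positive, increasing and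 convex, with $r^{(j)}$ bounded for $j=0,1,2,3$, $\inf_{R\in(0,1]}r(R)>0$, and $mR\le r'(R)\le MR$ for some constants $0<m<M$. Reference element: $\hat T=\{(\hat x_1,\hat x_2):\hat x_1,\hat x_2\ge 0,\ \hat x_1+\hat x_2\le 1\}$, with barycentric coordinates $\hat\lambda_1=1-\hat x_1-\hat x_2$, $\hat\lambda_2=\hat x_1$, $\hat\lambda_3=\hat x_2$, and quadratic shape functions $\hat\mu_i=\hat\lambda_i(2\hat\lambda_i-1)$ ($1\le i\le 3$), $\hat\mu_{ij}=4\hat\lambda_i\hat\lambda_j$ ($1\le i<j\le 3$). Given points $\boldsymbol{a}_i,\boldsymbol{a}_{ij}\in\mathbb{R}^2$, the quadratic map is $F_T(\hat{\boldsymbol{x}})=\sum_{i=1}^3\boldsymbol{a}_i\hat\mu_i(\hat{\boldsymbol{x}})+\sum_{1\le i<j\le3}\boldsymbol{a}_{ij}\hat\mu_{ij}(\hat{\boldsymbol{x}})$, and $T=F_T(\hat T)$ is a curved triangular element. Interpolation: on each element $T$, for $\boldsymbol{x}=F_T(\hat{\boldsymbol{x}})$, $\Pi\boldsymbol{u}(\boldsymbol{x})=\sum_{i=1}^3\boldsymbol{u}(\boldsymbol{a}_i)\hat\mu_i(\hat{\boldsymbol{x}})+\sum_{1\le i<j\le3}\boldsymbol{u}(\boldsymbol{a}_{ij})\hat\mu_{ij}(\hat{\boldsymbol{x}})$. Representative elements with parameters $(\epsilon,\tau,N)$: for $t>0$ and $\alpha\in\mathbb{R}$ write $P(t,\alpha)=t(\cos\alpha,\sin\alpha)$,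 and put $t_0=\epsilon$, $t_{1/2}=\epsilon+\tau/2$, $t_1=\epsilon+\tau$. Type A: $\boldsymbol{a}_1=P(t_0,0)$, $\boldsymbol{a}_2=P(t_1,-\frac{\pi}{N})$, $\boldsymbol{a}_3=P(t_1,\frac{\pi}{N})$, $\boldsymbol{a}_{12}=P(t_{1/2},-\frac{\pi}{2N})$, $\boldsymbol{a}_{13}=P(t_{1/2},\frac{\pi}{2N})$, $\boldsymbol{a}_{23}=P(t_1,0)$. Type B: $\boldsymbol{a}_1=P(t_1,0)$, $\boldsymbol{a}_2=P(t_0,\frac{\pi}{N})$, $\boldsymbol{a}_3=P(t_0,-\frac{\pi}{N})$, $\boldsymbol{a}_{12}=P(t_{1/2},\frac{\pi}{2N})$, $\boldsymbol{a}_{13}=P(t_{1/2},-\frac{\pi}{2N})$, $\boldsymbol{a}_{23}=P(t_0,0)$. Type C: $\boldsymbol{a}_1=P(t_0,0)$, $\boldsymbol{a}_2=P(t_1,0)$, $\boldsymbol{a}_3=P(t_0,\frac{\pi}{N})$, $\boldsymbol{a}_{12}=P(t_{1/2},0)$, $\boldsymbol{a}_{13}=P(t_0,\frac{\pi}{2N})$, $\boldsymbol{a}_{23}=P(t_{1/2},\frac{\pi}{2N})$. Type D: $\boldsymbol{a}_1=P(t_0,0)$, $\boldsymbol{a}_2=P(t_0,-\frac{\pi}{N})$, $\boldsymbol{a}_3=P(t_1,0)$, $\boldsymbol{a}_{12}=P(t_0,-\frac{\pi}{2N})$, $\boldsymbol{a}_{13}=P(t_{1/2},0)$, $\boldsymbol{a}_{23}=P(t_{1/2},-\frac{\pi}{2N})$.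 Layers: a layer of types A and B consists (up to a common rotation) of the $N$ rotations by $\frac{2\pi j}{N}$ of the representative A element and the $N$ rotations by $\frac{\pi}{N}+\frac{2\pi j}{N}$ of the representative B element, $j=0,\dots,N-1$ ($2N$ elements). A layer of types A, C and D is the same with each B element replaced by the pair consisting of the C and the D element rotated by the same angle ($3N$ elements). $O(\Psi)$ denotes a quantity bounded in absolute value by $C\Psi$, with a generic constant $C$ (which may depend on $r,p,\omega,g$) independent of $\epsilon$, $\tau$ and $N$; $\Phi\sim\Psi$ means that $C^{-1}\Psi\le\Phi\le C\Psi$ for such a constant $C$.
   Formalization: For the estimates of E_2(Πu) and E(Πu), det ∇Πu > 0 a.e. is strengthened to κ ≤ det ∇Πu ≤ 1/κ a.e. for an arbitrary κ > 0, and the O-constant may depend on κ; with det > 0 alone E_2(Πu) can be infinite. *)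

theory Defs
  imports "HOL-Analysis.Analysis"
begin

text \<open>The values of \<open>g\<close> on \<open>(-\<infinity>,0]\<close> are irrelevant.\<close>

definition volumetric_density :: "(real \<Rightarrow> real) \<Rightarrow> bool" where
  "volumetric_density g \<longleftrightarrow>
     (\<forall>d>0. 0 < g d) \<and>
     g C1_differentiable_on {0<..} \<and>
     (\<forall>x>0. \<forall>y>0. \<forall>t\<in>{0<..<1}. x \<noteq> y \<longrightarrow>
        g ((1 - t) * x + t * y) < (1 - t) * g x + t * g y) \<and>
     filterlim g at_top (at_right 0) \<and>
     filterlim (\<lambda>d. g d / d) at_top at_top"

text \<open>The gradient of \<open>v\<close> is \<open>jacobian v (at x)\<close>, and the Euclidean norm of the type
  \<open>real^2^2\<close> is the Frobenius norm. The integrals are Lebesgue integrals, hence \<open>0\<close> if the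
  integrand is not integrable; \<open>finite_E1\<close> and \<open>finite_E2\<close> say that this does not happen.\<close>

definition E1 :: "real \<Rightarrow> real \<Rightarrow> (real^2 \<Rightarrow> real^2) \<Rightarrow> (real^2) set \<Rightarrow> real" where
  "E1 \<omega> p v S = \<omega> * (LINT x:S|lebesgue. norm (jacobian v (at x)) powr p)"

definition E2 :: "(real \<Rightarrow> real) \<Rightarrow> (real^2 \<Rightarrow> real^2) \<Rightarrow> (real^2) set \<Rightarrow> real" where
  "E2 g v S = (LINT x:S|lebesgue. g (det (jacobian v (at x))))"

definition energy ::
  "real \<Rightarrow> real \<Rightarrow> (real \<Rightarrow> real) \<Rightarrow> (real^2 \<Rightarrow> real^2) \<Rightarrow> (real^2) set \<Rightarrow> real" where
  "energy \<omega> p g v S = E1 \<omega> p v S + E2 g v S"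

definition finite_E1 :: "real \<Rightarrow> (real^2 \<Rightarrow> real^2) \<Rightarrow> (real^2) set \<Rightarrow> bool" where
  "finite_E1 p v S \<longleftrightarrow>
     set_integrable lebesgue S (\<lambda>x. norm (jacobian v (at x)) powr p)"

definition finite_E2 :: "(real \<Rightarrow> real) \<Rightarrow> (real^2 \<Rightarrow> real^2) \<Rightarrow> (real^2) set \<Rightarrow> bool" where
  "finite_E2 g v S \<longleftrightarrow> set_integrable lebesgue S (\<lambda>x. g (det (jacobian v (at x))))"

text \<open>Orientation preservation with the quantitative bound \<open>\<kappa> \<le> det \<nabla>v \<le> 1/\<kappa>\<close>. A bound of
  this kind is needed for constants that do not depend on the mesh: \<open>g\<close> may grow
  arbitrarily fast at \<open>0\<close> and at \<open>\<infinity>\<close>, and on meshes with \<open>det \<nabla>v > 0\<close> but \<open>det \<nabla>v\<close> close to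
  \<open>0\<close> (or very large) at a single node, the integral of \<open>g (det \<nabla>v)\<close> is not controlled by
  the mesh parameters.\<close>

definition uniformly_orientation_preserving ::
  "real \<Rightarrow> (real^2 \<Rightarrow> real^2) \<Rightarrow> (real^2) set \<Rightarrow> bool" where
  "uniformly_orientation_preserving \<kappa> v S \<longleftrightarrow> 0 < \<kappa> \<and>
     (AE x\<in>S in lebesgue. \<kappa> \<le> det (jacobian v (at x)) \<and> det (jacobian v (at x)) \<le> 1 / \<kappa>)"

text \<open>\<open>D j\<close> is the \<open>j\<close>-th derivative of \<open>r\<close> on \<open>(0,1]\<close>, one-sided at \<open>1\<close>.\<close>

definition cavity_profile :: "(real \<Rightarrow> real) \<Rightarrow> bool" where
  "cavity_profile r \<longleftrightarrow>
     (\<exists>D :: nat \<Rightarrow> real \<Rightarrow> real.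
        (\<forall>R\<in>{0<..1}. D 0 R = r R) \<and>
        (\<forall>j. \<forall>R\<in>{0<..1}. (D j has_real_derivative D (Suc j) R) (at R within {0<..1})) \<and>
        (\<forall>j\<le>3. bounded (D j ` {0<..1})) \<and>
        (\<exists>m M. 0 < m \<and> m < M \<and> (\<forall>R\<in>{0<..1}. m * R \<le> D 1 R \<and> D 1 R \<le> M * R))) \<and>
     (\<forall>R\<in>{0<..1}. 0 < r R) \<and>
     strict_mono_on {0<..1} r \<and>
     convex_on {0<..1} r \<and>
     0 < (INF R\<in>{0<..1}. r R)"

definition cavity_map :: "(real \<Rightarrow> real) \<Rightarrow> real^2 \<Rightarrow> real^2" where
  "cavity_map r x = (r (norm x) / norm x) *\<^sub>R x"

definition ref_triangle :: "(real^2) set" where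
  "ref_triangle = {x. 0 \<le> x$1 \<and> 0 \<le> x$2 \<and> x$1 + x$2 \<le> 1}"

text \<open>The constructors stand for the nodes \<open>a\<^sub>1, a\<^sub>2, a\<^sub>3, a\<^sub>1\<^sub>2, a\<^sub>1\<^sub>3, a\<^sub>2\<^sub>3\<close>. A curved element is
  represented by the family of its six nodes.\<close>

datatype node = N1 | N2 | N3 | N12 | N13 | N23

type_synonym elem = "node \<Rightarrow> real^2"

definition bary1 :: "real^2 \<Rightarrow> real" where "bary1 x = 1 - x$1 - x$2"
definition bary2 :: "real^2 \<Rightarrow> real" where "bary2 x = x$1"
definition bary3 :: "real^2 \<Rightarrow> real" where "bary3 x = x$2"

fun shape :: "node \<Rightarrow> real^2 \<Rightarrow> real" where
  "shape N1 x = bary1 x * (2 * bary1 x - 1)"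
| "shape N2 x = bary2 x * (2 * bary2 x - 1)"
| "shape N3 x = bary3 x * (2 * bary3 x - 1)"
| "shape N12 x = 4 * bary1 x * bary2 x"
| "shape N13 x = 4 * bary1 x * bary3 x"
| "shape N23 x = 4 * bary2 x * bary3 x"

definition quad_map :: "elem \<Rightarrow> real^2 \<Rightarrow> real^2" where
  "quad_map a x =
     shape N1 x *\<^sub>R a N1 + shape N2 x *\<^sub>R a N2 + shape N3 x *\<^sub>R a N3 +
     shape N12 x *\<^sub>R a N12 + shape N13 x *\<^sub>R a N13 + shape N23 x *\<^sub>R a N23"

definition element :: "elem \<Rightarrow> (real^2) set" where
  "element a = quad_map a ` ref_triangle"

definition meshed_region :: "elem set \<Rightarrow> (real^2) set" where
  "meshed_region J = (\<Union>a\<in>J. element a)"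

text \<open>Invertibility of the maps \<open>F\<^sub>T\<close> on the reference element is part of being a triangulation;
  the interpolant below is not defined without it.\<close>

definition triangulation :: "elem set \<Rightarrow> bool" where
  "triangulation J \<longleftrightarrow>
     (\<forall>a\<in>J. inj_on (quad_map a) ref_triangle) \<and>
     (\<forall>a\<in>J. \<forall>b\<in>J. a \<noteq> b \<longrightarrow> interior (element a) \<inter> interior (element b) = {})"

text \<open>On a common edge of two elements of the meshes below both elements give the same value, so
  the choice made by \<open>SOME\<close> is immaterial.\<close>

definition interpolant :: "elem set \<Rightarrow> (real^2 \<Rightarrow> real^2) \<Rightarrow> real^2 \<Rightarrow> real^2" where
  "interpolant J u x =
     (let a = (SOME a. a \<in> J \<and> x \<in> element a)
      in quad_map (u \<circ> a) (inv_into ref_triangle (quad_map a) x))"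

definition polar :: "real \<Rightarrow> real \<Rightarrow> real^2" where
  "polar t \<alpha> = vector [t * cos \<alpha>, t * sin \<alpha>]"

definition rot :: "real \<Rightarrow> real^2 \<Rightarrow> real^2" where
  "rot \<phi> x = vector [cos \<phi> * x$1 - sin \<phi> * x$2, sin \<phi> * x$1 + cos \<phi> * x$2]"

fun elem_A :: "real \<Rightarrow> real \<Rightarrow> nat \<Rightarrow> elem" where
  "elem_A \<epsilon> \<tau> N N1 = polar \<epsilon> 0"
| "elem_A \<epsilon> \<tau> N N2 = polar (\<epsilon> + \<tau>) (- (pi / real N))"
| "elem_A \<epsilon> \<tau> N N3 = polar (\<epsilon> + \<tau>) (pi / real N)"
| "elem_A \<epsilon> \<tau> N N12 = polar (\<epsilon> + \<tau> / 2) (- (pi / (2 * real N)))"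
| "elem_A \<epsilon> \<tau> N N13 = polar (\<epsilon> + \<tau> / 2) (pi / (2 * real N))"
| "elem_A \<epsilon> \<tau> N N23 = polar (\<epsilon> + \<tau>) 0"

fun elem_B :: "real \<Rightarrow> real \<Rightarrow> nat \<Rightarrow> elem" where
  "elem_B \<epsilon> \<tau> N N1 = polar (\<epsilon> + \<tau>) 0"
| "elem_B \<epsilon> \<tau> N N2 = polar \<epsilon> (pi / real N)"
| "elem_B \<epsilon> \<tau> N N3 = polar \<epsilon> (- (pi / real N))"
| "elem_B \<epsilon> \<tau> N N12 = polar (\<epsilon> + \<tau> / 2) (pi / (2 * real N))"
| "elem_B \<epsilon> \<tau> N N13 = polar (\<epsilon> + \<tau> / 2) (- (pi / (2 * real N)))"
| "elem_B \<epsilon> \<tau> N N23 = polar \<epsilon> 0"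

fun elem_C :: "real \<Rightarrow> real \<Rightarrow> nat \<Rightarrow> elem" where
  "elem_C \<epsilon> \<tau> N N1 = polar \<epsilon> 0"
| "elem_C \<epsilon> \<tau> N N2 = polar (\<epsilon> + \<tau>) 0"
| "elem_C \<epsilon> \<tau> N N3 = polar \<epsilon> (pi / real N)"
| "elem_C \<epsilon> \<tau> N N12 = polar (\<epsilon> + \<tau> / 2) 0"
| "elem_C \<epsilon> \<tau> N N13 = polar \<epsilon> (pi / (2 * real N))"
| "elem_C \<epsilon> \<tau> N N23 = polar (\<epsilon> + \<tau> / 2) (pi / (2 * real N))"

fun elem_D :: "real \<Rightarrow> real \<Rightarrow> nat \<Rightarrow> elem" where
  "elem_D \<epsilon> \<tau> N N1 = polar \<epsilon> 0"
| "elem_D \<epsilon> \<tau> N N2 = polar \<epsilon> (- (pi / real N))"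
| "elem_D \<epsilon> \<tau> N N3 = polar (\<epsilon> + \<tau>) 0"
| "elem_D \<epsilon> \<tau> N N12 = polar \<epsilon> (- (pi / (2 * real N)))"
| "elem_D \<epsilon> \<tau> N N13 = polar (\<epsilon> + \<tau> / 2) 0"
| "elem_D \<epsilon> \<tau> N N23 = polar (\<epsilon> + \<tau> / 2) (- (pi / (2 * real N)))"

definition layer_AB :: "real \<Rightarrow> real \<Rightarrow> nat \<Rightarrow> real \<Rightarrow> elem set" where
  "layer_AB \<epsilon> \<tau> N \<phi> =
     (\<Union>j<N. {rot (\<phi> + 2 * pi * real j / real N) \<circ> elem_A \<epsilon> \<tau> N,
             rot (\<phi> + pi / real N + 2 * pi * real j / real N) \<circ> elem_B \<epsilon> \<tau> N})"

definition layer_ACD :: "real \<Rightarrow> real \<Rightarrow> nat \<Rightarrow> real \<Rightarrow> elem set" where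
  "layer_ACD \<epsilon> \<tau> N \<phi> =
     (\<Union>j<N. {rot (\<phi> + 2 * pi * real j / real N) \<circ> elem_A \<epsilon> \<tau> N,
             rot (\<phi> + pi / real N + 2 * pi * real j / real N) \<circ> elem_C \<epsilon> \<tau> N,
             rot (\<phi> + pi / real N + 2 * pi * real j / real N) \<circ> elem_D \<epsilon> \<tau> N})"

definition ring_region :: "real \<Rightarrow> real \<Rightarrow> (real^2) set" where
  "ring_region \<epsilon> \<tau> = {x. \<epsilon> \<le> norm x \<and> norm x \<le> \<epsilon> + \<tau>}"

definition ring_mesh :: "elem set \<Rightarrow> real \<Rightarrow> real \<Rightarrow> nat \<Rightarrow> bool" where
  "ring_mesh J \<epsilon> \<tau> N \<longleftrightarrow>
     0 < \<epsilon> \<and> 0 < \<tau> \<and> \<epsilon> + \<tau> \<le> 1 \<and> 0 < N \<and>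
     (\<exists>\<phi>. J = layer_AB \<epsilon> \<tau> N \<phi> \<or> J = layer_ACD \<epsilon> \<tau> N \<phi>) \<and>
     triangulation J"

definition ring_weight :: "real \<Rightarrow> real \<Rightarrow> real \<Rightarrow> real" where
  "ring_weight p \<epsilon> \<tau> = (2 - p) * integral {\<epsilon>..\<epsilon> + \<tau>} (\<lambda>t. t powr (1 - p))"

end

theory Submission
  imports Defs "HOL-Library.Landau_Symbols"
begin

text \<open>On every element the Jacobian determinant of \<open>F\<^sub>T\<close> and the two quantities that determine
  \<open>\<nabla>\<Pi>u\<close> are, by rotational symmetry, explicit polynomials whose leading terms depend on one
  coordinate \<open>s\<close> of the reference triangle only: with \<open>t = \<epsilon> + s \<tau>\<close> they agree with those of \<open>u\<close> at
  radius \<open>t\<close> up to a relative error \<open>\<Psi> = \<tau>\<^sup>2 + N\<^bsup>-2\<^esup> + (\<epsilon>/\<tau>) N\<^bsup>-4\<^esup>\<close>, the last term coming from the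
  bending of the edges. Integrated over one cell of the layer, the leading terms of \<open>\<Pi>u\<close> and of \<open>u\<close>
  both give exactly \<open>1/N\<close> of the ring integral of the radial density, because the densities of \<open>s\<close>
  on the elements add up to a constant. Only at a corner of element A can the Jacobian degenerate; this
  forces \<open>Psi\<close> to be bounded below, and an integrable bound by \<open>(x\<^sub>1 x\<^sub>2)\<^bsup>1-p\<^esup>\<close> suffices there.\<close>

section \<open>Change of variables on quadratic elements\<close>

text \<open>A priori nothing relates \<open>tau\<close>, \<open>eps\<close> and \<open>N\<close>,
  while the constants may depend on none of them. The only link is the injectivity of the element
  map of A. An injective quadratic map has a nonsingular derivative inside the triangle, so the
  Jacobian of A keeps its sign up to the boundary. Its value at node \<open>N3\<close> then gives
  \<open>(eps + tau) * eta\<^sup>2 <= (19/100) * tau\<close> with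
  \<open>eta = 1 - cos (pi / (2 * real N))\<close>, of order N^-2. This bounds the mesh error by 3
  and controls every term containing 1/tau. A second obstacle sits at the tip of A: the radius t may
  be much smaller than eps + tau there, but the tangential width is wrong by about eta*(eps + tau),
  not by eta*t. The relative Jacobian error therefore carries the weight 1 + (eps + tau)/t.
  Integration absorbs it, because s has density s on A and s*(eps + tau) <= t. The pulled-back first
  energy of the interpolant is X^(p/2) * D^(1-p) with D the Jacobian of the element map. Since 1 - p
  > -1, it tolerates D tending to 0. The density g allows no such slack; its argument is confined by
  the bound with \<kappa>.\<close>

lemma vec2_eq_iff: "v = w \<longleftrightarrow> v $ 1 = w $ 1 & v $ 2 = w $ 2" for v w :: "real^2"
  by (simp add: vec_eq_iff forall_2)

definition wedge :: "real^2 => real^2 => real" where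
  "wedge v w = v $ 1 * w $ 2 - v $ 2 * w $ 1"

text \<open>If a matrix \<open>A\<close> maps \<open>a, b\<close> to \<open>c, d\<close>, this is \<open>(norm A)\<^sup>2 * (wedge a b)\<^sup>2\<close>.\<close>

definition stretch :: "real^2 => real^2 => real^2 => real^2 => real" where
  "stretch a b c d = (c \<bullet> c) * (b \<bullet> b) + (d \<bullet> d) * (a \<bullet> a) - 2 * (c \<bullet> d) * (a \<bullet> b)"

lemma inner_vec2: "v \<bullet> w = v $ 1 * w $ 1 + v $ 2 * w $ 2" for v w :: "real^2"
  by (simp add: inner_vec_def sum_2)

lemma norm_vec2: "(norm v)\<^sup>2 = (v $ 1)\<^sup>2 + (v $ 2)\<^sup>2" for v :: "real^2"
  unfolding power2_norm_eq_inner by (simp add: inner_vec2 power2_eq_square)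

lemma norm_mat2:
  "(norm A)\<^sup>2 = (A $ 1 $ 1)\<^sup>2 + (A $ 1 $ 2)\<^sup>2 + (A $ 2 $ 1)\<^sup>2 + (A $ 2 $ 2)\<^sup>2" for A :: "real^2^2"
  unfolding power2_norm_eq_inner by (simp add: inner_vec_def sum_2 power2_eq_square)

text \<open>The squared terms are the entries of the matrix with columns \<open>c, d\<close> times
  the adjugate of the matrix with columns \<open>a, b\<close>. So \<open>stretch\<close> is a
  squared Frobenius norm for which no inverse has to be formed.\<close>

lemma stretch_eq_sum_squares:
  "stretch a b c d = (c $ 1 * b $ 2 - d $ 1 * a $ 2)\<^sup>2 + (d $ 1 * a $ 1 - c $ 1 * b $ 1)\<^sup>2
     + (c $ 2 * b $ 2 - d $ 2 * a $ 2)\<^sup>2 + (d $ 2 * a $ 1 - c $ 2 * b $ 1)\<^sup>2"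
  by (simp add: stretch_def inner_vec2 power2_eq_square algebra_simps)

lemma stretch_nonneg: "0 <= stretch a b c d"
  by (simp add: stretch_eq_sum_squares)

text \<open>The images of two vectors determine the gradient. Both identities are cleared of
  denominators, so they are polynomial and hold even for dependent \<open>a, b\<close>.\<close>

lemma jacobian_columns:
  fixes v :: "real^2 => real^2"
  assumes v: "(v has_derivative v') (at y)" and "v' a = c" "v' b = d"
  shows "det (jacobian v (at y)) * wedge a b = wedge c d"
    and "(norm (jacobian v (at y)))\<^sup>2 * (wedge a b)\<^sup>2 = stretch a b c d"
proof -
  have J: "jacobian v (at y) = matrix v'"
    using frechet_derivative_at[OF v] by (simp add: jacobian_def)
  have lin: "linear v'" using v by (rule has_derivative_linear)
  have c: "c = jacobian v (at y) *v a" and d: "d = jacobian v (at y) *v b"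
    using assms(2,3) matrix_vector_mul(2)[OF lin] by (metis J)+
  show "det (jacobian v (at y)) * wedge a b = wedge c d"
    by (simp add: c d det_2 wedge_def matrix_vector_mult_def sum_2 algebra_simps)
  show "(norm (jacobian v (at y)))\<^sup>2 * (wedge a b)\<^sup>2 = stretch a b c d"
    unfolding norm_mat2 c d stretch_eq_sum_squares wedge_def
    by (simp add: matrix_vector_mult_def sum_2 power2_eq_square algebra_simps)
qed

text \<open>The left side is the integrand after the change of variables. Splitting it into powers
  with exponents p/2 and 1 - p separates the numerator from the Jacobian, so that each can be
  estimated by itself.\<close>

lemma jacobian_norm_powr:
  fixes v :: "real^2 => real^2"
  assumes "(norm (jacobian v (at y)))\<^sup>2 * w\<^sup>2 = X" "w \<noteq> 0"
  shows "norm (jacobian v (at y)) powr p * \<bar>w\<bar> = X powr (p / 2) * \<bar>w\<bar> powr (1 - p)"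
proof -
  let ?n = "norm (jacobian v (at y))"
  have "X = (?n * \<bar>w\<bar>)\<^sup>2" using assms(1) by (simp add: power_mult_distrib)
  then have "X powr (p / 2) = (?n * \<bar>w\<bar>) powr p"
    by (cases "?n = 0") (use assms(2) in \<open>simp_all add: powr_powr flip: powr_numeral\<close>)
  also have "\<dots> = ?n powr p * \<bar>w\<bar> powr p" by (simp add: powr_mult)
  finally have "X powr (p / 2) * \<bar>w\<bar> powr (1 - p) = ?n powr p * (\<bar>w\<bar> powr p * \<bar>w\<bar> powr (1 - p))"
    by simp
  also have "\<bar>w\<bar> powr p * \<bar>w\<bar> powr (1 - p) = \<bar>w\<bar>"
    using assms(2) by (simp flip: powr_add)
  finally show ?thesis by simp
qed

section \<open>Derivative of the quadratic element map\<close>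

definition dquad1 :: "elem => real^2 => real^2" where
  "dquad1 a x = (1 - 4 * bary1 x) *\<^sub>R a N1 + (4 * x$1 - 1) *\<^sub>R a N2
     + (4 * (bary1 x - x$1)) *\<^sub>R a N12 - (4 * x$2) *\<^sub>R a N13 + (4 * x$2) *\<^sub>R a N23"

definition dquad2 :: "elem => real^2 => real^2" where
  "dquad2 a x = (1 - 4 * bary1 x) *\<^sub>R a N1 + (4 * x$2 - 1) *\<^sub>R a N3
     - (4 * x$1) *\<^sub>R a N12 + (4 * (bary1 x - x$2)) *\<^sub>R a N13 + (4 * x$1) *\<^sub>R a N23"

lemma quad_map_has_derivative:
  "(quad_map a has_derivative (%k. k$1 *\<^sub>R dquad1 a x + k$2 *\<^sub>R dquad2 a x)) (at x within S)"
  unfolding quad_map_def[abs_def] shape.simps bary1_def bary2_def bary3_def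
  apply (rule derivative_eq_intros bounded_linear.has_derivative[OF bounded_linear_vec_nth] refl)+
  apply (rule ext)
  apply (simp add: vec2_eq_iff dquad1_def dquad2_def bary1_def algebra_simps)
  done

lemma quad_map_continuous_on: "continuous_on S (quad_map a)"
  by (meson continuous_on_eq_continuous_within has_derivative_continuous quad_map_has_derivative)

text \<open>For a quadratic polynomial the mean value formula with the derivative at the midpoint is
  exact.\<close>

lemma quad_map_secant:
  "quad_map a x - quad_map a y =
     (x$1 - y$1) *\<^sub>R dquad1 a ((1/2) *\<^sub>R (x + y)) + (x$2 - y$2) *\<^sub>R dquad2 a ((1/2) *\<^sub>R (x + y))"
  by (simp add: vec2_eq_iff quad_map_def dquad1_def dquad2_def bary1_def bary2_def bary3_def field_simps)

definition open_triangle :: "(real^2) set" where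
  "open_triangle = {x. 0 < x$1 & 0 < x$2 & x$1 + x$2 < 1}"

lemma open_open_triangle: "open open_triangle"
  unfolding open_triangle_def
  by (intro open_Collect_conj open_Collect_less continuous_intros)

lemma open_triangle_subset: "open_triangle \<subseteq> ref_triangle"
  by (auto simp: open_triangle_def ref_triangle_def)

lemma open_triangle_in_lebesgue [measurable]: "open_triangle \<in> sets lebesgue"
  using open_open_triangle by auto

lemma negligible_coord: "negligible {x :: real^2. x $ i = c}"
proof -
  have "{x :: real^2. x $ i = c} = {x. x \<bullet> axis i 1 = c}" by (simp add: inner_axis)
  then show ?thesis using negligible_standard_hyperplane[of "axis i 1 :: real^2" c]
    by (metis Basis_real_def axis_in_Basis_iff insertI1)
qed

lemma negligible_triangle_boundary: "negligible (ref_triangle - open_triangle)"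
proof (rule negligible_subset)
  show "negligible ({x::real^2. x$1 = 0} \<union> {x. x$2 = 0} \<union> {x. vector [1, 1] \<bullet> x = 1})"
    by (intro negligible_Un negligible_coord negligible_hyperplane) simp
  show "ref_triangle - open_triangle \<subseteq> \<dots>"
    by (auto simp: ref_triangle_def open_triangle_def inner_vec2)
qed

text \<open>False for general smooth injective maps, true for quadratic ones: if k spans the kernel
  of the derivative at x, then x + t k and x - t k have midpoint x, so by
  \<open>quad_map_secant\<close> they have the same image.\<close>

lemma inj_quad_map_wedge_nonzero:
  assumes inj: "inj_on (quad_map a) ref_triangle" and x: "x \<in> open_triangle"
  shows "wedge (dquad1 a x) (dquad2 a x) \<noteq> 0"
proof
  assume 0: "wedge (dquad1 a x) (dquad2 a x) = 0"
  let ?p = "dquad1 a x" and ?q = "dquad2 a x"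
  obtain k :: "real^2" where k: "k \<noteq> 0" "k$1 *\<^sub>R ?p + k$2 *\<^sub>R ?q = 0"
  proof (cases "?p = 0 & ?q = 0")
    case True
    then show ?thesis using that[of "vector [1, 0]"] by (simp add: vec2_eq_iff)
  next
    case False
    then consider "?p $ 1 \<noteq> 0 \<or> ?q $ 1 \<noteq> 0" | "?p $ 2 \<noteq> 0 \<or> ?q $ 2 \<noteq> 0" by (auto simp: vec2_eq_iff)
    then show ?thesis
    proof cases
      case 1 then show ?thesis using that[of "vector [?q $ 1, - ?p $ 1]"] 0
        by (auto simp: vec2_eq_iff wedge_def algebra_simps)
    next
      case 2 then show ?thesis using that[of "vector [?q $ 2, - ?p $ 2]"] 0
        by (auto simp: vec2_eq_iff wedge_def algebra_simps)
    qed
  qed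
  obtain e where e: "e > 0" "ball x e \<subseteq> open_triangle"
    using open_open_triangle x open_contains_ball by blast
  define t where "t = e / (2 * norm k)"
  have t: "t > 0" "norm (t *\<^sub>R k) < e" using e k by (auto simp: t_def)
  have "x + t *\<^sub>R k \<in> ball x e" "x - t *\<^sub>R k \<in> ball x e"
    using t by (auto simp: dist_norm)
  then have mem: "x + t *\<^sub>R k \<in> ref_triangle" "x - t *\<^sub>R k \<in> ref_triangle"
    using e open_triangle_subset by blast+
  have "quad_map a (x + t *\<^sub>R k) - quad_map a (x - t *\<^sub>R k) = (2 * t) *\<^sub>R (k$1 *\<^sub>R ?p + k$2 *\<^sub>R ?q)"
    by (simp add: quad_map_secant algebra_simps flip: scaleR_2)
  then have "x + t *\<^sub>R k = x - t *\<^sub>R k" using inj_onD[OF inj _ mem] k by simp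
  then have "(2 * t) *\<^sub>R k = 0" by (simp add: algebra_simps flip: scaleR_2)
  then show False using t k by auto
qed

section \<open>Integration over a triangulation\<close>

lemma change_of_variables_real:
  fixes f :: "real^2 => real"
  assumes "S \<in> sets lebesgue" "!!x. x \<in> S ==> (g has_derivative g' x) (at x within S)" "inj_on g S"
    and int: "set_integrable lebesgue S (%x. \<bar>det (matrix (g' x))\<bar> * f (g x))"
  shows "set_integrable lebesgue (g ` S) f"
    and "(LINT x:g ` S|lebesgue. f x) = (LINT x:S|lebesgue. \<bar>det (matrix (g' x))\<bar> * f (g x))"
proof -
  let ?F = "%x. vec (f x) :: real^1"
  have 1: "(%x. \<bar>det (matrix (g' x))\<bar> *\<^sub>R ?F (g x)) absolutely_integrable_on S"
    using int by (simp add: absolutely_integrable_on_1_iff o_def)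
  have "?F absolutely_integrable_on (g ` S) &
    integral (g ` S) ?F = integral S (%x. \<bar>det (matrix (g' x))\<bar> *\<^sub>R ?F (g x))"
    using has_absolute_integral_change_of_variables[OF assms(1-3), of ?F] 1 by blast
  then have 2: "set_integrable lebesgue (g ` S) f"
    and 3: "integral (g ` S) f = integral S (%x. \<bar>det (matrix (g' x))\<bar> * f (g x))"
    by (auto simp: absolutely_integrable_on_1_iff integral_on_1_eq o_def vec_eq_iff)
  show "set_integrable lebesgue (g ` S) f" by fact
  show "(LINT x:g ` S|lebesgue. f x) = (LINT x:S|lebesgue. \<bar>det (matrix (g' x))\<bar> * f (g x))"
    using 3 set_lebesgue_integral_eq_integral(2)[OF 2] set_lebesgue_integral_eq_integral(2)[OF int] by simp
qed

lemma det_matrix_columns: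
  "det (matrix (%k. k$1 *\<^sub>R p + k$2 *\<^sub>R q)) = wedge p q" for p q :: "real^2"
  by (simp add: det_2 matrix_def wedge_def axis_def)

text \<open>A triangulation only makes the interiors of elements disjoint. The image of the open
  triangle is open by invariance of domain, and an open set that misses another set also misses its
  closure, which contains the whole element \<open>b\<close>.\<close>

lemma triangulation_interiors:
  assumes "triangulation J" "a \<in> J" "b \<in> J" "a \<noteq> b"
  shows "quad_map a ` open_triangle \<inter> element b = {}"
proof -
  have op: "open (quad_map a ` open_triangle)" if "a \<in> J" for a
    using that assms(1) open_triangle_subset
    by (intro invariance_of_domain quad_map_continuous_on open_open_triangle)
      (auto simp: triangulation_def intro: inj_on_subset)
  have int: "quad_map a ` open_triangle \<subseteq> interior (element a)" if "a \<in> J" for a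
    using op[OF that] open_triangle_subset unfolding element_def by (intro interior_maximal image_mono) auto
  have dj: "quad_map a ` open_triangle \<inter> quad_map b ` open_triangle = {}"
  proof -
    have "interior (element a) \<inter> interior (element b) = {}"
      using assms unfolding triangulation_def by blast
    then show ?thesis using int[OF assms(2)] int[OF assms(3)] by blast
  qed
  have cl: "ref_triangle \<subseteq> closure open_triangle"
  proof
    fix x assume x: "x \<in> ref_triangle"
    \<comment> \<open>Points of the closed triangle are approached from inside along the segment to
      the centroid.\<close>
    let ?c = "vector [1/3, 1/3] :: real^2"
    have "(%n. x + inverse (real (Suc n)) *\<^sub>R (?c - x)) \<longlonglongrightarrow> x + 0 *\<^sub>R (?c - x)"
      by (intro tendsto_intros LIMSEQ_inverse_real_of_nat)
    moreover have "x + l *\<^sub>R (?c - x) \<in> open_triangle" if l: "0 < l" "l <= 1" for l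
    proof -
      have "0 < (1 - l) * x$1 + l / 3" "0 < (1 - l) * x$2 + l / 3"
        using l x by (auto simp: ref_triangle_def intro!: add_nonneg_pos)
      moreover have "(1 - l) * (x$1 + x$2) <= (1 - l) * 1"
        using l x by (intro mult_left_mono) (auto simp: ref_triangle_def)
      ultimately show ?thesis using l
        by (auto simp: open_triangle_def algebra_simps)
    qed
    then have "x + inverse (real (Suc n)) *\<^sub>R (?c - x) \<in> open_triangle" for n
      by (simp add: divide_simps)
    ultimately show "x \<in> closure open_triangle"
      unfolding closure_sequential by (intro exI conjI) auto
  qed
  have "element b \<subseteq> closure (quad_map b ` open_triangle)"
    unfolding element_def using cl
    by (meson closure_mono closed_closure closure_subset image_closure_subset order_trans quad_map_continuous_on image_mono)
  then show ?thesis
    using dj op[OF assms(2)] open_Int_closure_eq_empty by blast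
qed

text \<open>The pulled-back integrand \<open>H\<close> is supplied in closed form and is compared
  with \<open>h\<close> on the open triangle only, where the interpolant is known to be
  differentiable. The images of the edges are negligible.\<close>

lemma mesh_integral:
  fixes h :: "real^2 => real"
  assumes J: "triangulation J" "finite J"
    and H: "!!a x. a \<in> J ==> x \<in> open_triangle ==>
        \<bar>wedge (dquad1 a x) (dquad2 a x)\<bar> * h (quad_map a x) = H a x"
    and int: "!!a. a \<in> J ==> set_integrable lebesgue open_triangle (H a)"
  shows "set_integrable lebesgue (meshed_region J) h"
    and "(LINT x:meshed_region J|lebesgue. h x) = (\<Sum>a\<in>J. LINT x:open_triangle|lebesgue. H a x)"
proof -
  have inj: "inj_on (quad_map a) open_triangle" if "a \<in> J" for a
    using that J open_triangle_subset by (auto simp: triangulation_def intro: inj_on_subset)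
  have int': "set_integrable lebesgue open_triangle (%x. \<bar>det (matrix (%k. k$1 *\<^sub>R dquad1 a x + k$2 *\<^sub>R dquad2 a x))\<bar> * h (quad_map a x))"
    if "a \<in> J" for a
    unfolding det_matrix_columns
    using int[OF that] H[OF that] by (subst set_integrable_cong[OF refl refl]) auto
  let ?U = "\<Union>a\<in>J. quad_map a ` open_triangle"
  note cov = change_of_variables_real[OF open_triangle_in_lebesgue quad_map_has_derivative inj int']
  have op: "open (quad_map a ` open_triangle)" if "a \<in> J" for a
    using that inj by (intro invariance_of_domain quad_map_continuous_on open_open_triangle)
  have eq: "(LINT x:quad_map a ` open_triangle|lebesgue. h x) = (LINT x:open_triangle|lebesgue. H a x)"
    if "a \<in> J" for a
    unfolding cov(2)[OF that that] det_matrix_columns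
    using H[OF that] by (intro set_lebesgue_integral_cong) auto
  have dj: "disjoint_family_on (%a. quad_map a ` open_triangle) J"
    using triangulation_interiors[OF J(1)] open_triangle_subset
    unfolding disjoint_family_on_def element_def by fast
  have U: "(LINT x:?U|lebesgue. h x) = (\<Sum>a\<in>J. LINT x:open_triangle|lebesgue. H a x)"
    using set_integral_finite_Union[OF J(2) dj, of lebesgue h] cov(1) op eq by simp
  have intU: "set_integrable lebesgue ?U h"
    using cov(1) op by (intro set_integrable_UN J) auto
  have sub: "?U \<subseteq> meshed_region J"
    using open_triangle_subset by (force simp: meshed_region_def element_def)
  have neg: "negligible (meshed_region J - ?U)"
  proof (rule negligible_subset)
    show "negligible (\<Union>a\<in>J. quad_map a ` (ref_triangle - open_triangle))"
      using J(2) negligible_triangle_boundary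
      by (intro negligible_Union finite_imageI)
        (auto simp: differentiable_on_def
          intro!: negligible_differentiable_image_negligible differentiableI quad_map_has_derivative)
    show "meshed_region J - ?U \<subseteq> \<dots>" by (auto simp: meshed_region_def element_def)
  qed
  have neg1: "negligible {x \<in> ?U - meshed_region J. h x \<noteq> 0}"
    using sub by (simp add: Diff_eq_empty_iff[THEN iffD2])
  have neg2: "negligible {x \<in> meshed_region J - ?U. h x \<noteq> 0}"
    using neg by (rule negligible_subset) auto
  show *: "set_integrable lebesgue (meshed_region J) h"
    by (rule absolutely_integrable_spike_set[OF intU neg1 neg2])
  have "integral (meshed_region J) h = integral ?U h"
    by (rule integral_spike_set[OF neg2 neg1])
  then show "(LINT x:meshed_region J|lebesgue. h x) = (\<Sum>a\<in>J. LINT x:open_triangle|lebesgue. H a x)"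
    using U set_lebesgue_integral_eq_integral(2)[OF intU] set_lebesgue_integral_eq_integral(2)[OF *] by simp
qed

section \<open>Closed forms of the element Jacobians\<close>

text \<open>At a point of the image of the open triangle, \<open>a\<close> is the only element
  containing the point, so \<open>SOME\<close> picks \<open>a\<close> there and on a neighbourhood.
  The interpolant is then locally a quadratic map composed with the inverse of another one, and the
  chain rule sends the columns of the element to those of its image nodes.\<close>

lemma interpolant_has_derivative:
  assumes J: "triangulation J" "a \<in> J" and x: "x \<in> open_triangle"
  obtains v' where "(interpolant J u has_derivative v') (at (quad_map a x))"
    "v' (dquad1 a x) = dquad1 (u \<circ> a) x" "v' (dquad2 a x) = dquad2 (u \<circ> a) x"
proof -
  let ?g = "inv_into ref_triangle (quad_map a)" and ?U = "quad_map a ` open_triangle"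
  let ?p = "dquad1 a x" and ?q = "dquad2 a x"
  let ?w = "wedge ?p ?q"
  \<comment> \<open>Cramer's rule for the inverse of the matrix with columns
    \<open>?p, ?q\<close>.\<close>
  let ?g' = "%y. vector [wedge y ?q / ?w, wedge ?p y / ?w] :: real^2"
  have inj: "inj_on (quad_map a) ref_triangle" using J by (auto simp: triangulation_def)
  have w: "?w \<noteq> 0" by (rule inj_quad_map_wedge_nonzero[OF inj x])
  have g: "?g (quad_map a z) = z" if "z \<in> open_triangle" for z
    using that open_triangle_subset inj by (auto intro: inv_into_f_f)
  have opU: "open ?U"
    using inj open_triangle_subset
    by (intro invariance_of_domain quad_map_continuous_on open_open_triangle) (auto intro: inj_on_subset)
  have "wedge y ?q *\<^sub>R ?p + wedge ?p y *\<^sub>R ?q = ?w *\<^sub>R y" for y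
    by (simp add: vec2_eq_iff wedge_def algebra_simps)
  then have "(%k. k$1 *\<^sub>R ?p + k$2 *\<^sub>R ?q) \<circ> ?g' = id"
    using w by (simp add: fun_eq_iff divide_inverse mult.commute[of _ "inverse _"]
        flip: scaleR_scaleR scaleR_add_right) simp
  then have dg: "(?g has_derivative ?g') (at (quad_map a x))"
    by (intro has_derivative_inverse_on[where f'="%x k. k$1 *\<^sub>R dquad1 a x + k$2 *\<^sub>R dquad2 a x" and g'="%_. ?g'"
          and S=open_triangle] open_open_triangle quad_map_has_derivative g x)
  have "((%y. quad_map (u \<circ> a) (?g y)) has_derivative
      (%y. ?g' y $ 1 *\<^sub>R dquad1 (u \<circ> a) x + ?g' y $ 2 *\<^sub>R dquad2 (u \<circ> a) x)) (at (quad_map a x))"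
    using has_derivative_compose[OF dg quad_map_has_derivative, of "u \<circ> a"] g[OF x] by simp
  moreover have "quad_map (u \<circ> a) (?g y) = interpolant J u y" if "y \<in> ?U" for y
  proof -
    have "y \<in> element a" using that open_triangle_subset by (auto simp: element_def)
    then have "(SOME b. b \<in> J & y \<in> element b) = a"
      using triangulation_interiors[OF J] that J(2) by (intro some_equality) auto
    then show ?thesis by (simp add: interpolant_def Let_def)
  qed
  ultimately have "(interpolant J u has_derivative
      (%y. ?g' y $ 1 *\<^sub>R dquad1 (u \<circ> a) x + ?g' y $ 2 *\<^sub>R dquad2 (u \<circ> a) x)) (at (quad_map a x))"
    using opU x by (elim has_derivative_transform_within_open) auto
  then show thesis
    by (rule that) (use w in \<open>simp_all add: wedge_def\<close>)
qed

section \<open>Rotations, polar coordinates and the gradient of the cavity map\<close>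

lemma rot_linear: "rot phi (v + w) = rot phi v + rot phi w" "rot phi (v - w) = rot phi v - rot phi w"
  "rot phi (c *\<^sub>R v) = c *\<^sub>R rot phi v"
  by (simp_all add: rot_def vec2_eq_iff algebra_simps)

lemma inner_rot: "rot phi v \<bullet> rot phi w = v \<bullet> w"
  unfolding inner_vec2 rot_def vector_2 using sin_cos_squared_add[of phi] by algebra

lemma wedge_rot: "wedge (rot phi v) (rot phi w) = wedge v w"
  unfolding wedge_def rot_def vector_2 using sin_cos_squared_add[of phi] by algebra

lemma norm_rot: "norm (rot phi v) = norm v"
  by (simp add: norm_eq_sqrt_inner inner_rot)

lemma quad_map_rot:
  "quad_map (rot phi \<circ> a) x = rot phi (quad_map a x)"
  "dquad1 (rot phi \<circ> a) x = rot phi (dquad1 a x)"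
  "dquad2 (rot phi \<circ> a) x = rot phi (dquad2 a x)"
  by (simp_all add: quad_map_def dquad1_def dquad2_def rot_linear)

lemma inj_on_quad_map_rot:
  assumes "inj_on (quad_map (rot phi \<circ> a)) S" shows "inj_on (quad_map a) S"
  using assms by (auto simp: inj_on_def quad_map_rot)

lemma cavity_map_rot: "cavity_map r \<circ> (rot phi \<circ> a) = rot phi \<circ> (cavity_map r \<circ> a)"
  by (simp add: fun_eq_iff cavity_map_def norm_rot rot_linear)

lemma rot_polar: "rot phi (polar t \<alpha>) = polar t (phi + \<alpha>)"
  by (simp add: rot_def polar_def vec2_eq_iff cos_add sin_add algebra_simps)

lemma norm_polar: "norm (polar t \<alpha>) = \<bar>t\<bar>"
proof -
  have "(norm (polar t \<alpha>))\<^sup>2 = \<bar>t\<bar>\<^sup>2"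
    unfolding norm_vec2 polar_def vector_2 power2_abs using sin_cos_squared_add[of \<alpha>] by algebra
  then show ?thesis by (rule power2_eq_imp_eq) auto
qed

lemma cavity_map_polar: "0 < t ==> cavity_map r (polar t \<alpha>) = polar (r t) \<alpha>"
  by (simp add: cavity_map_def norm_polar) (simp add: polar_def vec2_eq_iff)

lemma polar_inj:
  assumes "polar t \<alpha> = polar t bt" "0 < t" shows "\<exists>n::int. \<alpha> = bt + 2 * pi * of_int n"
proof -
  have "cos \<alpha> = cos bt" "sin \<alpha> = sin bt" using assms by (auto simp: polar_def vec2_eq_iff)
  then show ?thesis using sin_cos_eq_iff[of \<alpha> bt] by (auto simp: algebra_simps)
qed

text \<open>The radial direction and its quarter turn are eigenvectors of the gradient, with
  eigenvalues r' and r/R. Feeding these two vectors to \<open>jacobian_columns\<close> gives both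
  quantities.\<close>

lemma cavity_map_jacobian:
  assumes r: "(r has_real_derivative r') (at (norm x))" and "x \<noteq> 0"
  shows "det (jacobian (cavity_map r) (at x)) = r' * r (norm x) / norm x"
    and "(norm (jacobian (cavity_map r) (at x)))\<^sup>2 = r'\<^sup>2 + (r (norm x) / norm x)\<^sup>2"
proof -
  let ?n = "norm x" and ?y = "vector [- x$2, x$1] :: real^2"
  let ?D = "%h. ((r' * (h \<bullet> sgn x) * ?n - r ?n * (h \<bullet> sgn x)) / ?n\<^sup>2) *\<^sub>R x + (r ?n / ?n) *\<^sub>R h"
  have rn: "((%x. r (norm x)) has_derivative (%h. r' * (h \<bullet> sgn x))) (at x)"
    using has_derivative_compose[OF has_derivative_norm[of x] r[unfolded has_field_derivative_def]] assms
    by simp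
  have nn: "(norm has_derivative (%h. h \<bullet> sgn x)) (at x)"
    using has_derivative_norm[of x] assms by simp
  have D: "(cavity_map r has_derivative ?D) (at x)"
    unfolding cavity_map_def[abs_def]
    by (rule derivative_eq_intros rn nn refl | use assms in \<open>force simp: power2_eq_square\<close>)+
  have n2: "?n\<^sup>2 = x$1 * x$1 + x$2 * x$2" using norm_vec2[of x] by (simp add: power2_eq_square)
  have xx: "x \<bullet> sgn x = ?n" "?y \<bullet> sgn x = 0"
    using assms by (simp_all add: sgn_div_norm power2_norm_eq_inner[symmetric] power2_eq_square)
      (simp add: inner_vec2)
  have 1: "?D x = r' *\<^sub>R x"
    using assms by (simp add: xx field_simps power2_eq_square flip: scaleR_add_left)
  have 2: "?D ?y = (r ?n / ?n) *\<^sub>R ?y" by (simp add: xx)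
  have w: "wedge x ?y = ?n\<^sup>2" by (simp add: wedge_def n2)
  note J = jacobian_columns[OF D 1 2, unfolded w]
  have "wedge (r' *\<^sub>R x) ((r ?n / ?n) *\<^sub>R ?y) = (r' * r ?n / ?n) * ?n\<^sup>2"
    by (simp add: n2 wedge_def algebra_simps)
  then show "det (jacobian (cavity_map r) (at x)) = r' * r ?n / ?n"
    using J(1) assms by (metis mult_cancel_right norm_eq_zero power_not_zero)
  have "stretch x ?y (c *\<^sub>R x) (k *\<^sub>R ?y) = (c\<^sup>2 + k\<^sup>2) * (?n\<^sup>2)\<^sup>2" for c k
    unfolding n2 by (simp add: stretch_def inner_vec2 power2_eq_square algebra_simps)
  then show "(norm (jacobian (cavity_map r) (at x)))\<^sup>2 = r'\<^sup>2 + (r ?n / ?n)\<^sup>2"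
    using J(2) assms by simp
qed

text \<open>Elements of types A and B (\<open>fan\<close>) and of types C and D (\<open>side\<close>) whose nodes have the radii
  \<open>p, m, q\<close>. The angular width enters through \<open>eta = 1 - cos (\<pi>/2N)\<close> and \<open>sg = \<plusminus> sin (\<pi>/2N)\<close>.\<close>

fun fan :: "real => real => real => real => real => elem" where
  "fan p m q eta sg N1 = vector [p, 0]"
| "fan p m q eta sg N2 = vector [q * (1 - 2 * eta * (2 - eta)), - (2 * q * sg * (1 - eta))]"
| "fan p m q eta sg N3 = vector [q * (1 - 2 * eta * (2 - eta)), 2 * q * sg * (1 - eta)]"
| "fan p m q eta sg N12 = vector [m * (1 - eta), - (m * sg)]"
| "fan p m q eta sg N13 = vector [m * (1 - eta), m * sg]"
| "fan p m q eta sg N23 = vector [q, 0]"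

fun side :: "real => real => real => real => real => elem" where
  "side p m q eta sg N1 = vector [p, 0]"
| "side p m q eta sg N2 = vector [q, 0]"
| "side p m q eta sg N3 = vector [p * (1 - 2 * eta * (2 - eta)), 2 * p * sg * (1 - eta)]"
| "side p m q eta sg N12 = vector [m, 0]"
| "side p m q eta sg N13 = vector [p * (1 - eta), p * sg]"
| "side p m q eta sg N23 = vector [m * (1 - eta), m * sg]"

text \<open>In the coordinates s = x1 + x2 and y = x2 - x1 a fan is symmetric under y -> -y.
  \<open>fan_s\<close> is the first component of the s-derivative of the map, and
  \<open>2 * sg * fan_o\<close> is the second component of its y-derivative.\<close>

definition fan_s where "fan_s p m q eta s = (q - p) + (2 * (p + q - 2 * m) + 2 * eta * (2 * (m - q) + q * eta)) * (2 * s - 1)"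
  for p m q eta s :: real
definition fan_o where "fan_o m q eta s = 2 * m * (1 - s) + q * (1 - eta) * (2 * s - 1)" for m q eta s :: real

lemma fan_map:
  fixes x :: "real^2"
  defines "s == x$1 + x$2" and "y == x$2 - x$1"
  shows "quad_map (fan p m q eta sg) x = vector
      [p + s * (q - p) - (2 * (p + q - 2 * m) + 2 * eta * (2 * (m - q) + q * eta)) * s * (1 - s) - 2 * q * eta * (2 - eta) * y\<^sup>2,
       2 * sg * y * fan_o m q eta s]"
    and "dquad1 (fan p m q eta sg) x = vector
      [fan_s p m q eta s + 4 * q * eta * (2 - eta) * y, 4 * sg * (q * (1 - eta) - m) * y - 2 * sg * fan_o m q eta s]"
    and "dquad2 (fan p m q eta sg) x = vector
      [fan_s p m q eta s - 4 * q * eta * (2 - eta) * y, 4 * sg * (q * (1 - eta) - m) * y + 2 * sg * fan_o m q eta s]"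
  by (simp_all add: s_def y_def vec2_eq_iff quad_map_def dquad1_def dquad2_def bary1_def bary2_def bary3_def fan_s_def fan_o_def)
    (simp_all add: algebra_simps power2_eq_square)

text \<open>The analogous components for the coordinates s = x1 and y = x2: the s-derivative has
  first component \<open>side_s\<close>, and the y-derivative is \<open>- 2 * eta * side_r\<close>
  along the axis and \<open>2 * sg * side_o\<close> across it.\<close>

definition side_s where "side_s p m q eta s y = (q - p) + 2 * (p + q - 2 * m) * (2 * s - 1) - 4 * (m - p) * eta * y"
  for p m q eta s y :: real
definition side_o where "side_o p m eta s y = p * (1 - eta * (4 * y - 1)) + 2 * (m - p) * s" for p m eta s y :: real
definition side_r where "side_r p m eta s y = p * (1 + (1 - eta) * (4 * y - 1)) + 2 * (m - p) * s" for p m eta s y :: real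

lemma side_map:
  fixes x :: "real^2"
  defines "s == x$1" and "y == x$2"
  shows "quad_map (side p m q eta sg) x = vector
      [p * (1 - 2 * eta * y - 2 * eta * (1 - eta) * y * (2 * y - 1)) + s * (q - p) - 2 * (p + q - 2 * m) * s * (1 - s) - 4 * (m - p) * eta * s * y,
       2 * sg * y * (p * (1 - eta * (2 * y - 1)) + 2 * (m - p) * s)]"
    and "dquad1 (side p m q eta sg) x = vector [side_s p m q eta s y, 4 * sg * (m - p) * y]"
    and "dquad2 (side p m q eta sg) x = vector [- 2 * eta * side_r p m eta s y, 2 * sg * side_o p m eta s y]"
  by (simp_all add: s_def y_def vec2_eq_iff quad_map_def dquad1_def dquad2_def bary1_def bary2_def bary3_def
        side_s_def side_o_def side_r_def)
    (simp_all add: algebra_simps power2_eq_square)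

text \<open>\<open>fan_D\<close>, \<open>fan_V\<close> and \<open>fan_X\<close> are the Jacobian of
  the element, the Jacobian of its image under u and the stretch between them, after removal of the
  factors \<open>4 * sg * dl\<close>, \<open>4 * sg\<close> and
  \<open>(4 * sg * dl)\<^sup>2\<close>. With t = P + s*dl their leading values are t, dl*r'(t)*r(t)
  and r(t)^2 + (r'(t)*t)^2.\<close>

definition fan_D where "fan_D P dl eta s y =
    (1 + 2 * eta * ((P + dl) * eta / dl - 1) * (2 * s - 1)) * (P + s * dl + (P + dl) * eta * (1 - 2 * s))
      + 4 * (P + dl) * eta * (2 - eta) * y\<^sup>2 * (1 - 2 * (P + dl) * eta / dl)" for P dl eta s y :: real

definition fan_V where "fan_V p m q eta s y =
    fan_s p m q eta s * fan_o m q eta s + 8 * (q * (1 - eta) - m) * q * eta * (2 - eta) * y\<^sup>2" for p m q eta s y :: real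

definition fan_X where "fan_X P dl p m q eta s y =
    (fan_s p m q eta s / dl * (P + s * dl + (P + dl) * eta * (1 - 2 * s))
       + 8 * q * eta * (2 - eta) * y\<^sup>2 * (1/2 - (P + dl) * eta / dl))\<^sup>2
    + 4 * eta * (2 - eta) * y\<^sup>2 * ((P + dl) * (fan_s p m q eta s / dl)
       - q * (1 + 2 * eta * ((P + dl) * eta / dl - 1) * (2 * s - 1)))\<^sup>2
    + 16 * eta * (2 - eta) * (1 - eta)\<^sup>2 * y\<^sup>2 * ((q - m) / dl * (P + dl) - q / 2)\<^sup>2
    + (fan_o m q eta s * (1 + 2 * eta * ((P + dl) * eta / dl - 1) * (2 * s - 1))
       + 8 * ((q - m) / dl - q * eta / dl) * (P + dl) * eta * (2 - eta) * y\<^sup>2)\<^sup>2" for P dl p m q eta s y :: real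

text \<open>Replacing the two columns by their difference and sum has determinant 2, and
  \<open>stretch\<close> scales with its square. It serves to pass from x1, x2 to s, y.\<close>

lemma stretch_columns_add:
  "stretch (a - b) (a + b) (c - d) (c + d) = 4 * stretch a b c d"
  by (simp add: stretch_def inner_simps inner_commute[of b a] inner_commute[of d c] algebra_simps)

lemma fan_columns:
  fixes x :: "real^2" and P dl p m q eta sg :: real
  assumes dl: "dl \<noteq> 0" and sg: "sg\<^sup>2 = eta * (2 - eta)"
  defines "s == x$1 + x$2" and "y == x$2 - x$1"
  defines "F == fan P (P + dl / 2) (P + dl) eta sg" and "G == fan p m q eta sg"
  shows "wedge (dquad1 F x) (dquad2 F x) = 4 * sg * dl * fan_D P dl eta s y"
    and "wedge (dquad1 G x) (dquad2 G x) = 4 * sg * fan_V p m q eta s y"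
    and "stretch (dquad1 F x) (dquad2 F x) (dquad1 G x) (dquad2 G x) = (4 * sg * dl)\<^sup>2 * fan_X P dl p m q eta s y"
proof -
  define e where "e = 1 + 2 * eta * ((P + dl) * eta / dl - 1) * (2 * s - 1)"
  define z where "z = P + s * dl + (P + dl) * eta * (1 - 2 * s)"
  define c where "c = fan_s p m q eta s / dl"
  have Fs: "fan_s P (P + dl / 2) (P + dl) eta s = dl * e" and Fo: "fan_o (P + dl / 2) (P + dl) eta s = z"
    using dl by (simp_all add: fan_s_def fan_o_def e_def z_def field_simps)
  have Gs: "fan_s p m q eta s = dl * c" using dl by (simp add: c_def)
  show "wedge (dquad1 F x) (dquad2 F x) = 4 * sg * dl * fan_D P dl eta s y"
    unfolding F_def fan_map wedge_def vector_2 fan_D_def s_def[symmetric] y_def[symmetric] Fs Fo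
      e_def[symmetric] z_def[symmetric]
    using dl by (simp add: field_simps power2_eq_square)
  show "wedge (dquad1 G x) (dquad2 G x) = 4 * sg * fan_V p m q eta s y"
    unfolding G_def fan_map wedge_def vector_2 fan_V_def s_def[symmetric] y_def[symmetric]
    by (simp add: field_simps power2_eq_square)
  \<comment> \<open>The derivatives of the element map in s and y; \<open>c'\<close> and
    \<open>d\<close> below are those of the image.\<close>
  define a b :: "real^2" where "a = vector [dl * e, 4 * sg * ((P + dl) * (1 - eta) - (P + dl / 2)) * y]"
    and "b = vector [- (4 * (P + dl) * eta * (2 - eta) * y), 2 * sg * z]"
  define c' d :: "real^2" where "c' = vector [dl * c, 4 * sg * (q * (1 - eta) - m) * y]"
    and "d = vector [- (4 * q * eta * (2 - eta) * y), 2 * sg * fan_o m q eta s]"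
  have cols: "dquad1 F x = a - b" "dquad2 F x = a + b" "dquad1 G x = c' - d" "dquad2 G x = c' + d"
    unfolding F_def G_def fan_map s_def[symmetric] y_def[symmetric] Fs Fo Gs a_def b_def c'_def d_def
    by (simp_all add: vec2_eq_iff)
  have 1: "(c' $ 1 * b $ 2 - d $ 1 * a $ 2)\<^sup>2 = (2 * sg * dl)\<^sup>2 * (c * z + 8 * q * eta * (2 - eta) * y\<^sup>2 * (1/2 - (P + dl) * eta / dl))\<^sup>2"
    unfolding power_mult_distrib[symmetric] using dl
    by (intro arg_cong[where f="%x. x\<^sup>2"]) (simp add: a_def b_def c'_def d_def field_simps power2_eq_square)
  have 2: "(d $ 1 * a $ 1 - c' $ 1 * b $ 1)\<^sup>2 = (2 * sg * dl)\<^sup>2 * (4 * eta * (2 - eta) * y\<^sup>2 * ((P + dl) * c - q * e)\<^sup>2)"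
  proof -
    \<comment> \<open>Only products with eta*(2 - eta) = sg^2 occur, which exposes the common factor
      \<open>2 * sg * dl\<close> and leaves a square of order eta.\<close>
    have "d $ 1 * a $ 1 - c' $ 1 * b $ 1 = 4 * (eta * (2 - eta)) * dl * y * ((P + dl) * c - q * e)"
      by (simp add: a_def b_def c'_def d_def algebra_simps)
    also have "\<dots> = (2 * sg * dl) * (2 * sg * y * ((P + dl) * c - q * e))"
      unfolding sg[symmetric] by (simp add: power2_eq_square)
    finally show ?thesis by (simp add: power_mult_distrib sg)
  qed
  have 3: "(c' $ 2 * b $ 2 - d $ 2 * a $ 2)\<^sup>2 = (2 * sg * dl)\<^sup>2 * (16 * eta * (2 - eta) * (1 - eta)\<^sup>2 * y\<^sup>2 * ((q - m) / dl * (P + dl) - q / 2)\<^sup>2)"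
  proof -
    \<comment> \<open>Both second components are y times an affine function of s, so this minor is a
      multiple of the Wronskian of two affine functions: s drops out.\<close>
    have "c' $ 2 * b $ 2 - d $ 2 * a $ 2 = 8 * (sg\<^sup>2) * (1 - eta) * y * (dl * ((q - m) / dl * (P + dl) - q / 2))"
      using dl by (simp add: a_def b_def c'_def d_def fan_o_def z_def field_simps power2_eq_square)
    then have "(c' $ 2 * b $ 2 - d $ 2 * a $ 2)\<^sup>2 = 64 * sg\<^sup>2 * (sg\<^sup>2) * (1 - eta)\<^sup>2 * y\<^sup>2 * dl\<^sup>2 * ((q - m) / dl * (P + dl) - q / 2)\<^sup>2"
      by (simp add: power_mult_distrib power2_eq_square)
    then show ?thesis by (simp add: sg power_mult_distrib)
  qed
  have 4: "(d $ 2 * a $ 1 - c' $ 2 * b $ 1)\<^sup>2 = (2 * sg * dl)\<^sup>2 *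
      (fan_o m q eta s * e + 8 * ((q - m) / dl - q * eta / dl) * (P + dl) * eta * (2 - eta) * y\<^sup>2)\<^sup>2"
    unfolding power_mult_distrib[symmetric] using dl
    by (intro arg_cong[where f="%x. x\<^sup>2"]) (simp add: a_def b_def c'_def d_def field_simps power2_eq_square)
  show "stretch (dquad1 F x) (dquad2 F x) (dquad1 G x) (dquad2 G x) = (4 * sg * dl)\<^sup>2 * fan_X P dl p m q eta s y"
    unfolding cols stretch_columns_add
    unfolding stretch_eq_sum_squares 1 2 3 4 fan_X_def c_def[symmetric] z_def[symmetric] e_def[symmetric]
    by (simp add: power_mult_distrib algebra_simps)
qed

text \<open>Counterparts of \<open>fan_D\<close>, \<open>fan_V\<close>, \<open>fan_X\<close> with
  factors \<open>2 * sg * tau\<close>, \<open>2 * sg\<close> and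
  \<open>(2 * sg * tau)\<^sup>2\<close>. The quotient \<open>eta / (2 - eta)\<close> in
  \<open>side_X\<close> is eta^2/sg^2.\<close>

definition side_D where "side_D P tau eta s y = P + s * tau - P * eta * (4 * y - 1) * (1 - 2 * y)" for P tau eta s y :: real

definition side_V where "side_V p m q eta s y =
    side_s p m q eta s y * side_o p m eta s y + 4 * eta * (m - p) * y * side_r p m eta s y" for p m q eta s y :: real

definition side_X where "side_X P tau p m q eta s y =
    (side_s p m q eta s y / tau * (P + s * tau - P * eta * (4 * y - 1)) + 2 * eta * y * side_r p m eta s y)\<^sup>2
    + eta / (2 - eta) * (side_s p m q eta s y / tau * (P * (1 + (1 - eta) * (4 * y - 1)) + tau * s)
       - side_r p m eta s y * (1 - 2 * eta * y))\<^sup>2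
    + eta * (2 - eta) * (4 * y * ((m - p) / tau) * (P + s * tau - P * eta * (4 * y - 1)) - 2 * y * side_o p m eta s y)\<^sup>2
    + (side_o p m eta s y * (1 - 2 * eta * y)
       + 4 * eta * y * ((m - p) / tau) * (P * (1 + (1 - eta) * (4 * y - 1)) + tau * s))\<^sup>2" for P tau p m q eta s y :: real

lemma side_columns:
  fixes x :: "real^2" and P tau p m q eta sg :: real
  assumes tau: "tau \<noteq> 0" and sg: "sg\<^sup>2 = eta * (2 - eta)" and eta: "eta \<noteq> 2"
  defines "s == x$1" and "y == x$2"
  defines "F == side P (P + tau / 2) (P + tau) eta sg" and "G == side p m q eta sg"
  shows "wedge (dquad1 F x) (dquad2 F x) = 2 * sg * tau * side_D P tau eta s y"
    and "wedge (dquad1 G x) (dquad2 G x) = 2 * sg * side_V p m q eta s y"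
    and "stretch (dquad1 F x) (dquad2 F x) (dquad1 G x) (dquad2 G x) = (2 * sg * tau)\<^sup>2 * side_X P tau p m q eta s y"
proof -
  define k where "k = P * (1 + (1 - eta) * (4 * y - 1)) + tau * s"
  define z where "z = P + s * tau - P * eta * (4 * y - 1)"
  define c where "c = side_s p m q eta s y / tau"
  define h where "h = (m - p) / tau"
  have Fs: "side_s P (P + tau / 2) (P + tau) eta s y = tau * (1 - 2 * eta * y)"
    and Fo: "side_o P (P + tau / 2) eta s y = z" and Fr: "side_r P (P + tau / 2) eta s y = k"
    using tau by (simp_all add: side_s_def side_o_def side_r_def k_def z_def field_simps)
  have Gs: "side_s p m q eta s y = tau * c" using tau by (simp add: c_def)
  have mh: "m - p = tau * h" using tau by (simp add: h_def)
  show "wedge (dquad1 F x) (dquad2 F x) = 2 * sg * tau * side_D P tau eta s y"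
    unfolding F_def side_map wedge_def vector_2 side_D_def s_def[symmetric] y_def[symmetric] Fs Fo Fr
    by (simp add: z_def k_def field_simps power2_eq_square)
  show "wedge (dquad1 G x) (dquad2 G x) = 2 * sg * side_V p m q eta s y"
    unfolding G_def side_map wedge_def vector_2 side_V_def s_def[symmetric] y_def[symmetric]
    by (simp add: field_simps power2_eq_square)
  define a b :: "real^2" where "a = vector [tau * (1 - 2 * eta * y), 2 * sg * tau * y]"
    and "b = vector [- 2 * eta * k, 2 * sg * z]"
  define c' d :: "real^2" where "c' = vector [tau * c, 4 * sg * (tau * h) * y]"
    and "d = vector [- 2 * eta * side_r p m eta s y, 2 * sg * side_o p m eta s y]"
  have cols: "dquad1 F x = a" "dquad2 F x = b" "dquad1 G x = c'" "dquad2 G x = d"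
    unfolding F_def G_def side_map s_def[symmetric] y_def[symmetric] Fs Fo Fr Gs mh a_def b_def c'_def d_def
    by (simp_all add: vec2_eq_iff)
  have 1: "(c' $ 1 * b $ 2 - d $ 1 * a $ 2)\<^sup>2 = (2 * sg * tau)\<^sup>2 * (c * z + 2 * eta * y * side_r p m eta s y)\<^sup>2"
    unfolding power_mult_distrib[symmetric]
    by (intro arg_cong[where f="%x. x\<^sup>2"]) (simp add: a_def b_def c'_def d_def field_simps power2_eq_square)
  have 2: "(d $ 1 * a $ 1 - c' $ 1 * b $ 1)\<^sup>2 = (2 * sg * tau)\<^sup>2 * (eta / (2 - eta) * (c * k - side_r p m eta s y * (1 - 2 * eta * y))\<^sup>2)"
  proof -
    have "d $ 1 * a $ 1 - c' $ 1 * b $ 1 = (2 * tau * eta) * (c * k - side_r p m eta s y * (1 - 2 * eta * y))"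
      by (simp add: a_def b_def c'_def d_def algebra_simps power2_eq_square)
    then show ?thesis using eta by (simp add: power_mult_distrib sg) (simp add: power2_eq_square)
  qed
  have 3: "(c' $ 2 * b $ 2 - d $ 2 * a $ 2)\<^sup>2 = (2 * sg * tau)\<^sup>2 * (eta * (2 - eta) * (4 * y * h * z - 2 * y * side_o p m eta s y)\<^sup>2)"
  proof -
    have "c' $ 2 * b $ 2 - d $ 2 * a $ 2 = (2 * sg * tau) * (sg * (4 * y * h * z - 2 * y * side_o p m eta s y))"
      by (simp add: a_def b_def c'_def d_def algebra_simps power2_eq_square)
    then show ?thesis unfolding sg[symmetric] by (simp only: power_mult_distrib)
  qed
  have 4: "(d $ 2 * a $ 1 - c' $ 2 * b $ 1)\<^sup>2 = (2 * sg * tau)\<^sup>2 * (side_o p m eta s y * (1 - 2 * eta * y) + 4 * eta * y * h * k)\<^sup>2"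
    unfolding power_mult_distrib[symmetric]
    by (intro arg_cong[where f="%x. x\<^sup>2"]) (simp add: a_def b_def c'_def d_def field_simps power2_eq_square)
  show "stretch (dquad1 F x) (dquad2 F x) (dquad1 G x) (dquad2 G x) = (2 * sg * tau)\<^sup>2 * side_X P tau p m q eta s y"
    unfolding cols stretch_eq_sum_squares 1 2 3 4 side_X_def c_def[symmetric] h_def[symmetric] z_def[symmetric] k_def[symmetric]
    by (simp only: distrib_left)
qed

section \<open>Bounds for the Jacobians and radii of fans and sides\<close>

lemma abs_bounds: "\<bar>x\<bar> <= a ==> \<bar>y\<bar> <= b ==> \<bar>x * y\<bar> <= a * b" for x y a b :: real
  by (simp add: abs_mult mult_mono')

lemma norm_diff_from_squares:
  fixes n t K :: real
  assumes "0 <= n" "0 < t" "\<bar>n\<^sup>2 - t\<^sup>2\<bar> <= K * t\<^sup>2" shows "\<bar>n - t\<bar> <= K * t"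
proof -
  have "n\<^sup>2 - t\<^sup>2 = (n - t) * (n + t)" by (simp add: power2_eq_square algebra_simps)
  then have "\<bar>n - t\<bar> * (n + t) = \<bar>n\<^sup>2 - t\<^sup>2\<bar>"
    using assms(1,2) by (simp add: abs_mult)
  moreover have "\<bar>n - t\<bar> * t <= \<bar>n - t\<bar> * (n + t)" using assms by (intro mult_left_mono) auto
  ultimately have "\<bar>n - t\<bar> * t <= K * t\<^sup>2" using assms(3) by linarith
  then have "\<bar>n - t\<bar> * t <= (K * t) * t" by (simp add: power2_eq_square)
  then show ?thesis using assms by (simp add: mult_le_cancel_right)
qed

text \<open>One setting for A (\<open>dl > 0\<close>, tip on the inner circle) and B
  (\<open>dl < 0\<close>, tip on the outer circle); the base has radius \<open>P + dl\<close>. The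
  number 293/1000 is 1 - cos(pi/4) rounded up, the value of eta at N = 2.\<close>

locale fan_triangle =
  fixes P dl eta sg s y t :: real
  assumes P: "0 < P" and Q: "0 < P + dl" and dl: "dl \<noteq> 0"
    and eta: "0 < eta" "eta <= (293/1000)" and sg: "sg\<^sup>2 = eta * (2 - eta)"
    and s: "0 < s" "s <= 1" and y: "\<bar>y\<bar> <= s"
    and t: "t = P + s * dl"
begin

lemma t_pos: "0 < t"
proof -
  have "t = (1 - s) * P + s * (P + dl)" by (simp add: t algebra_simps)
  then show ?thesis using P Q s by (smt (verit) mult_nonneg_nonneg mult_pos_pos)
qed

text \<open>t is the convex combination (1 - s)*P + s*(P + dl). Although the base radius can be far
  larger than t near the tip, its product with s, and hence with y, is not; this makes the y-terms
  relative errors.\<close>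

lemma base_le: "(P + dl) * s <= t"
  using P s mult_left_le[of s P] by (simp add: t algebra_simps)

lemma base_y_le: "(P + dl) * \<bar>y\<bar> <= t" "(P + dl) * y\<^sup>2 <= t * \<bar>y\<bar>" "(P + dl) * y\<^sup>2 <= t"
proof -
  show 1: "(P + dl) * \<bar>y\<bar> <= t" using base_le y Q by (smt (verit) mult_left_mono)
  have "(P + dl) * y\<^sup>2 = ((P + dl) * \<bar>y\<bar>) * \<bar>y\<bar>"
    by (simp add: mult.assoc) (simp add: power2_eq_square flip: abs_mult)
  then show 2: "(P + dl) * y\<^sup>2 <= t * \<bar>y\<bar>" using mult_right_mono[OF 1, of "\<bar>y\<bar>"] by linarith
  have "t * \<bar>y\<bar> <= t" using y s t_pos by (simp add: mult_left_le)
  with 2 show "(P + dl) * y\<^sup>2 <= t" by linarith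
qed

lemma step_le: "\<bar>dl\<bar> * (s * (1 - s)) <= t"
proof (cases "0 < dl")
  case True
  have "dl * (s * (1 - s)) <= dl * s" using True s by (intro mult_left_mono) (auto simp: mult_left_le)
  then have "\<bar>dl\<bar> * (s * (1 - s)) <= s * dl" using True by (simp add: mult.commute)
  then show ?thesis using P unfolding t by linarith
next
  case False
  have "(P - (P + dl)) * (s * (1 - s)) <= P * (s * (1 - s))"
    using Q s by (intro mult_right_mono) auto
  also have "\<dots> <= P * (1 - s)" using P s by (intro mult_left_mono) (auto simp: mult_left_le_one_le)
  also have "\<dots> <= t" using Q s mult_nonneg_nonneg[of s "P + dl"] by (simp add: t algebra_simps)
  finally show ?thesis using False by simp
qed

text \<open>The shift of the tangential width is only of size eta*(P + dl), not eta*t; this produces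
  the weight at the tip of A. From below it is harmless: it is negative only for s > 1/2, where (P +
  dl)*(2*s - 1) <= (P + dl)*s <= t.\<close>

lemma base_shift:
  "\<bar>(P + dl) * eta * (1 - 2 * s)\<bar> <= eta * (P + dl)" "(7/10) * t <= t + (P + dl) * eta * (1 - 2 * s)"
proof -
  have "\<bar>1 - 2 * s\<bar> <= 1" using s by auto
  then show "\<bar>(P + dl) * eta * (1 - 2 * s)\<bar> <= eta * (P + dl)"
    using Q eta mult_left_mono[of "\<bar>1 - 2 * s\<bar>" 1 "(P + dl) * eta"] by (simp add: abs_mult mult.commute)
  have "(P + dl) * (2 * s - 1) <= (P + dl) * s" using Q s by (intro mult_left_mono) auto
  then have "(P + dl) * (2 * s - 1) <= t" using base_le by linarith
  then have "eta * ((P + dl) * (2 * s - 1)) <= eta * t" using eta by (intro mult_left_mono) auto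
  also have "\<dots> <= (3/10) * t" using eta t_pos by (intro mult_right_mono) auto
  finally have "- ((3/10) * t) <= (P + dl) * eta * (1 - 2 * s)" by (simp add: algebra_simps)
  then show "(7/10) * t <= t + (P + dl) * eta * (1 - 2 * s)" by linarith
qed

text \<open>The bending of the base contributes
  \<open>xi = (P + dl) * eta\<^sup>2 / \<bar>dl\<bar>\<close>, and the last term is
  \<open>base_shift\<close>. The assumption says xi <= 1, which tames the product of the
  two.\<close>

lemma fan_D_close:
  assumes X: "(P + dl) * eta\<^sup>2 <= \<bar>dl\<bar>"
  shows "\<bar>fan_D P dl eta s y - t\<bar> <= 20 * (eta + (P + dl) * eta\<^sup>2 / \<bar>dl\<bar>) * t + 4 * (eta * (P + dl))"
proof -
  define xi where "xi = (P + dl) * eta\<^sup>2 / \<bar>dl\<bar>"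
  define z where "z = (P + dl) * eta * (1 - 2 * s)"
  define c where "c = 2 * eta * ((P + dl) * eta / dl - 1) * (2 * s - 1)"
  define w where "w = 4 * (P + dl) * eta * (2 - eta) * y\<^sup>2 * (1 - 2 * (P + dl) * eta / dl)"
  have xi: "0 <= xi" "xi <= 1" using X dl Q by (auto simp: xi_def divide_le_eq)
  have D: "fan_D P dl eta s y - t = c * t + z + c * z + w"
    unfolding fan_D_def t[symmetric] c_def[symmetric] z_def[symmetric] w_def[symmetric] by (simp add: algebra_simps)
  have a: "\<bar>(P + dl) * eta\<^sup>2 / dl\<bar> = xi" using Q by (simp add: xi_def abs_mult)
  have c: "\<bar>c\<bar> <= 2 * xi + 2 * eta"
  proof -
    have "\<bar>2 * eta * ((P + dl) * eta / dl - 1)\<bar> = \<bar>2 * ((P + dl) * eta\<^sup>2 / dl) - 2 * eta\<bar>"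
      by (simp add: power2_eq_square algebra_simps)
    also have "\<dots> <= 2 * xi + 2 * eta" using a eta by linarith
    finally have "\<bar>c\<bar> <= (2 * xi + 2 * eta) * 1" unfolding c_def using s by (intro abs_bounds) auto
    then show ?thesis by simp
  qed
  have z: "\<bar>z\<bar> <= eta * (P + dl)" unfolding z_def by (rule base_shift)
  have ct: "\<bar>c * t\<bar> <= (2 * xi + 2 * eta) * t" using c t_pos by (intro abs_bounds) auto
  have cz: "\<bar>c * z\<bar> <= 3 * (eta * (P + dl))" using c z xi eta by (intro abs_bounds) auto
  have w: "\<bar>w\<bar> <= 8 * (eta + 2 * xi) * t"
  proof -
    have "w = (4 * (2 - eta) * ((P + dl) * y\<^sup>2)) * (eta - 2 * ((P + dl) * eta\<^sup>2 / dl))"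
      by (simp add: w_def power2_eq_square algebra_simps)
    moreover have "\<bar>4 * (2 - eta) * ((P + dl) * y\<^sup>2)\<bar> <= 8 * t"
    proof -
      have "\<bar>(4 * (2 - eta)) * ((P + dl) * y\<^sup>2)\<bar> <= 8 * t"
        using base_y_le(3) Q eta by (intro abs_bounds) auto
      then show ?thesis by simp
    qed
    moreover have "\<bar>eta - 2 * ((P + dl) * eta\<^sup>2 / dl)\<bar> <= eta + 2 * xi" using a eta by linarith
    ultimately have "\<bar>w\<bar> <= (8 * t) * (eta + 2 * xi)" by (metis abs_bounds)
    then show ?thesis by (simp add: algebra_simps)
  qed
  have "\<bar>fan_D P dl eta s y - t\<bar> <= \<bar>c * t\<bar> + \<bar>z\<bar> + \<bar>c * z\<bar> + \<bar>w\<bar>" unfolding D by linarith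
  also have "\<dots> <= 20 * (eta + xi) * t + 4 * (eta * (P + dl))"
  proof -
    have "20 * (eta + xi) * t - ((2 * xi + 2 * eta) * t + 8 * (eta + 2 * xi) * t) = 10 * (eta * t) + 2 * (xi * t)"
      by algebra
    moreover have "0 <= 10 * (eta * t) + 2 * (xi * t)" using t_pos eta xi by simp
    ultimately have "(2 * xi + 2 * eta) * t + 8 * (eta + 2 * xi) * t <= 20 * (eta + xi) * t" by linarith
    then show ?thesis using ct z cz w by linarith
  qed
  finally show ?thesis by (simp add: xi_def)
qed

context
  assumes C: "\<bar>2 * eta * ((P + dl) * eta / dl - 1)\<bar> <= (4/5)"
begin

text \<open>The first product is at least (1/5)*(7/10)*t = (14/100)*t. By (P + dl)*y^2 <= t the y^2
  term may take away half of that.\<close>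

lemma fan_D_lower:
  assumes w: "- (7/100) * (P + dl) <= 4 * (P + dl) * eta * (2 - eta) * (1 - 2 * (P + dl) * eta / dl)"
  shows "(7/100) * t <= fan_D P dl eta s y"
proof -
  have "\<bar>2 * eta * ((P + dl) * eta / dl - 1) * (2 * s - 1)\<bar> <= (4/5) * 1"
    using C s by (intro abs_bounds) auto
  then have 1: "(1/5) <= 1 + 2 * eta * ((P + dl) * eta / dl - 1) * (2 * s - 1)" by linarith
  have "(1/5) * ((7/10) * t) <= (1 + 2 * eta * ((P + dl) * eta / dl - 1) * (2 * s - 1)) * (t + (P + dl) * eta * (1 - 2 * s))"
    using 1 base_shift(2) t_pos by (intro mult_mono) auto
  moreover have "(- (7/100) * (P + dl)) * y\<^sup>2 <= (4 * (P + dl) * eta * (2 - eta) * (1 - 2 * (P + dl) * eta / dl)) * y\<^sup>2"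
    using w by (intro mult_right_mono) auto
  moreover have "(4 * (P + dl) * eta * (2 - eta) * (1 - 2 * (P + dl) * eta / dl)) * y\<^sup>2
      = 4 * (P + dl) * eta * (2 - eta) * y\<^sup>2 * (1 - 2 * (P + dl) * eta / dl)"
    by (simp only: ac_simps)
  moreover have "(- (7/100) * (P + dl)) * y\<^sup>2 = - (7/100) * ((P + dl) * y\<^sup>2)" by simp
  ultimately show ?thesis using base_y_le(3) unfolding fan_D_def t[symmetric] by linarith
qed

text \<open>Here n is the distance of the image point from the origin. The last bound keeps the
  element inside the disc of the outer radius, so that r is defined at n; the lower bound keeps
  singular powers of n comparable with those of t.\<close>

lemma fan_norm:
  fixes n :: real
  assumes n: "0 <= n" "n\<^sup>2 = (t - 2 * eta * ((P + dl) * eta - dl) * s * (1 - s) - 2 * (P + dl) * eta * (2 - eta) * y\<^sup>2)\<^sup>2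
        + (2 * sg * y * (t + (P + dl) * eta * (1 - 2 * s)))\<^sup>2"
  shows "\<bar>n - t\<bar> <= 45 * eta * t" and "(2/25) * t <= n" and "n <= max P (P + dl)"
proof -
  define c where "c = 2 * eta * ((P + dl) * eta - dl) * s * (1 - s)"
  define z where "z = t + (P + dl) * eta * (1 - 2 * s)"
  define e where "e = t - c"
  define k where "k = 2 * (P + dl) * eta * (2 - eta)"
  have n2: "n\<^sup>2 = (e - k * y\<^sup>2)\<^sup>2 + 4 * sg\<^sup>2 * y\<^sup>2 * z\<^sup>2"
    unfolding n(2) by (simp add: c_def z_def e_def k_def power_mult_distrib mult.assoc)
  have "2 * eta * ((P + dl) * eta - dl) = (2 * eta * ((P + dl) * eta / dl - 1)) * dl"
    using dl by (simp add: field_simps)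
  then have "c = (2 * eta * ((P + dl) * eta / dl - 1)) * (dl * (s * (1 - s)))"
    unfolding c_def by (simp only: mult.assoc)
  then have "\<bar>c\<bar> <= (4/5) * (\<bar>dl\<bar> * (s * (1 - s)))"
    using C s abs_bounds[OF C, of "dl * (s * (1 - s))" "\<bar>dl\<bar> * (s * (1 - s))"] by (simp add: abs_mult)
  note c = this
  have c1: "\<bar>c\<bar> <= 3 * eta * t"
  proof -
    have "c = 2 * eta * (eta * (((P + dl) * s) * (1 - s)) - dl * (s * (1 - s)))" by (simp add: c_def algebra_simps)
    moreover have "\<bar>((P + dl) * s) * (1 - s)\<bar> <= t * 1"
      using base_le Q s by (intro abs_bounds) auto
    moreover have "\<bar>dl * (s * (1 - s))\<bar> <= t" using step_le s by (simp add: abs_mult)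
    moreover have "\<bar>eta * (((P + dl) * s) * (1 - s))\<bar> <= (293/1000) * (t * 1)"
      using eta calculation(2) by (intro abs_bounds[of eta]) auto
    ultimately have "\<bar>eta * (((P + dl) * s) * (1 - s)) - dl * (s * (1 - s))\<bar> <= (1293/1000) * t"
      and cc: "c = 2 * eta * (eta * (((P + dl) * s) * (1 - s)) - dl * (s * (1 - s)))" by linarith+
    then have "\<bar>c\<bar> <= (2 * eta) * ((1293/1000) * t)" unfolding cc using eta by (intro abs_bounds) auto
    moreover have "(2 * eta) * ((1293/1000) * t) <= 3 * eta * t" using eta t_pos by simp
    ultimately show ?thesis by linarith
  qed
  have ky: "0 <= k * y\<^sup>2" "k * y\<^sup>2 <= 4 * eta * t" "k * y\<^sup>2 <= 2 * eta * (2 - eta) * (t * \<bar>y\<bar>)"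
  proof -
    have "k * y\<^sup>2 = 2 * eta * (2 - eta) * ((P + dl) * y\<^sup>2)" by (simp add: k_def)
    moreover have "2 * eta * (2 - eta) * ((P + dl) * y\<^sup>2) <= 2 * eta * (2 - eta) * (t * \<bar>y\<bar>)"
      using base_y_le(2) eta by (intro mult_left_mono) auto
    moreover have "2 * eta * (2 - eta) * ((P + dl) * y\<^sup>2) <= (4 * eta) * t"
    proof (rule mult_mono)
      show "2 * eta * (2 - eta) <= 4 * eta" using eta by (simp add: algebra_simps)
    qed (use base_y_le(3) eta Q in auto)
    ultimately show "k * y\<^sup>2 <= 4 * eta * t" "k * y\<^sup>2 <= 2 * eta * (2 - eta) * (t * \<bar>y\<bar>)" by linarith+
    show "0 <= k * y\<^sup>2" using Q eta by (simp add: k_def)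
  qed
  have z1: "(7/10) * t <= z" unfolding z_def by (rule base_shift)
  have yz: "\<bar>y * z\<bar> <= (1293/1000) * t"
  proof -
    have "y * z = y * t + eta * ((P + dl) * y) * (1 - 2 * s)" by (simp add: z_def algebra_simps)
    moreover have "\<bar>y * t\<bar> <= 1 * t" using y s t_pos by (intro abs_bounds) auto
    moreover have "\<bar>eta * ((P + dl) * y) * (1 - 2 * s)\<bar> <= ((293/1000) * t) * 1"
      using eta base_y_le(1) Q s by (intro abs_bounds) (auto simp: abs_mult)
    ultimately show ?thesis by linarith
  qed
  have O2: "4 * sg\<^sup>2 * y\<^sup>2 * z\<^sup>2 <= 14 * eta * t\<^sup>2"
  proof -
    have "(y * z)\<^sup>2 <= ((1293/1000) * t)\<^sup>2" using yz t_pos abs_le_square_iff[of "y * z" "(1293/1000) * t"] by simp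
    also have "\<dots> <= (17/10) * t\<^sup>2" unfolding power_mult_distrib
      by (intro mult_right_mono) (simp_all add: power2_eq_square)
    finally have yz2: "(y * z)\<^sup>2 <= (17/10) * t\<^sup>2" .
    have sg8: "4 * sg\<^sup>2 <= 8 * eta" using eta by (simp add: sg)
    have "(4 * sg\<^sup>2) * (y * z)\<^sup>2 <= (8 * eta) * ((17/10) * t\<^sup>2)"
      by (rule mult_mono[OF sg8 yz2]) (use eta in auto)
    moreover have "(8 * eta) * ((17/10) * t\<^sup>2) <= 14 * eta * t\<^sup>2" using eta by simp
    ultimately show ?thesis by (simp add: power_mult_distrib mult.assoc)
  qed
  have et: "\<bar>e - k * y\<^sup>2 - t\<bar> <= 7 * eta * t" using c1 ky by (simp add: e_def)
  have "\<bar>n\<^sup>2 - t\<^sup>2\<bar> <= (45 * eta) * t\<^sup>2"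
  proof -
    have "7 * eta * t <= (21/10) * t" using eta t_pos by simp
    then have "\<bar>e - k * y\<^sup>2 + t\<bar> <= (41/10) * t" using et t_pos by linarith
    then have "\<bar>(e - k * y\<^sup>2 - t) * (e - k * y\<^sup>2 + t)\<bar> <= (7 * eta * t) * ((41/10) * t)"
      using et by (intro abs_bounds)
    moreover have "(7 * eta * t) * ((41/10) * t) = (287/10) * (eta * t\<^sup>2)" by (simp add: power2_eq_square)
    moreover have "(e - k * y\<^sup>2 - t) * (e - k * y\<^sup>2 + t) = (e - k * y\<^sup>2)\<^sup>2 - t\<^sup>2"
      by (simp add: power2_eq_square algebra_simps)
    moreover have "0 <= 4 * sg\<^sup>2 * y\<^sup>2 * z\<^sup>2" by simp
    moreover have "0 <= eta * t\<^sup>2" using eta by simp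
    ultimately show ?thesis using O2 n2 by linarith
  qed
  then show "\<bar>n - t\<bar> <= 45 * eta * t" using norm_diff_from_squares[OF n(1) t_pos] by simp
  \<comment> \<open>The first coordinate falls below t/5 only by the y^2 term, and (7/10) of that
    term is dominated by the second coordinate. Hence t/5 <= (1 + 10/7)*n, and 7/85 > 2/25.\<close>
  show "(2/25) * t <= n"
  proof -
    have "(4/5) * (\<bar>dl\<bar> * (s * (1 - s))) <= (4/5) * t" using step_le by linarith
    then have e: "(1/5) * t <= e" using c unfolding e_def by linarith
    have nE: "e - k * y\<^sup>2 <= n"
      by (rule power2_le_imp_le) (use n2 n(1) in auto)
    have nO: "2 * \<bar>sg\<bar> * \<bar>y\<bar> * z <= n"
    proof (rule power2_le_imp_le)
      show "(2 * \<bar>sg\<bar> * \<bar>y\<bar> * z)\<^sup>2 <= n\<^sup>2" using n2 by (simp add: power_mult_distrib)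
    qed fact
    have "eta * (2 - eta) <= 1" using zero_le_power2[of "1 - eta"] by (simp add: power2_eq_square algebra_simps)
    then have "\<bar>sg\<bar> <= 1" by (metis sg abs_square_le_1)
    then have "\<bar>sg\<bar> * \<bar>sg\<bar> <= \<bar>sg\<bar> * 1" by (intro mult_left_mono) auto
    then have "sg\<^sup>2 <= \<bar>sg\<bar>" by (simp add: power2_eq_square)
    then have sg1: "eta * (2 - eta) <= \<bar>sg\<bar>" using sg by simp
    have "(7/10) * (k * y\<^sup>2) <= (2 * (eta * (2 - eta)) * \<bar>y\<bar>) * ((7/10) * t)" using ky(3) by (simp add: algebra_simps)
    also have "\<dots> <= (2 * \<bar>sg\<bar> * \<bar>y\<bar>) * z"
      using sg1 z1 t_pos eta by (intro mult_mono) auto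
    finally show ?thesis using e nE nO t_pos by linarith
  qed
  show "n <= max P (P + dl)"
  proof -
    define M where "M = max P (P + dl)"
    have M0: "0 < M" using P by (simp add: M_def)
    \<comment> \<open>At fixed s the squared distance is a convex quadratic in Y = y^2 on the
      interval from 0 to s^2, so it suffices to bound it at the two ends.\<close>
    define f where "f Y = (e - k * Y)\<^sup>2 + 4 * sg\<^sup>2 * Y * z\<^sup>2" for Y
    have "(4/5) * (\<bar>dl\<bar> * (s * (1 - s))) <= (4/5) * t" using step_le by linarith
    then have "0 <= e" using c t_pos unfolding e_def by linarith
    moreover have "e <= M"
    proof (cases "0 < dl")
      case True
      have "(4/5) * (dl * (s * (1 - s))) <= dl * (1 - s)"
      proof -
        have "(4/5) * s * (dl * (1 - s)) <= 1 * (dl * (1 - s))" using s True by (intro mult_right_mono) auto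
        then show ?thesis by (simp add: algebra_simps)
      qed
      moreover have "\<bar>c\<bar> <= (4/5) * (dl * (s * (1 - s)))" using c True by simp
      ultimately have "- c <= dl * (1 - s)" by linarith
      then show ?thesis using True by (simp add: e_def M_def t algebra_simps)
    next
      case False
      have "(4/5) * ((- dl) * (s * (1 - s))) <= (- dl) * s"
      proof -
        have "(4/5) * (1 - s) * ((- dl) * s) <= 1 * ((- dl) * s)"
          using s False by (intro mult_right_mono mult_nonneg_nonneg) auto
        then show ?thesis by (simp add: algebra_simps)
      qed
      then show ?thesis using c False by (simp add: e_def M_def t algebra_simps)
    qed
    ultimately have f0: "f 0 <= M\<^sup>2" by (simp add: f_def power_mono)
    \<comment> \<open>Y = s^2 is a lateral edge. Centring radius and parameter (\<open>m\<close>,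
      \<open>a\<close>, \<open>v\<close>) turns the value there into (m + a*v)^2 with damped
      coefficients.\<close>
    have f1: "f (s\<^sup>2) <= M\<^sup>2"
    proof -
      define m where "m = P + dl / 2"
      define v where "v = 2 * s - 1"
      define a where "a = dl / 2"
      have sv: "s = (1 + v) / 2" and Pm: "P = m - a" and dla: "dl = 2 * a" by (simp_all add: v_def m_def a_def)
      have v: "v\<^sup>2 <= 1" using s by (simp add: v_def abs_square_le_1)
      have "f (s\<^sup>2) = m\<^sup>2 * (1 - eta\<^sup>2 * v\<^sup>2 * (1 - v\<^sup>2)) + 2 * m * a * v * (1 - eta * (1 - v\<^sup>2))
          + a\<^sup>2 * v\<^sup>2 * (1 - eta * (2 - eta) * (1 - v\<^sup>2))"
        unfolding f_def e_def c_def k_def z_def sg t unfolding sv Pm dla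
        by (simp add: power2_eq_square field_simps)
      also have "\<dots> <= m\<^sup>2 + 2 * m * \<bar>a\<bar> + a\<^sup>2"
      proof -
        have m0: "0 < m" using P Q by (simp add: m_def)
        have h: "0 <= 1 - v\<^sup>2" "1 - v\<^sup>2 <= 1" using v by auto
        have "0 <= m\<^sup>2 * (eta\<^sup>2 * v\<^sup>2 * (1 - v\<^sup>2))" using h by (intro mult_nonneg_nonneg) auto
        moreover have "\<bar>v\<bar> <= 1" using v by (simp add: abs_square_le_1)
        have e1: "0 <= eta * (1 - v\<^sup>2)" "eta * (1 - v\<^sup>2) <= 1" "0 <= eta * (2 - eta) * (1 - v\<^sup>2)" "eta * (2 - eta) * (1 - v\<^sup>2) <= 1"
        proof -
          have e: "0 <= eta * (2 - eta)" "eta * (2 - eta) <= 1"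
            using eta zero_le_power2[of "1 - eta"] by (auto simp: power2_eq_square algebra_simps)
          show "0 <= eta * (1 - v\<^sup>2)" using eta h by simp
          show "0 <= eta * (2 - eta) * (1 - v\<^sup>2)" using e h by simp
          show "eta * (1 - v\<^sup>2) <= 1" by (rule mult_le_one) (use eta h in auto)
          show "eta * (2 - eta) * (1 - v\<^sup>2) <= 1" by (rule mult_le_one) (use e h in auto)
        qed
        have "\<bar>(a * v) * (1 - eta * (1 - v\<^sup>2))\<bar> <= (\<bar>a\<bar> * 1) * 1"
          using \<open>\<bar>v\<bar> <= 1\<close> e1 by (intro abs_bounds) auto
        then have "2 * m * ((a * v) * (1 - eta * (1 - v\<^sup>2))) <= 2 * m * \<bar>a\<bar>"
          using m0 by (intro mult_left_mono) auto
        moreover have "a\<^sup>2 * v\<^sup>2 * (1 - eta * (2 - eta) * (1 - v\<^sup>2)) <= a\<^sup>2 * 1 * 1"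
          using e1 v by (intro mult_mono mult_left_mono) auto
        ultimately show ?thesis by (simp add: algebra_simps)
      qed
      also have "\<dots> = (m + \<bar>a\<bar>)\<^sup>2" by (simp add: power2_sum)
      also have "m + \<bar>a\<bar> = M" by (auto simp: m_def a_def M_def max_def)
      finally show ?thesis .
    qed
    define th where "th = y\<^sup>2 / s\<^sup>2"
    have Y: "y\<^sup>2 = th * s\<^sup>2" using s by (simp add: th_def)
    have "y\<^sup>2 <= s\<^sup>2" using y s by (metis abs_le_square_iff abs_of_pos)
    then have th: "0 <= th" "th <= 1" using s by (auto simp: th_def divide_le_eq)
    have "(1 - th) * f 0 + th * f (s\<^sup>2) - f (th * s\<^sup>2) = th * (1 - th) * (k * s\<^sup>2)\<^sup>2"
      unfolding f_def by (simp add: power2_eq_square algebra_simps)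
    moreover have "0 <= th * (1 - th) * (k * s\<^sup>2)\<^sup>2" using th by simp
    moreover have "(1 - th) * f 0 + th * f (s\<^sup>2) <= (1 - th) * M\<^sup>2 + th * M\<^sup>2"
      using f0 f1 th by (intro add_mono mult_left_mono) auto
    ultimately have "f (y\<^sup>2) <= M\<^sup>2" unfolding Y by (simp add: algebra_simps)
    then have "n\<^sup>2 <= M\<^sup>2" using n2 by (simp add: f_def)
    then have "n <= M" by (rule power2_le_imp_le) (use M0 in simp)
    then show ?thesis by (simp only: M_def)
  qed
qed

end

end

text \<open>Nonvanishing is known only inside the triangle. \<open>fan_D\<close> is positive at s =
  1/2, y = 0, and along the segment from there to a boundary point the intermediate value theorem
  excludes a negative end value.\<close>

lemma fan_D_nonneg:
  assumes P: "0 < P" and tau: "0 < tau" and s: "0 <= s" "s <= 1" and y: "\<bar>y\<bar> <= s"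
    and nz: "!!s y. \<bar>y\<bar> < s ==> s < 1 ==> fan_D P tau eta s y \<noteq> 0"
  shows "0 <= fan_D P tau eta s y"
proof (rule ccontr)
  define f where "f l = fan_D P tau eta (1/2 + l * (s - 1/2)) (l * y)" for l
  assume "\<not> 0 <= fan_D P tau eta s y"
  then have 1: "f 1 <= 0" "f 1 \<noteq> 0" by (auto simp: f_def)
  have 0: "0 < f 0" using P tau by (simp add: f_def fan_D_def)
  have "continuous_on {0..1} f" unfolding f_def fan_D_def by (intro continuous_intros) (use tau in auto)
  then obtain l where l0: "0 <= l" "l <= 1" "f l = 0" using IVT2'[of f 1 0 0] 1 0 by auto
  have "l \<noteq> 1" using l0(3) 1 by auto
  then have l: "l < 1" using l0 by simp
  have "\<bar>l * y\<bar> <= l * s" using y l0(1) by (simp add: abs_mult mult_left_mono)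
  moreover have "l * s < 1/2 + l * (s - 1/2)" using l by (simp add: algebra_simps)
  moreover have "1/2 + l * (s - 1/2) < 1"
    using l s l0 mult_left_mono[of s 1 l] by (simp add: algebra_simps)
  ultimately show False using nz[of "l * y" "1/2 + l * (s - 1/2)"] l0(3) by (simp add: f_def)
qed

text \<open>At s = y = 1 the Jacobian is P + tau times an expression affine in X = (P +
  tau)*eta^2/tau with negative slope, so its sign bounds X by (1 + 5*eta - 2*eta^2)/(14 - 6*eta),
  which is below 19/100 for all admissible eta.\<close>

lemma fan_D_corner:
  assumes "0 < P" "0 < tau" "0 < eta" "eta <= (293/1000)" and D: "0 <= fan_D P tau eta 1 1"
  shows "(P + tau) * eta\<^sup>2 <= (19/100) * tau"
proof -
  define X where "X = (P + tau) * eta\<^sup>2 / tau"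
  have "fan_D P tau eta 1 1 = (P + tau) * ((1 - 2 * eta + 2 * X) * (1 - eta) + 4 * eta * (2 - eta) - 8 * X * (2 - eta))"
    using assms by (simp add: fan_D_def X_def field_simps power2_eq_square)
  then have "0 <= (1 - 2 * eta + 2 * X) * (1 - eta) + 4 * eta * (2 - eta) - 8 * X * (2 - eta)"
    using D assms by (simp add: zero_le_mult_iff)
  then have 1: "X * (14 - 6 * eta) <= 1 + 5 * eta - 2 * eta\<^sup>2" by (simp add: algebra_simps power2_eq_square)
  \<comment> \<open>The tangent of eta^2 at the right end makes the remaining inequality linear in
    eta.\<close>
  have "0 <= (eta - (293/1000))\<^sup>2" by simp
  then have "(293/500) * eta - (85849/1000000) <= eta\<^sup>2" by (simp add: power2_eq_square algebra_simps)
  then have "1 + 5 * eta - 2 * eta\<^sup>2 <= (19/100) * (14 - 6 * eta)" using assms by simp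
  then have "X * (14 - 6 * eta) <= (19/100) * (14 - 6 * eta)" using 1 by linarith
  then have "X <= (19/100)" using assms by (subst (asm) mult_le_cancel_right) auto
  then show ?thesis using assms by (simp add: X_def divide_le_eq)
qed

text \<open>The bounded quantity is the coefficient of 2*s - 1 in the radial factor of
  \<open>fan_D\<close>; a bound below 1 keeps that factor above 1/5.\<close>

lemma fan_slope_bound:
  fixes P dl eta :: real
  assumes "0 < P" "0 < P + dl" "dl \<noteq> 0" "0 < eta" "eta <= (293/1000)"
    and X: "max P (P + dl) * eta\<^sup>2 <= (19/100) * \<bar>dl\<bar>"
  shows "\<bar>2 * eta * ((P + dl) * eta / dl - 1)\<bar> <= (4/5)"
proof -
  have e: "2 * eta * ((P + dl) * eta / dl - 1) = 2 * ((P + dl) * eta\<^sup>2 / dl) - 2 * eta"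
    by (simp add: power2_eq_square algebra_simps)
  show ?thesis
  proof (cases "0 < dl")
    case True
    then have "(P + dl) * eta\<^sup>2 / dl <= (19/100)" "0 <= (P + dl) * eta\<^sup>2 / dl"
      using X assms by (auto simp: divide_le_eq max_def)
    then show ?thesis unfolding e using assms by linarith
  next
    case False
    then have d: "dl < 0" using assms by simp
    then have "P * eta\<^sup>2 <= (19/100) * (- dl)" using X by (simp add: max_def)
    \<comment> \<open>For \<open>dl < 0\<close> both terms of the slope have the same sign. The gain
      -eta^2, from P + dl = P - |dl|, is what keeps 2*(19/100 - eta^2 + eta) below 4/5.\<close>
    then have "(P + dl) * eta\<^sup>2 <= ((19/100) - eta\<^sup>2) * (- dl)" by (simp add: algebra_simps)
    then have 1: "- ((P + dl) * eta\<^sup>2 / dl) <= (19/100) - eta\<^sup>2" using d by (simp add: field_simps)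
    have "0 <= - ((P + dl) * eta\<^sup>2 / dl)" using d assms by (simp add: divide_nonneg_neg)
    moreover have "(293/500) * eta - (85849/1000000) <= eta\<^sup>2"
      using zero_le_power2[of "eta - (293/1000)"] by (simp add: power2_eq_square algebra_simps)
    ultimately show ?thesis unfolding e using 1 assms by linarith
  qed
qed

text \<open>The counterpart of \<open>fan_norm\<close> for C and D, with no condition relating tau
  to eta.\<close>

lemma side_norm:
  fixes P tau eta sg s y t n :: real
  assumes P: "0 < P" and tau: "0 < tau" and eta: "0 < eta" "eta <= 293/1000" and sg: "sg\<^sup>2 = eta * (2 - eta)"
    and s: "0 <= s" "0 <= y" "s + y <= 1" and t: "t = P + s * tau"
    and n: "0 <= n" "n\<^sup>2 = (P * (1 - 2 * eta * y - 2 * eta * (1 - eta) * y * (2 * y - 1)) + s * tau * (1 - 2 * eta * y))\<^sup>2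
        + (2 * sg * y * (P * (1 - eta * (2 * y - 1)) + s * tau))\<^sup>2"
  shows "\<bar>n - t\<bar> <= 45 * eta * t" and "(2/25) * t <= n" and "n <= P + tau"
proof -
  \<comment> \<open>The image point is P*q + s*tau*u. The upper bound is the triangle inequality
    with |q| <= 1 and s*|u| <= 1.\<close>
  define q u :: "real^2"
    where "q = vector [1 - 2 * eta * y - 2 * eta * (1 - eta) * y * (2 * y - 1), 2 * sg * y * (1 - eta * (2 * y - 1))]"
      and "u = vector [1 - 2 * eta * y, 2 * sg * y]"
  define v where "v = 2 * y - 1"
  have y: "y <= 1" and s1: "s <= 1 - y" using s by auto
  have v: "\<bar>v\<bar> <= 1" "v\<^sup>2 <= 1" using s y by (auto simp: v_def abs_square_le_1)
  have taus: "0 <= s * tau" and t0: "0 < t" using s tau P by (auto simp: t add_pos_nonneg)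
  have nv: "n = norm (P *\<^sub>R q + (s * tau) *\<^sub>R u)"
  proof -
    have "(norm (P *\<^sub>R q + (s * tau) *\<^sub>R u))\<^sup>2 = n\<^sup>2"
      unfolding norm_vec2 n(2) by (simp add: q_def u_def) (simp add: algebra_simps)
    then show ?thesis using n(1) by (simp add: power2_eq_iff_nonneg)
  qed
  have q1: "norm q <= 1"
  proof -
    have "(norm q)\<^sup>2 = 1 - eta\<^sup>2 * (v\<^sup>2 * (1 - v\<^sup>2))"
      unfolding norm_vec2 q_def vector_2 power_mult_distrib sg v_def by algebra
    moreover have "0 <= eta\<^sup>2 * (v\<^sup>2 * (1 - v\<^sup>2))" using v by simp
    ultimately have "(norm q)\<^sup>2 <= 1" by linarith
    then show ?thesis by (simp add: abs_square_le_1)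
  qed
  have u2: "(norm u)\<^sup>2 = 1 - 4 * eta * y + 8 * eta * y\<^sup>2"
    unfolding norm_vec2 u_def vector_2 power_mult_distrib sg by algebra
  have su: "s * norm u <= 1"
  proof -
    have "s\<^sup>2 <= (1 - y) * 1" using s s1 unfolding power2_eq_square by (intro mult_mono) auto
    moreover have "(norm u)\<^sup>2 <= 1 + (6/5) * y\<^sup>2"
    proof -
      have "4 * eta * (y * (2 * y - 1)) <= 4 * eta * (y * y)" using eta s y by (intro mult_left_mono) auto
      also have "\<dots> <= (6/5) * (y * y)" using eta by (intro mult_right_mono) auto
      finally have "4 * eta * (y * (2 * y - 1)) <= (6/5) * y\<^sup>2" by (simp only: power2_eq_square)
      moreover have "(norm u)\<^sup>2 = 1 + 4 * eta * (y * (2 * y - 1))" using u2 by algebra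
      ultimately show ?thesis by linarith
    qed
    ultimately have "s\<^sup>2 * (norm u)\<^sup>2 <= ((1 - y) * 1) * (1 + (6/5) * y\<^sup>2)" using y by (intro mult_mono) auto
    also have "\<dots> = 1 - y * (1 - (6/5) * (y * (1 - y)))" by (simp add: algebra_simps power2_eq_square)
    also have "\<dots> <= 1"
    proof -
      have "y * (1 - y) <= 1 * (1/4 * 2)" using zero_le_power2[of "y - 1/2"] by (simp add: power2_eq_square algebra_simps)
      then show ?thesis using s by simp
    qed
    finally have "(s * norm u)\<^sup>2 <= 1" by (simp add: power_mult_distrib)
    then show ?thesis using s by (simp add: abs_square_le_1)
  qed
  show "n <= P + tau"
  proof -
    have "n <= P * norm q + tau * (s * norm u)"
      unfolding nv using norm_triangle_ineq[of "P *\<^sub>R q" "(s * tau) *\<^sub>R u"] P tau s by (simp add: abs_mult mult_ac)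
    also have "\<dots> <= P * 1 + tau * 1" using P tau q1 su by (intro add_mono mult_left_mono) auto
    finally show ?thesis by simp
  qed
  define E where "E = P * (1 - 2 * eta * y - 2 * eta * (1 - eta) * y * (2 * y - 1)) + s * tau * (1 - 2 * eta * y)"
  define O' where "O' = 2 * sg * y * (P * (1 - eta * (2 * y - 1)) + s * tau)"
  have n2: "n\<^sup>2 = E\<^sup>2 + O'\<^sup>2" using n(2) by (simp add: E_def O'_def)
  have Et: "\<bar>E - t\<bar> <= 4 * eta * t"
  proof -
    have a: "\<bar>y * (1 + (1 - eta) * v)\<bar> <= 1 * 2"
    proof (rule abs_bounds)
      have "\<bar>(1 - eta) * v\<bar> <= 1 * 1" using eta v by (intro abs_bounds) auto
      then show "\<bar>1 + (1 - eta) * v\<bar> <= 2" by linarith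
    qed (use s y in auto)
    have "E - t = - (2 * eta) * (P * (y * (1 + (1 - eta) * v)) + (s * tau) * y)"
      unfolding E_def t v_def by algebra
    moreover have "\<bar>P * (y * (1 + (1 - eta) * v)) + (s * tau) * y\<bar> <= 2 * t"
    proof -
      have "\<bar>P * (y * (1 + (1 - eta) * v))\<bar> <= P * (1 * 2)" using P a by (intro abs_bounds[of P]) auto
      moreover have "\<bar>(s * tau) * y\<bar> <= (s * tau) * 1" using taus s y by (intro abs_bounds[of "s * tau"]) auto
      moreover have "\<bar>P * (y * (1 + (1 - eta) * v)) + (s * tau) * y\<bar>
          <= \<bar>P * (y * (1 + (1 - eta) * v))\<bar> + \<bar>(s * tau) * y\<bar>" by (rule abs_triangle_ineq)
      moreover have "P * (1 * 2) + (s * tau) * 1 <= 2 * t" unfolding t using taus by (simp add: mult.commute)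
      ultimately show ?thesis by (meson add_mono order_trans)
    qed
    ultimately have "\<bar>E - t\<bar> <= (2 * eta) * (2 * t)" using eta by (metis abs_bounds abs_minus_cancel abs_of_nonneg order_refl less_imp_le mult_pos_pos zero_less_numeral)
    then show ?thesis by simp
  qed
  have ov: "7/10 <= 1 - eta * v" "1 - eta * v <= 13/10"
  proof -
    have "\<bar>eta * v\<bar> <= (293/1000) * 1" using eta v by (intro abs_bounds) auto
    then show "7/10 <= 1 - eta * v" "1 - eta * v <= 13/10" by linarith+
  qed
  have "\<bar>n\<^sup>2 - t\<^sup>2\<bar> <= (45 * eta) * t\<^sup>2"
  proof -
    have "4 * eta * t <= (293/250) * t" using eta t0 by simp
    then have "\<bar>E + t\<bar> <= 4 * t" using Et t0 by linarith
    then have "\<bar>(E - t) * (E + t)\<bar> <= (4 * eta * t) * (4 * t)" using Et by (intro abs_bounds)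
    moreover have "(E - t) * (E + t) = E\<^sup>2 - t\<^sup>2" by algebra
    moreover have "(4 * eta * t) * (4 * t) = 16 * (eta * t\<^sup>2)" by (simp add: power2_eq_square)
    moreover have "O'\<^sup>2 <= 16 * (eta * t\<^sup>2)"
    proof -
      have "\<bar>y * (P * (1 - eta * v) + s * tau)\<bar> <= 1 * ((13/10) * t)"
      proof (rule abs_bounds)
        have "P * (1 - eta * v) <= P * (13/10)" "0 <= P * (1 - eta * v)" using P ov by (auto intro: mult_left_mono)
        then show "\<bar>P * (1 - eta * v) + s * tau\<bar> <= (13/10) * t" using taus unfolding t distrib_left by simp
      qed (use s y in auto)
      then have "(y * (P * (1 - eta * v) + s * tau))\<^sup>2 <= ((13/10) * t)\<^sup>2"
        using abs_le_square_iff[of "y * (P * (1 - eta * v) + s * tau)" "(13/10) * t"] t0 by simp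
      also have "\<dots> <= 2 * t\<^sup>2" unfolding power_mult_distrib by (intro mult_right_mono) (simp_all add: power2_eq_square)
      finally have a: "(y * (P * (1 - eta * v) + s * tau))\<^sup>2 <= 2 * t\<^sup>2" .
      have b: "4 * sg\<^sup>2 <= 8 * eta" using eta by (simp add: sg)
      have "O'\<^sup>2 = (4 * sg\<^sup>2) * (y * (P * (1 - eta * v) + s * tau))\<^sup>2"
        unfolding O'_def v_def by (simp add: power_mult_distrib)
      also have "\<dots> <= (8 * eta) * (2 * t\<^sup>2)" by (rule mult_mono[OF b a]) (use eta in auto)
      finally show ?thesis by simp
    qed
    moreover have "0 <= eta * t\<^sup>2" "0 <= O'\<^sup>2" using eta by simp_all
    ultimately show ?thesis using n2 by linarith
  qed
  then show "\<bar>n - t\<bar> <= 45 * eta * t" using norm_diff_from_squares[OF n(1) t0] by simp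
  show "(2/25) * t <= n"
  proof -
    have nE: "E <= n" using n2 n(1) by (smt (verit) power2_le_imp_le zero_le_power2)
    have nO: "\<bar>O'\<bar> <= n"
    proof (rule power2_le_imp_le)
      show "\<bar>O'\<bar>\<^sup>2 <= n\<^sup>2" using n2 by simp
    qed fact
    have "eta * (2 - eta) <= 1" using zero_le_power2[of "1 - eta"] by (simp add: power2_eq_square algebra_simps)
    then have "\<bar>sg\<bar> <= 1" by (metis sg abs_square_le_1)
    then have "\<bar>sg\<bar> * \<bar>sg\<bar> <= \<bar>sg\<bar> * 1" by (intro mult_left_mono) auto
    then have "sg\<^sup>2 <= \<bar>sg\<bar>" by (simp add: power2_eq_square)
    moreover have "eta * 1 <= eta * (2 - eta)" using eta by (intro mult_left_mono) auto
    ultimately have sg1: "eta <= \<bar>sg\<bar>" using sg by simp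
    have "(7/10) * P <= P * (1 - eta * v)" using ov(1) P by (simp add: mult.commute)
    then have "(7/10) * P <= P * (1 - eta * v) + s * tau" using taus by linarith
    then have "(2 * eta * y) * ((7/10) * P) <= (2 * \<bar>sg\<bar> * y) * (P * (1 - eta * v) + s * tau)"
      using sg1 s eta P by (intro mult_mono) auto
    also have "\<dots> = \<bar>O'\<bar>"
      using s \<open>(7/10) * P <= P * (1 - eta * v) + s * tau\<close> P unfolding O'_def v_def by (simp add: abs_mult)
    finally have O1: "(7/5) * (eta * y * P) <= \<bar>O'\<bar>" by (simp add: mult_ac)
    have "\<bar>(1 - eta) * y\<bar> <= 1 * y" using eta s by (intro abs_bounds) auto
    from abs_bounds[OF this v(1)] have "(1 - eta) * y * v <= y" by simp
    then have "P * (2 * eta) * ((1 - eta) * y * v) <= P * (2 * eta) * y" using P eta by (intro mult_left_mono) auto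
    then have "P - 4 * (eta * y * P) <= P * (1 - 2 * eta * y - 2 * eta * (1 - eta) * y * v)"
      by (simp add: algebra_simps)
    moreover have "(s * tau) * (2/5) <= (s * tau) * (1 - 2 * eta * y)"
    proof (rule mult_left_mono[OF _ taus])
      have "eta * y <= (293/1000) * 1" using eta s y by (intro mult_mono) auto
      then show "2/5 <= 1 - 2 * eta * y" by linarith
    qed
    ultimately have "P - 4 * (eta * y * P) + (2/5) * (s * tau) <= E" unfolding E_def v_def by linarith
    \<comment> \<open>The loss 4*eta*y*P in the first coordinate is paid for by the second, as
      3*(7/5) >= 4. The right side is at most 4*n, whence n >= t/10.\<close>
    then have "P + (2/5) * (s * tau) <= E + 3 * \<bar>O'\<bar>" using O1 mult_nonneg_nonneg[of "eta * y" P] eta s P by linarith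
    then show ?thesis using nE nO taus P unfolding t distrib_left by linarith
  qed
qed

text \<open>\<open>side_D\<close> contains no division by tau, and (4*y - 1)*(1 - 2*y) is at most
  1/8 (at y = 3/8), so C and D never degenerate.\<close>

lemma side_D_bounds:
  fixes P tau eta s y t :: real
  assumes P: "0 < P" and tau: "0 < tau" and eta: "0 < eta" "eta <= 293/1000"
    and s: "0 <= s" "0 <= y" "s + y <= 1" and t: "t = P + s * tau"
  shows "\<bar>side_D P tau eta s y - t\<bar> <= 3 * eta * t" and "(9/10) * t <= side_D P tau eta s y"
proof -
  have y: "y <= 1" using s by simp
  have taus: "0 <= s * tau" using s tau by simp
  have D: "side_D P tau eta s y = t - eta * P * ((4 * y - 1) * (1 - 2 * y))" by (simp add: side_D_def t)
  have "(4 * y - 1) * (1 - 2 * y) = 1/8 - 8 * (y - 3/8)\<^sup>2" by (simp add: power2_eq_square algebra_simps)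
  then have u: "(4 * y - 1) * (1 - 2 * y) <= 1/8" by simp
  have "\<bar>(4 * y - 1) * (1 - 2 * y)\<bar> <= 3 * 1" using s y by (intro abs_bounds) auto
  then have "\<bar>eta * P * ((4 * y - 1) * (1 - 2 * y))\<bar> <= (eta * P) * 3" using eta P by (intro abs_bounds[of "eta * P"]) auto
  moreover have "eta * P <= eta * t" using eta taus by (simp add: t)
  ultimately show "\<bar>side_D P tau eta s y - t\<bar> <= 3 * eta * t" unfolding D by linarith
  have "eta * P * ((4 * y - 1) * (1 - 2 * y)) <= eta * P * (1/8)" using u eta P by (intro mult_left_mono) auto
  also have "\<dots> <= (4/5) * P * (1/8)" using eta P by (intro mult_right_mono) auto
  finally have "eta * P * ((4 * y - 1) * (1 - 2 * y)) <= (1/10) * P" by simp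
  then show "(9/10) * t <= side_D P tau eta s y" unfolding D t distrib_left using taus P by linarith
qed

section \<open>The cavity profile\<close>

text \<open>The slope condition makes r'(R)*r(R)/R, the Jacobian of u, bounded above and away from 0
  as R -> 0. Derivatives are taken within (0,1], hence one-sided at 1.\<close>

locale cavity =
  fixes r r' r'' r''' :: "real => real" and B c m M :: real
  assumes deriv:
      "!!R. R \<in> {0<..1} ==> (r has_real_derivative r' R) (at R within {0<..1})"
      "!!R. R \<in> {0<..1} ==> (r' has_real_derivative r'' R) (at R within {0<..1})"
      "!!R. R \<in> {0<..1} ==> (r'' has_real_derivative r''' R) (at R within {0<..1})"
    and bound: "!!R. R \<in> {0<..1} ==> \<bar>r R\<bar> <= B" "!!R. R \<in> {0<..1} ==> \<bar>r' R\<bar> <= B"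
      "!!R. R \<in> {0<..1} ==> \<bar>r'' R\<bar> <= B" "!!R. R \<in> {0<..1} ==> \<bar>r''' R\<bar> <= B"
    and c: "0 < c" "!!R. R \<in> {0<..1} ==> c <= r R"
    and slope: "0 < m" "m < M" "!!R. R \<in> {0<..1} ==> m * R <= r' R" "!!R. R \<in> {0<..1} ==> r' R <= M * R"
begin

lemma M_pos: "0 < M" using slope by simp

lemma B_pos: "0 < B" using bound(1)[of 1] c(1) c(2)[of 1] by auto

lemma taylor2:
  assumes "z \<in> {0<..1}" "w \<in> {0<..1}"
  shows "\<bar>r z - (r w + r' w * (z - w) + r'' w * (z - w)\<^sup>2 / 2)\<bar> <= B * \<bar>z - w\<bar> ^ 3 / 2"
proof -
  let ?f = "%i::nat. if i = 0 then r else if i = 1 then r' else if i = 2 then r'' else r'''"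
  have "norm (?f 0 z - (\<Sum>i\<le>2. ?f i w * (z - w) ^ i / fact i)) <= B * norm (z - w) ^ (Suc 2) / fact 2"
    by (rule field_Taylor[where S="{0<..1}" and f="?f"]) (use assms deriv bound(4) in \<open>auto simp: le_Suc_eq numeral_2_eq_2\<close>)
  then show ?thesis by (simp add: numeral_2_eq_2 numeral_3_eq_3)
qed

lemma taylor1:
  assumes "z \<in> {0<..1}" "w \<in> {0<..1}"
  shows "\<bar>r z - (r w + r' w * (z - w))\<bar> <= B * \<bar>z - w\<bar>\<^sup>2"
proof -
  let ?f = "%i::nat. if i = 0 then r else if i = 1 then r' else r''"
  have "norm (?f 0 z - (\<Sum>i\<le>1. ?f i w * (z - w) ^ i / fact i)) <= B * norm (z - w) ^ (Suc 1) / fact 1"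
    by (rule field_Taylor[where S="{0<..1}" and f="?f"]) (use assms deriv bound(3) in \<open>auto simp: le_Suc_eq\<close>)
  then show ?thesis by (simp add: numeral_2_eq_2)
qed

text \<open>The Lipschitz constant shrinks with the radius because r'(R) <= M*R. This is the origin
  of the factor eps + tau in the volume error.\<close>

lemma r_lipschitz:
  assumes "0 < z" "z <= x" "0 < w" "w <= x" "x <= 1"
  shows "\<bar>r z - r w\<bar> <= M * x * \<bar>z - w\<bar>"
proof -
  let ?f = "%i. if i = (0::nat) then r else r'"
  have "norm (?f 0 z - (\<Sum>i\<le>0. ?f i w * (z - w) ^ i / fact i)) <= (M * x) * norm (z - w) ^ (Suc 0) / fact 0"
  proof (rule field_Taylor[where S="{0<..x}" and f="?f"])
    fix i :: nat and R assume "R \<in> {0<..x}" "i <= 0"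
    then show "(?f i has_real_derivative ?f (Suc i) R) (at R within {0<..x})"
      using deriv(1)[of R] assms by (auto intro: DERIV_subset)
  next
    fix R assume R: "R \<in> {0<..x}"
    then have "m * R <= r' R" "r' R <= M * R" using slope assms by auto
    moreover have "M * R <= M * x" "0 <= m * R" using R slope by auto
    ultimately show "norm (?f (Suc 0) R) <= M * x" by simp
  qed (use assms in auto)
  then show ?thesis by simp
qed

text \<open>The first combination is the derivative in s of the quadratic interpolant of r on the
  three radii. The next two are the lines through the last two and through the first two values, and
  each has second order error.\<close>

lemma interpolation_errors:
  assumes "0 < P" "P <= 1" "0 < P + dl" "P + dl <= 1" "0 <= s" "s <= 1"
  defines "p == r P" and "n == r (P + dl / 2)" and "q == r (P + dl)" and "t == P + s * dl"
  shows "0 < t" "t <= max P (P + dl)"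
    and "\<bar>(q - p) + 2 * (p + q - 2 * n) * (2 * s - 1) - dl * r' t\<bar> <= 5 * B * \<bar>dl\<bar> ^ 3"
    and "\<bar>2 * n * (1 - s) + q * (2 * s - 1) - r t\<bar> <= 3 * B * dl\<^sup>2"
    and "\<bar>p + 2 * (n - p) * s - r t\<bar> <= 3 * B * dl\<^sup>2"
    and "\<bar>q - n\<bar> <= M * max P (P + dl) * \<bar>dl\<bar>" and "\<bar>n - p\<bar> <= M * max P (P + dl) * \<bar>dl\<bar>"
proof -
  have "t = (1 - s) * P + s * (P + dl)" by (simp add: t_def algebra_simps)
  then show t0: "0 < t"
    using assms by (smt (verit) mult_nonneg_nonneg mult_pos_pos)
  show tm: "t <= max P (P + dl)"
  proof (cases "0 <= dl")
    case True then have "s * dl <= 1 * dl" using assms by (intro mult_right_mono) auto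
    then show ?thesis by (simp add: t_def max_def)
  next
    case False then have "s * dl <= 0" using assms by (simp add: mult_nonneg_nonpos)
    then show ?thesis by (simp add: t_def max_def)
  qed
  have mem: "P \<in> {0<..1}" "P + dl / 2 \<in> {0<..1}" "P + dl \<in> {0<..1}" "t \<in> {0<..1}"
    using assms t0 tm by auto
  have diff: "P - t = - s * dl" "P + dl / 2 - t = (1/2 - s) * dl" "P + dl - t = (1 - s) * dl"
    by (simp_all add: t_def algebra_simps)
  have le: "\<bar>P - t\<bar> <= 1 * \<bar>dl\<bar>" "\<bar>P + dl / 2 - t\<bar> <= 1 * \<bar>dl\<bar>" "\<bar>P + dl - t\<bar> <= 1 * \<bar>dl\<bar>"
    unfolding diff using assms by (intro abs_bounds; auto)+
  define e where "e x = r x - (r t + r' t * (x - t) + r'' t * (x - t)\<^sup>2 / 2)" for x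
  define f where "f x = r x - (r t + r' t * (x - t))" for x
  have e: "\<bar>e x\<bar> <= B * \<bar>dl\<bar> ^ 3 / 2" if "x \<in> {0<..1}" "\<bar>x - t\<bar> <= 1 * \<bar>dl\<bar>" for x
  proof -
    have "\<bar>x - t\<bar> ^ 3 <= \<bar>dl\<bar> ^ 3" using that by (intro power_mono) auto
    then have "B * \<bar>x - t\<bar> ^ 3 <= B * \<bar>dl\<bar> ^ 3" using B_pos by (intro mult_left_mono) auto
    then show ?thesis using taylor2[OF that(1) mem(4)] unfolding e_def by linarith
  qed
  have f: "\<bar>f x\<bar> <= B * dl\<^sup>2" if "x \<in> {0<..1}" "\<bar>x - t\<bar> <= 1 * \<bar>dl\<bar>" for x
  proof -
    have "\<bar>x - t\<bar>\<^sup>2 <= \<bar>dl\<bar>\<^sup>2" using that by (intro power_mono) auto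
    then have "B * \<bar>x - t\<bar>\<^sup>2 <= B * \<bar>dl\<bar>\<^sup>2" using B_pos by (intro mult_left_mono) auto
    then show ?thesis using taylor1[OF that(1) mem(4)] unfolding f_def power2_abs by linarith
  qed
  have s2: "\<bar>2 * s - 1\<bar> <= 1" "\<bar>1 - s\<bar> <= 1" "\<bar>s\<bar> <= 1" using assms by auto
  have pe: "p = r t + r' t * (- s * dl) + r'' t * (- s * dl)\<^sup>2 / 2 + e P"
    "n = r t + r' t * ((1/2 - s) * dl) + r'' t * ((1/2 - s) * dl)\<^sup>2 / 2 + e (P + dl / 2)"
    "q = r t + r' t * ((1 - s) * dl) + r'' t * ((1 - s) * dl)\<^sup>2 / 2 + e (P + dl)"
    unfolding e_def diff by (simp_all add: p_def n_def q_def)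
  have pf: "p = r t + r' t * (- s * dl) + f P"
    "n = r t + r' t * ((1/2 - s) * dl) + f (P + dl / 2)"
    "q = r t + r' t * ((1 - s) * dl) + f (P + dl)"
    unfolding f_def diff by (simp_all add: p_def n_def q_def)
  have "(q - p) + 2 * (p + q - 2 * n) * (2 * s - 1) - dl * r' t
      = (e (P + dl) - e P) + (2 * (e P + e (P + dl) - 2 * e (P + dl / 2))) * (2 * s - 1)"
    unfolding pe by (simp add: power2_eq_square field_simps)
  moreover have "\<bar>(2 * (e P + e (P + dl) - 2 * e (P + dl / 2))) * (2 * s - 1)\<bar> <= (8 * (B * \<bar>dl\<bar> ^ 3 / 2)) * 1"
  proof (rule abs_bounds[OF _ s2(1)])
    have "\<bar>2 * (x + y - 2 * z)\<bar> <= 8 * k" if "\<bar>x\<bar> <= k" "\<bar>y\<bar> <= k" "\<bar>z\<bar> <= k" for x y z k :: real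
      unfolding distrib_left right_diff_distrib using that by linarith
    then show "\<bar>2 * (e P + e (P + dl) - 2 * e (P + dl / 2))\<bar> <= 8 * (B * \<bar>dl\<bar> ^ 3 / 2)"
      using e[OF mem(1) le(1)] e[OF mem(2) le(2)] e[OF mem(3) le(3)] by blast
  qed
  ultimately show "\<bar>(q - p) + 2 * (p + q - 2 * n) * (2 * s - 1) - dl * r' t\<bar> <= 5 * B * \<bar>dl\<bar> ^ 3"
    using e[OF mem(1) le(1)] e[OF mem(3) le(3)] by linarith
  have "2 * n * (1 - s) + q * (2 * s - 1) - r t = 2 * f (P + dl / 2) * (1 - s) + f (P + dl) * (2 * s - 1)"
    unfolding pf by (simp add: field_simps)
  moreover have "\<bar>2 * f (P + dl / 2) * (1 - s)\<bar> <= (2 * (B * dl\<^sup>2)) * 1"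
    by (rule abs_bounds[OF _ s2(2)]) (use f[OF mem(2) le(2)] in linarith)
  moreover have "\<bar>f (P + dl) * (2 * s - 1)\<bar> <= (B * dl\<^sup>2) * 1"
    by (rule abs_bounds[OF f[OF mem(3) le(3)] s2(1)])
  ultimately show "\<bar>2 * n * (1 - s) + q * (2 * s - 1) - r t\<bar> <= 3 * B * dl\<^sup>2" by linarith
  have "p + 2 * (n - p) * s - r t = 2 * f (P + dl / 2) * s + f P * (1 - 2 * s)"
    unfolding pf by (simp add: field_simps)
  moreover have "\<bar>2 * f (P + dl / 2) * s\<bar> <= (2 * (B * dl\<^sup>2)) * 1"
    by (rule abs_bounds[OF _ s2(3)]) (use f[OF mem(2) le(2)] in linarith)
  moreover have "\<bar>f P * (1 - 2 * s)\<bar> <= (B * dl\<^sup>2) * 1"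
    by (rule abs_bounds[OF f[OF mem(1) le(1)]]) (use s2(1) in linarith)
  ultimately show "\<bar>p + 2 * (n - p) * s - r t\<bar> <= 3 * B * dl\<^sup>2" by linarith
  have M0: "0 <= M * max P (P + dl)" using M_pos assms by (simp add: max_def)
  have "\<bar>q - n\<bar> <= M * max P (P + dl) * \<bar>P + dl - (P + dl / 2)\<bar>"
    unfolding q_def n_def using assms by (intro r_lipschitz) (auto simp: max_def)
  also have "\<dots> <= M * max P (P + dl) * \<bar>dl\<bar>" using M0 by (intro mult_left_mono) auto
  finally show "\<bar>q - n\<bar> <= M * max P (P + dl) * \<bar>dl\<bar>" .
  have "\<bar>n - p\<bar> <= M * max P (P + dl) * \<bar>P + dl / 2 - P\<bar>"
    unfolding p_def n_def using assms by (intro r_lipschitz) (auto simp: max_def)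
  also have "\<dots> <= M * max P (P + dl) * \<bar>dl\<bar>" using M0 by (intro mult_left_mono) auto
  finally show "\<bar>n - p\<bar> <= M * max P (P + dl) * \<bar>dl\<bar>" .
qed

end

lemma cavity_profileE:
  assumes "cavity_profile r"
  obtains r' r'' r''' B c m M where "cavity r r' r'' r''' B c m M"
proof -
  obtain D :: "nat => real => real" and m M where D0: "!!R. R \<in> {0<..1} ==> D 0 R = r R"
    and D: "!!j R. R \<in> {0<..1} ==> (D j has_real_derivative D (Suc j) R) (at R within {0<..1})"
    and bd: "!!j. j <= 3 ==> bounded (D j ` {0<..1})"
    and mM: "0 < m" "m < M" "!!R. R \<in> {0<..1} ==> m * R <= D 1 R & D 1 R <= M * R"
    using assms unfolding cavity_profile_def by blast
  have "\<exists>b. \<forall>R\<in>{0<..1}. \<bar>D j R\<bar> <= b" if "j <= 3" for j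
    using bd[OF that] by (auto simp: bounded_iff)
  then obtain b where b: "!!j R. j <= 3 ==> R \<in> {0<..1} ==> \<bar>D j R\<bar> <= b j" by metis
  define B where "B = Max (b ` {..3})"
  have B: "\<bar>D j R\<bar> <= B" if "j <= 3" "R \<in> {0<..1}" for j R
    using b[OF that] that(1) by (auto simp: B_def intro: order_trans Max_ge)
  have inf: "0 < (INF R\<in>{0<..1}. r R)" and pos: "!!R. R \<in> {0<..1} ==> 0 < r R"
    using assms unfolding cavity_profile_def by auto
  have "bdd_below (r ` {0<..1})" using pos by (intro bdd_belowI2[of _ 0]) (auto intro: less_imp_le)
  then have c: "(INF R\<in>{0<..1}. r R) <= r R" if "R \<in> {0<..1}" for R
    using that by (rule cINF_lower)
  have "(r has_real_derivative D 1 R) (at R within {0<..1})" if "R \<in> {0<..1}" for R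
    using D[OF that, of 0] has_derivative_transform[OF that, of r "D 0"] D0
    by (simp add: has_field_derivative_def)
  then have "cavity r (D 1) (D 2) (D 3) B (INF R\<in>{0<..1}. r R) m M"
    using D[of _ 1] D[of _ 2] B[of 0] B[of 1] B[of 2] B[of 3] D0 inf c mM
    by unfold_locales (auto simp: numeral_2_eq_2 numeral_3_eq_3)
  then show thesis by (rule that)
qed

section \<open>Interpolation errors on an element\<close>

lemma bigo_principalI:
  fixes f g :: "'q => real"
  assumes "!!x. x \<in> S ==> \<bar>f x\<bar> <= K * g x" "!!x. x \<in> S ==> 0 <= g x"
  shows "f \<in> O[principal S](g)"
  \<comment> \<open>With the filter \<open>principal S\<close> a Landau symbol involves no limit: it
    is a bound with one constant on all of \<open>S\<close>. Error terms can so be added and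
    multiplied without naming constants.\<close>
  using assms by (intro bigoI[where c=K]) (simp add: eventually_principal)

lemma bigo_principalD:
  fixes f g :: "'q => real"
  assumes "f \<in> O[principal S](g)"
  obtains K where "0 < K" "!!x. x \<in> S ==> \<bar>f x\<bar> <= K * \<bar>g x\<bar>"
  using assms by (auto elim!: landau_o.bigE simp: eventually_principal)

lemma bigo_principal_cong:
  fixes f g h :: "'q => real"
  assumes "g \<in> O[principal S](h)" "!!x. x \<in> S ==> f x = g x"
  shows "f \<in> O[principal S](h)"
  using assms by (subst landau_o.big.in_cong) (auto simp: eventually_principal)

lemma bigo_mult_bounded:
  fixes f g h :: "'q => real"
  shows "f \<in> O[F](g) ==> h \<in> O[F](%_. 1) ==> (%x. f x * h x) \<in> O[F](g)"
  by (rule landau_o.big_1_mult)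

lemma bounded_const: "(%_. c) \<in> O[F](%_. 1 :: real)" for c :: real
  by simp

lemma bounded_power: "f \<in> O[F](%_. 1) ==> (%x. f x ^ k) \<in> O[F](%_. 1)" for f :: "'q => real"
  by (induction k) (auto intro: landau_o.big.mult_in_1)

lemma bounded_uminus: "f \<in> O[F](g) ==> (%x. - f x) \<in> O[F](g)" for f g :: "'q => real"
  by simp

lemmas bounded_intros = sum_in_bigo landau_o.big.mult_in_1 bounded_const bounded_power bounded_uminus

text \<open>All mesh data and the point of the triangle are functions on an index set
  \<open>S\<close>. Every constant hidden in \<open>O[principal S]\<close> is then independent of
  radii, width, angle and point.\<close>

locale cavity_family = cavity r r' r'' r''' B c m M
  for r r' r'' r''' :: "real => real" and B c m M :: real +
  fixes S :: "'q set" and P d eta s y :: "'q => real"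
  assumes params: "!!x. x \<in> S ==> 0 < P x" "!!x. x \<in> S ==> P x <= 1"
      "!!x. x \<in> S ==> 0 < P x + d x" "!!x. x \<in> S ==> P x + d x <= 1" "!!x. x \<in> S ==> d x \<noteq> 0"
      "!!x. x \<in> S ==> 0 < eta x" "!!x. x \<in> S ==> eta x <= 1"
      "!!x. x \<in> S ==> 0 <= s x" "!!x. x \<in> S ==> s x <= 1" "!!x. x \<in> S ==> \<bar>y x\<bar> <= 1"
begin

definition "t x = P x + s x * d x"
definition "f1 x = max (P x) (P x + d x)"
definition "p x = r (P x)"
definition "n x = r (P x + d x / 2)"
definition "q x = r (P x + d x)"
definition "rt x = r (t x)"
definition "rt' x = r' (t x)"
definition "h x = (q x - n x) / d x"
definition "h' x = (n x - p x) / d x"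
text \<open>\<open>a\<close> is the radial derivative of the quadratic interpolant of r;
  \<open>oa\<close> and \<open>ob\<close> are the lines through two of its nodes. They approximate
  r' and r at t.\<close>

definition "a x = ((q x - p x) + 2 * (p x + q x - 2 * n x) * (2 * s x - 1)) / d x"
definition "oa x = 2 * n x * (1 - s x) + q x * (2 * s x - 1)"
definition "ob x = p x + 2 * (n x - p x) * s x"

abbreviation "tame f == f \<in> O[principal S](%_. 1 :: real)"

lemma errors:
  assumes "x \<in> S"
  shows "0 < t x" "t x <= f1 x" "f1 x <= 1" "0 < f1 x" "\<bar>d x\<bar> <= 1"
    "\<bar>d x * (a x - rt' x)\<bar> <= 5 * B * \<bar>d x\<bar> ^ 3" "\<bar>oa x - rt x\<bar> <= 3 * B * (d x)\<^sup>2" "\<bar>ob x - rt x\<bar> <= 3 * B * (d x)\<^sup>2"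
    "\<bar>d x * h x\<bar> <= M * (f1 x * \<bar>d x\<bar>)" "\<bar>d x * h' x\<bar> <= M * (f1 x * \<bar>d x\<bar>)"
    "\<bar>rt x\<bar> <= B" "\<bar>rt' x\<bar> <= M * f1 x" "\<bar>p x\<bar> <= B" "\<bar>n x\<bar> <= B" "\<bar>q x\<bar> <= B"
proof -
  note e = interpolation_errors[of "P x" "d x" "s x", folded t_def p_def n_def q_def, folded rt_def rt'_def f1_def oa_def ob_def]
  note A = params[OF assms]
  show t: "0 < t x" "t x <= f1 x" using e(1,2) A by simp_all
  show f1: "f1 x <= 1" "0 < f1 x" "\<bar>d x\<bar> <= 1" using A by (auto simp: f1_def)
  have "d x * (a x - rt' x) = (q x - p x) + 2 * (p x + q x - 2 * n x) * (2 * s x - 1) - d x * rt' x"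
    using A(5) by (simp add: a_def field_simps)
  then show "\<bar>d x * (a x - rt' x)\<bar> <= 5 * B * \<bar>d x\<bar> ^ 3" using e(3) A by simp
  show "\<bar>oa x - rt x\<bar> <= 3 * B * (d x)\<^sup>2" "\<bar>ob x - rt x\<bar> <= 3 * B * (d x)\<^sup>2" using e(4,5) A by simp_all
  show "\<bar>d x * h x\<bar> <= M * (f1 x * \<bar>d x\<bar>)" "\<bar>d x * h' x\<bar> <= M * (f1 x * \<bar>d x\<bar>)"
    using e(6,7) A by (simp_all add: h_def h'_def mult.assoc)
  have mem: "t x \<in> {0<..1}" using t f1 by simp
  show "\<bar>rt x\<bar> <= B" using bound(1)[OF mem] by (simp add: rt_def)
  have "m * t x <= r' (t x)" "r' (t x) <= M * t x" using slope(3,4)[OF mem] by auto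
  moreover have "0 <= m * t x" "M * t x <= M * f1 x" using slope t M_pos by simp_all
  ultimately show "\<bar>rt' x\<bar> <= M * f1 x" by (simp add: rt'_def)
  show "\<bar>p x\<bar> <= B" "\<bar>n x\<bar> <= B" "\<bar>q x\<bar> <= B" using A by (auto simp: p_def n_def q_def intro!: bound(1))
qed

lemma bounded_params:
  shows "tame P" "tame d" "tame eta" "tame s" "tame y" "tame t" "tame f1"
    "tame p" "tame n" "tame q" "tame rt" "tame rt'" "tame h" "tame h'" "tame a" "tame oa" "tame ob"
    and small_a: "(%x. a x - rt' x) \<in> O[principal S](%x. (d x)\<^sup>2)"
    and small_o: "(%x. oa x - rt x) \<in> O[principal S](%x. (d x)\<^sup>2)" "(%x. ob x - rt x) \<in> O[principal S](%x. (d x)\<^sup>2)"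
proof -
  show b1: "tame P" "tame d" "tame eta" "tame s" "tame y" "tame t" "tame f1"
    using params errors(1-5) by (auto intro!: bigo_principalI[where K=1] simp: less_imp_le) (force+)?
  show b2: "tame p" "tame n" "tame q" "tame rt"
    using errors by (auto intro!: bigo_principalI[where K=B])
  have "\<bar>rt' x\<bar> <= M * 1" if "x \<in> S" for x
  proof -
    have "M * f1 x <= M * 1" using errors(3)[OF that] M_pos by (intro mult_left_mono) auto
    then show ?thesis using errors(12)[OF that] by linarith
  qed
  then show b3: "tame rt'" by (intro bigo_principalI[where K=M]) auto
  have h: "\<bar>g x\<bar> <= M" if "x \<in> S" "\<bar>d x * g x\<bar> <= M * (f1 x * \<bar>d x\<bar>)" for g x
  proof -
    have "\<bar>d x\<bar> * \<bar>g x\<bar> <= \<bar>d x\<bar> * (M * f1 x)" using that by (simp add: abs_mult mult_ac)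
    then have "\<bar>g x\<bar> <= M * f1 x" using params(5)[OF that(1)] by simp
    also have "\<dots> <= M * 1" using errors(3)[OF that(1)] M_pos by (intro mult_left_mono) auto
    finally show ?thesis by simp
  qed
  show "tame h" "tame h'"
  proof -
    have hM: "\<bar>h x\<bar> <= M * 1" "\<bar>h' x\<bar> <= M * 1" if "x \<in> S" for x
      using h[where g=h, OF that errors(9)[OF that]] h[where g=h', OF that errors(10)[OF that]] by simp_all
    show "tame h" "tame h'" by (rule bigo_principalI[OF hM(1)] bigo_principalI[OF hM(2)]; simp)+
  qed
  show sa: "(%x. a x - rt' x) \<in> O[principal S](%x. (d x)\<^sup>2)"
  proof (rule bigo_principalI[where K="5 * B"])
    fix x assume x: "x \<in> S"
    have "\<bar>d x\<bar> * \<bar>a x - rt' x\<bar> <= \<bar>d x\<bar> * (5 * B * (d x)\<^sup>2)"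
      using errors(6)[OF x] by (simp add: abs_mult power3_eq_cube power2_eq_square mult_ac flip: power2_abs)
    then show "\<bar>a x - rt' x\<bar> <= 5 * B * (d x)\<^sup>2" using params(5)[OF x] by simp
  qed simp
  show so: "(%x. oa x - rt x) \<in> O[principal S](%x. (d x)\<^sup>2)" "(%x. ob x - rt x) \<in> O[principal S](%x. (d x)\<^sup>2)"
    using errors(7,8) by (auto intro!: bigo_principalI[where K="3 * B"])
  have d2: "(%x. (d x)\<^sup>2) \<in> O[principal S](%_. 1)" by (intro bounded_intros b1)
  have "(%x. (a x - rt' x) + rt' x) \<in> O[principal S](%_. 1)"
    "(%x. (oa x - rt x) + rt x) \<in> O[principal S](%_. 1)" "(%x. (ob x - rt x) + rt x) \<in> O[principal S](%_. 1)"
    by (intro sum_in_bigo landau_o.big_trans[OF sa d2] landau_o.big_trans[OF so(1) d2]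
        landau_o.big_trans[OF so(2) d2] b2 b3)+
  then show "tame a" "tame oa" "tame ob" by simp_all
qed

end

text \<open>The assumption makes the bending term at most 1. \<open>Psi\<close> and
  \<open>Phi\<close> are the mesh error and the volume error with eta in place of N^-2.\<close>

locale fan_family = cavity_family +
  assumes slender: "!!x. x \<in> S ==> f1 x * (eta x)\<^sup>2 <= \<bar>d x\<bar>"
begin

definition "Psi x = (d x)\<^sup>2 + eta x + f1 x * (eta x)\<^sup>2 / \<bar>d x\<bar>"
definition "Phi x = \<bar>d x\<bar> ^ 3 + f1 x * \<bar>d x\<bar> * eta x + (eta x)\<^sup>2"

text \<open>The quotient eta^2/d is not bounded by itself. In \<open>fan_X\<close> it occurs only
  multiplied by a radius, and these two products are bounded and of order
  \<open>Psi\<close>.\<close>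

definition "wt x = (eta x)\<^sup>2 / d x * t x"
definition "wQ x = (eta x)\<^sup>2 / d x * (P x + d x)"
definition "e x = 1 + 2 * (wQ x - eta x) * (2 * s x - 1)"
definition "z x = t x + (P x + d x) * eta x * (1 - 2 * s x)"

lemma small:
  shows "(%x. (d x)\<^sup>2) \<in> O[principal S](Psi)" "eta \<in> O[principal S](Psi)" "wt \<in> O[principal S](Psi)" "wQ \<in> O[principal S](Psi)"
    and "tame wt" "tame wQ"
proof -
  have pos: "0 <= f1 x * (eta x)\<^sup>2 / \<bar>d x\<bar>" "0 <= eta x" if "x \<in> S" for x using errors(4)[OF that] params(6)[OF that] by auto
  have w: "\<bar>(eta x)\<^sup>2 / d x * u\<bar> <= f1 x * (eta x)\<^sup>2 / \<bar>d x\<bar>" if "x \<in> S" "0 < u" "u <= f1 x" for x u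
  proof -
    have "\<bar>(eta x)\<^sup>2 / d x * u\<bar> = (eta x)\<^sup>2 / \<bar>d x\<bar> * u" using that by (simp add: abs_mult)
    also have "\<dots> <= (eta x)\<^sup>2 / \<bar>d x\<bar> * f1 x" using that by (intro mult_left_mono) auto
    finally show ?thesis by (simp add: mult.commute)
  qed
  have w1: "\<bar>wt x\<bar> <= f1 x * (eta x)\<^sup>2 / \<bar>d x\<bar>" "\<bar>wQ x\<bar> <= f1 x * (eta x)\<^sup>2 / \<bar>d x\<bar>" if "x \<in> S" for x
    unfolding wt_def wQ_def
  proof -
    show "\<bar>(eta x)\<^sup>2 / d x * t x\<bar> <= f1 x * (eta x)\<^sup>2 / \<bar>d x\<bar>" by (rule w[OF that errors(1,2)[OF that]])
    have "P x + d x <= f1 x" by (simp add: f1_def)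
    then show "\<bar>(eta x)\<^sup>2 / d x * (P x + d x)\<bar> <= f1 x * (eta x)\<^sup>2 / \<bar>d x\<bar>" by (rule w[OF that params(3)[OF that]])
  qed
  have 1: "f1 x * (eta x)\<^sup>2 / \<bar>d x\<bar> <= 1" if "x \<in> S" for x
    using slender[OF that] params(5)[OF that] by (subst divide_le_eq_1_pos) auto
  show "(%x. (d x)\<^sup>2) \<in> O[principal S](Psi)" "eta \<in> O[principal S](Psi)" "wt \<in> O[principal S](Psi)" "wQ \<in> O[principal S](Psi)"
  proof -
    have Psi: "\<bar>(d x)\<^sup>2\<bar> <= 1 * Psi x" "\<bar>eta x\<bar> <= 1 * Psi x" "\<bar>wt x\<bar> <= 1 * Psi x" "\<bar>wQ x\<bar> <= 1 * Psi x" "0 <= Psi x" if "x \<in> S" for x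
      unfolding Psi_def mult_1 using pos[OF that] w1[OF that] zero_le_power2[of "d x"] by linarith+
    show "(%x. (d x)\<^sup>2) \<in> O[principal S](Psi)" by (rule bigo_principalI[OF Psi(1,5)])
    show "eta \<in> O[principal S](Psi)" by (rule bigo_principalI[OF Psi(2,5)])
    show "wt \<in> O[principal S](Psi)" by (rule bigo_principalI[OF Psi(3,5)])
    show "wQ \<in> O[principal S](Psi)" by (rule bigo_principalI[OF Psi(4,5)])
  qed
  have w2: "\<bar>wt x\<bar> <= 1 * 1" "\<bar>wQ x\<bar> <= 1 * 1" if "x \<in> S" for x
    using w1[OF that] 1[OF that] by linarith+
  show "tame wt" "tame wQ" by (rule bigo_principalI[OF w2(1)] bigo_principalI[OF w2(2)]; simp)+
qed

lemma bounded_ez: "tame e" "tame z"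
  unfolding e_def z_def by (intro bounded_intros bounded_params small)+

lemma small_e: "(%x. e x - 1) \<in> O[principal S](Psi)"
proof -
  have "(%x. wQ x * (2 * (2 * s x - 1)) - eta x * (2 * (2 * s x - 1))) \<in> O[principal S](Psi)"
    by (intro sum_in_bigo bigo_mult_bounded small bounded_intros bounded_params)
  then show ?thesis by (rule bigo_principal_cong) (simp add: e_def algebra_simps)
qed

text \<open>Of the four squares in \<open>fan_X\<close>, the first is \<open>T1\<close> squared with
  T1 close to r'*t, the last is \<open>T4\<close> squared with T4 close to r, and the other two
  carry a factor eta and form \<open>R\<close>. Differences of squares reduce the claim to first
  order estimates of \<open>T1\<close> and \<open>T4\<close>.\<close>

lemma fan_X_close:
  "(%x. fan_X (P x) (d x) (p x) (n x) (q x) (eta x) (s x) (y x) - ((rt x)\<^sup>2 + (rt' x * t x)\<^sup>2)) \<in> O[principal S](Psi)"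
proof -
  define T1 where "T1 x = a x * z x - 4 * eta x * h x * (2 * s x - 1) * z x
      + 2 * q x * (2 * s x - 1) * (wt x + wQ x * eta x * (1 - 2 * s x))
      + 4 * q x * eta x * (2 - eta x) * (y x)\<^sup>2 - 8 * q x * (2 - eta x) * (y x)\<^sup>2 * wQ x" for x
  define T4 where "T4 x = (oa x - q x * eta x * (2 * s x - 1)) * e x + 8 * h x * (P x + d x) * eta x * (2 - eta x) * (y x)\<^sup>2
      - 8 * q x * wQ x * (2 - eta x) * (y x)\<^sup>2" for x
  define R where "R x = 4 * (2 - eta x) * (y x)\<^sup>2 * ((P x + d x) * a x - 4 * eta x * h x * (P x + d x) * (2 * s x - 1)
        + 2 * q x * wQ x * (2 * s x - 1) - q x * e x)\<^sup>2
      + 16 * (2 - eta x) * (1 - eta x)\<^sup>2 * (y x)\<^sup>2 * (h x * (P x + d x) - q x / 2)\<^sup>2" for x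
  note bd = bounded_intros bounded_params bounded_ez small(5,6)
  have A: "(%x. a x - rt' x) \<in> O[principal S](Psi)" and O: "(%x. oa x - rt x) \<in> O[principal S](Psi)"
    using small_a small_o(1) small(1) by (blast intro: landau_o.big_trans)+
  have b1: "tame T1" and b4: "tame T4" unfolding T1_def T4_def by (intro bd)+
  have bR: "tame R" unfolding R_def divide_inverse by (intro bd)
  have "(%x. (a x - rt' x) * z x
      + eta x * (rt' x * (P x + d x) * (1 - 2 * s x) - 4 * h x * (2 * s x - 1) * z x + 4 * q x * (2 - eta x) * (y x)\<^sup>2)
      + wt x * (2 * q x * (2 * s x - 1))
      + wQ x * (2 * q x * (2 * s x - 1) * eta x * (1 - 2 * s x) - 8 * q x * (2 - eta x) * (y x)\<^sup>2)) \<in> O[principal S](Psi)"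
    by (intro sum_in_bigo bigo_mult_bounded A small bd)
  then have 1: "(%x. T1 x - rt' x * t x) \<in> O[principal S](Psi)"
    by (rule bigo_principal_cong) (simp add: T1_def z_def algebra_simps)
  have "(%x. (oa x - rt x) * e x + (e x - 1) * rt x
      + eta x * (8 * h x * (P x + d x) * (2 - eta x) * (y x)\<^sup>2 - q x * (2 * s x - 1) * e x)
      - wQ x * (8 * q x * (2 - eta x) * (y x)\<^sup>2)) \<in> O[principal S](Psi)"
    by (intro sum_in_bigo bigo_mult_bounded O small small_e bd)
  then have 4: "(%x. T4 x - rt x) \<in> O[principal S](Psi)"
    by (rule bigo_principal_cong) (simp add: T4_def algebra_simps)
  have "(%x. (T1 x - rt' x * t x) * (T1 x + rt' x * t x) + eta x * R x + (T4 x - rt x) * (T4 x + rt x)) \<in> O[principal S](Psi)"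
    by (intro sum_in_bigo bigo_mult_bounded 1 4 small b1 b4 bR bd)
  then show ?thesis
  proof (rule bigo_principal_cong)
    fix x assume x: "x \<in> S"
    have d: "d x \<noteq> 0" using params(5)[OF x] .
    have c: "fan_s (p x) (n x) (q x) (eta x) (s x) / d x
        = a x - 4 * eta x * h x * (2 * s x - 1) + 2 * q x * ((eta x)\<^sup>2 / d x) * (2 * s x - 1)"
      using d by (simp add: fan_s_def a_def h_def field_simps power2_eq_square)
    have e: "1 + 2 * eta x * ((P x + d x) * eta x / d x - 1) * (2 * s x - 1) = e x"
      by (simp add: e_def wQ_def power2_eq_square algebra_simps)
    have h: "(q x - n x) / d x = h x" by (simp add: h_def)
    have o: "fan_o (n x) (q x) (eta x) (s x) = oa x - q x * eta x * (2 * s x - 1)"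
      by (simp add: fan_o_def oa_def algebra_simps)
    have T1: "fan_s (p x) (n x) (q x) (eta x) (s x) / d x * (P x + s x * d x + (P x + d x) * eta x * (1 - 2 * s x))
       + 8 * q x * eta x * (2 - eta x) * (y x)\<^sup>2 * (1/2 - (P x + d x) * eta x / d x) = T1 x"
    proof -
      define v where "v = eta x / d x"
      have v: "(eta x)\<^sup>2 / d x = eta x * v" "(P x + d x) * eta x / d x = (P x + d x) * v"
        by (simp_all add: v_def power2_eq_square)
      show ?thesis
        unfolding c T1_def z_def wt_def wQ_def t_def v by (simp add: algebra_simps power2_eq_square)
    qed
    have T4: "fan_o (n x) (q x) (eta x) (s x) * e x
        + 8 * (h x - q x * eta x / d x) * (P x + d x) * eta x * (2 - eta x) * (y x)\<^sup>2 = T4 x"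
      unfolding o T4_def wQ_def by (simp add: algebra_simps power2_eq_square)
    have Q: "(P x + d x) * (fan_s (p x) (n x) (q x) (eta x) (s x) / d x) - q x * e x
        = (P x + d x) * a x - 4 * eta x * h x * (P x + d x) * (2 * s x - 1) + 2 * q x * wQ x * (2 * s x - 1) - q x * e x"
      unfolding c wQ_def by (simp add: algebra_simps)
    show "fan_X (P x) (d x) (p x) (n x) (q x) (eta x) (s x) (y x) - ((rt x)\<^sup>2 + (rt' x * t x)\<^sup>2) =
        (T1 x - rt' x * t x) * (T1 x + rt' x * t x) + eta x * R x + (T4 x - rt x) * (T4 x + rt x)"
      unfolding fan_X_def e h T1 T4 Q R_def by (simp add: power2_eq_square algebra_simps)
  qed
qed

text \<open>Nothing is divided by d here, so the bending enters as eta^2 alone. Terms with d*eta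
  come with d*h or d*r', both bounded by M*f1*|d|.\<close>

lemma fan_V_close:
  "(%x. fan_V (p x) (n x) (q x) (eta x) (s x) (y x) - d x * rt' x * rt x) \<in> O[principal S](Phi)"
proof -
  note bd = bounded_intros bounded_params
  have pos: "0 <= \<bar>d x\<bar> ^ 3" "0 <= f1 x * \<bar>d x\<bar> * eta x" "0 <= (eta x)\<^sup>2" if "x \<in> S" for x
    using errors(4)[OF that] params(6)[OF that] by auto
  have a: "(%x. d x * (a x - rt' x)) \<in> O[principal S](Phi)"
  proof (rule bigo_principalI[where K="5 * B"])
    fix x assume x: "x \<in> S"
    have "5 * B * \<bar>d x\<bar> ^ 3 <= 5 * B * Phi x" using B_pos pos[OF x] by (intro mult_left_mono) (auto simp: Phi_def)
    then show "\<bar>d x * (a x - rt' x)\<bar> <= 5 * B * Phi x" using errors(6)[OF x] by linarith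
  qed (use pos in \<open>auto simp: Phi_def\<close>)
  have eta2: "(%x. (eta x)\<^sup>2) \<in> O[principal S](Phi)"
    using pos by (intro bigo_principalI[where K=1]) (auto simp: Phi_def)
  have mid: "(%x. g x * eta x) \<in> O[principal S](Phi)" if g: "!!x. x \<in> S ==> \<bar>g x\<bar> <= M * (f1 x * \<bar>d x\<bar>)" for g
  proof (rule bigo_principalI[where K=M])
    fix x assume x: "x \<in> S"
    have "\<bar>g x * eta x\<bar> <= (M * (f1 x * \<bar>d x\<bar>)) * eta x" using g[OF x] params(6)[OF x] by (intro abs_bounds) auto
    also have "\<dots> = M * (f1 x * \<bar>d x\<bar> * eta x)" by simp
    also have "\<dots> <= M * Phi x" using M_pos pos[OF x] by (intro mult_left_mono) (auto simp: Phi_def)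
    finally show "\<bar>g x * eta x\<bar> <= M * Phi x" .
  qed (use pos in \<open>auto simp: Phi_def\<close>)
  have h: "(%x. (d x * h x) * eta x) \<in> O[principal S](Phi)" using errors(9) by (rule mid)
  have r: "(%x. (d x * rt' x) * eta x) \<in> O[principal S](Phi)"
  proof (rule mid)
    fix x assume x: "x \<in> S"
    show "\<bar>d x * rt' x\<bar> <= M * (f1 x * \<bar>d x\<bar>)"
      using abs_bounds[OF order_refl errors(12)[OF x], of "d x"] by (simp add: mult_ac)
  qed
  have o: "(%x. (d x * (oa x - rt x)) * rt' x) \<in> O[principal S](Phi)"
  proof (rule bigo_mult_bounded[OF bigo_principalI[where K="3 * B"] bounded_params(12)])
    fix x assume x: "x \<in> S"
    have "\<bar>d x * (oa x - rt x)\<bar> <= \<bar>d x\<bar> * (3 * B * (d x)\<^sup>2)" using errors(7)[OF x] by (intro abs_bounds) auto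
    also have "\<dots> = 3 * B * \<bar>d x\<bar> ^ 3" by (simp add: power3_eq_cube power2_eq_square mult_ac flip: power2_abs)
    also have "\<dots> <= 3 * B * Phi x" using B_pos pos[OF x] by (intro mult_left_mono) (auto simp: Phi_def)
    finally show "\<bar>d x * (oa x - rt x)\<bar> <= 3 * B * Phi x" .
  qed (use pos in \<open>auto simp: Phi_def\<close>)
  let ?o = "%x. oa x - q x * eta x * (2 * s x - 1)"
  have "(%x. (d x * (a x - rt' x)) * ?o x + ((d x * h x) * eta x) * (8 * q x * (2 - eta x) * (y x)\<^sup>2 - 4 * (2 * s x - 1) * ?o x)
      + (eta x)\<^sup>2 * (2 * q x * (2 * s x - 1) * ?o x - 8 * q x * q x * (2 - eta x) * (y x)\<^sup>2)
      + (d x * (oa x - rt x)) * rt' x - ((d x * rt' x) * eta x) * (q x * (2 * s x - 1))) \<in> O[principal S](Phi)"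
    by (intro sum_in_bigo o) (intro bigo_mult_bounded a eta2 h r bd)+
  then show ?thesis
  proof (rule bigo_principal_cong)
    fix x assume x: "x \<in> S"
    have d: "d x \<noteq> 0" using params(5)[OF x] .
    have n: "n x = q x - d x * h x" using d by (simp add: h_def)
    have S: "fan_s (p x) (n x) (q x) (eta x) (s x)
        = d x * a x + 2 * eta x * (q x * eta x - 2 * (d x * h x)) * (2 * s x - 1)"
      using d by (simp add: fan_s_def a_def h_def field_simps power2_eq_square)
    have O: "fan_o (n x) (q x) (eta x) (s x) = ?o x" by (simp add: fan_o_def oa_def algebra_simps)
    have N: "q x * (1 - eta x) - n x = d x * h x - q x * eta x" using n by (simp add: algebra_simps)
    show "fan_V (p x) (n x) (q x) (eta x) (s x) (y x) - d x * rt' x * rt x =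
      (d x * (a x - rt' x)) * ?o x + ((d x * h x) * eta x) * (8 * q x * (2 - eta x) * (y x)\<^sup>2 - 4 * (2 * s x - 1) * ?o x)
      + (eta x)\<^sup>2 * (2 * q x * (2 * s x - 1) * ?o x - 8 * q x * q x * (2 - eta x) * (y x)\<^sup>2)
      + (d x * (oa x - rt x)) * rt' x - ((d x * rt' x) * eta x) * (q x * (2 * s x - 1))"
      unfolding fan_V_def S O N by (simp add: power2_eq_square algebra_simps)
  qed
qed

end

section \<open>Expansions on elements of types C and D\<close>

locale side_family = cavity_family
begin

definition "Psi x = (d x)\<^sup>2 + eta x"
definition "Phi x = \<bar>d x\<bar> ^ 3 + f1 x * \<bar>d x\<bar> * eta x"

lemma side_small: "(%x. (d x)\<^sup>2) \<in> O[principal S](Psi)" "eta \<in> O[principal S](Psi)"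
  using params(6) by (auto intro!: bigo_principalI[where K=1] simp: Psi_def less_imp_le)

lemma side_ratio: "tame (%x. 1 / (2 - eta x))"
proof (rule bigo_principalI[where K=1])
  fix x assume "x \<in> S"
  then have "1 <= 2 - eta x" using params(7) by fastforce
  then show "\<bar>1 / (2 - eta x)\<bar> <= 1 * 1" by simp
qed simp

lemma side_decomposition:
  assumes "x \<in> S"
  shows "side_s (p x) (n x) (q x) (eta x) (s x) (y x) / d x = a x - 4 * h' x * eta x * y x"
    and "side_s (p x) (n x) (q x) (eta x) (s x) (y x) = d x * a x - 4 * (d x * h' x) * eta x * y x"
    and "side_o (p x) (n x) (eta x) (s x) (y x) = ob x - p x * eta x * (4 * y x - 1)"
    and "side_r (p x) (n x) (eta x) (s x) (y x) = ob x + p x * (1 - eta x) * (4 * y x - 1)"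
    and "n x - p x = d x * h' x"
  using params(5)[OF assms]
  by (simp_all add: side_s_def side_o_def side_r_def a_def h'_def ob_def field_simps)

lemma side_X_close:
  "(%x. side_X (P x) (d x) (p x) (n x) (q x) (eta x) (s x) (y x) - ((rt x)\<^sup>2 + (rt' x * t x)\<^sup>2)) \<in> O[principal S](Psi)"
proof -
  let ?o = "%x. ob x - p x * eta x * (4 * y x - 1)" and ?r = "%x. ob x + p x * (1 - eta x) * (4 * y x - 1)"
  let ?s = "%x. a x - 4 * h' x * eta x * y x" and ?z = "%x. t x - P x * eta x * (4 * y x - 1)"
  let ?k = "%x. P x * (1 + (1 - eta x) * (4 * y x - 1)) + d x * s x"
  define T1 where "T1 x = ?s x * ?z x + 2 * eta x * y x * ?r x" for x
  define T4 where "T4 x = ?o x * (1 - 2 * eta x * y x) + 4 * eta x * y x * h' x * ?k x" for x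
  define R where "R x = 1 / (2 - eta x) * (?s x * ?k x - ?r x * (1 - 2 * eta x * y x))\<^sup>2
    + (2 - eta x) * (4 * y x * h' x * ?z x - 2 * y x * ?o x)\<^sup>2" for x
  note bd = bounded_intros bounded_params side_ratio
  have A: "(%x. a x - rt' x) \<in> O[principal S](Psi)" and O: "(%x. ob x - rt x) \<in> O[principal S](Psi)"
    \<comment> \<open>In \<open>side_s\<close> the factor eta multiplies m - p, which is itself of
      order d; dividing by d leaves no singular term, and \<open>Psi\<close> has no bending
      part.\<close>
    using small_a small_o(2) side_small(1) by (blast intro: landau_o.big_trans)+
  have b1: "tame T1" and b4: "tame T4" unfolding T1_def T4_def by (intro bd)+
  have bR: "tame R" unfolding R_def by (intro bd)
  have "(%x. (a x - rt' x) * ?z x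
      + eta x * (2 * y x * ?r x - 4 * h' x * y x * ?z x - rt' x * P x * (4 * y x - 1))) \<in> O[principal S](Psi)"
    by (intro sum_in_bigo bigo_mult_bounded A side_small bd)
  then have 1: "(%x. T1 x - rt' x * t x) \<in> O[principal S](Psi)"
    by (rule bigo_principal_cong) (simp add: T1_def algebra_simps)
  have "(%x. (ob x - rt x) * 1 + eta x * (4 * y x * h' x * ?k x - p x * (4 * y x - 1) - 2 * ?o x * y x)) \<in> O[principal S](Psi)"
    by (intro sum_in_bigo bigo_mult_bounded O side_small bd)
  then have 4: "(%x. T4 x - rt x) \<in> O[principal S](Psi)"
    by (rule bigo_principal_cong) (simp add: T4_def algebra_simps)
  have "(%x. (T1 x - rt' x * t x) * (T1 x + rt' x * t x) + eta x * R x + (T4 x - rt x) * (T4 x + rt x)) \<in> O[principal S](Psi)"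
    by (intro sum_in_bigo bigo_mult_bounded 1 4 side_small b1 b4 bR bd)
  then show ?thesis
  proof (rule bigo_principal_cong)
    fix x assume x: "x \<in> S"
    note D = side_decomposition[OF x]
    have h: "(n x - p x) / d x = h' x" by (simp add: h'_def)
    have z: "P x + s x * d x - P x * eta x * (4 * y x - 1) = ?z x" by (simp add: t_def)
    show "side_X (P x) (d x) (p x) (n x) (q x) (eta x) (s x) (y x) - ((rt x)\<^sup>2 + (rt' x * t x)\<^sup>2) =
        (T1 x - rt' x * t x) * (T1 x + rt' x * t x) + eta x * R x + (T4 x - rt x) * (T4 x + rt x)"
      unfolding side_X_def D(1,3,4) h z unfolding T1_def[symmetric] T4_def[symmetric] R_def
      by (simp add: power2_eq_square distrib_left) (simp add: algebra_simps)
  qed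
qed

lemma side_V_close:
  "(%x. side_V (p x) (n x) (q x) (eta x) (s x) (y x) - d x * rt' x * rt x) \<in> O[principal S](Phi)"
proof -
  note bd = bounded_intros bounded_params
  have pos: "0 <= \<bar>d x\<bar> ^ 3" "0 <= f1 x * \<bar>d x\<bar> * eta x" if "x \<in> S" for x
    using errors(4)[OF that] params(6)[OF that] by auto
  have a: "(%x. d x * (a x - rt' x)) \<in> O[principal S](Phi)"
  proof (rule bigo_principalI[where K="5 * B"])
    fix x assume x: "x \<in> S"
    have "5 * B * \<bar>d x\<bar> ^ 3 <= 5 * B * Phi x" using B_pos pos[OF x] by (intro mult_left_mono) (auto simp: Phi_def)
    then show "\<bar>d x * (a x - rt' x)\<bar> <= 5 * B * Phi x" using errors(6)[OF x] by linarith
  qed (use pos in \<open>auto simp: Phi_def\<close>)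
  have mid: "(%x. g x * eta x) \<in> O[principal S](Phi)" if g: "!!x. x \<in> S ==> \<bar>g x\<bar> <= M * (f1 x * \<bar>d x\<bar>)" for g
  proof (rule bigo_principalI[where K=M])
    fix x assume x: "x \<in> S"
    have "\<bar>g x * eta x\<bar> <= (M * (f1 x * \<bar>d x\<bar>)) * eta x" using g[OF x] params(6)[OF x] by (intro abs_bounds) auto
    also have "\<dots> = M * (f1 x * \<bar>d x\<bar> * eta x)" by simp
    also have "\<dots> <= M * Phi x" using M_pos pos[OF x] by (intro mult_left_mono) (auto simp: Phi_def)
    finally show "\<bar>g x * eta x\<bar> <= M * Phi x" .
  qed (use pos in \<open>auto simp: Phi_def\<close>)
  have h: "(%x. (d x * h' x) * eta x) \<in> O[principal S](Phi)" using errors(10) by (rule mid)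
  have r: "(%x. (d x * rt' x) * eta x) \<in> O[principal S](Phi)"
  proof (rule mid)
    fix x assume x: "x \<in> S"
    show "\<bar>d x * rt' x\<bar> <= M * (f1 x * \<bar>d x\<bar>)"
      using abs_bounds[OF order_refl errors(12)[OF x], of "d x"] by (simp add: mult_ac)
  qed
  have o: "(%x. (d x * (ob x - rt x)) * rt' x) \<in> O[principal S](Phi)"
  proof (rule bigo_mult_bounded[OF bigo_principalI[where K="3 * B"] bounded_params(12)])
    fix x assume x: "x \<in> S"
    have "\<bar>d x * (ob x - rt x)\<bar> <= \<bar>d x\<bar> * (3 * B * (d x)\<^sup>2)" using errors(8)[OF x] by (intro abs_bounds) auto
    also have "\<dots> = 3 * B * \<bar>d x\<bar> ^ 3" by (simp add: power3_eq_cube power2_eq_square mult_ac flip: power2_abs)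
    also have "\<dots> <= 3 * B * Phi x" using B_pos pos[OF x] by (intro mult_left_mono) (auto simp: Phi_def)
    finally show "\<bar>d x * (ob x - rt x)\<bar> <= 3 * B * Phi x" .
  qed (use pos in \<open>auto simp: Phi_def\<close>)
  let ?o = "%x. ob x - p x * eta x * (4 * y x - 1)" and ?r = "%x. ob x + p x * (1 - eta x) * (4 * y x - 1)"
  have "(%x. (d x * (a x - rt' x)) * ?o x + ((d x * h' x) * eta x) * (4 * y x * ?r x - 4 * y x * ?o x)
      + (d x * (ob x - rt x)) * rt' x - ((d x * rt' x) * eta x) * (p x * (4 * y x - 1))) \<in> O[principal S](Phi)"
    by (intro sum_in_bigo o) (intro bigo_mult_bounded a h r bd)+
  then show ?thesis
  proof (rule bigo_principal_cong)
    fix x assume x: "x \<in> S"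
    note D = side_decomposition[OF x]
    show "side_V (p x) (n x) (q x) (eta x) (s x) (y x) - d x * rt' x * rt x =
      (d x * (a x - rt' x)) * ?o x + ((d x * h' x) * eta x) * (4 * y x * ?r x - 4 * y x * ?o x)
      + (d x * (ob x - rt x)) * rt' x - ((d x * rt' x) * eta x) * (p x * (4 * y x - 1))"
      unfolding side_V_def D(2-5) by (simp add: algebra_simps)
  qed
qed

end

section \<open>Integrals over the reference triangle and over rings\<close>

lemma measurable_vec2: "(%(a, b). vector [a, b] :: real^2) \<in> borel_measurable (lborel \<Otimes>\<^sub>M lborel)"
proof -
  have "(%(a, b). vector [a, b] :: real^2) = (%z. fst z *\<^sub>R axis 1 1 + snd z *\<^sub>R axis 2 1)"
    by (auto simp: fun_eq_iff vec2_eq_iff axis_def)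
  then have "continuous_on UNIV (%(a, b). vector [a, b] :: real^2)" by (simp add: continuous_intros)
  then show ?thesis by (simp add: borel_measurable_continuous_onI lborel_prod)
qed

text \<open>Identifies Lebesgue measure on \<open>real^2\<close> with the product measure, so that
  Tonelli's theorem can be applied in coordinates.\<close>

lemma lborel_vec2:
  "(lborel :: (real^2) measure) = distr (lborel \<Otimes>\<^sub>M lborel) borel (%(a, b). vector [a, b])"
proof (rule lborel_eqI)
  let ?f = "%(a, b). vector [a, b] :: real^2"
  have meas: "?f \<in> borel_measurable (lborel \<Otimes>\<^sub>M lborel)" by (rule measurable_vec2)
  fix l u :: "real^2" assume lu: "!!b. b \<in> Basis ==> l \<bullet> b <= u \<bullet> b"
  have le: "l $ 1 <= u $ 1" "l $ 2 <= u $ 2"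
    using lu[of "axis 1 1"] lu[of "axis 2 1"] by (auto simp: axis_in_Basis_iff inner_axis)
  have "?f -` box l u \<inter> space (lborel \<Otimes>\<^sub>M lborel) = {l$1<..<u$1} \<times> {l$2<..<u$2}"
    by (auto simp: mem_box Basis_vec_def inner_axis UNIV_2 space_pair_measure)
  then have "emeasure (distr (lborel \<Otimes>\<^sub>M lborel) borel ?f) (box l u) = emeasure (lborel \<Otimes>\<^sub>M lborel) ({l$1<..<u$1} \<times> {l$2<..<u$2})"
    using meas by (simp add: emeasure_distr)
  also have "\<dots> = ennreal (u$1 - l$1) * ennreal (u$2 - l$2)"
    using le by (subst lborel.emeasure_pair_measure_Times) auto
  also have "\<dots> = (\<Prod>b\<in>Basis. (u - l) \<bullet> b)"
  proof -
    have B: "(Basis :: (real^2) set) = {axis 1 1, axis 2 1}" by (auto simp: Basis_vec_def UNIV_2)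
    have "axis 1 1 \<noteq> (axis 2 1 :: real^2)" by (simp add: axis_eq_axis)
    then show ?thesis using le unfolding B by (simp add: inner_axis ennreal_mult)
  qed
  finally show "emeasure (distr (lborel \<Otimes>\<^sub>M lborel) borel ?f) (box l u) = (\<Prod>b\<in>Basis. (u - l) \<bullet> b)" .
qed simp

lemma nn_integral_vec2:
  assumes [measurable]: "f \<in> borel_measurable borel"
  shows "(\<integral>\<^sup>+x. f (x :: real^2) \<partial>lborel) = (\<integral>\<^sup>+a. \<integral>\<^sup>+b. f (vector [a, b]) \<partial>lborel \<partial>lborel)"
proof -
  let ?f = "%(a, b). vector [a, b] :: real^2"
  note measurable_vec2 [measurable]
  have "(\<integral>\<^sup>+x. f (x :: real^2) \<partial>lborel) = (\<integral>\<^sup>+z. f (?f z) \<partial>(lborel \<Otimes>\<^sub>M lborel))"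
    by (subst lborel_vec2) (simp add: nn_integral_distr)
  also have "\<dots> = (\<integral>\<^sup>+a. \<integral>\<^sup>+b. f (vector [a, b]) \<partial>lborel \<partial>lborel)"
    by (subst lborel.nn_integral_fst[symmetric]) (auto simp: case_prod_beta')
  finally show ?thesis .
qed

text \<open>Fubini for a nonnegative function supported on \<open>{x. x$1 \<in> {0<..<1} \<and> x$2 \<in> {0<..<l (x$1)}}\<close>
  which depends on \<open>x$1\<close> only.\<close>

lemma set_integral_first_coordinate:
  fixes phi l :: "real => real" and A :: "(real^2) set"
  assumes A: "open A" "!!a b. vector [a, b] \<in> A \<longleftrightarrow> 0 < a & a < 1 & 0 < b & b < l a"
    and phi: "continuous_on {0<..<1} phi" "!!s. s \<in> {0<..<1} ==> 0 <= phi s"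
    and l: "!!s. s \<in> {0<..<1} ==> 0 < l s"
    and int: "set_integrable lborel {0<..<1} (%s. l s * phi s)"
  shows "set_integrable lebesgue A (%x. phi (x $ 1))"
    and "(LINT x:A|lebesgue. phi (x $ 1)) = (LINT s:{0<..<1}|lborel. l s * phi s)"
proof -
  define f where "f s = indicator {0<..<1} s * phi s" for s :: real
  have f [measurable]: "f \<in> borel_measurable borel"
    unfolding f_def using borel_measurable_continuous_on_indicator[OF _ phi(1)] by simp
  have [measurable]: "A \<in> sets borel" using A(1) by simp
  have fA: "indicator A x *\<^sub>R phi (x $ 1) = indicator A x * f (x $ 1)" for x :: "real^2"
  proof (cases "x \<in> A")
    case True
    moreover have "x = vector [x $ 1, x $ 2]" by (simp add: vec2_eq_iff)
    ultimately have "x $ 1 \<in> {0<..<1}" using A(2)[of "x $ 1" "x $ 2"] by simp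
    then show ?thesis by (simp add: f_def)
  qed simp
  have [measurable]: "(%x :: real^2. x $ 1) \<in> borel_measurable borel"
    by (intro borel_measurable_continuous_onI continuous_intros)
  have m: "(%x. indicator A x * f (x $ 1)) \<in> borel_measurable (lborel :: (real^2) measure)" by measurable
  have f0: "0 <= f s" for s using phi(2) by (simp add: f_def indicator_def)
  have "(\<integral>\<^sup>+x. ennreal (indicator A x * f (x $ 1)) \<partial>(lborel :: (real^2) measure))
      = (\<integral>\<^sup>+a. \<integral>\<^sup>+b. ennreal (indicator A (vector [a, b] :: real^2) * f a) \<partial>lborel \<partial>lborel)"
    by (subst nn_integral_vec2) auto
  also have "\<dots> = (\<integral>\<^sup>+a. ennreal (indicator {0<..<1} a *\<^sub>R (l a * phi a)) \<partial>lborel)"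
  proof (intro nn_integral_cong)
    fix a :: real
    show "(\<integral>\<^sup>+b. ennreal (indicator A (vector [a, b] :: real^2) * f a) \<partial>lborel)
        = ennreal (indicator {0<..<1} a *\<^sub>R (l a * phi a))"
    proof (cases "a \<in> {0<..<1}")
      case True
      then have "(\<integral>\<^sup>+b. ennreal (indicator A (vector [a, b] :: real^2) * f a) \<partial>lborel)
          = (\<integral>\<^sup>+b. ennreal (f a) * indicator {0<..<l a} b \<partial>lborel)"
        by (intro nn_integral_cong) (auto simp: indicator_def A(2))
      also have "\<dots> = ennreal (f a) * ennreal (l a)"
        using l[OF True] by (subst nn_integral_cmult_indicator) auto
      finally show ?thesis using True f0[of a] l[OF True] by (simp add: f_def ennreal_mult'' mult.commute)
    next
      case False
      then have "f a = 0" by (simp add: f_def)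
      then show ?thesis using False by simp
    qed
  qed
  also have "\<dots> = ennreal (LINT s:{0<..<1}|lborel. l s * phi s)"
    unfolding set_lebesgue_integral_def
    by (rule nn_integral_eq_integral)
      (use int l phi(2) in \<open>auto simp: set_integrable_def indicator_def less_imp_le\<close>)
  finally have "has_bochner_integral lborel (%x. indicator A x * f (x $ 1)) (LINT s:{0<..<1}|lborel. l s * phi s)"
    using m f0 l phi(2)
    by (intro has_bochner_integral_nn_integral)
      (auto simp: set_lebesgue_integral_def less_imp_le intro!: integral_nonneg_AE simp: indicator_def)
  then have "has_bochner_integral lebesgue (%x. indicator A x *\<^sub>R phi (x $ 1)) (LINT s:{0<..<1}|lborel. l s * phi s)"
    unfolding fA using m by (simp add: has_bochner_integral_iff integrable_completion integral_completion)
  then show "set_integrable lebesgue A (%x. phi (x $ 1))"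
    and "(LINT x:A|lebesgue. phi (x $ 1)) = (LINT s:{0<..<1}|lborel. l s * phi s)"
    by (simp_all add: set_integrable_def set_lebesgue_integral_def has_bochner_integral_iff)
qed

lemma set_integrable_reflect:
  fixes phi :: "real => real"
  shows "set_integrable lborel {0<..<1} (%s. phi (1 - s)) \<longleftrightarrow> set_integrable lborel {0<..<1} phi"
    and "(LINT s:{0<..<1}|lborel. phi (1 - s)) = (LINT s:{0<..<1}|lborel. phi s)"
proof -
  have ind: "indicator {0<..<1} s = (indicator {0<..<1} (1 - s) :: real)" for s :: real by (auto simp: indicator_def)
  show "set_integrable lborel {0<..<1} (%s. phi (1 - s)) \<longleftrightarrow> set_integrable lborel {0<..<1} phi"
    using lborel_integrable_real_affine_iff[of "-1" "%s. indicator {0<..<1} s *\<^sub>R phi s" 1]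
    unfolding set_integrable_def by (simp add: ind[symmetric])
  show "(LINT s:{0<..<1}|lborel. phi (1 - s)) = (LINT s:{0<..<1}|lborel. phi s)"
    using lborel_integral_real_affine[of "-1" "%s. indicator {0<..<1} s *\<^sub>R phi s" 1]
    unfolding set_lebesgue_integral_def by (simp add: ind[symmetric])
qed

lemma set_integrable_bounded_continuous:
  fixes phi :: "real => real"
  assumes "continuous_on {0<..<1} phi" "!!s. s \<in> {0<..<1} ==> \<bar>phi s\<bar> <= C"
  shows "set_integrable lborel {0<..<1} phi"
proof -
  have "set_integrable lborel {0<..<1::real} (%_. C)" by (simp add: set_integrable_def)
  then show ?thesis
  proof (rule set_integrable_bound)
    show "set_borel_measurable lborel {0<..<1} phi"
      using borel_measurable_continuous_on_indicator[OF _ assms(1)] by (simp add: set_borel_measurable_def)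
    show "AE s in lborel. s \<in> {0<..<1} \<longrightarrow> norm (phi s) <= norm C" using assms(2) by (fastforce intro!: AE_I2)
  qed
qed

text \<open>For the area preserving affine symmetries of the triangle: the swap of x1 and x2, and
  the map exchanging the first two barycentric coordinates.\<close>

lemma affine_triangle_integral:
  fixes f :: "real^2 => real" and a1 a2 b1 b2 c1 c2 :: real
  defines "g == %x. vector [c1 + a1 * x$1 + a2 * x$2, c2 + b1 * x$1 + b2 * x$2] :: real^2"
  assumes det: "\<bar>a1 * b2 - a2 * b1\<bar> = 1" and im: "g ` open_triangle = open_triangle"
    and int: "set_integrable lebesgue open_triangle (%x. f (g x))"
  shows "set_integrable lebesgue open_triangle f"
    and "(LINT x:open_triangle|lebesgue. f x) = (LINT x:open_triangle|lebesgue. f (g x))"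
proof -
  let ?p = "vector [a1, b1] :: real^2" and ?q = "vector [a2, b2] :: real^2"
  have geq: "g = (%x. vector [c1, c2] + (x$1 *\<^sub>R ?p + x$2 *\<^sub>R ?q))"
    by (auto simp: g_def vec2_eq_iff)
  have d: "(g has_derivative (%k. k$1 *\<^sub>R ?p + k$2 *\<^sub>R ?q)) (at x within open_triangle)" for x
    unfolding geq by (auto intro!: derivative_eq_intros bounded_linear.has_derivative[OF bounded_linear_vec_nth])
  have w: "\<bar>det (matrix (%k. k$1 *\<^sub>R ?p + k$2 *\<^sub>R ?q))\<bar> = 1"
    unfolding det_matrix_columns using det by (simp add: wedge_def algebra_simps)
  have "inj g"
  proof (rule injI)
    fix x y :: "real^2" assume "g x = g y"
    then have e: "a1 * (x$1 - y$1) + a2 * (x$2 - y$2) = 0" "b1 * (x$1 - y$1) + b2 * (x$2 - y$2) = 0"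
      by (auto simp: g_def vec2_eq_iff algebra_simps)
    have "(a1 * b2 - a2 * b1) * (x$1 - y$1) = 0" "(a1 * b2 - a2 * b1) * (x$2 - y$2) = 0"
      using e by algebra+
    then show "x = y" using det by (auto simp: vec2_eq_iff)
  qed
  then have inj: "inj_on g open_triangle" by (rule inj_on_subset) simp
  note cov = change_of_variables_real[OF open_triangle_in_lebesgue d inj, unfolded w mult_1, OF int, unfolded im]
  show "set_integrable lebesgue open_triangle f"
    and "(LINT x:open_triangle|lebesgue. f x) = (LINT x:open_triangle|lebesgue. f (g x))"
    using cov by simp_all
qed

text \<open>The slice x1 = s has length 1 - s. The swap carries this to x2, and exchanging the
  barycentric coordinates turns 1 - x1 into x1 + x2, whose density is s.\<close>

lemma triangle_integral:
  fixes phi :: "real => real"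
  assumes phi: "continuous_on {0<..<1} phi" "!!s. s \<in> {0<..<1} ==> 0 <= phi s" "set_integrable lborel {0<..<1} phi"
  shows "set_integrable lebesgue open_triangle (%x. phi (x$1))"
    "set_integrable lebesgue open_triangle (%x. phi (x$2))"
    "set_integrable lebesgue open_triangle (%x. phi (x$1 + x$2))"
    "set_integrable lborel {0<..<1} (%s. (1 - s) * phi s)" "set_integrable lborel {0<..<1} (%s. s * phi s)"
    "(LINT x:open_triangle|lebesgue. phi (x$1)) = (LINT s:{0<..<1}|lborel. (1 - s) * phi s)"
    "(LINT x:open_triangle|lebesgue. phi (x$2)) = (LINT s:{0<..<1}|lborel. (1 - s) * phi s)"
    "(LINT x:open_triangle|lebesgue. phi (x$1 + x$2)) = (LINT s:{0<..<1}|lborel. s * phi s)"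
proof -
  have int: "set_integrable lborel {0<..<1} (%s. f s * psi s)"
    if "continuous_on {0<..<1} psi" "set_integrable lborel {0<..<1} psi" "continuous_on {0<..<1} f"
      "!!s. s \<in> {0<..<1} ==> \<bar>f s\<bar> <= 1" for f psi :: "real => real"
    using that(2)
  proof (rule set_integrable_bound)
    show "set_borel_measurable lborel {0<..<1} (%s. f s * psi s)"
      unfolding set_borel_measurable_def using borel_measurable_continuous_on_indicator[of "{0<..<1}" "%s. f s * psi s"] that(1,3)
      by (simp add: continuous_on_mult)
    show "AE s in lborel. s \<in> {0<..<1} \<longrightarrow> norm (f s * psi s) <= norm (psi s)"
      using that(4) by (auto simp: abs_mult mult_left_le_one_le)
  qed
  show int1: "set_integrable lborel {0<..<1} (%s. (1 - s) * phi s)" "set_integrable lborel {0<..<1} (%s. s * phi s)"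
    by (intro int phi continuous_intros; simp)+
  have tri: "vector [a, b] \<in> open_triangle \<longleftrightarrow> 0 < a & a < 1 & 0 < b & b < 1 - a" for a b :: real
    by (auto simp: open_triangle_def)
  have 1: "set_integrable lebesgue open_triangle (%x. psi (x$1))"
      "(LINT x:open_triangle|lebesgue. psi (x$1)) = (LINT s:{0<..<1}|lborel. (1 - s) * psi s)"
    if "continuous_on {0<..<1} psi" "!!s. s \<in> {0<..<1} ==> 0 <= psi s" "set_integrable lborel {0<..<1} psi" for psi
  proof -
    have "set_integrable lborel {0<..<1} (%s. (1 - s) * psi s)" by (intro int that continuous_intros) simp
    then show "set_integrable lebesgue open_triangle (%x. psi (x$1))"
      "(LINT x:open_triangle|lebesgue. psi (x$1)) = (LINT s:{0<..<1}|lborel. (1 - s) * psi s)"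
      using set_integral_first_coordinate[OF open_open_triangle tri that(1,2)] by auto
  qed
  show "set_integrable lebesgue open_triangle (%x. phi (x$1))" by (rule 1(1)[OF phi])
  show "(LINT x:open_triangle|lebesgue. phi (x$1)) = (LINT s:{0<..<1}|lborel. (1 - s) * phi s)" by (rule 1(2)[OF phi])
  have im: "(%x. vector [0 + 0 * x$1 + 1 * x$2, 0 + 1 * x$1 + 0 * x$2] :: real^2) ` open_triangle = open_triangle"
  proof -
    have "x \<in> (%x. vector [x$2, x$1] :: real^2) ` open_triangle" if "x \<in> open_triangle" for x
      by (rule image_eqI[where x="vector [x$2, x$1]"]) (use that in \<open>auto simp: open_triangle_def vec2_eq_iff\<close>)
    then show ?thesis by (auto simp: open_triangle_def)
  qed
  have "set_integrable lebesgue open_triangle (%x. phi ((vector [0 + 0 * x$1 + 1 * x$2, 0 + 1 * x$1 + 0 * x$2] :: real^2) $ 2))"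
    using 1(1)[OF phi] by simp
  note swap = affine_triangle_integral[OF _ im this]
  show "set_integrable lebesgue open_triangle (%x. phi (x$2))" by (rule swap(1)) simp
  have "(LINT x:open_triangle|lebesgue. phi (x$2)) = (LINT x:open_triangle|lebesgue. phi (x$1))"
    by (subst swap(2)) simp_all
  then show "(LINT x:open_triangle|lebesgue. phi (x$2)) = (LINT s:{0<..<1}|lborel. (1 - s) * phi s)"
    using 1(2)[OF phi] by simp
  define psi where "psi s = phi (1 - s)" for s
  have "continuous_on {0<..<1} psi"
    unfolding psi_def[abs_def] by (rule continuous_on_compose2[OF phi(1)]) (auto intro!: continuous_intros)
  then have psi: "continuous_on {0<..<1} psi" "!!s. s \<in> {0<..<1} ==> 0 <= psi s" "set_integrable lborel {0<..<1} psi"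
    using phi(2,3) set_integrable_reflect(1)[of phi] by (auto simp: psi_def[abs_def])
  have im: "(%x. vector [1 + (-1) * x$1 + (-1) * x$2, 0 + 0 * x$1 + 1 * x$2] :: real^2) ` open_triangle = open_triangle"
  proof -
    have "x \<in> (%x. vector [1 - x$1 - x$2, x$2] :: real^2) ` open_triangle" if "x \<in> open_triangle" for x
      by (rule image_eqI[where x="vector [1 - x$1 - x$2, x$2]"]) (use that in \<open>auto simp: open_triangle_def vec2_eq_iff\<close>)
    then show ?thesis by (auto simp: open_triangle_def)
  qed
  have "set_integrable lebesgue open_triangle (%x. (%z. phi (z$1 + z$2)) (vector [1 + (-1) * x$1 + (-1) * x$2, 0 + 0 * x$1 + 1 * x$2] :: real^2))"
    using 1(1)[OF psi] by (simp add: psi_def)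
  note shear = affine_triangle_integral[OF _ im this]
  show "set_integrable lebesgue open_triangle (%x. phi (x$1 + x$2))" by (rule shear(1)) simp
  have "(LINT x:open_triangle|lebesgue. phi (x$1 + x$2)) = (LINT x:open_triangle|lebesgue. psi (x$1))"
    by (subst shear(2)) (simp_all add: psi_def)
  also have "\<dots> = (LINT s:{0<..<1}|lborel. (1 - s) * psi s)" by (rule 1(2)[OF psi])
  also have "\<dots> = (LINT s:{0<..<1}|lborel. s * phi s)"
    using set_integrable_reflect(2)[of "%s. s * phi s"] by (simp add: psi_def)
  finally show "(LINT x:open_triangle|lebesgue. phi (x$1 + x$2)) = (LINT s:{0<..<1}|lborel. s * phi s)" .
qed


text \<open>Polar coordinates over the open rectangle; the bounding circles and the slit on the
  first axis are negligible.\<close>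

lemma ring_integral:
  fixes h :: "real^2 => real" and phi :: "real => real"
  assumes eps: "0 < eps" "0 < tau"
    and h: "!!x. eps < norm x ==> norm x < eps + tau ==> h x = phi (norm x)"
    and phi: "continuous_on {0<..<1} (%s. phi (eps + s * tau))" "!!s. s \<in> {0<..<1} ==> 0 <= phi (eps + s * tau)"
      "set_integrable lborel {0<..<1} (%s. phi (eps + s * tau) * (eps + s * tau))"
  shows "set_integrable lebesgue (ring_region eps tau) h"
    and "(LINT x:ring_region eps tau|lebesgue. h x) = 2 * pi * tau * (LINT s:{0<..<1}|lborel. phi (eps + s * tau) * (eps + s * tau))"
proof -
  define R where "R = {x :: real^2. 0 < x$1 & x$1 < 1 & 0 < x$2 & x$2 < 2 * pi}"
  define G where "G x = polar (eps + x$1 * tau) (x$2)" for x :: "real^2"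
  define p q :: "real^2 => real^2" where "p x = tau *\<^sub>R polar 1 (x$2)"
    and "q x = (eps + x$1 * tau) *\<^sub>R polar 1 (x$2 + pi / 2)" for x
  define f where "f s = tau * (phi (eps + s * tau) * (eps + s * tau))" for s
  have openR: "open R" unfolding R_def by (intro open_Collect_conj open_Collect_less continuous_intros)
  have pos: "0 < eps + s * tau" if "0 < s" for s using eps that by (simp add: add_pos_pos)
  have f: "continuous_on {0<..<1} f" "!!s. s \<in> {0<..<1} ==> 0 <= f s" "set_integrable lborel {0<..<1} (%s. 2 * pi * f s)"
    using phi eps pos unfolding f_def[abs_def]
    by (auto intro!: continuous_intros mult_nonneg_nonneg set_integrable_mult_right simp: less_imp_le)
  note int = set_integral_first_coordinate[OF openR _ f(1,2) _ f(3)]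
  have intR: "set_integrable lebesgue R (%x. f (x$1))"
    and intR': "(LINT x:R|lebesgue. f (x$1)) = (LINT s:{0<..<1}|lborel. 2 * pi * f s)"
    by (rule int; simp add: R_def)+
  have dG: "(G has_derivative (%k. k$1 *\<^sub>R p x + k$2 *\<^sub>R q x)) (at x within R)" for x
  proof -
    have G': "G = (%x. ((eps + x$1 * tau) * cos (x$2)) *\<^sub>R axis 1 1 + ((eps + x$1 * tau) * sin (x$2)) *\<^sub>R axis 2 1)"
      by (auto simp: G_def fun_eq_iff vec2_eq_iff polar_def axis_def)
    show ?thesis unfolding G' p_def q_def
      by (rule derivative_eq_intros bounded_linear.has_derivative[OF bounded_linear_vec_nth] refl)+
        (auto simp: fun_eq_iff vec2_eq_iff polar_def axis_def cos_add sin_add algebra_simps)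
  qed
  have detG: "\<bar>det (matrix (%k. k$1 *\<^sub>R p x + k$2 *\<^sub>R q x))\<bar>
      = tau * (eps + x$1 * tau)" if "x \<in> R" for x
  proof -
    have "wedge (p x) (q x)
        = (tau * cos (x$2)) * ((eps + x$1 * tau) * cos (x$2)) + (tau * sin (x$2)) * ((eps + x$1 * tau) * sin (x$2))"
      by (simp add: wedge_def p_def q_def polar_def cos_add sin_add)
    also have "\<dots> = tau * (eps + x$1 * tau)" using sin_cos_squared_add[of "x$2"] by algebra
    finally have "wedge (p x) (q x) = tau * (eps + x$1 * tau)" .
    then show ?thesis unfolding det_matrix_columns using that eps pos[of "x$1"] by (simp add: R_def)
  qed
  have injG: "inj_on G R"
  proof (rule inj_onI)
    fix x z assume x: "x \<in> R" and z: "z \<in> R" and e: "G x = G z"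
    have "eps + x$1 * tau = eps + z$1 * tau"
      using arg_cong[OF e, of norm] pos[of "x$1"] pos[of "z$1"] x z by (simp add: G_def norm_polar R_def)
    then have 1: "x$1 = z$1" using eps by simp
    then obtain k :: int where k: "x$2 = z$2 + 2 * pi * of_int k"
      using polar_inj e pos[of "x$1"] x by (fastforce simp: G_def R_def)
    have "\<bar>2 * pi * of_int k\<bar> < 2 * pi" using x z k by (auto simp: R_def)
    then have "\<bar>of_int k :: real\<bar> < 1" by (simp add: abs_mult)
    then have "k = 0" by linarith
    then show "x = z" using 1 k by (simp add: vec2_eq_iff)
  qed
  have hG: "tau * (eps + x$1 * tau) * h (G x) = f (x$1)" if "x \<in> R" for x
  proof -
    have "norm (G x) = eps + x$1 * tau" using that pos[of "x$1"] by (simp add: G_def norm_polar R_def)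
    moreover have "x$1 * tau < 1 * tau" "0 < x$1 * tau" using that eps by (auto simp: R_def)
    ultimately show ?thesis using h[of "G x"] by (simp add: f_def)
  qed
  have int1: "set_integrable lebesgue R (%x. \<bar>det (matrix (%k. k$1 *\<^sub>R p x + k$2 *\<^sub>R q x))\<bar> * h (G x))"
    using intR by (subst set_integrable_cong[OF refl refl, of _ _ "%x. f (x$1)"]) (auto simp: detG hG)
  have Rm: "R \<in> sets lebesgue" using openR by auto
  note cov = change_of_variables_real[OF Rm dG injG int1]
  have eq: "(LINT x:G ` R|lebesgue. h x) = (LINT x:R|lebesgue. f (x$1))"
    unfolding cov(2) using Rm by (intro set_lebesgue_integral_cong) (auto simp: detG hG)
  have sub: "G ` R \<subseteq> ring_region eps tau"
  proof
    fix z assume "z \<in> G ` R"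
    then obtain x where x: "x \<in> R" "z = G x" by blast
    have "norm z = eps + x$1 * tau" using x pos[of "x$1"] by (simp add: G_def norm_polar R_def)
    moreover have "x$1 * tau <= 1 * tau" using x eps by (intro mult_right_mono) (auto simp: R_def)
    ultimately show "z \<in> ring_region eps tau" using x eps by (auto simp: ring_region_def R_def)
  qed
  have neg: "negligible (ring_region eps tau - G ` R)"
  proof (rule negligible_subset)
    show "negligible (sphere 0 eps \<union> sphere 0 (eps + tau) \<union> {x :: real^2. x$2 = 0})"
      by (intro negligible_Un negligible_sphere negligible_coord)
    show "ring_region eps tau - G ` R \<subseteq> \<dots>"
    proof
      fix z assume z: "z \<in> ring_region eps tau - G ` R"
      show "z \<in> sphere 0 eps \<union> sphere 0 (eps + tau) \<union> {x. x$2 = 0}"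
      proof (rule ccontr)
        assume no: "\<not> ?thesis"
        let ?n = "norm z"
        have n: "eps < ?n" "?n < eps + tau" and z2: "z$2 \<noteq> 0" using z no by (auto simp: ring_region_def)
        have "(z$1 / ?n)\<^sup>2 + (z$2 / ?n)\<^sup>2 = 1"
          using n eps norm_vec2[of z] by (simp add: power_divide flip: add_divide_distrib) (use z2 in simp)
        then obtain th where th: "0 <= th" "th < 2 * pi" "z$1 / ?n = cos th" "z$2 / ?n = sin th"
          using sincos_total_2pi by blast
        have "th \<noteq> 0" using th z2 n eps by auto
        moreover have "z$1 = ?n * cos th" "z$2 = ?n * sin th"
          unfolding th(3,4)[symmetric] using n eps by auto
        ultimately have zp: "z = polar ?n th" and "0 < th"
          unfolding vec2_eq_iff polar_def vector_2 using th(1) by (blast, linarith)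
        let ?x = "vector [(?n - eps) / tau, th] :: real^2"
        have "(?n - eps) / tau < 1" using n eps by (subst divide_less_eq_1_pos) auto
        then have "?x \<in> R" using \<open>0 < th\<close> th(2) n eps unfolding R_def by simp
        moreover have "G ?x = z" unfolding G_def vector_2 using eps zp by simp
        ultimately have "z \<in> G ` R" by (metis image_eqI)
        then show False using z by blast
      qed
    qed
  qed
  have neg1: "negligible {x \<in> G ` R - ring_region eps tau. h x \<noteq> 0}" using sub by (simp add: Diff_eq_empty_iff[THEN iffD2])
  have neg2: "negligible {x \<in> ring_region eps tau - G ` R. h x \<noteq> 0}" using neg by (rule negligible_subset) auto
  show *: "set_integrable lebesgue (ring_region eps tau) h"
    by (rule absolutely_integrable_spike_set[OF cov(1) neg1 neg2])
  have "integral (ring_region eps tau) h = integral (G ` R) h"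
    by (rule integral_spike_set[OF neg2 neg1])
  then have "(LINT x:ring_region eps tau|lebesgue. h x) = (LINT x:G ` R|lebesgue. h x)"
    using set_lebesgue_integral_eq_integral(2)[OF *] set_lebesgue_integral_eq_integral(2)[OF cov(1)] by simp
  also have "\<dots> = (LINT s:{0<..<1}|lborel. 2 * pi * f s)" using eq intR' by simp
  also have "\<dots> = 2 * pi * tau * (LINT s:{0<..<1}|lborel. phi (eps + s * tau) * (eps + s * tau))"
    unfolding f_def by (simp add: mult.assoc)
  finally show "(LINT x:ring_region eps tau|lebesgue. h x) = 2 * pi * tau * (LINT s:{0<..<1}|lborel. phi (eps + s * tau) * (eps + s * tau))" .
qed

text \<open>Enlarging the triangle to the unit square turns the integral into the square of that of
  a^b over (0,1), which is 1/(1 + b). It is applied with b = 1 - p.\<close>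

lemma product_integral_bound:
  fixes b :: real
  assumes b: "- 1 < b" "b < 0"
  shows "set_integrable lebesgue open_triangle (%x. (x$1 * x$2) powr b)"
    and "(LINT x:open_triangle|lebesgue. (x$1 * x$2) powr b) <= 1 / (1 + b)\<^sup>2"
proof -
  define k :: "real => real" where "k a = indicator {0..1} a * a powr b" for a
  have [measurable]: "k \<in> borel_measurable borel" unfolding k_def by measurable
  have [measurable]: "(%x :: real^2. x $ 1) \<in> borel_measurable borel" "(%x :: real^2. x $ 2) \<in> borel_measurable borel"
    by (intro borel_measurable_continuous_onI continuous_intros)+
  have [measurable]: "open_triangle \<in> sets borel" using open_open_triangle by simp
  have k0: "0 <= k a" for a by (simp add: k_def)
  have k1: "(\<integral>\<^sup>+a. ennreal (k a) \<partial>lborel) = ennreal (1 / (1 + b))"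
  proof -
    have "((%a. a powr b) has_integral (1 powr (b + 1) / (b + 1) - 0 powr (b + 1) / (b + 1))) {0..1}"
    proof (rule fundamental_theorem_of_calculus_interior)
      show "continuous_on {0..1} (%a. a powr (b + 1) / (b + 1))"
        using b by (intro continuous_intros continuous_on_powr') auto
      show "((%a. a powr (b + 1) / (b + 1)) has_vector_derivative a powr b) (at a)" if "a \<in> {0<..<1}" for a
        using that b by (auto intro!: derivative_eq_intros simp flip: has_real_derivative_iff_has_vector_derivative)
    qed simp
    then have "((%a. a powr b) has_integral (1 / (1 + b))) {0..1}" using b by (simp add: add.commute)
    then have "((%a. indicator {0..1} a * a powr b) has_integral (1 / (1 + b))) UNIV"
    proof (subst (asm) has_integral_restrict_UNIV[symmetric])
      have "(%a. indicator {0..1} a * a powr b) = (%a. if a \<in> {0..1} then a powr b else 0)"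
        by (auto simp: indicator_def)
      then show "((%a. if a \<in> {0..1} then a powr b else 0) has_integral 1 / (1 + b)) UNIV ==>
          ((%a. indicator {0..1} a * a powr b) has_integral 1 / (1 + b)) UNIV" by simp
    qed
    then show ?thesis unfolding k_def
      by (intro nn_integral_has_integral_lborel) auto
  qed
  have "(\<integral>\<^sup>+x. ennreal (indicator open_triangle x * (x$1 * x$2) powr b) \<partial>(lborel :: (real^2) measure))
      <= (\<integral>\<^sup>+x. ennreal (k (x$1)) * ennreal (k (x$2)) \<partial>(lborel :: (real^2) measure))"
    by (intro nn_integral_mono) (auto simp: indicator_def open_triangle_def k_def powr_mult ennreal_mult)
  also have "\<dots> = (\<integral>\<^sup>+a. \<integral>\<^sup>+c. ennreal (k a) * ennreal (k c) \<partial>lborel \<partial>lborel)"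
    by (subst nn_integral_vec2) auto
  also have "\<dots> = ennreal (1 / (1 + b)\<^sup>2)"
    using b by (simp add: nn_integral_cmult nn_integral_multc k1 power2_eq_square flip: ennreal_mult)
  finally have le: "(\<integral>\<^sup>+x. ennreal (indicator open_triangle x * (x$1 * x$2) powr b) \<partial>(lborel :: (real^2) measure)) <= ennreal (1 / (1 + b)\<^sup>2)" .
  then have int: "integrable lborel (%x :: real^2. indicator open_triangle x * (x$1 * x$2) powr b)"
    by (intro integrableI_nonneg) (auto simp: order_le_less_trans)
  then have "(LINT x|lborel. indicator open_triangle x * (x$1 * x$2) powr b) <= 1 / (1 + b)\<^sup>2"
    using le by (subst (asm) nn_integral_eq_integral) auto
  then show "set_integrable lebesgue open_triangle (%x. (x$1 * x$2) powr b)"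
    and "(LINT x:open_triangle|lebesgue. (x$1 * x$2) powr b) <= 1 / (1 + b)\<^sup>2"
    using int by (simp_all add: set_integrable_def set_lebesgue_integral_def integrable_completion integral_completion)
qed

section \<open>Pointwise comparison of energy densities\<close>

text \<open>For an exponent in [0,1] the power lies between 1 and z, so z = 0 is allowed.\<close>

lemma powr_near_one:
  fixes z a :: real
  assumes "0 <= z" "0 <= a" "a <= 1" shows "\<bar>z powr a - 1\<bar> <= \<bar>z - 1\<bar>"
proof (cases "z = 0")
  case False
  then have z: "0 < z" using assms by simp
  show ?thesis
  proof (cases "1 <= z")
    case True
    then have "1 <= z powr a" "z powr a <= z powr 1"
      using assms powr_mono[of a 1 z] by (auto intro: ge_one_powr_ge_zero)
    then show ?thesis using z True by simp
  next
    case False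
    then have "z powr 1 <= z powr a" "z powr a <= 1"
      using assms z powr_mono'[of a 1 z] by (auto intro: powr_le1)
    then show ?thesis using z False by simp
  qed
qed simp

text \<open>A negative power needs z away from 0; the constant is the largest derivative on [1/K,
  infinity).\<close>

lemma powr_near_one_neg:
  fixes z b K :: real
  assumes "b <= 0" "1 <= K" "1 / K <= z"
  shows "\<bar>z powr b - 1\<bar> <= (- b * K powr (1 - b)) * \<bar>z - 1\<bar>" and "z powr b <= K powr (- b)"
proof -
  have K: "0 < 1 / K" "1 / K <= 1" using assms by auto
  have le: "x powr a <= K powr (- a)" if "1 / K <= x" "a <= 0" for x a
  proof -
    have "x powr a <= (1 / K) powr a" using that K by (intro powr_mono2') auto
    also have "\<dots> = K powr (- a)" using assms by (simp add: powr_divide powr_minus_divide)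
    finally show ?thesis .
  qed
  show "z powr b <= K powr (- b)" using le assms by simp
  have "norm (z powr b - 1 powr b) <= (- b * K powr (1 - b)) * norm (z - 1)"
  proof (rule field_differentiable_bound[where S="{1 / K..}" and f'="%x. b * x powr (b - 1)"])
    fix x assume x: "x \<in> {1 / K..}"
    then have "0 < x" using less_le_trans[OF K(1)] by simp
    then show "((%x. x powr b) has_field_derivative b * x powr (b - 1)) (at x within {1 / K..})"
      by (auto intro!: derivative_eq_intros)
    have "- b * x powr (b - 1) <= - b * K powr (- (b - 1))" using x assms by (intro mult_left_mono le) auto
    then show "norm (b * x powr (b - 1)) <= - b * K powr (1 - b)" using assms by (simp add: abs_mult)
  qed (use assms K in auto)
  then show "\<bar>z powr b - 1\<bar> <= (- b * K powr (1 - b)) * \<bar>z - 1\<bar>" by simp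
qed

lemma volumetric_density_bounds:
  assumes g: "volumetric_density g" and ab: "0 < a" "a <= b"
  obtains L U where "0 < L" "0 < U" "!!x y. x \<in> {a..b} ==> y \<in> {a..b} ==> \<bar>g x - g y\<bar> <= L * \<bar>x - y\<bar>"
    "!!x. x \<in> {a..b} ==> 0 < g x & g x <= U"
proof -
  have pos: "!!d. 0 < d ==> 0 < g d" and "g C1_differentiable_on {0<..}"
    using g by (auto simp: volumetric_density_def)
  then obtain D where D: "!!x. 0 < x ==> (g has_vector_derivative D x) (at x)" "continuous_on {0<..} D"
    by (auto simp: C1_differentiable_on_def)
  have cD: "continuous_on {a..b} D" using D(2) ab by (auto intro: continuous_on_subset)
  have "continuous_on {a..b} g"
    using has_vector_derivative_continuous[OF D(1)] ab by (intro continuous_at_imp_continuous_on) auto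
  then have "bounded (g ` {a..b})" "bounded (D ` {a..b})"
    using cD by (auto intro: compact_imp_bounded compact_continuous_image)
  then obtain U L where U: "0 < U" "!!x. x \<in> {a..b} ==> \<bar>g x\<bar> <= U" and L: "0 < L" "!!x. x \<in> {a..b} ==> \<bar>D x\<bar> <= L"
    by (auto simp: bounded_pos)
  have "norm (g x - g y) <= L * norm (x - y)" if "x \<in> {a..b}" "y \<in> {a..b}" for x y
  proof (rule field_differentiable_bound[where S="{a..b}" and f'=D])
    fix z assume z: "z \<in> {a..b}"
    then show "(g has_field_derivative D z) (at z within {a..b})"
      using D(1)[of z] ab by (auto simp: has_real_derivative_iff_has_vector_derivative intro: has_vector_derivative_at_within)
    show "norm (D z) <= L" using L(2)[OF z] by simp
  qed (use that in auto)
  then show thesis using that[of L U] U L pos ab by (force simp: abs_le_iff)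
qed

lemma volumetric_density_continuous:
  assumes "volumetric_density g" shows "continuous_on {0<..} g"
  using assms C1_differentiable_imp_continuous_on by (auto simp: volumetric_density_def)

context cavity
begin

lemma r'_lipschitz:
  assumes "z \<in> {0<..1}" "w \<in> {0<..1}" shows "\<bar>r' z - r' w\<bar> <= B * \<bar>z - w\<bar>"
proof -
  have "norm (r' z - r' w) <= B * norm (z - w)"
    by (rule field_differentiable_bound[where S="{0<..1}" and f'=r'']) (use assms deriv bound in auto)
  then show ?thesis by simp
qed

lemma profile_continuous: "continuous_on {0<..1} r" "continuous_on {0<..1} r'"
  unfolding continuous_on_eq_continuous_within using DERIV_continuous[OF deriv(1)] DERIV_continuous[OF deriv(2)] by blast+

text \<open>\<open>Zr R\<close> is R^2 times the squared gradient norm of u at radius R. Unlike the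
  gradient it stays bounded, and away from 0, as R -> 0. \<open>w1\<close> is the density of the
  first energy and \<open>du\<close> the Jacobian of u.\<close>

definition "Zr R = (r R)\<^sup>2 + (r' R * R)\<^sup>2"
definition "w1 p R = ((r' R)\<^sup>2 + (r R / R)\<^sup>2) powr (p / 2)"
definition "du R = r' R * r R / R"

lemma r'_nonneg: "R \<in> {0<..1} ==> 0 < r' R"
  using slope(1) slope(3)[of R] by (smt (verit) greaterThanAtMost_iff mult_pos_pos)

lemma Zr_bounds:
  assumes "R \<in> {0<..1}" shows "c\<^sup>2 <= Zr R" "Zr R <= 2 * B\<^sup>2" "0 < Zr R"
proof -
  have "c\<^sup>2 <= (r R)\<^sup>2" using c assms by (intro power_mono) auto
  then show "c\<^sup>2 <= Zr R" by (simp add: Zr_def add_increasing2)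
  then show "0 < Zr R" using c(1) by (smt (verit) zero_less_power)
  have "\<bar>r' R * R\<bar> <= B * 1" using assms bound(2) by (intro abs_bounds) auto
  then have "(r' R * R)\<^sup>2 <= B\<^sup>2" using abs_le_square_iff[of "r' R * R" B] B_pos by simp
  moreover have "(r R)\<^sup>2 <= B\<^sup>2" using abs_le_square_iff[of "r R" B] B_pos bound(1)[OF assms] by simp
  ultimately show "Zr R <= 2 * B\<^sup>2" by (simp add: Zr_def)
qed

lemma w1_eq: "R \<in> {0<..1} ==> w1 p R = Zr R powr (p / 2) * R powr (- p)"
proof -
  assume R: "R \<in> {0<..1}"
  have "(r' R)\<^sup>2 + (r R / R)\<^sup>2 = Zr R * (R powr (- 2))"
    using R by (simp add: Zr_def powr_minus field_simps)
  then show ?thesis using R Zr_bounds(3)[OF R] by (simp add: w1_def powr_mult powr_powr)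
qed

lemma w1_bounds:
  assumes "R \<in> {0<..1}" "0 < p"
  shows "c powr p * R powr (- p) <= w1 p R" "w1 p R <= (2 * B\<^sup>2) powr (p / 2) * R powr (- p)"
proof -
  have "(c\<^sup>2) powr (p / 2) = c powr p" using c(1) by (simp add: powr_powr flip: powr_numeral)
  moreover have "(c\<^sup>2) powr (p / 2) <= Zr R powr (p / 2)" "Zr R powr (p / 2) <= (2 * B\<^sup>2) powr (p / 2)"
    using Zr_bounds[OF assms(1)] assms by (auto intro!: powr_mono2)
  ultimately show "c powr p * R powr (- p) <= w1 p R" "w1 p R <= (2 * B\<^sup>2) powr (p / 2) * R powr (- p)"
    unfolding w1_eq[OF assms(1)] by (auto intro!: mult_right_mono)
qed

lemma Zr_lipschitz:
  assumes "z \<in> {0<..1}" "w \<in> {0<..1}" shows "\<bar>Zr z - Zr w\<bar> <= (2 * B * M + 4 * B\<^sup>2) * \<bar>z - w\<bar>"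
proof -
  have 1: "\<bar>r z - r w\<bar> <= M * \<bar>z - w\<bar>" using r_lipschitz[of z 1 w] assms by auto
  have "\<bar>r z + r w\<bar> <= 2 * B" using bound(1)[OF assms(1)] bound(1)[OF assms(2)] by linarith
  with 1 have a: "\<bar>(r z - r w) * (r z + r w)\<bar> <= (M * \<bar>z - w\<bar>) * (2 * B)" by (rule abs_bounds)
  have "\<bar>(r' z - r' w) * z\<bar> <= (B * \<bar>z - w\<bar>) * 1" using r'_lipschitz[OF assms] assms by (intro abs_bounds) auto
  moreover have "\<bar>r' w * (z - w)\<bar> <= B * \<bar>z - w\<bar>" using bound(2)[OF assms(2)] by (intro abs_bounds) auto
  moreover have "r' z * z - r' w * w = (r' z - r' w) * z + r' w * (z - w)" by (simp add: algebra_simps)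
  ultimately have 2: "\<bar>r' z * z - r' w * w\<bar> <= 2 * B * \<bar>z - w\<bar>" by linarith
  have "\<bar>r' z * z\<bar> <= B * 1" "\<bar>r' w * w\<bar> <= B * 1" using assms bound(2) by (intro abs_bounds; auto)+
  then have "\<bar>r' z * z + r' w * w\<bar> <= 2 * B" by linarith
  with 2 have b: "\<bar>(r' z * z - r' w * w) * (r' z * z + r' w * w)\<bar> <= (2 * B * \<bar>z - w\<bar>) * (2 * B)" by (rule abs_bounds)
  have "Zr z - Zr w = (r z - r w) * (r z + r w) + (r' z * z - r' w * w) * (r' z * z + r' w * w)"
    by (simp add: Zr_def power2_eq_square algebra_simps)
  moreover have "(2 * B * M + 4 * B\<^sup>2) * \<bar>z - w\<bar> = (M * \<bar>z - w\<bar>) * (2 * B) + (2 * B * \<bar>z - w\<bar>) * (2 * B)"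
    by (simp add: power2_eq_square algebra_simps)
  ultimately show ?thesis using a b by linarith
qed

lemma du_bounds:
  assumes "R \<in> {0<..1}" shows "m * c <= du R" "du R <= M * B" "0 < m * c"
proof -
  have R: "0 < R" using assms by simp
  have rc: "c <= r R" "r R <= B" using c(2) bound(1) assms by (auto simp: abs_le_iff)
  have q: "m <= r' R / R" "r' R / R <= M" using slope(3,4)[OF assms] R by (auto simp: field_simps)
  have du: "du R = (r' R / R) * r R" by (simp add: du_def)
  show "m * c <= du R" unfolding du by (rule mult_mono) (use q rc slope c(1) in auto)
  show "du R <= M * B" unfolding du by (rule mult_mono) (use q rc slope c(1) M_pos in auto)
  show "0 < m * c" using slope c by simp
qed

text \<open>Because of the quotient r/R, closeness of \<open>du\<close> at two radii is governed by
  their relative distance.\<close>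

lemma du_close:
  assumes z: "z \<in> {0<..1}" and w: "w \<in> {0<..1}"
  shows "\<bar>du z - du w\<bar> <= (2 * M * B + B\<^sup>2) * (\<bar>z - w\<bar> / w)"
proof -
  have w0: "0 < w" "0 < z" using w z by auto
  have "(du z - du w) * w = du z * (w - z) + ((r' z - r' w) * r z + r' w * (r z - r w))"
    using w0 by (simp add: du_def field_simps)
  moreover have "\<bar>du z * (w - z)\<bar> <= (M * B) * \<bar>z - w\<bar>"
    using du_bounds[OF z] by (intro abs_bounds) auto
  moreover have "\<bar>(r' z - r' w) * r z\<bar> <= (B * \<bar>z - w\<bar>) * B"
    using r'_lipschitz[OF z w] bound(1)[OF z] by (intro abs_bounds) auto
  moreover have "\<bar>r' w * (r z - r w)\<bar> <= B * (M * \<bar>z - w\<bar>)"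
    using bound(2)[OF w] r_lipschitz[of z 1 w] z w by (intro abs_bounds) auto
  ultimately have "\<bar>(du z - du w) * w\<bar> <= (M * B) * \<bar>z - w\<bar> + (B * \<bar>z - w\<bar>) * B + B * (M * \<bar>z - w\<bar>)"
    by linarith
  then have "\<bar>du z - du w\<bar> * w <= (M * B) * \<bar>z - w\<bar> + (B * \<bar>z - w\<bar>) * B + B * (M * \<bar>z - w\<bar>)"
    using w0 by (simp add: abs_mult)
  also have "\<dots> = ((2 * M * B + B\<^sup>2) * (\<bar>z - w\<bar> / w)) * w" using w0 by (simp add: power2_eq_square algebra_simps)
  finally show ?thesis using w0 by (simp only: mult_le_cancel_right_pos)
qed

text \<open>\<open>D\<close> is the Jacobian of the element map, whose model value is \<open>n * th * t\<close>, and \<open>X\<close> is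
  \<open>D\<^sup>2\<close> times the squared norm of the interpolant's gradient.\<close>

lemma interpolant_density_close:
  assumes p: "1 < p" "p < 2" and K: "1 <= K"
  obtains C where "0 < C" "!!th n t bt Psi D X. 0 < th ==> 1 <= n ==> n <= 2 ==> t \<in> {0<..1} ==> 1 <= bt ==> 0 <= Psi ==>
      \<bar>D - n * th * t\<bar> <= K * th * t * Psi * bt ==> th * t / K <= D ==>
      0 <= X ==> \<bar>X - (n * th)\<^sup>2 * Zr t\<bar> <= K * th\<^sup>2 * Psi ==>
      \<bar>X powr (p / 2) * D powr (1 - p) - n * th * (w1 p t * t)\<bar> <= C * (th * t powr (1 - p) * Psi * bt)"
proof -
  define C1 where "C1 = - (1 - p) * (2 * K) powr (1 - (1 - p))"
  define C2 where "C2 = K / c\<^sup>2 * (2 * K) powr (- (1 - p)) + C1 * K"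
  define C where "C = 2 * (2 * B\<^sup>2) powr (p / 2) * C2"
  have C1: "0 <= C1" using p by (simp add: C1_def)
  have C2: "0 < C2" using K c(1) C1 by (simp add: C2_def add_pos_nonneg)
  have "0 < C" using C2 B_pos by (simp add: C_def)
  moreover have "\<bar>X powr (p / 2) * D powr (1 - p) - n * th * (w1 p t * t)\<bar> <= C * (th * t powr (1 - p) * Psi * bt)"
    if h: "0 < th" "1 <= n" "n <= 2" "t \<in> {0<..1}" "1 <= bt" "0 <= Psi" "\<bar>D - n * th * t\<bar> <= K * th * t * Psi * bt"
      "th * t / K <= D" "0 <= X" "\<bar>X - (n * th)\<^sup>2 * Zr t\<bar> <= K * th\<^sup>2 * Psi" for th n t bt Psi D X
  proof -
    have t: "0 < t" "0 < n" using h by auto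
    note Z = Zr_bounds[OF h(4)]
    \<comment> \<open>\<open>X\<close> and \<open>D\<close> are compared with their model values
      through the ratios \<open>x\<close> and \<open>d\<close>. The powers of n*th combine, since p
      + (1 - p) = 1.\<close>
    define x where "x = X / ((n * th)\<^sup>2 * Zr t)"
    define d where "d = D / (n * th * t)"
    have nt: "0 < n * th * t" "0 < n * th" using h t by auto
    have x0: "0 <= x" using h Z by (simp add: x_def)
    have x1: "\<bar>x - 1\<bar> <= K / c\<^sup>2 * (Psi * bt)"
    proof -
      have "x - 1 = (X - (n * th)\<^sup>2 * Zr t) / ((n * th)\<^sup>2 * Zr t)" using h(1) t(2) Z by (simp add: x_def diff_divide_distrib)
      then have "\<bar>x - 1\<bar> <= (K * th\<^sup>2 * Psi) / ((n * th)\<^sup>2 * Zr t)" using h(10) nt Z by (simp add: divide_right_mono)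
      also have "\<dots> <= (K * th\<^sup>2 * Psi) / (th\<^sup>2 * c\<^sup>2)"
      proof (intro divide_left_mono)
        have "1\<^sup>2 <= n\<^sup>2" using h by (intro power_mono) auto
        then have "1 * c\<^sup>2 <= n\<^sup>2 * Zr t" using Z by (intro mult_mono) auto
        then have "th\<^sup>2 * (1 * c\<^sup>2) <= th\<^sup>2 * (n\<^sup>2 * Zr t)" by (intro mult_left_mono) auto
        then show "th\<^sup>2 * c\<^sup>2 <= (n * th)\<^sup>2 * Zr t" by (simp add: power_mult_distrib mult_ac)
        show "0 < (n * th)\<^sup>2 * Zr t * (th\<^sup>2 * c\<^sup>2)" using nt h Z c(1) by simp
      qed (use K h in auto)
      also have "\<dots> = K / c\<^sup>2 * Psi" using h by simp
      also have "\<dots> <= K / c\<^sup>2 * (Psi * bt)" using K h mult_left_mono[of 1 bt Psi] by (intro mult_left_mono) auto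
      finally show ?thesis .
    qed
    have d1: "\<bar>d - 1\<bar> <= K * (Psi * bt)"
    proof -
      have "d - 1 = (D - n * th * t) / (n * th * t)" using h(1) t by (simp add: d_def diff_divide_distrib)
      then have "\<bar>d - 1\<bar> = \<bar>D - n * th * t\<bar> / (n * th * t)" using nt by (simp only: abs_divide abs_of_pos)
      also have "\<dots> <= (K * th * t * Psi * bt) / (n * th * t)" using h(7) nt by (intro divide_right_mono) auto
      also have "\<dots> = (K * (Psi * bt)) / n" using h t by simp
      also have "\<dots> <= (K * (Psi * bt)) / 1" using h K by (intro divide_left_mono) auto
      finally show ?thesis by simp
    qed
    have d2: "1 / (2 * K) <= d"
    proof -
      have "1 / (2 * K) = (th * t / K) / (2 * th * t)" using h t by (simp add: field_simps)
      also have "\<dots> <= (th * t / K) / (n * th * t)"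
        using h t K by (intro divide_left_mono mult_right_mono) auto
      also have "\<dots> <= d" unfolding d_def using h(8) nt by (intro divide_right_mono) auto
      finally show ?thesis .
    qed
    have d0: "0 < d" using d2 K by (smt (verit) divide_pos_pos)
    note dp = powr_near_one_neg[of "1 - p" "2 * K" d, OF _ _ d2, folded C1_def]
    have "\<bar>x powr (p / 2) - 1\<bar> * d powr (1 - p) <= (K / c\<^sup>2 * (Psi * bt)) * (2 * K) powr (- (1 - p))"
    proof (rule mult_mono)
      show "\<bar>x powr (p / 2) - 1\<bar> <= K / c\<^sup>2 * (Psi * bt)" using powr_near_one[OF x0, of "p / 2"] x1 p by linarith
      show "d powr (1 - p) <= (2 * K) powr (- (1 - p))" by (rule dp(2)) (use p K in auto)
    qed (use K h in auto)
    moreover have "\<bar>d powr (1 - p) - 1\<bar> <= C1 * (K * (Psi * bt))"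
    proof -
      have "\<bar>d powr (1 - p) - 1\<bar> <= C1 * \<bar>d - 1\<bar>" by (rule dp(1)) (use p K in auto)
      also have "\<dots> <= C1 * (K * (Psi * bt))" using d1 C1 by (intro mult_left_mono) auto
      finally show ?thesis .
    qed
    moreover have "\<bar>x powr (p / 2) * d powr (1 - p) - 1\<bar> <= \<bar>x powr (p / 2) - 1\<bar> * d powr (1 - p) + \<bar>d powr (1 - p) - 1\<bar>"
    proof -
      have "x powr (p / 2) * d powr (1 - p) - 1 = (x powr (p / 2) - 1) * d powr (1 - p) + (d powr (1 - p) - 1)"
        by (simp add: algebra_simps)
      then show ?thesis using abs_triangle_ineq[of "(x powr (p / 2) - 1) * d powr (1 - p)" "d powr (1 - p) - 1"]
        by (simp add: abs_mult)
    qed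
    ultimately have xd: "\<bar>x powr (p / 2) * d powr (1 - p) - 1\<bar> <= C2 * (Psi * bt)"
      unfolding C2_def distrib_right by (simp add: mult_ac)
    have X: "X powr (p / 2) = (n * th) powr p * Zr t powr (p / 2) * x powr (p / 2)"
    proof -
      have "X = ((n * th) powr 2) * Zr t * x" using h(1) t nt Z by (simp add: x_def)
      then show ?thesis using nt Z x0 by (simp add: powr_mult powr_powr)
    qed
    have D: "D powr (1 - p) = (n * th) powr (1 - p) * t powr (1 - p) * d powr (1 - p)"
    proof -
      have "D = (n * th) * t * d" using h(1) t by (simp add: d_def)
      then show ?thesis using nt t d0 by (simp add: powr_mult)
    qed
    have nn: "(n * th) powr p * (n * th) powr (1 - p) = n * th" using nt by (simp flip: powr_add)
    have tt: "t powr (- p) * t = t powr (1 - p)" using t by (simp add: powr_diff powr_minus field_simps)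
    have "X powr (p / 2) * D powr (1 - p) - n * th * (w1 p t * t)
        = ((n * th) powr p * (n * th) powr (1 - p)) * Zr t powr (p / 2) * t powr (1 - p) * (x powr (p / 2) * d powr (1 - p))
          - n * th * Zr t powr (p / 2) * (t powr (- p) * t)"
      unfolding X D w1_eq[OF h(4)] by (simp add: mult_ac)
    also have "\<dots> = (n * Zr t powr (p / 2)) * (th * t powr (1 - p)) * (x powr (p / 2) * d powr (1 - p) - 1)"
      unfolding nn tt by (simp add: algebra_simps)
    finally have "\<bar>X powr (p / 2) * D powr (1 - p) - n * th * (w1 p t * t)\<bar>
        = (n * Zr t powr (p / 2)) * (th * t powr (1 - p)) * \<bar>x powr (p / 2) * d powr (1 - p) - 1\<bar>"
      using h t by (simp add: abs_mult)
    also have "\<dots> <= (2 * (2 * B\<^sup>2) powr (p / 2)) * (th * t powr (1 - p)) * (C2 * (Psi * bt))"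
    proof (rule mult_mono[OF mult_right_mono xd])
      have "Zr t powr (p / 2) <= (2 * B\<^sup>2) powr (p / 2)" using Z p by (intro powr_mono2) auto
      then show "n * Zr t powr (p / 2) <= 2 * (2 * B\<^sup>2) powr (p / 2)" using h by (intro mult_mono) auto
    qed (use h t in auto)
    also have "\<dots> = C * (th * t powr (1 - p) * Psi * bt)" by (simp add: C_def mult_ac)
    finally show ?thesis .
  qed
  ultimately show thesis by (rule that)
qed

text \<open>\<open>rho\<close> is the true radius of the image point and \<open>t\<close> its model
  value. The condition t/K <= rho controls the singular power rho^(-p) contained in
  \<open>w1\<close>.\<close>

lemma deformation_density_close:
  assumes p: "1 < p" "p < 2" and K: "1 <= K"
  obtains C where "0 < C" "!!th n t rho bt Psi D. 0 < th ==> 1 <= n ==> n <= 2 ==> t \<in> {0<..1} ==> rho \<in> {0<..1} ==> 1 <= bt ==>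
      0 <= Psi ==> Psi <= K ==> \<bar>D - n * th * t\<bar> <= K * th * t * Psi * bt ==> t / K <= rho ==> \<bar>rho - t\<bar> <= K * Psi * t ==>
      \<bar>w1 p rho * D - n * th * (w1 p t * t)\<bar> <= C * (th * t powr (1 - p) * Psi * bt)"
proof -
  define L where "L = 2 * B * M + 4 * B\<^sup>2"
  define C1 where "C1 = - (- p) * K powr (1 - (- p))"
  define Kp where "Kp = K powr (- (- p))"
  define C2 where "C2 = L * K / c\<^sup>2 * Kp * (1 + K * K) + C1 * K * (1 + K * K) + K"
  define C where "C = 2 * (2 * B\<^sup>2) powr (p / 2) * C2"
  have pos: "0 < L" "0 <= C1" "0 < Kp" using p K B_pos M_pos by (auto simp: L_def C1_def Kp_def add_pos_pos)
  have C2: "0 < C2" using pos K c(1) by (simp add: C2_def add_nonneg_pos)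
  have "0 < C" using C2 B_pos by (simp add: C_def)
  moreover have "\<bar>w1 p rho * D - n * th * (w1 p t * t)\<bar> <= C * (th * t powr (1 - p) * Psi * bt)"
    if h: "0 < th" "1 <= n" "n <= 2" "t \<in> {0<..1}" "rho \<in> {0<..1}" "1 <= bt" "0 <= Psi" "Psi <= K"
      "\<bar>D - n * th * t\<bar> <= K * th * t * Psi * bt" "t / K <= rho" "\<bar>rho - t\<bar> <= K * Psi * t" for th n t rho bt Psi D
  proof -
    have t: "0 < t" "0 < n" "0 < rho" "t <= 1" using h by auto
    note Z = Zr_bounds[OF h(4)] and Z' = Zr_bounds[OF h(5)]
    define x where "x = Zr rho / Zr t"
    define z where "z = rho / t"
    define d where "d = D / (n * th * t)"
    have nt: "0 < n * th * t" using h t by auto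
    have Psibt: "Psi <= Psi * bt" using h mult_left_mono[of 1 bt Psi] by simp
    have x0: "0 <= x" using Z Z' by (simp add: x_def)
    have x1: "\<bar>x - 1\<bar> <= L * K / c\<^sup>2 * Psi"
    proof -
      have "x - 1 = (Zr rho - Zr t) / Zr t" using Z by (simp add: x_def diff_divide_distrib)
      then have "\<bar>x - 1\<bar> = \<bar>Zr rho - Zr t\<bar> / Zr t" using Z by simp
      also have "\<dots> <= (L * \<bar>rho - t\<bar>) / Zr t"
        using Zr_lipschitz[OF h(5,4)] Z by (intro divide_right_mono) (auto simp: L_def)
      also have "\<dots> <= (L * (K * Psi)) / c\<^sup>2"
      proof (intro frac_le mult_left_mono)
        have "K * Psi * t <= K * Psi * 1" using K h t by (intro mult_left_mono) auto
        then show "\<bar>rho - t\<bar> <= K * Psi" using h(11) by linarith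
      qed (use pos K h Z c(1) in auto)
      finally show ?thesis by (simp add: mult_ac)
    qed
    have z1: "\<bar>z - 1\<bar> <= K * Psi"
    proof -
      have "z - 1 = (rho - t) / t" using t by (simp add: z_def field_simps)
      then show ?thesis using h(11) t by (simp add: divide_le_eq)
    qed
    have z2: "1 / K <= z" using h(10) t K by (simp add: z_def field_simps)
    have d1: "\<bar>d - 1\<bar> <= K * (Psi * bt)"
    proof -
      have "d - 1 = (D - n * th * t) / (n * th * t)" using h(1) t by (simp add: d_def diff_divide_distrib)
      then have "\<bar>d - 1\<bar> = \<bar>D - n * th * t\<bar> / (n * th * t)" using nt by (simp only: abs_divide abs_of_pos)
      also have "\<dots> <= (K * th * t * Psi * bt) / (n * th * t)" using h(9) nt by (intro divide_right_mono) auto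
      also have "\<dots> = (K * (Psi * bt)) / n" using h t by simp
      also have "\<dots> <= (K * (Psi * bt)) / 1" using h K by (intro divide_left_mono) auto
      finally show ?thesis by simp
    qed
    have d2: "\<bar>d\<bar> <= (1 + K * K) * bt"
    proof -
      have "K * (Psi * bt) <= K * (K * bt)" using h K by (intro mult_left_mono mult_right_mono) auto
      then have "\<bar>d\<bar> <= 1 + K * (K * bt)" using d1 by linarith
      also have "\<dots> <= bt + K * (K * bt)" using h by simp
      finally show ?thesis by (simp add: algebra_simps)
    qed
    note zp = powr_near_one_neg[of "- p" K z, OF _ K z2, folded C1_def Kp_def]
    have zp: "\<bar>z powr (- p) - 1\<bar> <= C1 * (K * Psi)" "z powr (- p) <= Kp"
    proof -
      have "\<bar>z powr (- p) - 1\<bar> <= C1 * \<bar>z - 1\<bar>" by (rule zp(1)) (use p in auto)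
      also have "\<dots> <= C1 * (K * Psi)" using z1 pos by (intro mult_left_mono) auto
      finally show "\<bar>z powr (- p) - 1\<bar> <= C1 * (K * Psi)" .
      show "z powr (- p) <= Kp" by (rule zp(2)) (use p in auto)
    qed
    have xp: "\<bar>x powr (p / 2) - 1\<bar> <= L * K / c\<^sup>2 * Psi" using powr_near_one[OF x0, of "p / 2"] x1 p by linarith
    have "\<bar>(x powr (p / 2) - 1) * z powr (- p) * d\<bar> <= (L * K / c\<^sup>2 * Psi) * Kp * ((1 + K * K) * bt)"
      using xp zp d2 by (intro abs_bounds) auto
    moreover have "\<bar>(z powr (- p) - 1) * d\<bar> <= (C1 * (K * Psi)) * ((1 + K * K) * bt)"
      using zp d2 by (intro abs_bounds) auto
    moreover have "x powr (p / 2) * z powr (- p) * d - 1 = (x powr (p / 2) - 1) * z powr (- p) * d + (z powr (- p) - 1) * d + (d - 1)"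
      by (simp add: algebra_simps)
    ultimately have "\<bar>x powr (p / 2) * z powr (- p) * d - 1\<bar>
        <= (L * K / c\<^sup>2 * Psi) * Kp * ((1 + K * K) * bt) + (C1 * (K * Psi)) * ((1 + K * K) * bt) + K * (Psi * bt)"
      using d1 by linarith
    also have "\<dots> = C2 * (Psi * bt)" unfolding C2_def by (simp add: algebra_simps)
    finally have xzd: "\<bar>x powr (p / 2) * z powr (- p) * d - 1\<bar> <= C2 * (Psi * bt)" .
    have "Zr rho = Zr t * x" "rho = t * z" "D = n * th * t * d" using Z t h(1) by (simp_all add: x_def z_def d_def)
    then have "w1 p rho * D = (Zr t powr (p / 2) * x powr (p / 2)) * (t powr (- p) * z powr (- p)) * (n * th * t * d)"
      unfolding w1_eq[OF h(5)] using Z x0 t z2 K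
      by (metis (no_types, lifting) powr_mult)
    then have "w1 p rho * D - n * th * (w1 p t * t) = (n * Zr t powr (p / 2)) * (th * (t powr (- p) * t)) * (x powr (p / 2) * z powr (- p) * d - 1)"
      unfolding w1_eq[OF h(4)] by (simp add: algebra_simps)
    also have "t powr (- p) * t = t powr (1 - p)" using t by (simp add: powr_diff powr_minus field_simps)
    finally have "\<bar>w1 p rho * D - n * th * (w1 p t * t)\<bar>
        = (n * Zr t powr (p / 2)) * (th * t powr (1 - p)) * \<bar>x powr (p / 2) * z powr (- p) * d - 1\<bar>"
      using h t by (simp add: abs_mult)
    also have "\<dots> <= (2 * (2 * B\<^sup>2) powr (p / 2)) * (th * t powr (1 - p)) * (C2 * (Psi * bt))"
    proof (rule mult_mono[OF mult_right_mono xzd])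
      have "Zr t powr (p / 2) <= (2 * B\<^sup>2) powr (p / 2)" using Z p by (intro powr_mono2) auto
      then show "n * Zr t powr (p / 2) <= 2 * (2 * B\<^sup>2) powr (p / 2)" using h by (intro mult_mono) auto
    qed (use h t in auto)
    also have "\<dots> = C * (th * t powr (1 - p) * Psi * bt)" by (simp add: C_def mult_ac)
    finally show ?thesis .
  qed
  ultimately show thesis by (rule that)
qed

text \<open>g is Lipschitz on compact subintervals of (0, infinity) only. The second estimate is
  therefore restricted to Jacobian ratios V/D confined by \<open>kap\<close>.\<close>

lemma volume_density_close:
  assumes g: "volumetric_density g" and K: "1 <= K" and kap: "0 < kap"
  obtains C where "0 < C"
    "!!th n t rho bt Psi D. 0 < th ==> 1 <= n ==> n <= 2 ==> t \<in> {0<..1} ==> rho \<in> {0<..1} ==> 1 <= bt ==>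
      0 <= Psi ==> Psi <= K ==> \<bar>D - n * th * t\<bar> <= K * th * t * Psi * bt ==> \<bar>rho - t\<bar> <= K * Psi * t ==>
      \<bar>g (du rho) * D - n * th * (g (du t) * t)\<bar> <= C * (th * t * Psi * bt)"
    "!!th n t rho bt Psi D V Phi. 0 < th ==> 1 <= n ==> n <= 2 ==> t \<in> {0<..1} ==> rho \<in> {0<..1} ==> 1 <= bt ==>
      0 <= Psi ==> Psi <= K ==> \<bar>D - n * th * t\<bar> <= K * th * t * Psi * bt ==> \<bar>rho - t\<bar> <= K * Psi * t ==>
      0 < D ==> \<bar>V - n * th * r' t * r t\<bar> <= K * Phi ==> kap <= V / D ==> V / D <= 1 / kap ==>
      \<bar>g (V / D) * D - g (du rho) * D\<bar> <= C * (Phi + th * t * Psi * bt)"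
proof -
  \<comment> \<open>The interval from \<open>lo\<close> to \<open>hi\<close> contains both the
    admissible ratios V/D and all values of \<open>du\<close>.\<close>
  define lo where "lo = min kap (m * c)"
  define hi where "hi = max (1 / kap) (M * B)"
  have lo: "0 < lo" using kap slope c(1) by (simp add: lo_def)
  have "m * c <= M * B" using du_bounds(1,2)[of 1] by simp
  then have "lo <= hi" by (auto simp: lo_def hi_def)
  with lo obtain L U where L: "0 < L" "0 < U" "!!x y. x \<in> {lo..hi} ==> y \<in> {lo..hi} ==> \<bar>g x - g y\<bar> <= L * \<bar>x - y\<bar>"
      "!!x. x \<in> {lo..hi} ==> 0 < g x & g x <= U"
    using volumetric_density_bounds[OF g] by metis
  have du: "du R \<in> {lo..hi}" if "R \<in> {0<..1}" for R using du_bounds[OF that] by (auto simp: lo_def hi_def)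
  define E where "E = 2 * M * B + B\<^sup>2"
  have E: "0 < E" using M_pos B_pos by (simp add: E_def add_pos_pos)
  define C1 where "C1 = L * (E * K) * (2 + K * K) + U * K"
  define C2 where "C2 = L * (K + M * B * K + E * K * (2 + K * K))"
  have base: "\<bar>D\<bar> <= (2 + K * K) * (th * t * bt)" "\<bar>du rho - du t\<bar> <= E * K * Psi"
    if h: "0 < th" "1 <= n" "n <= 2" "t \<in> {0<..1}" "rho \<in> {0<..1}" "1 <= bt" "0 <= Psi" "Psi <= K"
      "\<bar>D - n * th * t\<bar> <= K * th * t * Psi * bt" "\<bar>rho - t\<bar> <= K * Psi * t" for th n t rho bt Psi D
  proof -
    have t: "0 < t" using h by simp
    have "n * th * t <= 2 * th * t * bt"
    proof -
      have "n * (th * t) * 1 <= 2 * (th * t) * bt" using h t by (intro mult_mono) auto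
      then show ?thesis by (simp add: mult.assoc)
    qed
    moreover have "K * th * t * Psi * bt <= K * th * t * K * bt" using h t K by (intro mult_right_mono mult_left_mono) auto
    moreover have "(2 + K * K) * (th * t * bt) = 2 * th * t * bt + K * th * t * K * bt" by (simp add: algebra_simps)
    moreover have "0 < n * th * t" using h t by simp
    ultimately show "\<bar>D\<bar> <= (2 + K * K) * (th * t * bt)" using h(9) by linarith
    have "\<bar>du rho - du t\<bar> <= E * (\<bar>rho - t\<bar> / t)" unfolding E_def by (rule du_close[OF h(5,4)])
    also have "\<dots> <= E * (K * Psi)" using h(10) t E by (intro mult_left_mono) (auto simp: divide_le_eq)
    finally show "\<bar>du rho - du t\<bar> <= E * K * Psi" by (simp add: mult.assoc)
  qed
  have 1: "\<bar>g (du rho) * D - n * th * (g (du t) * t)\<bar> <= (C1 + C2) * (th * t * Psi * bt)"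
    if h: "0 < th" "1 <= n" "n <= 2" "t \<in> {0<..1}" "rho \<in> {0<..1}" "1 <= bt" "0 <= Psi" "Psi <= K"
      "\<bar>D - n * th * t\<bar> <= K * th * t * Psi * bt" "\<bar>rho - t\<bar> <= K * Psi * t" for th n t rho bt Psi D
  proof -
    note b = base[OF h]
    have "\<bar>g (du rho) - g (du t)\<bar> <= L * \<bar>du rho - du t\<bar>" using L(3) du h by blast
    also have "\<dots> <= L * (E * K * Psi)" using b(2) L(1) by (intro mult_left_mono) auto
    finally have "\<bar>(g (du rho) - g (du t)) * D\<bar> <= (L * (E * K * Psi)) * ((2 + K * K) * (th * t * bt))"
      using b(1) by (rule abs_bounds)
    moreover have "\<bar>g (du t) * (D - n * th * t)\<bar> <= U * (K * th * t * Psi * bt)"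
      using L(4)[OF du[OF h(4)]] h(9) by (intro abs_bounds) auto
    moreover have "g (du rho) * D - n * th * (g (du t) * t) = (g (du rho) - g (du t)) * D + g (du t) * (D - n * th * t)"
      by (simp add: algebra_simps)
    ultimately have "\<bar>g (du rho) * D - n * th * (g (du t) * t)\<bar>
        <= (L * (E * K * Psi)) * ((2 + K * K) * (th * t * bt)) + U * (K * th * t * Psi * bt)" by linarith
    also have "\<dots> = C1 * (th * t * Psi * bt)" by (simp add: C1_def algebra_simps)
    also have "\<dots> <= (C1 + C2) * (th * t * Psi * bt)"
      using h L K E M_pos B_pos by (intro mult_right_mono) (auto simp: C2_def)
    finally show ?thesis .
  qed
  have 2: "\<bar>g (V / D) * D - g (du rho) * D\<bar> <= (C1 + C2) * (Phi + th * t * Psi * bt)"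
    if h: "0 < th" "1 <= n" "n <= 2" "t \<in> {0<..1}" "rho \<in> {0<..1}" "1 <= bt" "0 <= Psi" "Psi <= K"
      "\<bar>D - n * th * t\<bar> <= K * th * t * Psi * bt" "\<bar>rho - t\<bar> <= K * Psi * t"
      and h': "0 < D" "\<bar>V - n * th * r' t * r t\<bar> <= K * Phi" "kap <= V / D" "V / D <= 1 / kap" for th n t rho bt Psi D V Phi
  proof -
    note b = base[OF h]
    have t: "0 < t" using h by simp
    have Phi: "0 <= Phi" using h'(2) K by (smt (verit) zero_le_mult_iff)
    have "V / D \<in> {lo..hi}" using h' by (auto simp: lo_def hi_def)
    then have "\<bar>g (V / D) - g (du rho)\<bar> * D <= (L * \<bar>V / D - du rho\<bar>) * D"
      using L(3) du[OF h(5)] h' by (intro mult_right_mono) auto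
    \<comment> \<open>Multiplying by D before estimating removes the quotient, so D may be
      arbitrarily small here.\<close>
    also have "\<dots> = L * \<bar>V - du rho * D\<bar>"
    proof -
      have "V - du rho * D = (V / D - du rho) * D" using h' by (simp add: field_simps)
      then show ?thesis using h' by (simp add: abs_mult)
    qed
    also have "\<dots> <= L * (K * Phi + M * B * (K * th * t * Psi * bt) + (E * K * Psi) * ((2 + K * K) * (th * t * bt)))"
    proof (intro mult_left_mono)
      have "n * th * r' t * r t = du t * (n * th * t)" using t by (simp add: du_def)
      then have "V - du rho * D = (V - n * th * r' t * r t) - du t * (D - n * th * t) - (du rho - du t) * D"
        by (simp add: algebra_simps)
      moreover have "\<bar>du t * (D - n * th * t)\<bar> <= M * B * (K * th * t * Psi * bt)"
        using du_bounds[OF h(4)] h(9) by (intro abs_bounds) auto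
      moreover have "\<bar>(du rho - du t) * D\<bar> <= (E * K * Psi) * ((2 + K * K) * (th * t * bt))"
        using b by (intro abs_bounds)
      ultimately show "\<bar>V - du rho * D\<bar> <= K * Phi + M * B * (K * th * t * Psi * bt) + (E * K * Psi) * ((2 + K * K) * (th * t * bt))"
        using h'(2) by linarith
    qed (use L in auto)
    also have "\<dots> = L * (K * Phi + (M * B * K + E * K * (2 + K * K)) * (th * t * Psi * bt))" by (simp add: algebra_simps)
    also have "\<dots> <= L * (K + M * B * K + E * K * (2 + K * K)) * (Phi + th * t * Psi * bt)"
    proof -
      have "0 <= (M * B * K + E * K * (2 + K * K)) * Phi" "0 <= K * (th * t * Psi * bt)"
        using Phi M_pos B_pos K E h t by auto
      then have "K * Phi + (M * B * K + E * K * (2 + K * K)) * (th * t * Psi * bt)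
          <= (K + M * B * K + E * K * (2 + K * K)) * (Phi + th * t * Psi * bt)"
        by (simp add: algebra_simps)
      then show ?thesis using L(1) by (simp add: mult.assoc)
    qed
    also have "\<dots> <= (C1 + C2) * (Phi + th * t * Psi * bt)"
      unfolding C2_def using Phi h t L K E by (intro mult_right_mono) (auto simp: C1_def)
    finally show ?thesis using h' by (simp add: abs_mult flip: left_diff_distrib)
  qed
  have "0 < C1 + C2" using L K E M_pos B_pos by (simp add: C1_def C2_def add_pos_pos)
  then show thesis using 1 2 by (rule that)
qed

end

section \<open>Element estimates\<close>

definition edet :: "elem => real^2 => real" where
  "edet a x = \<bar>wedge (dquad1 a x) (dquad2 a x)\<bar>"

definition estretch :: "(real^2 => real^2) => elem => real^2 => real" where
  "estretch u a x = stretch (dquad1 a x) (dquad2 a x) (dquad1 (u \<circ> a) x) (dquad2 (u \<circ> a) x)"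

text \<open>The sign makes \<open>evol / edet\<close> the quotient of the two oriented Jacobians,
  also for a \<open>side\<close> with negative \<open>sg\<close>, whose nodes run clockwise.\<close>

definition evol :: "(real^2 => real^2) => elem => real^2 => real" where
  "evol u a x = wedge (dquad1 (u \<circ> a) x) (dquad2 (u \<circ> a) x) * sgn (wedge (dquad1 a x) (dquad2 a x))"

definition mesh_error :: "real => real => nat => real" where
  "mesh_error eps tau N = tau\<^sup>2 + 1 / real N ^ 2 + eps / tau * (1 / real N ^ 4)"

definition volume_error :: "real => real => nat => real" where
  "volume_error eps tau N = tau ^ 3 + (eps + tau) * tau * (1 / real N ^ 2) + 1 / real N ^ 4"

text \<open>\<open>2 * sg\<close>, which appears in the exact formulas, replaces the angle h = pi/N
  up to a relative error 1/N^2 <= 1/4.\<close>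

lemma angle_bounds:
  fixes N :: nat
  assumes N: "2 <= N"
  defines "eta == 1 - cos (pi / (2 * real N))" and "sg == sin (pi / (2 * real N))" and "h == pi / real N"
  shows "0 < eta" "eta <= 293/1000" "sg\<^sup>2 = eta * (2 - eta)" "0 < sg" "eta <= 2 / real N ^ 2"
    "\<bar>2 * sg - h\<bar> <= h * (1 / real N ^ 2)" "2 * sg <= h" "(3/4) * h <= 2 * sg" "0 < h"
proof -
  define x where "x = pi / (2 * real N)"
  have h: "h = 2 * x" using N by (simp add: h_def x_def)
  have "pi * 2 <= pi * real N" using N by (intro mult_left_mono) auto
  then have x: "0 < x" "x <= pi / 4" using N by (auto simp: x_def field_simps)
  then have x2: "x < pi / 2" using pi_gt_zero by linarith
  show sg: "0 < sg" unfolding sg_def x_def[symmetric] using x x2 by (intro sin_gt_zero2) auto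
  have "cos x < cos 0" using x x2 by (intro cos_monotone_0_pi) auto
  then show "0 < eta" by (simp add: eta_def x_def)
  have "cos (pi / 4) <= cos x" using x by (intro cos_monotone_0_pi_le) auto
  moreover have "1414/1000 <= sqrt 2" by (rule real_le_rsqrt) (simp add: power2_eq_square)
  ultimately show "eta <= 293/1000" by (simp add: eta_def x_def[symmetric] cos_45)
  show "sg\<^sup>2 = eta * (2 - eta)"
    using sin_cos_squared_add[of x] unfolding sg_def eta_def x_def[symmetric] by algebra
  have pi4: "pi\<^sup>2 <= 16" using power_mono[of pi 4 2] pi_less_4 pi_gt_zero by simp
  have xN: "x\<^sup>2 <= 4 / real N ^ 2"
  proof -
    have "x\<^sup>2 = (pi\<^sup>2 / 4) / real N ^ 2" by (simp add: x_def power_divide power_mult_distrib)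
    also have "\<dots> <= 4 / real N ^ 2" using pi4 by (intro divide_right_mono) auto
    finally show ?thesis .
  qed
  have "eta = 2 * (sin (x / 2))\<^sup>2" using cos_double_sin[of "x / 2"] by (simp add: eta_def x_def)
  also have "\<dots> <= 2 * (x / 2)\<^sup>2"
    using abs_sin_x_le_abs_x[of "x / 2"] abs_le_square_iff[of "sin (x / 2)" "x / 2"] by simp
  also have "\<dots> = x\<^sup>2 / 2" by (simp add: power_divide)
  finally show "eta <= 2 / real N ^ 2" using xN by simp
  show h0: "0 < h" using x h by simp
  have "\<bar>sin x - (\<Sum>m<3. sin_coeff m * x ^ m)\<bar> <= inverse (fact 3) * \<bar>x\<bar> ^ 3" by (rule Maclaurin_sin_bound)
  then have "\<bar>sin x - x\<bar> <= x ^ 3 / 6" using x by (simp add: eval_nat_numeral sin_coeff_def lessThan_Suc)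
  then have "2 * \<bar>sin x - x\<bar> <= h * (x\<^sup>2 / 6)" by (simp add: h power2_eq_square power3_eq_cube)
  moreover have "\<bar>2 * sg - h\<bar> = 2 * \<bar>sin x - x\<bar>"
    unfolding sg_def x_def[symmetric] h right_diff_distrib[symmetric] abs_mult by simp
  ultimately have "\<bar>2 * sg - h\<bar> <= h * (x\<^sup>2 / 6)" by simp
  also have "\<dots> <= h * (1 / real N ^ 2)"
  proof (rule mult_left_mono)
    have "x\<^sup>2 <= 4 * (1 / real N ^ 2)" "0 <= 1 / real N ^ 2" using xN by simp_all
    then show "x\<^sup>2 / 6 <= 1 / real N ^ 2" by linarith
  qed (use h0 in simp)
  finally show 1: "\<bar>2 * sg - h\<bar> <= h * (1 / real N ^ 2)" .
  show "2 * sg <= h" using sin_x_le_x[of x] x by (simp add: sg_def x_def[symmetric] h)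
  have "2\<^sup>2 <= real N ^ 2" using N by (intro power_mono) auto
  then have "1 / real N ^ 2 <= 1 / 4" using N by (intro divide_left_mono) auto
  then have "h * (1 / real N ^ 2) <= h * (1 / 4)" using h0 by (intro mult_left_mono) auto
  then show "(3/4) * h <= 2 * sg" using 1 by linarith
qed

text \<open>Translates errors in eta into errors in N^-2; the factors 2 and 4 come from eta <= 2/N^2
  and its square.\<close>

lemma error_bounds:
  fixes N :: nat
  assumes "0 < eps" "0 < tau" "eps + tau <= 1" "2 <= N"
  defines "eta == 1 - cos (pi / (2 * real N))"
  shows "1 / real N ^ 2 <= mesh_error eps tau N" "tau\<^sup>2 <= mesh_error eps tau N" "eta <= 2 * mesh_error eps tau N"
    "(eps + tau) * eta\<^sup>2 / tau <= 4 * mesh_error eps tau N" "0 < mesh_error eps tau N"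
    "tau ^ 3 + (eps + tau) * tau * eta + eta\<^sup>2 <= 4 * volume_error eps tau N" "0 <= volume_error eps tau N"
proof -
  define psi where "psi = 1 / real N ^ 2"
  have psi: "0 < psi" "psi <= 1" using assms(4) by (auto simp: psi_def divide_le_eq)
  have e: "mesh_error eps tau N = tau\<^sup>2 + psi + eps / tau * psi\<^sup>2" "volume_error eps tau N = tau ^ 3 + (eps + tau) * tau * psi + psi\<^sup>2"
    by (simp_all add: mesh_error_def volume_error_def psi_def power_divide)
  have eta: "0 < eta" "eta <= 2 * psi" using angle_bounds(1,5)[OF assms(4)] by (simp_all add: eta_def psi_def)
  have q: "0 <= eps / tau * psi\<^sup>2" using assms by simp
  show "1 / real N ^ 2 <= mesh_error eps tau N" "tau\<^sup>2 <= mesh_error eps tau N" "0 < mesh_error eps tau N"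
    unfolding e psi_def[symmetric] using q psi zero_le_power2[of tau] by linarith+
  then show "eta <= 2 * mesh_error eps tau N" using eta by (simp add: psi_def)
  have eta2: "eta\<^sup>2 <= 4 * psi\<^sup>2" using power_mono[of eta "2 * psi" 2] eta by (simp add: power_mult_distrib)
  have psi2: "psi\<^sup>2 <= psi" using psi by (simp add: power2_eq_square mult_left_le)
  have "(eps + tau) * eta\<^sup>2 / tau <= (eps + tau) * (4 * psi\<^sup>2) / tau"
    using eta2 assms by (intro divide_right_mono mult_left_mono) auto
  also have "\<dots> = 4 * (eps / tau * psi\<^sup>2) + 4 * psi\<^sup>2" using assms by (simp add: field_simps)
  finally show "(eps + tau) * eta\<^sup>2 / tau <= 4 * mesh_error eps tau N"
    unfolding e distrib_left using psi2 zero_le_power2[of tau] by linarith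
  have "(eps + tau) * tau * eta <= (eps + tau) * tau * (2 * psi)" using eta assms by (intro mult_left_mono) auto
  moreover have "(eps + tau) * tau * (2 * psi) = 2 * ((eps + tau) * tau * psi)" by simp
  moreover have "0 <= (eps + tau) * tau * psi" "0 <= tau ^ 3" using assms psi by auto
  ultimately show "tau ^ 3 + (eps + tau) * tau * eta + eta\<^sup>2 <= 4 * volume_error eps tau N" "0 <= volume_error eps tau N"
    unfolding e distrib_left using eta2 zero_le_power2[of psi] by linarith+
qed

context cavity
begin

text \<open>The index set becomes the set of all admissible tuples (P, d, eta, s, y), so the Landau
  constants turn into one number depending on the profile alone.\<close>

lemma fan_profile_close:
  obtains K where "0 < K" "!!P d eta s y. 0 < P ==> P <= 1 ==> 0 < P + d ==> P + d <= 1 ==> d \<noteq> 0 ==> 0 < eta ==> eta <= 1 ==>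
      0 <= s ==> s <= 1 ==> \<bar>y\<bar> <= 1 ==> max P (P + d) * eta\<^sup>2 <= \<bar>d\<bar> ==>
      \<bar>fan_X P d (r P) (r (P + d / 2)) (r (P + d)) eta s y - Zr (P + s * d)\<bar> <= K * (d\<^sup>2 + eta + max P (P + d) * eta\<^sup>2 / \<bar>d\<bar>) &
      \<bar>fan_V (r P) (r (P + d / 2)) (r (P + d)) eta s y - d * r' (P + s * d) * r (P + s * d)\<bar>
        <= K * (\<bar>d\<bar> ^ 3 + max P (P + d) * \<bar>d\<bar> * eta + eta\<^sup>2)"
proof -
  define S :: "(real \<times> real \<times> real \<times> real \<times> real) set" where "S = {(P, d, eta, s, y). 0 < P & P <= 1 & 0 < P + d & P + d <= 1 & d \<noteq> 0 & 0 < eta &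
      eta <= 1 & 0 <= s & s <= 1 & \<bar>y\<bar> <= 1 & max P (P + d) * eta\<^sup>2 <= \<bar>d\<bar>}"
  interpret A: cavity_family r r' r'' r''' B c m M S fst "fst \<circ> snd" "fst \<circ> snd \<circ> snd" "fst \<circ> snd \<circ> snd \<circ> snd" "snd \<circ> snd \<circ> snd \<circ> snd"
    by unfold_locales (auto simp: S_def)
  interpret A: fan_family r r' r'' r''' B c m M S fst "fst \<circ> snd" "fst \<circ> snd \<circ> snd" "fst \<circ> snd \<circ> snd \<circ> snd" "snd \<circ> snd \<circ> snd \<circ> snd"
    by unfold_locales (auto simp: S_def A.f1_def)
  obtain K1 where K1: "0 < K1" "!!x. x \<in> S ==> \<bar>fan_X (fst x) ((fst \<circ> snd) x) (A.p x) (A.n x) (A.q x) ((fst \<circ> snd \<circ> snd) x) ((fst \<circ> snd \<circ> snd \<circ> snd) x)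
      ((snd \<circ> snd \<circ> snd \<circ> snd) x) - ((A.rt x)\<^sup>2 + (A.rt' x * A.t x)\<^sup>2)\<bar> <= K1 * \<bar>A.Psi x\<bar>"
    by (rule bigo_principalD[OF A.fan_X_close]) (rule that)
  obtain K2 where K2: "0 < K2" "!!x. x \<in> S ==> \<bar>fan_V (A.p x) (A.n x) (A.q x) ((fst \<circ> snd \<circ> snd) x) ((fst \<circ> snd \<circ> snd \<circ> snd) x)
      ((snd \<circ> snd \<circ> snd \<circ> snd) x) - (fst \<circ> snd) x * A.rt' x * A.rt x\<bar> <= K2 * \<bar>A.Phi x\<bar>"
    by (rule bigo_principalD[OF A.fan_V_close]) (rule that)
  show thesis
  proof (rule that[of "K1 + K2"], use K1 K2 in simp, intro conjI)
    fix P d eta s y :: real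
    assume h: "0 < P" "P <= 1" "0 < P + d" "P + d <= 1" "d \<noteq> 0" "0 < eta" "eta <= 1"
      "0 <= s" "s <= 1" "\<bar>y\<bar> <= 1" "max P (P + d) * eta\<^sup>2 <= \<bar>d\<bar>"
    then have S: "(P, d, eta, s, y) \<in> S" by (simp add: S_def)
    have mx: "0 < max P (P + d)" using h by simp
    define a where "a = d\<^sup>2 + eta + max P (P + d) * eta\<^sup>2 / \<bar>d\<bar>"
    define b where "b = \<bar>d\<bar> ^ 3 + max P (P + d) * \<bar>d\<bar> * eta + eta\<^sup>2"
    have ab: "0 <= a" "0 <= b" unfolding a_def b_def using h mx by (auto intro!: add_nonneg_nonneg)
    have "\<bar>fan_X P d (r P) (r (P + d / 2)) (r (P + d)) eta s y - Zr (P + s * d)\<bar> <= K1 * \<bar>a\<bar>"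
      using K1(2)[OF S] by (simp add: A.p_def A.n_def A.q_def A.rt_def A.rt'_def A.t_def A.Psi_def A.f1_def Zr_def a_def)
    also have "\<dots> <= (K1 + K2) * a" using K1 K2 ab by (simp add: algebra_simps)
    finally show "\<bar>fan_X P d (r P) (r (P + d / 2)) (r (P + d)) eta s y - Zr (P + s * d)\<bar>
        <= (K1 + K2) * (d\<^sup>2 + eta + max P (P + d) * eta\<^sup>2 / \<bar>d\<bar>)" unfolding a_def .
    have "\<bar>fan_V (r P) (r (P + d / 2)) (r (P + d)) eta s y - d * r' (P + s * d) * r (P + s * d)\<bar> <= K2 * \<bar>b\<bar>"
      using K2(2)[OF S] by (simp add: A.p_def A.n_def A.q_def A.rt_def A.rt'_def A.t_def A.Phi_def A.f1_def b_def)
    also have "\<dots> <= (K1 + K2) * b" using K1 K2 ab by (simp add: algebra_simps)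
    finally show "\<bar>fan_V (r P) (r (P + d / 2)) (r (P + d)) eta s y - d * r' (P + s * d) * r (P + s * d)\<bar>
        <= (K1 + K2) * (\<bar>d\<bar> ^ 3 + max P (P + d) * \<bar>d\<bar> * eta + eta\<^sup>2)" unfolding b_def .
  qed
qed

lemma side_profile_close:
  obtains K where "0 < K" "!!P d eta s y. 0 < P ==> P <= 1 ==> 0 < P + d ==> P + d <= 1 ==> d \<noteq> 0 ==> 0 < eta ==> eta <= 1 ==>
      0 <= s ==> s <= 1 ==> \<bar>y\<bar> <= 1 ==>
      \<bar>side_X P d (r P) (r (P + d / 2)) (r (P + d)) eta s y - Zr (P + s * d)\<bar> <= K * (d\<^sup>2 + eta) &
      \<bar>side_V (r P) (r (P + d / 2)) (r (P + d)) eta s y - d * r' (P + s * d) * r (P + s * d)\<bar>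
        <= K * (\<bar>d\<bar> ^ 3 + max P (P + d) * \<bar>d\<bar> * eta)"
proof -
  define S :: "(real \<times> real \<times> real \<times> real \<times> real) set" where "S = {(P, d, eta, s, y). 0 < P & P <= 1 & 0 < P + d & P + d <= 1 & d \<noteq> 0 & 0 < eta &
      eta <= 1 & 0 <= s & s <= 1 & \<bar>y\<bar> <= 1}"
  interpret A: side_family r r' r'' r''' B c m M S fst "fst \<circ> snd" "fst \<circ> snd \<circ> snd" "fst \<circ> snd \<circ> snd \<circ> snd" "snd \<circ> snd \<circ> snd \<circ> snd"
    by unfold_locales (auto simp: S_def)
  obtain K1 where K1: "0 < K1" "!!x. x \<in> S ==> \<bar>side_X (fst x) ((fst \<circ> snd) x) (A.p x) (A.n x) (A.q x) ((fst \<circ> snd \<circ> snd) x) ((fst \<circ> snd \<circ> snd \<circ> snd) x)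
      ((snd \<circ> snd \<circ> snd \<circ> snd) x) - ((A.rt x)\<^sup>2 + (A.rt' x * A.t x)\<^sup>2)\<bar> <= K1 * \<bar>A.Psi x\<bar>"
    by (rule bigo_principalD[OF A.side_X_close]) (rule that)
  obtain K2 where K2: "0 < K2" "!!x. x \<in> S ==> \<bar>side_V (A.p x) (A.n x) (A.q x) ((fst \<circ> snd \<circ> snd) x) ((fst \<circ> snd \<circ> snd \<circ> snd) x)
      ((snd \<circ> snd \<circ> snd \<circ> snd) x) - (fst \<circ> snd) x * A.rt' x * A.rt x\<bar> <= K2 * \<bar>A.Phi x\<bar>"
    by (rule bigo_principalD[OF A.side_V_close]) (rule that)
  show thesis
  proof (rule that[of "K1 + K2"], use K1 K2 in simp, intro conjI)
    fix P d eta s y :: real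
    assume h: "0 < P" "P <= 1" "0 < P + d" "P + d <= 1" "d \<noteq> 0" "0 < eta" "eta <= 1" "0 <= s" "s <= 1" "\<bar>y\<bar> <= 1"
    then have S: "(P, d, eta, s, y) \<in> S" by (simp add: S_def)
    have mx: "0 < max P (P + d)" using h by simp
    define a where "a = d\<^sup>2 + eta"
    define b where "b = \<bar>d\<bar> ^ 3 + max P (P + d) * \<bar>d\<bar> * eta"
    have ab: "0 <= a" "0 <= b" unfolding a_def b_def using h mx by (auto intro!: add_nonneg_nonneg)
    have "\<bar>side_X P d (r P) (r (P + d / 2)) (r (P + d)) eta s y - Zr (P + s * d)\<bar> <= K1 * \<bar>a\<bar>"
      using K1(2)[OF S] by (simp add: A.p_def A.n_def A.q_def A.rt_def A.rt'_def A.t_def A.Psi_def A.f1_def Zr_def a_def)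
    also have "\<dots> <= (K1 + K2) * a" using K1 K2 ab by (simp add: algebra_simps)
    finally show "\<bar>side_X P d (r P) (r (P + d / 2)) (r (P + d)) eta s y - Zr (P + s * d)\<bar> <= (K1 + K2) * (d\<^sup>2 + eta)"
      unfolding a_def .
    have "\<bar>side_V (r P) (r (P + d / 2)) (r (P + d)) eta s y - d * r' (P + s * d) * r (P + s * d)\<bar> <= K2 * \<bar>b\<bar>"
      using K2(2)[OF S] by (simp add: A.p_def A.n_def A.q_def A.rt_def A.rt'_def A.t_def A.Phi_def A.f1_def b_def)
    also have "\<dots> <= (K1 + K2) * b" using K1 K2 ab by (simp add: algebra_simps)
    finally show "\<bar>side_V (r P) (r (P + d / 2)) (r (P + d)) eta s y - d * r' (P + s * d) * r (P + s * d)\<bar>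
        <= (K1 + K2) * (\<bar>d\<bar> ^ 3 + max P (P + d) * \<bar>d\<bar> * eta)" unfolding b_def .
  qed
qed

text \<open>\<open>t\<close> is the model radius, \<open>n\<close> is 2 for A and B and 1 for C and
  D, and n*(pi/N)*tau*t is the model Jacobian. The weight \<open>bt\<close> enters the Jacobian
  error only.\<close>

definition model_element :: "real => real => real => nat => real => (real^2 => real) => (real^2 => real) => elem => bool" where
  "model_element K eps tau N n t bt a \<longleftrightarrow> (\<forall>x\<in>open_triangle.
     eps <= t x & t x <= eps + tau & norm (quad_map a x) <= eps + tau & t x / K <= norm (quad_map a x) &
     \<bar>norm (quad_map a x) - t x\<bar> <= K * mesh_error eps tau N * t x & 0 < edet a x &
     \<bar>edet a x - n * (pi / real N * tau) * t x\<bar> <= K * (pi / real N * tau) * t x * mesh_error eps tau N * bt x &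
     \<bar>estretch (cavity_map r) a x - (n * (pi / real N * tau))\<^sup>2 * Zr (t x)\<bar> <= K * (pi / real N * tau)\<^sup>2 * mesh_error eps tau N &
     \<bar>evol (cavity_map r) a x - n * (pi / real N * tau) * r' (t x) * r (t x)\<bar> <= K * (pi / real N * volume_error eps tau N))"

lemma model_element_mono:
  assumes "model_element K eps tau N n t bt a" "0 < K" "K <= K'" "0 < eps" "0 < tau" "eps + tau <= 1" "2 <= N"
    and bt: "!!x. x \<in> open_triangle ==> 0 <= bt x"
  shows "model_element K' eps tau N n t bt a"
  unfolding model_element_def
proof (intro ballI)
  fix x assume x: "x \<in> open_triangle"
  note h = assms(1)[unfolded model_element_def, rule_format, OF x]
  have pos: "0 < mesh_error eps tau N" "0 <= volume_error eps tau N" "0 < t x" "0 <= pi / real N" "0 <= bt x"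
    using error_bounds[OF assms(4-7)] h assms(4) bt[OF x] by auto
  have m: "K * y <= K' * y" if "0 <= y" for y using that assms(3) by (rule mult_right_mono[rotated])
  have "t x / K' <= t x / K" using pos assms(2,3) by (intro divide_left_mono) auto
  moreover have "K * (mesh_error eps tau N * t x) <= K' * (mesh_error eps tau N * t x)"
    "K * ((pi / real N * tau) * t x * mesh_error eps tau N * bt x) <= K' * ((pi / real N * tau) * t x * mesh_error eps tau N * bt x)"
    "K * ((pi / real N * tau)\<^sup>2 * mesh_error eps tau N) <= K' * ((pi / real N * tau)\<^sup>2 * mesh_error eps tau N)"
    "K * (pi / real N * volume_error eps tau N) <= K' * (pi / real N * volume_error eps tau N)"
    using pos assms(5) by (intro m mult_nonneg_nonneg; simp)+
  ultimately show "eps <= t x & t x <= eps + tau & norm (quad_map a x) <= eps + tau & t x / K' <= norm (quad_map a x) &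
     \<bar>norm (quad_map a x) - t x\<bar> <= K' * mesh_error eps tau N * t x & 0 < edet a x &
     \<bar>edet a x - n * (pi / real N * tau) * t x\<bar> <= K' * (pi / real N * tau) * t x * mesh_error eps tau N * bt x &
     \<bar>estretch (cavity_map r) a x - (n * (pi / real N * tau))\<^sup>2 * Zr (t x)\<bar> <= K' * (pi / real N * tau)\<^sup>2 * mesh_error eps tau N &
     \<bar>evol (cavity_map r) a x - n * (pi / real N * tau) * r' (t x) * r (t x)\<bar> <= K' * (pi / real N * volume_error eps tau N)"
    using h by (auto simp: mult.assoc intro: order_trans)
qed

text \<open>Transfers the estimates for the coefficient functions, in which \<open>2 * sg\<close> plays the role of
  \<open>\<pi>/N\<close>, to the element.\<close>

lemma coefficient_estimates:
  fixes N :: nat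
  assumes ring: "0 < eps" "0 < tau" "eps + tau <= 1" "2 <= N"
    and t: "eps <= t" "t <= eps + tau" and dl: "\<bar>dl\<bar> = tau" and sg': "\<bar>sg'\<bar> = sin (pi / (2 * real N))" and n: "1 <= n" "n <= 2"
    and K: "0 < K" and bt: "1 <= bt"
    and D: "\<bar>D - t\<bar> <= K * mesh_error eps tau N * t * bt" "0 < D"
    and X: "\<bar>X - Zr t\<bar> <= K * mesh_error eps tau N"
    and V: "\<bar>V - dl * r' t * r t\<bar> <= K * volume_error eps tau N"
  defines "C == 2 * (K + 1) + 4 * K + 16 * B\<^sup>2 + 2 * K + 2 * M * B"
  shows "\<bar>\<bar>2 * n * sg' * dl * D\<bar> - n * (pi / real N * tau) * t\<bar> <= C * (pi / real N * tau) * t * mesh_error eps tau N * bt"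
    and "\<bar>(2 * n * sg' * dl)\<^sup>2 * X - (n * (pi / real N * tau))\<^sup>2 * Zr t\<bar> <= C * (pi / real N * tau)\<^sup>2 * mesh_error eps tau N"
    and "\<bar>2 * n * sg' * V * sgn (2 * n * sg' * dl * D) - n * (pi / real N * tau) * r' t * r t\<bar> <= C * (pi / real N * volume_error eps tau N)"
proof -
  define h where "h = pi / real N"
  define sg where "sg = sin (pi / (2 * real N))"
  define Psi where "Psi = mesh_error eps tau N"
  define Phi where "Phi = volume_error eps tau N"
  define psi where "psi = 1 / real N ^ 2"
  note E = error_bounds[OF ring, folded Psi_def Phi_def psi_def]
  note A = angle_bounds[OF ring(4), folded sg_def h_def psi_def]
  have sg0: "0 < sg" "\<bar>sg'\<bar> = sg" using A(4) sg' by (simp_all add: sg_def)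
  have t0: "0 < t" "t \<in> {0<..1}" using t ring by auto
  have tau: "0 < tau" "\<bar>dl\<bar> = tau" using ring dl by auto
  have Psibt: "Psi <= Psi * bt" using E(5) bt mult_left_mono[of 1 bt Psi] by simp
  have C: "2 * (K + 1) <= C" "4 * K + 16 * B\<^sup>2 <= C" "2 * K + 2 * M * B <= C"
    unfolding C_def using K B_pos M_pos by (auto intro!: add_increasing add_increasing2 simp: mult_nonneg_nonneg)
  have sgh: "\<bar>2 * sg - h\<bar> <= h * Psi" using A(6) E(1) A(9) mult_left_mono[of psi Psi h] by linarith
  show "\<bar>\<bar>2 * n * sg' * dl * D\<bar> - n * (pi / real N * tau) * t\<bar> <= C * (pi / real N * tau) * t * mesh_error eps tau N * bt"
  proof -
    have "\<bar>2 * n * sg' * dl * D\<bar> - n * (h * tau) * t = n * tau * ((2 * sg) * (D - t) + (2 * sg - h) * t)"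
      using n D(2) sg0 tau by (simp add: abs_mult algebra_simps)
    moreover have "\<bar>(2 * sg) * (D - t)\<bar> <= h * (K * Psi * t * bt)"
      using D(1) A(7) sg0 by (intro abs_bounds) (auto simp: Psi_def)
    moreover have "\<bar>(2 * sg - h) * t\<bar> <= (h * Psi) * t" using sgh t0 by (intro abs_bounds) auto
    moreover have "(h * Psi) * t <= h * (Psi * t * bt)" using Psibt A(9) t0 mult_left_mono[OF Psibt, of "h * t"] by (simp add: mult_ac)
    ultimately have "\<bar>(2 * sg) * (D - t) + (2 * sg - h) * t\<bar> <= h * (K * Psi * t * bt) + h * (Psi * t * bt)"
      and eq: "\<bar>2 * n * sg' * dl * D\<bar> - n * (h * tau) * t = n * tau * ((2 * sg) * (D - t) + (2 * sg - h) * t)" by linarith+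
    then have "\<bar>n * tau * ((2 * sg) * (D - t) + (2 * sg - h) * t)\<bar> <= (2 * tau) * (h * (K * Psi * t * bt) + h * (Psi * t * bt))"
      using n tau by (intro abs_bounds) auto
    also have "\<dots> = (2 * (K + 1)) * (h * tau * t * Psi * bt)" by (simp add: algebra_simps)
    also have "\<dots> <= C * (h * tau * t * Psi * bt)" using C(1) A(9) tau t0 E(5) bt by (intro mult_right_mono) auto
    finally show ?thesis unfolding eq[unfolded h_def] by (simp add: h_def Psi_def mult_ac)
  qed
  show "\<bar>(2 * n * sg' * dl)\<^sup>2 * X - (n * (pi / real N * tau))\<^sup>2 * Zr t\<bar> <= C * (pi / real N * tau)\<^sup>2 * mesh_error eps tau N"
  proof -
    have s2: "sg'\<^sup>2 = sg\<^sup>2" "dl\<^sup>2 = tau\<^sup>2" using sg0 tau by (metis power2_abs)+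
    have n2: "n\<^sup>2 <= 4" using power_mono[of n 2 2] n by simp
    have "(2 * n * sg' * dl)\<^sup>2 * X - (n * (h * tau))\<^sup>2 * Zr t
        = (n\<^sup>2 * tau\<^sup>2) * ((2 * sg)\<^sup>2 * (X - Zr t) + (2 * sg - h) * (2 * sg + h) * Zr t)"
      by (simp add: power_mult_distrib s2) (simp add: power2_eq_square algebra_simps)
    moreover have "\<bar>(2 * sg)\<^sup>2 * (X - Zr t)\<bar> <= h\<^sup>2 * (K * Psi)"
      using X A(7) sg0 power_mono[OF A(7), of 2] by (intro abs_bounds) (auto simp: Psi_def)
    moreover have "\<bar>(2 * sg - h) * (2 * sg + h) * Zr t\<bar> <= (h * Psi) * (2 * h) * (2 * B\<^sup>2)"
      using sgh A(7,9) sg0 Zr_bounds[OF t0(2)] by (intro abs_bounds) auto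
    ultimately have "\<bar>(2 * sg)\<^sup>2 * (X - Zr t) + (2 * sg - h) * (2 * sg + h) * Zr t\<bar> <= h\<^sup>2 * (K * Psi) + (h * Psi) * (2 * h) * (2 * B\<^sup>2)"
      and eq: "(2 * n * sg' * dl)\<^sup>2 * X - (n * (h * tau))\<^sup>2 * Zr t
        = (n\<^sup>2 * tau\<^sup>2) * ((2 * sg)\<^sup>2 * (X - Zr t) + (2 * sg - h) * (2 * sg + h) * Zr t)" by linarith+
    then have "\<bar>(n\<^sup>2 * tau\<^sup>2) * ((2 * sg)\<^sup>2 * (X - Zr t) + (2 * sg - h) * (2 * sg + h) * Zr t)\<bar>
        <= (4 * tau\<^sup>2) * (h\<^sup>2 * (K * Psi) + (h * Psi) * (2 * h) * (2 * B\<^sup>2))"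
      using n2 by (intro abs_bounds) (auto intro: mult_right_mono)
    also have "\<dots> = (4 * K + 16 * B\<^sup>2) * ((h * tau)\<^sup>2 * Psi)" by (simp add: power2_eq_square algebra_simps)
    also have "\<dots> <= C * ((h * tau)\<^sup>2 * Psi)" using C(2) E(5) by (intro mult_right_mono) auto
    finally show ?thesis unfolding eq[unfolded h_def] by (simp add: h_def Psi_def mult.assoc)
  qed
  show "\<bar>2 * n * sg' * V * sgn (2 * n * sg' * dl * D) - n * (pi / real N * tau) * r' t * r t\<bar> <= C * (pi / real N * volume_error eps tau N)"
  proof -
    have sg: "2 * n * sg' * V * sgn (2 * n * sg' * dl * D) = 2 * n * sg * (sgn dl * V)"
    proof -
      have "sgn (2 * n * sg' * dl * D) = sgn sg' * sgn dl" using n D(2) by (simp add: sgn_mult)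
      moreover have "sg' * sgn sg' = sg" using sg0 by (simp add: abs_sgn)
      ultimately show ?thesis by (metis mult.assoc mult.commute)
    qed
    have sd: "sgn dl * dl = tau" "\<bar>sgn dl\<bar> = 1" using tau by (auto simp: sgn_if split: if_splits)
    have "2 * n * sg * (sgn dl * V) - n * (h * tau) * r' t * r t
        = n * ((2 * sg) * (sgn dl * (V - dl * r' t * r t)) + (2 * sg - h) * (tau * r' t * r t))"
    proof -
      have "sgn dl * (V - dl * r' t * r t) = sgn dl * V - (sgn dl * dl) * (r' t * r t)" by (simp add: algebra_simps)
      then show ?thesis unfolding sd(1) by (simp only:) (simp add: algebra_simps)
    qed
    moreover have "\<bar>(2 * sg) * (sgn dl * (V - dl * r' t * r t))\<bar> <= h * (1 * (K * Phi))"
      using V A(7) sg0 sd by (intro abs_bounds) (auto simp: Phi_def)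
    moreover have "\<bar>(2 * sg - h) * (tau * r' t * r t)\<bar> <= (h * psi) * (tau * (M * (eps + tau)) * B)"
    proof (intro abs_bounds)
      have "M * t <= M * (eps + tau)" using t M_pos by simp
      then show "\<bar>r' t\<bar> <= M * (eps + tau)" using slope(4)[OF t0(2)] r'_nonneg[OF t0(2)] by simp
    qed (use A(6) tau bound(1)[OF t0(2)] in auto)
    moreover have "(h * psi) * (tau * (M * (eps + tau)) * B) <= h * (M * B * Phi)"
    proof -
      have "0 <= tau ^ 3" "0 <= 1 / real N ^ 4" using tau by simp_all
      then have "(eps + tau) * tau * psi <= Phi" unfolding Phi_def volume_error_def psi_def by linarith
      then have "(h * M * B) * ((eps + tau) * tau * psi) <= (h * M * B) * Phi"
        using A(9) M_pos B_pos by (intro mult_left_mono) auto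
      then show ?thesis by (simp add: mult_ac)
    qed
    ultimately have "\<bar>(2 * sg) * (sgn dl * (V - dl * r' t * r t)) + (2 * sg - h) * (tau * r' t * r t)\<bar> <= h * (1 * (K * Phi)) + h * (M * B * Phi)"
      and eq: "2 * n * sg * (sgn dl * V) - n * (h * tau) * r' t * r t
        = n * ((2 * sg) * (sgn dl * (V - dl * r' t * r t)) + (2 * sg - h) * (tau * r' t * r t))" by linarith+
    then have "\<bar>n * ((2 * sg) * (sgn dl * (V - dl * r' t * r t)) + (2 * sg - h) * (tau * r' t * r t))\<bar>
        <= 2 * (h * (1 * (K * Phi)) + h * (M * B * Phi))"
      using n by (intro abs_bounds) auto
    also have "\<dots> = (2 * K + 2 * M * B) * (h * Phi)" by (simp add: algebra_simps)
    also have "\<dots> <= C * (h * Phi)" using C(3) A(9) E(7) by (intro mult_right_mono) auto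
    finally show ?thesis unfolding sg eq[unfolded h_def] by (simp add: h_def Phi_def mult.assoc)
  qed
qed

text \<open>Covers A and B at once. The slenderness with 19/100 and the positivity of
  \<open>fan_D\<close> are what injectivity provides for A.\<close>

lemma fan_element:
  obtains K where "1 <= K" "!!eps tau (N::nat) P dl sg' a. 0 < eps ==> 0 < tau ==> eps + tau <= 1 ==> 2 <= N ==>
      (eps + tau) * (1 - cos (pi / (2 * real N)))\<^sup>2 <= (19/100) * tau ==> P = eps & dl = tau \<or> P = eps + tau & dl = - tau ==>
      \<bar>sg'\<bar> = sin (pi / (2 * real N)) ==>
      (!!s y. \<bar>y\<bar> < s ==> s < 1 ==> 0 < fan_D P dl (1 - cos (pi / (2 * real N))) s y) ==>
      a = fan P (P + dl / 2) (P + dl) (1 - cos (pi / (2 * real N))) sg' ==>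
      cavity_map r \<circ> a = fan (r P) (r (P + dl / 2)) (r (P + dl)) (1 - cos (pi / (2 * real N))) sg' ==>
      model_element K eps tau N 2 (%x. P + (x$1 + x$2) * dl) (%x. 1 + (P + dl) / (P + (x$1 + x$2) * dl)) a"
proof -
  obtain K1 where K1: "0 < K1" "!!P d eta s y. 0 < P ==> P <= 1 ==> 0 < P + d ==> P + d <= 1 ==> d \<noteq> 0 ==> 0 < eta ==> eta <= 1 ==>
      0 <= s ==> s <= 1 ==> \<bar>y\<bar> <= 1 ==> max P (P + d) * eta\<^sup>2 <= \<bar>d\<bar> ==>
      \<bar>fan_X P d (r P) (r (P + d / 2)) (r (P + d)) eta s y - Zr (P + s * d)\<bar> <= K1 * (d\<^sup>2 + eta + max P (P + d) * eta\<^sup>2 / \<bar>d\<bar>) &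
      \<bar>fan_V (r P) (r (P + d / 2)) (r (P + d)) eta s y - d * r' (P + s * d) * r (P + s * d)\<bar>
        <= K1 * (\<bar>d\<bar> ^ 3 + max P (P + d) * \<bar>d\<bar> * eta + eta\<^sup>2)"
    using fan_profile_close by metis
  \<comment> \<open>7 = 1 + 2 + 4 adds the bounds for tau^2, eta and the bending term; 120 = 20*(2 +
    4) comes from \<open>fan_D_close\<close>. The 100 in \<open>K\<close> covers 45*eta <= 90 times
    the mesh error and the lower bound 2/25 for the radius.\<close>
  define K2 where "K2 = 7 * K1 + 120"
  define C where "C = 2 * (K2 + 1) + 4 * K2 + 16 * B\<^sup>2 + 2 * K2 + 2 * M * B"
  define K where "K = 100 + C"
  have K2: "0 < K2" using K1 by (simp add: K2_def)
  have C0: "0 <= C" unfolding C_def using K2 M_pos B_pos by (auto intro!: add_nonneg_nonneg)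
  show thesis
  proof (rule that[of K])
    show "1 <= K" using C0 by (simp add: K_def)
    fix eps tau P dl sg' :: real and N :: nat and a
    let ?eta = "1 - cos (pi / (2 * real N))"
    assume ring: "0 < eps" "0 < tau" "eps + tau <= 1" "2 <= N" and slender: "(eps + tau) * ?eta\<^sup>2 <= (19/100) * tau"
      and Pdl: "P = eps & dl = tau \<or> P = eps + tau & dl = - tau" and sg': "\<bar>sg'\<bar> = sin (pi / (2 * real N))"
      and Dpos: "!!s y. \<bar>y\<bar> < s ==> s < 1 ==> 0 < fan_D P dl ?eta s y"
      and a: "a = fan P (P + dl / 2) (P + dl) ?eta sg'"
      and ua: "cavity_map r \<circ> a = fan (r P) (r (P + dl / 2)) (r (P + dl)) ?eta sg'"
    define eta where "eta = ?eta"
    note E = error_bounds[OF ring, folded eta_def]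
    note A = angle_bounds[OF ring(4), folded eta_def]
    have par: "0 < P" "P <= 1" "0 < P + dl" "P + dl <= 1" "dl \<noteq> 0" "\<bar>dl\<bar> = tau" "max P (P + dl) = eps + tau" "P + dl <= eps + tau"
      using Pdl ring by auto
    have sl: "max P (P + dl) * eta\<^sup>2 <= (19/100) * \<bar>dl\<bar>" using slender par by (simp add: eta_def)
    have sg2: "sg'\<^sup>2 = eta * (2 - eta)" using A(3) sg' by (metis power2_abs)
    have slope: "\<bar>2 * eta * ((P + dl) * eta / dl - 1)\<bar> <= (4/5)"
      by (rule fan_slope_bound[OF par(1,3,5) A(1,2) sl])
    show "model_element K eps tau N 2 (%x. P + (x$1 + x$2) * dl) (%x. 1 + (P + dl) / (P + (x$1 + x$2) * dl)) a"
      unfolding model_element_def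
    proof (intro ballI)
      fix x assume x: "x \<in> open_triangle"
      define s where "s = x$1 + x$2"
      define y where "y = x$2 - x$1"
      define t where "t = P + s * dl"
      define bt where "bt = 1 + (P + dl) / t"
      have sy: "0 < s" "s < 1" "\<bar>y\<bar> < s" using x by (auto simp: open_triangle_def s_def y_def)
      interpret F: fan_triangle P dl eta sg' s y t
        by unfold_locales (use par A sg2 sy in \<open>auto simp: t_def\<close>)
      have "s * tau <= 1 * tau" "0 <= s * tau" using sy ring by (auto intro!: mult_right_mono)
      then have t: "eps <= t" "t <= eps + tau" using Pdl by (auto simp: t_def)
      have bt: "1 <= bt" "t * bt = t + (P + dl)" using F.t_pos par by (auto simp: bt_def field_simps)
      have qmap: "(norm (quad_map a x))\<^sup>2 = (t - 2 * eta * ((P + dl) * eta - dl) * s * (1 - s) - 2 * (P + dl) * eta * (2 - eta) * y\<^sup>2)\<^sup>2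
          + (2 * sg' * y * (t + (P + dl) * eta * (1 - 2 * s)))\<^sup>2"
        unfolding a norm_vec2 fan_map vector_2 eta_def[symmetric] s_def[symmetric] y_def[symmetric]
        by (rule arg_cong2[where f="(+)"]; rule arg_cong[where f="%z. z\<^sup>2"]; simp add: fan_o_def t_def field_simps)
      note nrm = F.fan_norm[OF slope norm_ge_zero qmap]
      have Dp: "0 < fan_D P dl eta s y" using Dpos sy by (simp add: eta_def)
      have X4: "(P + dl) * eta\<^sup>2 / \<bar>dl\<bar> <= 4 * mesh_error eps tau N"
      proof -
        have "(P + dl) * eta\<^sup>2 / \<bar>dl\<bar> <= (eps + tau) * eta\<^sup>2 / tau" using par ring by (auto intro!: divide_right_mono mult_right_mono)
        then show ?thesis using E(4) by linarith
      qed
      have "max P (P + dl) * eta\<^sup>2 <= \<bar>dl\<bar>" using sl by linarith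
      moreover have "(P + dl) * eta\<^sup>2 <= max P (P + dl) * eta\<^sup>2" by (intro mult_right_mono) auto
      ultimately have sl1: "max P (P + dl) * eta\<^sup>2 <= \<bar>dl\<bar>" "(P + dl) * eta\<^sup>2 <= \<bar>dl\<bar>" by linarith+
      have D: "\<bar>fan_D P dl eta s y - t\<bar> <= K2 * mesh_error eps tau N * t * bt"
      proof -
        let ?Psi = "mesh_error eps tau N"
        have "\<bar>fan_D P dl eta s y - t\<bar> <= 20 * (eta + (P + dl) * eta\<^sup>2 / \<bar>dl\<bar>) * t + 4 * (eta * (P + dl))"
          by (rule F.fan_D_close[OF sl1(2)])
        also have "\<dots> <= (120 * ?Psi) * t + (120 * ?Psi) * (P + dl)"
        proof (rule add_mono)
          have "20 * (eta + (P + dl) * eta\<^sup>2 / \<bar>dl\<bar>) <= 120 * ?Psi" unfolding distrib_left using X4 E(3) by linarith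
          then show "20 * (eta + (P + dl) * eta\<^sup>2 / \<bar>dl\<bar>) * t <= (120 * ?Psi) * t" using F.t_pos by (intro mult_right_mono) auto
          have "(4 * eta) * (P + dl) <= (120 * ?Psi) * (P + dl)" using E(3,5) par by (intro mult_right_mono) auto
          then show "4 * (eta * (P + dl)) <= (120 * ?Psi) * (P + dl)" by (simp add: mult.assoc)
        qed
        also have "\<dots> = 120 * ?Psi * (t * bt)" unfolding bt by (simp add: algebra_simps)
        also have "\<dots> <= K2 * ?Psi * (t * bt)"
          using E(5) F.t_pos bt(1) K1 by (intro mult_right_mono) (auto simp: K2_def)
        finally show ?thesis by (simp add: mult.assoc)
      qed
      note k = K1(2)[OF par(1-5) A(1) _ _ _ _ sl1(1), of s y, folded t_def]
      have X: "\<bar>fan_X P dl (r P) (r (P + dl / 2)) (r (P + dl)) eta s y - Zr t\<bar> <= K2 * mesh_error eps tau N"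
      proof -
        have "\<bar>fan_X P dl (r P) (r (P + dl / 2)) (r (P + dl)) eta s y - Zr t\<bar> <= K1 * (dl\<^sup>2 + eta + max P (P + dl) * eta\<^sup>2 / \<bar>dl\<bar>)"
          using k sy A(2) by auto
        also have "\<dots> <= K1 * (7 * mesh_error eps tau N)"
        proof (rule mult_left_mono)
          have "dl\<^sup>2 = tau\<^sup>2" using par(6) by (metis power2_abs)
          then show "dl\<^sup>2 + eta + max P (P + dl) * eta\<^sup>2 / \<bar>dl\<bar> <= 7 * mesh_error eps tau N"
            unfolding par(6,7) using E(2,3,4) by linarith
        qed (use K1 in auto)
        also have "\<dots> <= K2 * mesh_error eps tau N" using E(5) by (simp add: K2_def algebra_simps)
        finally show ?thesis .
      qed
      have V: "\<bar>fan_V (r P) (r (P + dl / 2)) (r (P + dl)) eta s y - dl * r' t * r t\<bar> <= K2 * volume_error eps tau N"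
      proof -
        have "\<bar>fan_V (r P) (r (P + dl / 2)) (r (P + dl)) eta s y - dl * r' t * r t\<bar>
            <= K1 * (\<bar>dl\<bar> ^ 3 + max P (P + dl) * \<bar>dl\<bar> * eta + eta\<^sup>2)"
          using k sy A(2) by auto
        also have "\<dots> <= K1 * (4 * volume_error eps tau N)" unfolding par(6,7) using E(6) K1 by (intro mult_left_mono) auto
        also have "\<dots> <= K2 * volume_error eps tau N" using E(7) K1 by (simp add: K2_def algebra_simps)
        finally show ?thesis .
      qed
      note cols = fan_columns(1)[OF par(5) sg2, where P=P and x=x, folded s_def y_def a[folded eta_def]]
        fan_columns(2)[OF par(5) sg2, where x=x and p="r P" and m="r (P + dl / 2)" and q="r (P + dl)",
          folded s_def y_def ua[folded eta_def]]
        fan_columns(3)[OF par(5) sg2, where P=P and x=x and p="r P" and m="r (P + dl / 2)" and q="r (P + dl)",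
          folded s_def y_def a[folded eta_def] ua[folded eta_def]]
      have ed: "edet a x = \<bar>2 * 2 * sg' * dl * fan_D P dl eta s y\<bar>" unfolding edet_def cols(1) by simp
      have es: "estretch (cavity_map r) a x = (2 * 2 * sg' * dl)\<^sup>2 * fan_X P dl (r P) (r (P + dl / 2)) (r (P + dl)) eta s y"
        unfolding estretch_def cols(3) by simp
      have ev: "evol (cavity_map r) a x = 2 * 2 * sg' * fan_V (r P) (r (P + dl / 2)) (r (P + dl)) eta s y * sgn (2 * 2 * sg' * dl * fan_D P dl eta s y)"
        unfolding evol_def cols(1,2) by simp
      note ce = coefficient_estimates[OF ring t par(6) sg' one_le_numeral order_refl K2 bt(1) D Dp X V, folded ed es ev C_def]
      have h: "0 < pi / real N" using A(9) .
      have CK: "C <= K" by (simp add: K_def)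
      have "C * (pi / real N * tau) * t * mesh_error eps tau N * bt <= K * (pi / real N * tau) * t * mesh_error eps tau N * bt"
        "C * (pi / real N * tau)\<^sup>2 * mesh_error eps tau N <= K * (pi / real N * tau)\<^sup>2 * mesh_error eps tau N"
        "C * (pi / real N * volume_error eps tau N) <= K * (pi / real N * volume_error eps tau N)"
        using CK E(5,7) h ring(2) F.t_pos bt(1) by (intro mult_right_mono; simp)+
      note ce = order_trans[OF ce(1) this(1)] order_trans[OF ce(2) this(2)] order_trans[OF ce(3) this(3)]
      have "sg' \<noteq> 0" using A(4) sg' by auto
      then have 1: "0 < edet a x" unfolding ed using par Dp by simp
      have 2: "\<bar>norm (quad_map a x) - t\<bar> <= K * mesh_error eps tau N * t"
      proof -
        have "45 * eta * t <= (100 * mesh_error eps tau N) * t" using E(3,5) F.t_pos by (intro mult_right_mono) auto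
        also have "\<dots> <= (K * mesh_error eps tau N) * t" using E(5) F.t_pos C0 by (intro mult_right_mono) (auto simp: K_def)
        finally show ?thesis using nrm(1) by linarith
      qed
      have 3: "t / K <= norm (quad_map a x)"
      proof -
        have "t / K <= t / 100" using F.t_pos C0 by (intro divide_left_mono) (auto simp: K_def)
        then show ?thesis using nrm(2) F.t_pos by linarith
      qed
      show "eps <= P + (x$1 + x$2) * dl & P + (x$1 + x$2) * dl <= eps + tau & norm (quad_map a x) <= eps + tau &
         (P + (x$1 + x$2) * dl) / K <= norm (quad_map a x) &
         \<bar>norm (quad_map a x) - (P + (x$1 + x$2) * dl)\<bar> <= K * mesh_error eps tau N * (P + (x$1 + x$2) * dl) & 0 < edet a x &
         \<bar>edet a x - 2 * (pi / real N * tau) * (P + (x$1 + x$2) * dl)\<bar>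
           <= K * (pi / real N * tau) * (P + (x$1 + x$2) * dl) * mesh_error eps tau N * (1 + (P + dl) / (P + (x$1 + x$2) * dl)) &
         \<bar>estretch (cavity_map r) a x - (2 * (pi / real N * tau))\<^sup>2 * Zr (P + (x$1 + x$2) * dl)\<bar> <= K * (pi / real N * tau)\<^sup>2 * mesh_error eps tau N &
         \<bar>evol (cavity_map r) a x - 2 * (pi / real N * tau) * r' (P + (x$1 + x$2) * dl) * r (P + (x$1 + x$2) * dl)\<bar> <= K * (pi / real N * volume_error eps tau N)"
        unfolding s_def[symmetric] t_def[symmetric] bt_def[symmetric]
        using t nrm(3)[unfolded par(7)] 1 2 3 ce by blast
    qed
  qed
qed

text \<open>Here the lower bound for the Jacobian comes along without slenderness or injectivity, by
  \<open>side_D_bounds\<close>.\<close>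

lemma side_element:
  obtains K where "1 <= K" "!!eps tau (N::nat) sg' a. 0 < eps ==> 0 < tau ==> eps + tau <= 1 ==> 2 <= N ==>
      \<bar>sg'\<bar> = sin (pi / (2 * real N)) ==>
      a = side eps (eps + tau / 2) (eps + tau) (1 - cos (pi / (2 * real N))) sg' ==>
      cavity_map r \<circ> a = side (r eps) (r (eps + tau / 2)) (r (eps + tau)) (1 - cos (pi / (2 * real N))) sg' ==>
      model_element K eps tau N 1 (%x. eps + x$1 * tau) (%x. 1) a &
      (\<forall>x\<in>open_triangle. (pi / real N * tau) * (eps + x$1 * tau) / K <= edet a x)"
proof -
  obtain K1 where K1: "0 < K1" "!!P d eta s y. 0 < P ==> P <= 1 ==> 0 < P + d ==> P + d <= 1 ==> d \<noteq> 0 ==> 0 < eta ==> eta <= 1 ==>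
      0 <= s ==> s <= 1 ==> \<bar>y\<bar> <= 1 ==>
      \<bar>side_X P d (r P) (r (P + d / 2)) (r (P + d)) eta s y - Zr (P + s * d)\<bar> <= K1 * (d\<^sup>2 + eta) &
      \<bar>side_V (r P) (r (P + d / 2)) (r (P + d)) eta s y - d * r' (P + s * d) * r (P + s * d)\<bar>
        <= K1 * (\<bar>d\<bar> ^ 3 + max P (P + d) * \<bar>d\<bar> * eta)"
    using side_profile_close by metis
  define K2 where "K2 = 7 * K1 + 120"
  define C where "C = 2 * (K2 + 1) + 4 * K2 + 16 * B\<^sup>2 + 2 * K2 + 2 * M * B"
  define K where "K = 100 + C"
  have K2: "0 < K2" using K1 by (simp add: K2_def)
  have C0: "0 <= C" unfolding C_def using K2 M_pos B_pos by (auto intro!: add_nonneg_nonneg)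
  show thesis
  proof (rule that[of K])
    show "1 <= K" using C0 by (simp add: K_def)
    fix eps tau sg' :: real and N :: nat and a
    let ?eta = "1 - cos (pi / (2 * real N))"
    assume ring: "0 < eps" "0 < tau" "eps + tau <= 1" "2 <= N"
      and sg': "\<bar>sg'\<bar> = sin (pi / (2 * real N))"
      and a: "a = side eps (eps + tau / 2) (eps + tau) ?eta sg'"
      and ua: "cavity_map r \<circ> a = side (r eps) (r (eps + tau / 2)) (r (eps + tau)) ?eta sg'"
    define eta where "eta = ?eta"
    note E = error_bounds[OF ring, folded eta_def]
    note A = angle_bounds[OF ring(4), folded eta_def]
    have sg2: "sg'\<^sup>2 = eta * (2 - eta)" using A(3) sg' by (metis power2_abs)
    have "(eps <= eps + x$1 * tau & eps + x$1 * tau <= eps + tau & norm (quad_map a x) <= eps + tau &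
         (eps + x$1 * tau) / K <= norm (quad_map a x) &
         \<bar>norm (quad_map a x) - (eps + x$1 * tau)\<bar> <= K * mesh_error eps tau N * (eps + x$1 * tau) & 0 < edet a x &
         \<bar>edet a x - 1 * (pi / real N * tau) * (eps + x$1 * tau)\<bar>
           <= K * (pi / real N * tau) * (eps + x$1 * tau) * mesh_error eps tau N * 1 &
         \<bar>estretch (cavity_map r) a x - (1 * (pi / real N * tau))\<^sup>2 * Zr (eps + x$1 * tau)\<bar> <= K * (pi / real N * tau)\<^sup>2 * mesh_error eps tau N &
         \<bar>evol (cavity_map r) a x - 1 * (pi / real N * tau) * r' (eps + x$1 * tau) * r (eps + x$1 * tau)\<bar> <= K * (pi / real N * volume_error eps tau N)) &
         (pi / real N * tau) * (eps + x$1 * tau) / K <= edet a x"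
      if x: "x \<in> open_triangle" for x
    proof -
      define s where "s = x$1"
      define y where "y = x$2"
      define t where "t = eps + s * tau"
      have sy: "0 <= s" "0 <= y" "s + y <= 1" "s <= 1" "\<bar>y\<bar> <= 1" using x by (auto simp: open_triangle_def s_def y_def)
      have "s * tau <= 1 * tau" "0 <= s * tau" using sy ring by (auto intro!: mult_right_mono)
      then have t: "eps <= t" "t <= eps + tau" and t0: "0 < t" using ring by (auto simp: t_def)
      have qmap: "(norm (quad_map a x))\<^sup>2 = (eps * (1 - 2 * eta * y - 2 * eta * (1 - eta) * y * (2 * y - 1)) + s * tau * (1 - 2 * eta * y))\<^sup>2
          + (2 * sg' * y * (eps * (1 - eta * (2 * y - 1)) + s * tau))\<^sup>2"
        unfolding a norm_vec2 side_map vector_2 eta_def[symmetric] s_def[symmetric] y_def[symmetric]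
        by (rule arg_cong2[where f="(+)"]; rule arg_cong[where f="%z. z\<^sup>2"]; simp add: field_simps)
      note nrm = side_norm[OF ring(1,2) A(1,2) sg2 sy(1-3) t_def norm_ge_zero qmap]
      note sD = side_D_bounds[OF ring(1,2) A(1,2) sy(1-3) t_def]
      have Dp: "0 < side_D eps tau eta s y" using sD(2) t0 by linarith
      have D: "\<bar>side_D eps tau eta s y - t\<bar> <= K2 * mesh_error eps tau N * t * 1"
      proof -
        have "3 * eta * t <= (K2 * mesh_error eps tau N) * t"
        proof (rule mult_right_mono)
          have "6 * mesh_error eps tau N <= K2 * mesh_error eps tau N" using E(5) K1 by (intro mult_right_mono) (auto simp: K2_def)
          then show "3 * eta <= K2 * mesh_error eps tau N" using E(3) by linarith
        qed (use t0 in auto)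
        then show ?thesis using sD(1) by simp
      qed
      have k: "\<bar>side_X eps tau (r eps) (r (eps + tau / 2)) (r (eps + tau)) eta s y - Zr t\<bar> <= K1 * (tau\<^sup>2 + eta)"
        "\<bar>side_V (r eps) (r (eps + tau / 2)) (r (eps + tau)) eta s y - tau * r' t * r t\<bar> <= K1 * (\<bar>tau\<bar> ^ 3 + max eps (eps + tau) * \<bar>tau\<bar> * eta)"
        using K1(2)[of eps tau eta s y] ring A(1,2) sy unfolding t_def by auto
      have X: "\<bar>side_X eps tau (r eps) (r (eps + tau / 2)) (r (eps + tau)) eta s y - Zr t\<bar> <= K2 * mesh_error eps tau N"
      proof -
        note k(1)
        also have "K1 * (tau\<^sup>2 + eta) <= K1 * (7 * mesh_error eps tau N)" using E(2,3,5) K1 by (intro mult_left_mono) auto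
        also have "\<dots> <= K2 * mesh_error eps tau N" using E(5) by (simp add: K2_def algebra_simps)
        finally show ?thesis .
      qed
      have V: "\<bar>side_V (r eps) (r (eps + tau / 2)) (r (eps + tau)) eta s y - tau * r' t * r t\<bar> <= K2 * volume_error eps tau N"
      proof -
        note k(2)
        also have "K1 * (\<bar>tau\<bar> ^ 3 + max eps (eps + tau) * \<bar>tau\<bar> * eta) <= K1 * (4 * volume_error eps tau N)"
        proof (rule mult_left_mono)
          have "tau ^ 3 + (eps + tau) * tau * eta <= 4 * volume_error eps tau N" using E(6) zero_le_power2[of eta] by linarith
          then show "\<bar>tau\<bar> ^ 3 + max eps (eps + tau) * \<bar>tau\<bar> * eta <= 4 * volume_error eps tau N" using ring by simp
        qed (use K1 in simp)
        also have "\<dots> <= K2 * volume_error eps tau N" using E(7) K1 by (simp add: K2_def algebra_simps)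
        finally show ?thesis .
      qed
      have nz: "tau \<noteq> 0" "eta \<noteq> 2" and tau: "\<bar>tau\<bar> = tau" using ring A(2) by auto
      note cols = side_columns(1)[OF nz(1) sg2 nz(2), where P=eps and x=x, folded s_def y_def a[folded eta_def]]
        side_columns(2)[OF nz(1) sg2 nz(2), where x=x and p="r eps" and m="r (eps + tau / 2)" and q="r (eps + tau)",
          folded s_def y_def ua[folded eta_def]]
        side_columns(3)[OF nz(1) sg2 nz(2), where P=eps and x=x and p="r eps" and m="r (eps + tau / 2)" and q="r (eps + tau)",
          folded s_def y_def a[folded eta_def] ua[folded eta_def]]
      have ed: "edet a x = \<bar>2 * 1 * sg' * tau * side_D eps tau eta s y\<bar>" unfolding edet_def cols(1) by simp
      have es: "estretch (cavity_map r) a x = (2 * 1 * sg' * tau)\<^sup>2 * side_X eps tau (r eps) (r (eps + tau / 2)) (r (eps + tau)) eta s y"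
        unfolding estretch_def cols(3) by simp
      have ev: "evol (cavity_map r) a x = 2 * 1 * sg' * side_V (r eps) (r (eps + tau / 2)) (r (eps + tau)) eta s y * sgn (2 * 1 * sg' * tau * side_D eps tau eta s y)"
        unfolding evol_def cols(1,2) by simp
      note ce = coefficient_estimates[OF ring t tau sg' order_refl one_le_numeral K2 order_refl D Dp X V, folded ed es ev C_def]
      have h: "0 < pi / real N" using A(9) .
      have CK: "C <= K" by (simp add: K_def)
      have "C * (pi / real N * tau) * t * mesh_error eps tau N * 1 <= K * (pi / real N * tau) * t * mesh_error eps tau N * 1"
        "C * (pi / real N * tau)\<^sup>2 * mesh_error eps tau N <= K * (pi / real N * tau)\<^sup>2 * mesh_error eps tau N"
        "C * (pi / real N * volume_error eps tau N) <= K * (pi / real N * volume_error eps tau N)"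
        using CK E(5,7) h ring(2) t0 by (intro mult_right_mono; simp)+
      note ce = order_trans[OF ce(1) this(1)] order_trans[OF ce(2) this(2)] order_trans[OF ce(3) this(3)]
      have "sg' \<noteq> 0" using A(4) sg' by auto
      then have 1: "0 < edet a x" unfolding ed using ring Dp by simp
      have 2: "\<bar>norm (quad_map a x) - t\<bar> <= K * mesh_error eps tau N * t"
      proof -
        have "45 * eta * t <= (100 * mesh_error eps tau N) * t" using E(3,5) t0 by (intro mult_right_mono) auto
        also have "\<dots> <= (K * mesh_error eps tau N) * t" using E(5) t0 C0 by (intro mult_right_mono) (auto simp: K_def)
        finally show ?thesis using nrm(1) by linarith
      qed
      have K100: "u / K <= u / 100" if "0 <= u" for u using that C0 by (intro divide_left_mono) (auto simp: K_def)
      have 3: "t / K <= norm (quad_map a x)" using K100[of t] nrm(2) t0 by linarith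
      have 4: "(pi / real N * tau) * t / K <= edet a x"
      proof -
        have "edet a x = (2 * sin (pi / (2 * real N))) * tau * side_D eps tau eta s y"
          unfolding ed using ring Dp sg' by (simp add: abs_mult)
        moreover have "((3/4) * (pi / real N)) * tau * ((9/10) * t) <= (2 * sin (pi / (2 * real N))) * tau * side_D eps tau eta s y"
          using mult_mono[OF mult_right_mono[OF A(8), of tau] sD(2)] ring t0 A(4) by simp
        moreover have "(pi / real N * tau) * t / K <= (pi / real N * tau) * t / 100" using h ring t0 by (intro K100) auto
        moreover have "0 <= (pi / real N * tau) * t" using h ring t0 by simp
        ultimately show ?thesis by (simp add: mult_ac)
      qed
      show ?thesis unfolding s_def[symmetric] t_def[symmetric] using t nrm(3) 1 2 3 4 ce by blast
    qed
    then show "model_element K eps tau N 1 (%x. eps + x$1 * tau) (%x. 1) a &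
      (\<forall>x\<in>open_triangle. (pi / real N * tau) * (eps + x$1 * tau) / K <= edet a x)"
      unfolding model_element_def by blast
  qed
qed

end

section \<open>The four element types as fans and sides\<close>

fun swap_node :: "node => node" where
  "swap_node N2 = N3" | "swap_node N3 = N2" | "swap_node N12 = N13" | "swap_node N13 = N12"
| "swap_node N1 = N1" | "swap_node N23 = N23"

definition swap :: "real^2 => real^2" where "swap x = vector [x$2, x$1]"

lemma swap_simps [simp]: "swap x $ 1 = x $ 2" "swap x $ 2 = x $ 1"
  by (simp_all add: swap_def)

text \<open>D is the mirror image of C with N2 and N3 exchanged. Relabelling the nodes amounts to
  swapping the coordinates of the reference triangle, which reduces D to a
  \<open>side\<close>.\<close>

lemma quad_map_swap:
  "quad_map (a \<circ> swap_node) x = quad_map a (swap x)"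
  "dquad1 (a \<circ> swap_node) x = dquad2 a (swap x)" "dquad2 (a \<circ> swap_node) x = dquad1 a (swap x)"
  by (simp_all add: quad_map_def dquad1_def dquad2_def bary1_def bary2_def bary3_def algebra_simps)

lemma swap_mem_open_triangle: "swap x \<in> open_triangle \<longleftrightarrow> x \<in> open_triangle"
  by (auto simp: open_triangle_def add.commute)

lemma element_swap:
  "edet (a \<circ> swap_node) x = edet a (swap x)"
  "estretch u (a \<circ> swap_node) x = estretch u a (swap x)"
  "evol u (a \<circ> swap_node) x = evol u a (swap x)"
proof -
  have w: "wedge v w = - wedge w v" for v w by (simp add: wedge_def)
  have u: "u \<circ> (a \<circ> swap_node) = (u \<circ> a) \<circ> swap_node" by (simp add: o_assoc)
  show "edet (a \<circ> swap_node) x = edet a (swap x)"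
    unfolding edet_def quad_map_swap by (subst w) simp
  show "estretch u (a \<circ> swap_node) x = estretch u a (swap x)"
    unfolding estretch_def u quad_map_swap by (simp add: stretch_def inner_commute)
  show "evol u (a \<circ> swap_node) x = evol u a (swap x)"
    unfolding evol_def u quad_map_swap
    by (subst w[of "dquad2 a (swap x)"], subst w[of "dquad2 (u \<circ> a) (swap x)"]) (simp add: sgn_minus)
qed

lemma rotated_element:
  "edet (rot phi \<circ> a) x = edet a x"
  "estretch (cavity_map r) (rot phi \<circ> a) x = estretch (cavity_map r) a x"
  "evol (cavity_map r) (rot phi \<circ> a) x = evol (cavity_map r) a x"
  "norm (quad_map (rot phi \<circ> a) x) = norm (quad_map a x)"
  by (simp_all add: edet_def estretch_def evol_def cavity_map_rot quad_map_rot wedge_rot stretch_def inner_rot norm_rot)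

lemma polar_angle:
  fixes N :: nat
  assumes "0 < N"
  defines "eta == 1 - cos (pi / (2 * real N))" and "sg == sin (pi / (2 * real N))"
  shows "polar t 0 = vector [t, 0]"
    "polar t (pi / real N) = vector [t * (1 - 2 * eta * (2 - eta)), 2 * t * sg * (1 - eta)]"
    "polar t (- (pi / real N)) = vector [t * (1 - 2 * eta * (2 - eta)), - (2 * t * sg * (1 - eta))]"
    "polar t (pi / (2 * real N)) = vector [t * (1 - eta), t * sg]"
    "polar t (- (pi / (2 * real N))) = vector [t * (1 - eta), - (t * sg)]"
proof -
  define x where "x = pi / (2 * real N)"
  have x2: "pi / real N = 2 * x" using assms(1) by (simp add: x_def)
  have c: "cos (2 * x) = 1 - 2 * eta * (2 - eta)"
    using cos_double_cos[of x] unfolding eta_def x_def[symmetric] by (simp add: power2_eq_square algebra_simps)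
  have s: "sin (2 * x) = 2 * sg * (1 - eta)"
    using sin_double[of x] unfolding eta_def sg_def x_def[symmetric] by simp
  have c1: "cos x = 1 - eta" "sin x = sg" by (simp_all add: eta_def sg_def x_def)
  show "polar t 0 = vector [t, 0]"
    "polar t (pi / real N) = vector [t * (1 - 2 * eta * (2 - eta)), 2 * t * sg * (1 - eta)]"
    "polar t (- (pi / real N)) = vector [t * (1 - 2 * eta * (2 - eta)), - (2 * t * sg * (1 - eta))]"
    "polar t (pi / (2 * real N)) = vector [t * (1 - eta), t * sg]"
    "polar t (- (pi / (2 * real N))) = vector [t * (1 - eta), - (t * sg)]"
    unfolding x2 x_def[symmetric] polar_def cos_minus sin_minus c s c1 by (simp_all add: mult_ac)
qed

text \<open>B is a fan with its tip on the outer circle. Its node N2 lies at the positive angle,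
  hence the negative \<open>sg\<close>.\<close>

lemma elements_as_fans_and_sides:
  fixes N :: nat and eps tau :: real and r :: "real => real"
  assumes N: "0 < N" and ring: "0 < eps" "0 < tau"
  defines "eta == 1 - cos (pi / (2 * real N))" and "sg == sin (pi / (2 * real N))"
  shows "elem_A eps tau N = fan eps (eps + tau / 2) (eps + tau) eta sg"
    "elem_B eps tau N = fan (eps + tau) (eps + tau / 2) eps eta (- sg)"
    "elem_C eps tau N = side eps (eps + tau / 2) (eps + tau) eta sg"
    "elem_D eps tau N = side eps (eps + tau / 2) (eps + tau) eta (- sg) \<circ> swap_node"
    "cavity_map r \<circ> elem_A eps tau N = fan (r eps) (r (eps + tau / 2)) (r (eps + tau)) eta sg"
    "cavity_map r \<circ> elem_B eps tau N = fan (r (eps + tau)) (r (eps + tau / 2)) (r eps) eta (- sg)"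
    "cavity_map r \<circ> elem_C eps tau N = side (r eps) (r (eps + tau / 2)) (r (eps + tau)) eta sg"
    "cavity_map r \<circ> side eps (eps + tau / 2) (eps + tau) eta (- sg) = side (r eps) (r (eps + tau / 2)) (r (eps + tau)) eta (- sg)"
proof -
  note P = polar_angle[OF N, folded eta_def sg_def]
  have pos: "0 < eps + tau / 2" "0 < eps + tau" using ring by auto
  note cm = cavity_map_polar[OF ring(1)] cavity_map_polar[OF pos(1)] cavity_map_polar[OF pos(2)]
  show A: "elem_A eps tau N = fan eps (eps + tau / 2) (eps + tau) eta sg"
    "elem_B eps tau N = fan (eps + tau) (eps + tau / 2) eps eta (- sg)"
    "elem_C eps tau N = side eps (eps + tau / 2) (eps + tau) eta sg"
    and D: "elem_D eps tau N = side eps (eps + tau / 2) (eps + tau) eta (- sg) \<circ> swap_node"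
    by (rule ext, case_tac x; simp add: P)+
  show "cavity_map r \<circ> elem_A eps tau N = fan (r eps) (r (eps + tau / 2)) (r (eps + tau)) eta sg"
    "cavity_map r \<circ> elem_B eps tau N = fan (r (eps + tau)) (r (eps + tau / 2)) (r eps) eta (- sg)"
    "cavity_map r \<circ> elem_C eps tau N = side (r eps) (r (eps + tau / 2)) (r (eps + tau)) eta sg"
    by (rule ext, case_tac x; simp add: cm; simp add: P)+
  have D': "cavity_map r \<circ> elem_D eps tau N = side (r eps) (r (eps + tau / 2)) (r (eps + tau)) eta (- sg) \<circ> swap_node"
    by (rule ext, case_tac x; simp add: cm; simp add: P)
  have "swap_node \<circ> swap_node = id" by (rule ext, case_tac x) auto
  then show "cavity_map r \<circ> side eps (eps + tau / 2) (eps + tau) eta (- sg) = side (r eps) (r (eps + tau / 2)) (r (eps + tau)) eta (- sg)"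
    using arg_cong[OF D'[unfolded D], of "%f. f \<circ> swap_node"] by (simp add: comp_assoc)
qed

text \<open>The corner \<open>s = y = 1\<close> of the element A is where \<open>fan_D\<close> may come close to \<open>0\<close>.\<close>

lemma elem_A_injective:
  fixes N :: nat
  assumes ring: "0 < eps" "0 < tau" "eps + tau <= 1" "0 < N" and inj: "inj_on (quad_map (elem_A eps tau N)) ref_triangle"
  defines "eta == 1 - cos (pi / (2 * real N))"
  shows "2 <= N" "(eps + tau) * eta\<^sup>2 <= (19/100) * tau"
    "!!s y. 0 <= s ==> s <= 1 ==> \<bar>y\<bar> <= s ==> 0 <= fan_D eps tau eta s y"
    "!!s y. \<bar>y\<bar> < s ==> s < 1 ==> 0 < fan_D eps tau eta s y"
proof -
  show N: "2 <= N"
  proof (rule ccontr)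
    assume "\<not> 2 <= N"
    then have "N = 1" using ring by simp
    \<comment> \<open>For N = 1 the angles pi and -pi describe the same point.\<close>
    have e: "elem_A eps tau N N2 = elem_A eps tau N N3" by (simp add: \<open>N = 1\<close> polar_def)
    let ?x = "vector [1, 0] :: real^2" and ?y = "vector [0, 1] :: real^2"
    have q: "quad_map a ?x = a N2" "quad_map a ?y = a N3" for a
      by (simp_all add: quad_map_def bary1_def bary2_def bary3_def)
    have "?x = ?y"
    proof (rule inj_onD[OF inj])
      show "quad_map (elem_A eps tau N) ?x = quad_map (elem_A eps tau N) ?y" unfolding q by (rule e)
    qed (simp_all add: ref_triangle_def)
    then show False by (simp add: vec2_eq_iff)
  qed
  note A = angle_bounds[OF N, folded eta_def]
  have nz: "fan_D eps tau eta s y \<noteq> 0" if "\<bar>y\<bar> < s" "s < 1" for s y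
  proof -
    \<comment> \<open>The point of the reference triangle with coordinates s and y.\<close>
    let ?x = "vector [(s - y) / 2, (s + y) / 2] :: real^2"
    have "?x \<in> open_triangle" using that by (auto simp: open_triangle_def field_simps)
    then have "wedge (dquad1 (elem_A eps tau N) ?x) (dquad2 (elem_A eps tau N) ?x) \<noteq> 0"
      by (rule inj_quad_map_wedge_nonzero[OF inj])
    moreover have "?x $ 1 + ?x $ 2 = s" "?x $ 2 - ?x $ 1 = y" by (simp_all add: field_simps)
    ultimately show ?thesis
      unfolding elements_as_fans_and_sides(1)[OF ring(4,1,2)] eta_def[symmetric]
      using fan_columns(1)[of tau "sin (pi / (2 * real N))" eta eps ?x] A(3) ring by simp
  qed
  show nonneg: "0 <= fan_D eps tau eta s y" if "0 <= s" "s <= 1" "\<bar>y\<bar> <= s" for s y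
    by (rule fan_D_nonneg[OF ring(1,2) that nz])
  show "0 < fan_D eps tau eta s y" if "\<bar>y\<bar> < s" "s < 1" for s y
  proof -
    have "0 <= s" "\<bar>y\<bar> <= s" "s <= 1" using that by linarith+
    then show ?thesis using nonneg[of s y] nz[OF that] by linarith
  qed
  show "(eps + tau) * eta\<^sup>2 <= (19/100) * tau"
    by (rule fan_D_corner[OF ring(1,2) A(1,2) nonneg]) auto
qed

context cavity
begin

text \<open>For B the base radius is eps, the smallest radius, so the weight 1 + eps/t is at most 2
  and can be absorbed into the constant.\<close>

lemma model_element_bounded_weight:
  assumes "model_element K eps tau N n t bt a" "1 <= K" "0 < eps" "0 < tau" "eps + tau <= 1" "2 <= N"
    and bt: "!!x. x \<in> open_triangle ==> 0 <= bt x & bt x <= 2"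
  shows "model_element (2 * K) eps tau N n t (%_. 1) a"
proof -
  have h: "model_element (2 * K) eps tau N n t bt a"
    by (rule model_element_mono[OF assms(1)]) (use assms bt in auto)
  show ?thesis
    unfolding model_element_def
  proof (intro ballI)
    fix x assume x: "x \<in> open_triangle"
    note hx = h[unfolded model_element_def, rule_format, OF x]
    have pos: "0 < mesh_error eps tau N" "0 < t x" "0 <= pi / real N" using error_bounds[OF assms(3-6)] hx assms(3) by auto
    have "K * (pi / real N * tau) * t x * mesh_error eps tau N * bt x <= K * (pi / real N * tau) * t x * mesh_error eps tau N * 2"
      using bt[OF x] assms pos by (intro mult_left_mono mult_nonneg_nonneg) auto
    also have "\<dots> = 2 * K * (pi / real N * tau) * t x * mesh_error eps tau N * 1" by simp
    finally have "\<bar>edet a x - n * (pi / real N * tau) * t x\<bar> <= 2 * K * (pi / real N * tau) * t x * mesh_error eps tau N * 1"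
      using assms(1)[unfolded model_element_def, rule_format, OF x] by linarith
    then show "eps <= t x & t x <= eps + tau & norm (quad_map a x) <= eps + tau & t x / (2 * K) <= norm (quad_map a x) &
     \<bar>norm (quad_map a x) - t x\<bar> <= 2 * K * mesh_error eps tau N * t x & 0 < edet a x &
     \<bar>edet a x - n * (pi / real N * tau) * t x\<bar> <= 2 * K * (pi / real N * tau) * t x * mesh_error eps tau N * 1 &
     \<bar>estretch (cavity_map r) a x - (n * (pi / real N * tau))\<^sup>2 * Zr (t x)\<bar> <= 2 * K * (pi / real N * tau)\<^sup>2 * mesh_error eps tau N &
     \<bar>evol (cavity_map r) a x - n * (pi / real N * tau) * r' (t x) * r (t x)\<bar> <= 2 * K * (pi / real N * volume_error eps tau N)"
      using hx by linarith
  qed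
qed

definition nondegenerate :: "real => real => real => nat => (real^2 => real) => elem => bool" where
  "nondegenerate K eps tau N t a \<longleftrightarrow> (\<forall>x\<in>open_triangle. pi / real N * tau * t x / K <= edet a x)"

text \<open>The alternative for A: the Jacobian may vanish towards the lateral edges, but only when
  the mesh error is bounded below, so an error of order one is then acceptable.\<close>

definition degenerate :: "real => real => real => nat => elem => bool" where
  "degenerate K eps tau N a \<longleftrightarrow> 1 / K <= mesh_error eps tau N &
     (\<forall>x\<in>open_triangle. pi / real N * tau * (eps + tau) * (x$1 * x$2) / K <= edet a x)"

lemma mesh_elements:
  obtains K where "3 <= K" "!!eps tau (N::nat). 0 < eps ==> 0 < tau ==> eps + tau <= 1 ==> 0 < N ==>
      inj_on (quad_map (elem_A eps tau N)) ref_triangle ==>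
      2 <= N &
      model_element K eps tau N 2 (%x. eps + (x$1 + x$2) * tau) (%x. 1 + (eps + tau) / (eps + (x$1 + x$2) * tau)) (elem_A eps tau N) &
      (nondegenerate K eps tau N (%x. eps + (x$1 + x$2) * tau) (elem_A eps tau N) \<or> degenerate K eps tau N (elem_A eps tau N)) &
      model_element K eps tau N 2 (%x. eps + (1 - (x$1 + x$2)) * tau) (%x. 1) (elem_B eps tau N) &
      nondegenerate K eps tau N (%x. eps + (1 - (x$1 + x$2)) * tau) (elem_B eps tau N) &
      model_element K eps tau N 1 (%x. eps + x$1 * tau) (%x. 1) (elem_C eps tau N) &
      nondegenerate K eps tau N (%x. eps + x$1 * tau) (elem_C eps tau N) &
      model_element K eps tau N 1 (%x. eps + x$2 * tau) (%x. 1) (elem_D eps tau N) &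
      nondegenerate K eps tau N (%x. eps + x$2 * tau) (elem_D eps tau N)"
proof -
  obtain K1 where K1: "1 <= K1" and fan1: "!!eps tau (N::nat) P dl sg' a. 0 < eps ==> 0 < tau ==> eps + tau <= 1 ==> 2 <= N ==>
      (eps + tau) * (1 - cos (pi / (2 * real N)))\<^sup>2 <= (19/100) * tau ==> P = eps & dl = tau \<or> P = eps + tau & dl = - tau ==>
      \<bar>sg'\<bar> = sin (pi / (2 * real N)) ==>
      (!!s y. \<bar>y\<bar> < s ==> s < 1 ==> 0 < fan_D P dl (1 - cos (pi / (2 * real N))) s y) ==>
      a = fan P (P + dl / 2) (P + dl) (1 - cos (pi / (2 * real N))) sg' ==>
      cavity_map r \<circ> a = fan (r P) (r (P + dl / 2)) (r (P + dl)) (1 - cos (pi / (2 * real N))) sg' ==>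
      model_element K1 eps tau N 2 (%x. P + (x$1 + x$2) * dl) (%x. 1 + (P + dl) / (P + (x$1 + x$2) * dl)) a"
  proof (rule fan_element, goal_cases)
    case (1 K)
    show ?case by (rule 1(1)[OF 1(2)], rule 1(3)) (assumption | blast)+
  qed
  obtain K2 where K2: "1 <= K2" and side2: "!!eps tau (N::nat) sg' a. 0 < eps ==> 0 < tau ==> eps + tau <= 1 ==> 2 <= N ==>
      \<bar>sg'\<bar> = sin (pi / (2 * real N)) ==>
      a = side eps (eps + tau / 2) (eps + tau) (1 - cos (pi / (2 * real N))) sg' ==>
      cavity_map r \<circ> a = side (r eps) (r (eps + tau / 2)) (r (eps + tau)) (1 - cos (pi / (2 * real N))) sg' ==>
      model_element K2 eps tau N 1 (%x. eps + x$1 * tau) (%x. 1) a &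
      (\<forall>x\<in>open_triangle. (pi / real N * tau) * (eps + x$1 * tau) / K2 <= edet a x)"
    by (rule side_element) (rule that)
  define K where "K = 2 * K1 + K2 + 1000"
  have K: "0 < K1" "2 * K1 <= K" "K1 <= K" "0 < K2" "K2 <= K" "3 <= K" "1000 <= K" using K1 K2 by (auto simp: K_def)
  show thesis
  proof (rule that[OF K(6)])
    fix eps tau :: real and N :: nat
    assume ring: "0 < eps" "0 < tau" "eps + tau <= 1" "0 < N" and inj: "inj_on (quad_map (elem_A eps tau N)) ref_triangle"
    define eta where "eta = 1 - cos (pi / (2 * real N))"
    define sg where "sg = sin (pi / (2 * real N))"
    define h where "h = pi / real N"
    note I = elem_A_injective[OF ring inj, folded eta_def]
    note ring' = ring(1-3) I(1)
    note A = angle_bounds[OF I(1), folded eta_def sg_def h_def] and E = error_bounds[OF ring', folded eta_def]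
    note FS = elements_as_fans_and_sides[OF ring(4,1,2), folded eta_def sg_def]
    have sga: "\<bar>sg\<bar> = sg" "\<bar>- sg\<bar> = sg" using A(4) by auto
    have tpos: "0 < eps + s * tau" if "0 <= s" for s using that ring by (simp add: add_pos_nonneg)
    have dA: "edet (elem_A eps tau N) x = 4 * sg * tau * fan_D eps tau eta (x$1 + x$2) (x$2 - x$1)" if "x \<in> open_triangle" for x
    proof -
      have "0 < fan_D eps tau eta (x$1 + x$2) (x$2 - x$1)" using that by (intro I(4)) (auto simp: open_triangle_def)
      then show ?thesis
        unfolding edet_def FS(1) fan_columns(1)[OF less_imp_neq[OF ring(2), symmetric] A(3)] using A(4) ring by simp
    qed
    have lowD: "h * tau * u / K <= 4 * sg * tau * D" if "0 <= u" "(7/100) * u <= D" for u D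
    proof -
      have "h * tau * u / K <= h * tau * u / 1000" using that A(9) ring K by (intro divide_left_mono) auto
      moreover have "(2 * ((3/4) * h)) * tau <= (2 * (2 * sg)) * tau" using A(8) ring by (intro mult_right_mono) auto
      then have "(2 * ((3/4) * h)) * tau * ((7/100) * u) <= (2 * (2 * sg)) * tau * D"
        by (rule mult_mono[OF _ that(2)]) (use A(4) that ring in auto)
      moreover have "0 <= h * tau * u" using that A(9) ring by simp
      moreover have "(2 * ((3/4) * h)) * tau * ((7/100) * u) = (105/1000) * (h * tau * u)" "(2 * (2 * sg)) * tau * D = 4 * sg * tau * D" by simp_all
      ultimately show ?thesis by linarith
    qed
    have a1: "model_element K eps tau N 2 (%x. eps + (x$1 + x$2) * tau) (%x. 1 + (eps + tau) / (eps + (x$1 + x$2) * tau)) (elem_A eps tau N)"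
    proof (rule model_element_mono[OF _ K(1,3) ring'])
      show "model_element K1 eps tau N 2 (%x. eps + (x$1 + x$2) * tau) (%x. 1 + (eps + tau) / (eps + (x$1 + x$2) * tau)) (elem_A eps tau N)"
        by (rule fan1[OF ring', folded eta_def sg_def, where sg'=sg]) (use I(2,4) sga FS(1,5) in auto)
      show "0 <= 1 + (eps + tau) / (eps + (x$1 + x$2) * tau)" if "x \<in> open_triangle" for x
        using that ring tpos[of "x$1 + x$2"] by (auto simp: open_triangle_def intro!: add_nonneg_nonneg divide_nonneg_nonneg)
    qed
    have sA: "\<bar>2 * eta * ((eps + tau) * eta / tau - 1)\<bar> <= (4/5)"
      by (rule fan_slope_bound) (use ring A I(2) in auto)
    have a2: "nondegenerate K eps tau N (%x. eps + (x$1 + x$2) * tau) (elem_A eps tau N) \<or> degenerate K eps tau N (elem_A eps tau N)"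
    \<comment> \<open>The dichotomy is on the coefficient of y^2 in \<open>fan_D\<close>. If it is
      not too negative, \<open>fan_D_lower\<close> applies.\<close>
    proof (cases "- (7/100) * (eps + tau) <= 4 * (eps + tau) * eta * (2 - eta) * (1 - 2 * (eps + tau) * eta / tau)")
      case True
      have "nondegenerate K eps tau N (%x. eps + (x$1 + x$2) * tau) (elem_A eps tau N)"
        unfolding nondegenerate_def h_def[symmetric]
      proof (intro ballI)
        fix x assume x: "x \<in> open_triangle"
        interpret F: fan_triangle eps tau eta sg "x$1 + x$2" "x$2 - x$1" "eps + (x$1 + x$2) * tau"
          by unfold_locales (use ring A x in \<open>auto simp: open_triangle_def\<close>)
        show "h * tau * (eps + (x$1 + x$2) * tau) / K <= edet (elem_A eps tau N) x"
          unfolding dA[OF x] using F.t_pos F.fan_D_lower[OF sA True] by (intro lowD) auto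
      qed
      then show ?thesis ..
    next
      case False
      define W where "W = - (4 * (eps + tau) * eta * (2 - eta) * (1 - 2 * (eps + tau) * eta / tau))"
      have "- (7/100) * (eps + tau) = - ((7/100) * (eps + tau))" by simp
      with False have W: "(7/100) * (eps + tau) <= W" unfolding W_def not_le by linarith
      have "W <= 16 * (eps + tau) * ((eps + tau) * eta\<^sup>2 / tau)"
      proof -
        have "W = 4 * (eps + tau) * (2 - eta) * (2 * ((eps + tau) * eta\<^sup>2 / tau) - eta)"
        proof -
          have "- (4 * q * eta * (2 - eta) * (1 - 2 * q * eta / tau)) = 4 * q * (2 - eta) * (2 * (q * eta\<^sup>2 / tau) - eta)" for q
            by (simp add: power2_eq_square algebra_simps)
          then show ?thesis unfolding W_def .
        qed
        also have "\<dots> <= 4 * (eps + tau) * (2 - eta) * (2 * ((eps + tau) * eta\<^sup>2 / tau))"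
          using A(1,2) ring by (intro mult_left_mono) auto
        also have "\<dots> <= 4 * (eps + tau) * 2 * (2 * ((eps + tau) * eta\<^sup>2 / tau))"
          using A(1,2) ring by (intro mult_right_mono mult_left_mono) auto
        also have "\<dots> = 16 * (eps + tau) * ((eps + tau) * eta\<^sup>2 / tau)" by (simp only: mult_ac)
        finally show ?thesis .
      qed
      also have "\<dots> <= 16 * (eps + tau) * (4 * mesh_error eps tau N)" using E(4) ring by (intro mult_left_mono) auto
      also have "\<dots> = (eps + tau) * (64 * mesh_error eps tau N)" by simp
      finally have "(eps + tau) * (7/100) <= (eps + tau) * (64 * mesh_error eps tau N)"
        using W mult.commute[of "7/100" "eps + tau"] by linarith
      \<comment> \<open>A strongly negative coefficient means a large bending term: the mesh error
        is at least 7/6400 > 1/1000, hence the 1000 in \<open>K\<close>.\<close>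
      then have "7/100 <= 64 * mesh_error eps tau N" by (rule mult_left_le_imp_le) (use ring in simp)
      moreover have "1 / K <= 1 / 1000" using K by (intro divide_left_mono) auto
      ultimately have e: "1 / K <= mesh_error eps tau N" by linarith
      have "degenerate K eps tau N (elem_A eps tau N)"
        unfolding degenerate_def h_def[symmetric]
      proof (intro conjI ballI e)
        fix x assume x: "x \<in> open_triangle"
        let ?s = "x$1 + x$2" and ?y = "x$2 - x$1"
        \<comment> \<open>On the lateral edge |y| = s the Jacobian is nonnegative by injectivity.
          Moving inward to y gains W*(s^2 - y^2) = 4*W*x1*x2.\<close>
        have "fan_D eps tau eta ?s ?y = fan_D eps tau eta ?s ?s + W * (?s\<^sup>2 - ?y\<^sup>2)"
        proof -
          have "u + v * y * w = (u + v * s * w) + (- (v * w)) * (s - y)" for u v s y w :: real by (simp add: algebra_simps)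
          then show ?thesis unfolding fan_D_def W_def .
        qed
        also have "?s\<^sup>2 - ?y\<^sup>2 = 4 * (x$1 * x$2)" by (simp add: power2_eq_square algebra_simps)
        finally have "W * (4 * (x$1 * x$2)) <= fan_D eps tau eta ?s ?y"
          using I(3)[of ?s ?s] x by (auto simp: open_triangle_def)
        moreover have "((7/100) * (eps + tau)) * (1 * (x$1 * x$2)) <= W * (4 * (x$1 * x$2))"
          using W x ring by (intro mult_mono) (auto simp: open_triangle_def)
        ultimately have "(7/100) * ((eps + tau) * (x$1 * x$2)) <= fan_D eps tau eta ?s ?y"
          unfolding mult.assoc[of "7/100"] mult_1 by (rule order_trans[rotated])
        moreover have "0 <= (eps + tau) * (x$1 * x$2)" using x ring by (auto simp: open_triangle_def)
        ultimately show "h * tau * (eps + tau) * (x$1 * x$2) / K <= edet (elem_A eps tau N) x"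
          unfolding dA[OF x] using lowD by (simp add: mult.assoc)
      qed
      then show ?thesis ..
    qed
    have slB: "max (eps + tau) (eps + tau + - tau) * eta\<^sup>2 <= (19/100) * \<bar>- tau\<bar>" using ring I(2) by simp
    have sB: "\<bar>2 * eta * (((eps + tau) + - tau) * eta / (- tau) - 1)\<bar> <= (4/5)"
      by (rule fan_slope_bound) (use ring A slB in auto)
    have DB: "(7/100) * (eps + tau + s * (- tau)) <= fan_D (eps + tau) (- tau) eta s y" "0 < eps + tau + s * (- tau)"
      if "\<bar>y\<bar> < s" "s < 1" for s y
    proof -
      interpret F: fan_triangle "eps + tau" "- tau" eta sg s y "eps + tau + s * (- tau)"
        by unfold_locales (use ring A that in auto)
      show "0 < eps + tau + s * (- tau)" by (rule F.t_pos)
      show "(7/100) * (eps + tau + s * (- tau)) <= fan_D (eps + tau) (- tau) eta s y"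
      proof (rule F.fan_D_lower[OF sB])
        \<comment> \<open>For \<open>dl < 0\<close> the coefficient of y^2 is nonnegative, so B
          cannot degenerate this way.\<close>
        have "0 <= 4 * (eps + tau + - tau) * eta * (2 - eta) * (1 - 2 * (eps + tau + - tau) * eta / (- tau))"
          using ring A by (intro mult_nonneg_nonneg) auto
        then show "- (7/100) * (eps + tau + - tau) <= 4 * (eps + tau + - tau) * eta * (2 - eta) * (1 - 2 * (eps + tau + - tau) * eta / (- tau))"
          using ring by (elim order_trans[rotated]) auto
      qed
    qed
    have tB: "eps + tau + s * (- tau) = eps + (1 - s) * tau" for s by (simp add: algebra_simps)
    have b1: "model_element K eps tau N 2 (%x. eps + (1 - (x$1 + x$2)) * tau) (%x. 1) (elem_B eps tau N)"
    proof (rule model_element_mono[OF model_element_bounded_weight _ _ ring'])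
      have "model_element K1 eps tau N 2 (%x. (eps + tau) + (x$1 + x$2) * (- tau)) (%x. 1 + ((eps + tau) + (- tau)) / ((eps + tau) + (x$1 + x$2) * (- tau))) (elem_B eps tau N)"
      proof (rule fan1[OF ring', folded eta_def sg_def, where sg'="- sg"])
        fix s y :: real assume "\<bar>y\<bar> < s" "s < 1"
        note d = DB[OF this]
        have "0 < (7/100) * (eps + tau + s * (- tau))" using d(2) by (intro mult_pos_pos) auto
        then show "0 < fan_D (eps + tau) (- tau) eta s y" using d(1) by (rule less_le_trans)
      next
        have m: "eps + tau + - tau / 2 = eps + tau / 2" "eps + tau + - tau = eps" by auto
        show "elem_B eps tau N = fan (eps + tau) (eps + tau + - tau / 2) (eps + tau + - tau) eta (- sg)"
          "cavity_map r \<circ> elem_B eps tau N = fan (r (eps + tau)) (r (eps + tau + - tau / 2)) (r (eps + tau + - tau)) eta (- sg)"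
          unfolding m by (fact FS(2), fact FS(6))
      qed (use I(2) sga in auto)
      then show "model_element K1 eps tau N 2 (%x. eps + (1 - (x$1 + x$2)) * tau) (%x. 1 + eps / (eps + (1 - (x$1 + x$2)) * tau)) (elem_B eps tau N)"
        unfolding tB by simp
      show "0 <= 1 + eps / (eps + (1 - (x$1 + x$2)) * tau) & 1 + eps / (eps + (1 - (x$1 + x$2)) * tau) <= 2" if "x \<in> open_triangle" for x
        using that ring tpos[of "1 - (x$1 + x$2)"] by (auto simp: open_triangle_def divide_le_eq intro!: add_nonneg_nonneg divide_nonneg_nonneg)
    qed (use K1 K ring' in auto)
    have b2: "nondegenerate K eps tau N (%x. eps + (1 - (x$1 + x$2)) * tau) (elem_B eps tau N)"
      unfolding nondegenerate_def h_def[symmetric]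
    proof (intro ballI)
      fix x assume x: "x \<in> open_triangle"
      let ?s = "x$1 + x$2" and ?y = "x$2 - x$1"
      have sy: "\<bar>?y\<bar> < ?s" "?s < 1" using x by (auto simp: open_triangle_def)
      note D = DB[OF sy]
      have m: "elem_B eps tau N = fan (eps + tau) (eps + tau + - tau / 2) (eps + tau + - tau) eta (- sg)" unfolding FS(2) by (simp add: add.commute)
      have sgm: "(- sg)\<^sup>2 = eta * (2 - eta)" "- tau \<noteq> 0" using A(3) ring by auto
      have "edet (elem_B eps tau N) x = 4 * sg * tau * fan_D (eps + tau) (- tau) eta ?s ?y"
        unfolding edet_def m fan_columns(1)[OF sgm(2,1)] using A(4) ring D by (simp add: abs_mult)
      then show "h * tau * (eps + (1 - ?s) * tau) / K <= edet (elem_B eps tau N) x"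
        using lowD[of "eps + (1 - ?s) * tau"] D unfolding tB by auto
    qed
    have K2K: "pi / real N * tau * u / K <= pi / real N * tau * u / K2" if "0 <= u" for u
      using that K ring A(9) by (intro divide_left_mono) (auto simp: h_def)
    have tp: "0 <= eps + x$1 * tau" "0 <= eps + x$2 * tau" if "x \<in> open_triangle" for x
      using that tpos[of "x$1"] tpos[of "x$2"] by (auto simp: open_triangle_def)
    note c = side2[OF ring', folded eta_def sg_def, OF sga(1) FS(3) FS(7)]
    have c1: "model_element K eps tau N 1 (%x. eps + x$1 * tau) (%x. 1) (elem_C eps tau N)"
      by (rule model_element_mono[OF conjunct1[OF c] K(4,5) ring']) simp
    have c2: "nondegenerate K eps tau N (%x. eps + x$1 * tau) (elem_C eps tau N)"
      unfolding nondegenerate_def using c K2K tp by (blast intro: order_trans)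
    note d = side2[OF ring', folded eta_def sg_def, OF sga(2) refl FS(8)]
    let ?d = "side eps (eps + tau / 2) (eps + tau) eta (- sg)"
    have d0: "model_element K eps tau N 1 (%x. eps + x$1 * tau) (%x. 1) ?d"
      by (rule model_element_mono[OF conjunct1[OF d] K(4,5) ring']) simp
    have d1: "model_element K eps tau N 1 (%x. eps + x$2 * tau) (%x. 1) (elem_D eps tau N)"
      unfolding model_element_def FS(4) element_swap quad_map_swap
    proof (intro ballI)
      fix x :: "real^2" assume "x \<in> open_triangle"
      then have "swap x \<in> open_triangle" by (simp add: swap_mem_open_triangle)
      from d0[unfolded model_element_def, rule_format, OF this] show "eps <= eps + x$2 * tau & eps + x$2 * tau <= eps + tau &
          norm (quad_map ?d (swap x)) <= eps + tau & (eps + x$2 * tau) / K <= norm (quad_map ?d (swap x)) &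
          \<bar>norm (quad_map ?d (swap x)) - (eps + x$2 * tau)\<bar> <= K * mesh_error eps tau N * (eps + x$2 * tau) & 0 < edet ?d (swap x) &
          \<bar>edet ?d (swap x) - 1 * (pi / real N * tau) * (eps + x$2 * tau)\<bar> <= K * (pi / real N * tau) * (eps + x$2 * tau) * mesh_error eps tau N * 1 &
          \<bar>estretch (cavity_map r) ?d (swap x) - (1 * (pi / real N * tau))\<^sup>2 * Zr (eps + x$2 * tau)\<bar> <= K * (pi / real N * tau)\<^sup>2 * mesh_error eps tau N &
          \<bar>evol (cavity_map r) ?d (swap x) - 1 * (pi / real N * tau) * r' (eps + x$2 * tau) * r (eps + x$2 * tau)\<bar> <= K * (pi / real N * volume_error eps tau N)"
        by simp
    qed
    have d2: "nondegenerate K eps tau N (%x. eps + x$2 * tau) (elem_D eps tau N)"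
      unfolding nondegenerate_def FS(4) element_swap
    proof (intro ballI)
      fix x :: "real^2" assume x: "x \<in> open_triangle"
      then have "swap x \<in> open_triangle" by (simp add: swap_mem_open_triangle)
      then have "pi / real N * tau * (eps + x$2 * tau) / K2 <= edet ?d (swap x)" using conjunct2[OF d] by fastforce
      then show "pi / real N * tau * (eps + x$2 * tau) / K <= edet ?d (swap x)" using K2K[OF tp(2)[OF x]] by linarith
    qed
    show "2 <= N &
      model_element K eps tau N 2 (%x. eps + (x$1 + x$2) * tau) (%x. 1 + (eps + tau) / (eps + (x$1 + x$2) * tau)) (elem_A eps tau N) &
      (nondegenerate K eps tau N (%x. eps + (x$1 + x$2) * tau) (elem_A eps tau N) \<or> degenerate K eps tau N (elem_A eps tau N)) &
      model_element K eps tau N 2 (%x. eps + (1 - (x$1 + x$2)) * tau) (%x. 1) (elem_B eps tau N) &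
      nondegenerate K eps tau N (%x. eps + (1 - (x$1 + x$2)) * tau) (elem_B eps tau N) &
      model_element K eps tau N 1 (%x. eps + x$1 * tau) (%x. 1) (elem_C eps tau N) &
      nondegenerate K eps tau N (%x. eps + x$1 * tau) (elem_C eps tau N) &
      model_element K eps tau N 1 (%x. eps + x$2 * tau) (%x. 1) (elem_D eps tau N) &
      nondegenerate K eps tau N (%x. eps + x$2 * tau) (elem_D eps tau N)"
      using I(1) a1 a2 b1 b2 c1 c2 d1 d2 by blast
  qed
qed

end

section \<open>Summation over a layer\<close>

text \<open>An open image inside a closed ball lies in its interior. Strictness matters at outer
  radius 1, where r is differentiable from one side only.\<close>

lemma quad_map_norm_less:
  assumes inj: "inj_on (quad_map a) ref_triangle" and le: "!!x. x \<in> open_triangle ==> norm (quad_map a x) <= R"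
    and x: "x \<in> open_triangle"
  shows "norm (quad_map a x) < R"
proof -
  have "open (quad_map a ` open_triangle)"
    using inj open_triangle_subset
    by (intro invariance_of_domain quad_map_continuous_on open_open_triangle) (auto intro: inj_on_subset)
  moreover have "quad_map a ` open_triangle \<subseteq> cball 0 R" using le by auto
  ultimately have "quad_map a ` open_triangle \<subseteq> interior (cball 0 R)" by (rule interior_maximal[rotated])
  then show ?thesis using x by auto
qed

text \<open>A closed condition on a continuous function that holds almost everywhere holds
  everywhere: the violating set has an open image, and a nonempty open set is not
  negligible.\<close>

lemma AE_open_everywhere:
  fixes Q :: "real^2 => bool"
  assumes ae: "AE y\<in>S in lebesgue. Q y" and sub: "quad_map a ` open_triangle \<subseteq> S"
    and inj: "inj_on (quad_map a) ref_triangle"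
    and Q: "!!x. x \<in> open_triangle ==> Q (quad_map a x) \<longleftrightarrow> f x \<in> C"
    and f: "continuous_on open_triangle f" and C: "closed C" and x: "x \<in> open_triangle"
  shows "f x \<in> (C :: real set)"
proof (rule ccontr)
  assume nx: "f x \<notin> C"
  define U where "U = open_triangle \<inter> f -` (- C)"
  have "open U" unfolding U_def
    using f C by (intro continuous_open_preimage open_open_triangle) auto
  have "U \<subseteq> ref_triangle" using open_triangle_subset by (auto simp: U_def)
  then have "open (quad_map a ` U)"
    using inj \<open>open U\<close> by (intro invariance_of_domain quad_map_continuous_on) (auto intro: inj_on_subset)
  moreover have "negligible (quad_map a ` U)"
  proof -
    have "AE y in lebesgue. y \<notin> quad_map a ` U"
      using ae by eventually_elim (use sub Q in \<open>auto simp: U_def\<close>)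
    then show ?thesis by (auto simp: negligible_iff_null_sets completion.AE_iff_null_sets AE_iff_null_sets intro: calculation lmeasurable_open)
  qed
  ultimately have "quad_map a ` U = {}" using open_not_negligible by blast
  then show False using x nx by (auto simp: U_def)
qed

text \<open>The push-forward of Lebesgue measure on the reference triangle under \<open>s\<close> has density \<open>gam\<close>.\<close>

definition coordinate_density :: "(real^2 => real) => (real => real) => bool" where
  "coordinate_density s gam \<longleftrightarrow> continuous_on open_triangle s & s ` open_triangle \<subseteq> {0<..<1} &
     (\<forall>sg\<in>{0<..<1}. 0 <= gam sg & gam sg <= 1) &
     (\<forall>phi. continuous_on {0<..<1} phi \<longrightarrow> (\<forall>sg\<in>{0<..<1}. 0 <= phi sg) \<longrightarrow> set_integrable lborel {0<..<1} phi \<longrightarrow>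
        set_integrable lebesgue open_triangle (%x. phi (s x)) & set_integrable lborel {0<..<1} (%sg. gam sg * phi sg) &
        (LINT x:open_triangle|lebesgue. phi (s x)) = (LINT sg:{0<..<1}|lborel. gam sg * phi sg))"

text \<open>In the order C, D, A, B. The coordinate s always increases with the radius, so for B,
  whose tip lies on the outer circle, it is 1 - (x1 + x2).\<close>

lemma coordinate_densities:
  "coordinate_density (%x. x$1) (%sg. 1 - sg)"
  "coordinate_density (%x. x$2) (%sg. 1 - sg)"
  "coordinate_density (%x. x$1 + x$2) (%sg. sg)"
  "coordinate_density (%x. 1 - (x$1 + x$2)) (%sg. 1 - sg)"
proof -
  show "coordinate_density (%x. x$1) (%sg. 1 - sg)" "coordinate_density (%x. x$2) (%sg. 1 - sg)"
    "coordinate_density (%x. x$1 + x$2) (%sg. sg)"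
    unfolding coordinate_density_def
    by (intro conjI allI impI continuous_intros triangle_integral; auto simp: open_triangle_def)+
  have "set_integrable lebesgue open_triangle (%x. phi (1 - (x$1 + x$2))) & set_integrable lborel {0<..<1} (%sg. (1 - sg) * phi sg) &
        (LINT x:open_triangle|lebesgue. phi (1 - (x$1 + x$2))) = (LINT sg:{0<..<1}|lborel. (1 - sg) * phi sg)"
    if phi: "continuous_on {0<..<1} phi" "\<forall>sg\<in>{0<..<1}. 0 <= phi sg" "set_integrable lborel {0<..<1} phi" for phi :: "real => real"
  proof -
    define psi where "psi s = phi (1 - s)" for s
    have "continuous_on {0<..<1} psi"
      unfolding psi_def[abs_def] by (rule continuous_on_compose2[OF phi(1)]) (auto intro!: continuous_intros)
    then have psi: "continuous_on {0<..<1} psi" "!!s. s \<in> {0<..<1} ==> 0 <= psi s" "set_integrable lborel {0<..<1} psi"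
      using phi(2,3) set_integrable_reflect(1)[of phi] by (auto simp: psi_def[abs_def])
    note T = triangle_integral[OF psi]
    have "(LINT x:open_triangle|lebesgue. phi (1 - (x$1 + x$2))) = (LINT sg:{0<..<1}|lborel. sg * phi (1 - sg))"
      using T(8) by (simp add: psi_def)
    also have "\<dots> = (LINT sg:{0<..<1}|lborel. (1 - sg) * phi sg)"
      using set_integrable_reflect(2)[of "%sg. (1 - sg) * phi sg"] by simp
    moreover have "set_integrable lborel {0<..<1} (%sg. (1 - sg) * phi sg)"
      using phi by (intro triangle_integral) auto
    ultimately show ?thesis using T(3) by (simp add: psi_def)
  qed
  then show "coordinate_density (%x. 1 - (x$1 + x$2)) (%sg. 1 - sg)"
    unfolding coordinate_density_def by (intro conjI continuous_intros) (simp_all add: open_triangle_def image_subset_iff)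
qed

lemma set_integrable_open_triangle:
  fixes F G :: "real^2 => real"
  assumes F: "continuous_on open_triangle F" and G: "set_integrable lebesgue open_triangle G"
    and le: "!!x. x \<in> open_triangle ==> \<bar>F x\<bar> <= G x"
  shows "set_integrable lebesgue open_triangle F" "\<bar>LINT x:open_triangle|lebesgue. F x\<bar> <= (LINT x:open_triangle|lebesgue. G x)"
proof -
  show int: "set_integrable lebesgue open_triangle F"
    using G
  proof (rule set_integrable_bound)
    have "F \<in> borel_measurable (lebesgue_on open_triangle)"
      by (rule continuous_imp_measurable_on_sets_lebesgue[OF F open_triangle_in_lebesgue])
    then show "set_borel_measurable lebesgue open_triangle F"
      unfolding set_borel_measurable_def by (subst (asm) borel_measurable_restrict_space_iff) (auto simp: mult.commute)
    show "AE x in lebesgue. x \<in> open_triangle \<longrightarrow> norm (F x) <= norm (G x)"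
      using le by (intro AE_I2) (fastforce intro: order_trans)
  qed
  have "(LINT x:open_triangle|lebesgue. F x) <= (LINT x:open_triangle|lebesgue. G x)"
    using le by (intro set_integral_mono int G) (auto simp: abs_le_iff)
  moreover have "(LINT x:open_triangle|lebesgue. - G x) <= (LINT x:open_triangle|lebesgue. F x)"
    using le by (intro set_integral_mono int) (use G in \<open>auto simp: abs_le_iff set_integrable_def\<close>, force)
  ultimately show "\<bar>LINT x:open_triangle|lebesgue. F x\<bar> <= (LINT x:open_triangle|lebesgue. G x)"
    by (simp add: set_lebesgue_integral_def)
qed

text \<open>Model and error bound both depend on s only, so the comparison over the triangle reduces
  to integrals over the unit interval with the same density.\<close>

lemma pushforward_comparison:
  assumes s: "coordinate_density s gam" and F: "continuous_on open_triangle F"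
    and W: "continuous_on {0<..<1} W" "!!sg. sg \<in> {0<..<1} ==> 0 <= W sg" "set_integrable lborel {0<..<1} W"
    and E: "continuous_on {0<..<1} E" "!!sg. sg \<in> {0<..<1} ==> 0 <= E sg" "set_integrable lborel {0<..<1} E"
    and le: "!!x. x \<in> open_triangle ==> \<bar>F x - k * W (s x)\<bar> <= l * E (s x)"
  shows "set_integrable lebesgue open_triangle F"
    "\<bar>(LINT x:open_triangle|lebesgue. F x) - k * (LINT sg:{0<..<1}|lborel. gam sg * W sg)\<bar> <= l * (LINT sg:{0<..<1}|lborel. gam sg * E sg)"
proof -
  have W': "set_integrable lebesgue open_triangle (%x. W (s x))"
      "(LINT x:open_triangle|lebesgue. W (s x)) = (LINT sg:{0<..<1}|lborel. gam sg * W sg)"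
    and E': "set_integrable lebesgue open_triangle (%x. E (s x))"
      "(LINT x:open_triangle|lebesgue. E (s x)) = (LINT sg:{0<..<1}|lborel. gam sg * E sg)"
    and sc: "continuous_on open_triangle s" "s ` open_triangle \<subseteq> {0<..<1}"
    using s W E unfolding coordinate_density_def by auto
  have kW: "set_integrable lebesgue open_triangle (%x. k * W (s x))" and lE: "set_integrable lebesgue open_triangle (%x. l * E (s x))"
    using W' E' by (auto intro: set_integrable_mult_right)
  have c: "continuous_on open_triangle (%x. F x - k * W (s x))"
    by (intro continuous_intros F continuous_on_compose2[OF W(1) sc])
  note d = set_integrable_open_triangle[OF c lE le]
  have "set_integrable lebesgue open_triangle (%x. (F x - k * W (s x)) + k * W (s x))" by (rule set_integral_add(1)[OF d(1) kW])
  then show 1: "set_integrable lebesgue open_triangle F" by simp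
  show "\<bar>(LINT x:open_triangle|lebesgue. F x) - k * (LINT sg:{0<..<1}|lborel. gam sg * W sg)\<bar> <= l * (LINT sg:{0<..<1}|lborel. gam sg * E sg)"
    using d(2) set_integral_diff(2)[OF 1 kW] W'(2) E'(2) by simp
qed

lemma pushforward_lower_bound:
  assumes s: "coordinate_density s gam" and F: "set_integrable lebesgue open_triangle F"
    and W: "continuous_on {0<..<1} W" "!!sg. sg \<in> {0<..<1} ==> 0 <= W sg" "set_integrable lborel {0<..<1} W"
    and le: "!!x. x \<in> open_triangle ==> k * W (s x) <= F x"
  shows "k * (LINT sg:{0<..<1}|lborel. gam sg * W sg) <= (LINT x:open_triangle|lebesgue. F x)"
proof -
  have W': "set_integrable lebesgue open_triangle (%x. W (s x))"
      "(LINT x:open_triangle|lebesgue. W (s x)) = (LINT sg:{0<..<1}|lborel. gam sg * W sg)"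
    using s W unfolding coordinate_density_def by auto
  have kW: "set_integrable lebesgue open_triangle (%x. k * W (s x))" using W' by (auto intro: set_integrable_mult_right)
  show ?thesis using set_integral_mono[OF kW F le] W'(2) by simp
qed

lemma set_integral_open_triangle_close:
  fixes F G :: "real^2 => real"
  assumes F: "continuous_on open_triangle F" and G: "continuous_on open_triangle G" "set_integrable lebesgue open_triangle G"
    and k: "0 <= k" "!!x. x \<in> open_triangle ==> \<bar>F x - G x\<bar> <= k"
  shows "set_integrable lebesgue open_triangle F"
    "\<bar>(LINT x:open_triangle|lebesgue. F x) - (LINT x:open_triangle|lebesgue. G x)\<bar> <= k"
proof -
  have one: "continuous_on {0<..<1::real} (%_. 1::real)" "set_integrable lborel {0<..<1::real} (%_. 1::real)"
    by simp (rule set_integrable_bounded_continuous[where C=1]; simp)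
  have c: "continuous_on open_triangle (%x. F x - G x)" by (intro continuous_intros F G)
  have le: "\<bar>(F x - G x) - 0 * 1\<bar> <= k * 1" if "x \<in> open_triangle" for x using k(2)[OF that] by simp
  note d = pushforward_comparison[OF coordinate_densities(3) c one(1) _ one(2) one(1) _ one(2) le, simplified]
  have "set_integrable lebesgue open_triangle (%x. (F x - G x) + G x)" by (rule set_integral_add(1)[OF d(1) G(2)])
  then show 1: "set_integrable lebesgue open_triangle F" by simp
  have "(LINT sg:{0<..<1}|lborel. sg) <= (LINT sg:{0<..<1::real}|lborel. 1::real)"
    by (rule set_integral_mono) (use triangle_integral(5)[OF one(1) _ one(2)] one in auto)
  also have "\<dots> = 1" by (simp add: set_lebesgue_integral_def)
  finally have "k * (LINT sg:{0<..<1}|lborel. sg) <= k * 1" using k(1) by (rule mult_left_mono)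
  then show "\<bar>(LINT x:open_triangle|lebesgue. F x) - (LINT x:open_triangle|lebesgue. G x)\<bar> <= k"
    using d(2) set_integral_diff(2)[OF 1 G(2)] by simp
qed

text \<open>Averaging with the reflection s -> 1 - s reduces the claim to (1/2 - s)*(phi(s) - phi(1
  - s)) >= 0, which is monotonicity.\<close>

lemma decreasing_first_moment:
  fixes phi :: "real => real"
  assumes phi: "continuous_on {0<..<1} phi" "!!s. s \<in> {0<..<1} ==> 0 <= phi s" "set_integrable lborel {0<..<1} phi"
    and dec: "!!s s'. 0 < s ==> s <= s' ==> s' < 1 ==> phi s' <= phi s"
  shows "(LINT s:{0<..<1}|lborel. phi s) / 2 <= (LINT s:{0<..<1}|lborel. (1 - s) * phi s)"
proof -
  have r: "set_integrable lborel {0<..<1} (%s. phi (1 - s))" using phi(3) by (simp add: set_integrable_reflect)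
  have m: "set_integrable lborel {0<..<1} (%s. (1 - s) * phi s)" by (rule triangle_integral(4)[OF phi])
  have rm: "set_integrable lborel {0<..<1} (%s. s * phi (1 - s))" using m set_integrable_reflect(1)[of "%s. (1 - s) * phi s"] by simp
  have "(LINT s:{0<..<1}|lborel. phi s) = ((LINT s:{0<..<1}|lborel. phi s) + (LINT s:{0<..<1}|lborel. phi (1 - s))) / 2"
    by (simp add: set_integrable_reflect)
  also have "\<dots> = (LINT s:{0<..<1}|lborel. phi s + phi (1 - s)) / 2" using set_integral_add(2)[OF phi(3) r] by simp
  also have "\<dots> = (LINT s:{0<..<1}|lborel. (phi s + phi (1 - s)) / 2)" by (simp add: set_integral_divide_zero)
  also have "\<dots> <= (LINT s:{0<..<1}|lborel. (1 - s) * phi s + s * phi (1 - s))"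
  proof (rule set_integral_mono)
    show "set_integrable lborel {0<..<1} (%s. (phi s + phi (1 - s)) / 2)" using set_integral_add(1)[OF phi(3) r] by (rule set_integrable_divide)
    show "set_integrable lborel {0<..<1} (%s. (1 - s) * phi s + s * phi (1 - s))" by (rule set_integral_add(1)[OF m rm])
    fix s :: real assume s: "s \<in> {0<..<1}"
    have "0 <= (1 / 2 - s) * (phi s - phi (1 - s))"
    proof (cases "s <= 1 / 2")
      case True then show ?thesis using dec[of s "1 - s"] s by (intro mult_nonneg_nonneg) auto
    next
      case False then show ?thesis using dec[of "1 - s" s] s by (intro mult_nonpos_nonpos) auto
    qed
    then show "(phi s + phi (1 - s)) / 2 <= (1 - s) * phi s + s * phi (1 - s)" by (simp add: field_simps)
  qed
  also have "\<dots> = (LINT s:{0<..<1}|lborel. (1 - s) * phi s) + (LINT s:{0<..<1}|lborel. s * phi (1 - s))"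
    by (rule set_integral_add(2)[OF m rm])
  also have "(LINT s:{0<..<1}|lborel. s * phi (1 - s)) = (LINT s:{0<..<1}|lborel. (1 - s) * phi s)"
    using set_integrable_reflect(2)[of "%s. (1 - s) * phi s"] by simp
  finally show ?thesis by linarith
qed

lemma ring_weight_eq:
  assumes p: "1 < p" "p < 2" and ring: "0 < eps" "0 < tau"
  shows "ring_weight p eps tau = (eps + tau) powr (2 - p) - eps powr (2 - p)"
    "set_integrable lborel {0<..<1} (%s. (eps + s * tau) powr (1 - p))"
    "ring_weight p eps tau = (2 - p) * (tau * (LINT s:{0<..<1}|lborel. (eps + s * tau) powr (1 - p)))"
proof -
  let ?F = "%t. t powr (2 - p) / (2 - p)"
  have d: "(?F has_real_derivative t powr (1 - p)) (at t)" if "0 < t" for t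
    using that p by (auto intro!: derivative_eq_intros)
  have "((%t. t powr (1 - p)) has_integral (?F (eps + tau) - ?F eps)) {eps..eps + tau}"
  proof (rule fundamental_theorem_of_calculus)
    fix t assume "t \<in> {eps..eps + tau}"
    then have "0 < t" using ring by simp
    from d[OF this] show "(?F has_vector_derivative t powr (1 - p)) (at t within {eps..eps + tau})"
      unfolding has_real_derivative_iff_has_vector_derivative[symmetric] by (rule has_field_derivative_at_within)
  qed (use ring in simp)
  then show w: "ring_weight p eps tau = (eps + tau) powr (2 - p) - eps powr (2 - p)"
    unfolding ring_weight_def using p by (simp add: integral_unique right_diff_distrib)
  have pos: "0 < eps + s * tau" if "0 <= s" for s using ring that by (simp add: add_pos_nonneg)
  show int: "set_integrable lborel {0<..<1} (%s. (eps + s * tau) powr (1 - p))"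
  proof (rule set_integrable_bounded_continuous[where C="eps powr (1 - p)"])
    show "continuous_on {0<..<1} (%s. (eps + s * tau) powr (1 - p))"
      by (intro continuous_intros ballI) (metis pos greaterThanLessThan_iff less_imp_le less_irrefl)
    show "\<bar>(eps + s * tau) powr (1 - p)\<bar> <= eps powr (1 - p)" if "s \<in> {0<..<1}" for s
      using that ring p by (auto intro!: powr_mono2')
  qed
  have "((%s. (eps + s * tau) powr (1 - p)) has_integral (?F (eps + 1 * tau) / tau - ?F (eps + 0 * tau) / tau)) {0..1}"
  proof (intro fundamental_theorem_of_calculus)
    fix s :: real assume "s \<in> {0..1}"
    then have s: "0 < eps + s * tau" using pos by simp
    have "((%s. ?F (eps + s * tau) / tau) has_real_derivative ((eps + s * tau) powr (1 - p) * tau) / tau) (at s)"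
      by (intro DERIV_cdivide DERIV_chain2[where g="%s. eps + s * tau", OF d[OF s]]) (auto intro!: derivative_eq_intros)
    then show "((%s. ?F (eps + s * tau) / tau) has_vector_derivative (eps + s * tau) powr (1 - p)) (at s within {0..1})"
      unfolding has_real_derivative_iff_has_vector_derivative[symmetric] using ring by (simp add: has_field_derivative_at_within)
  qed simp
  then have "((%s. (eps + s * tau) powr (1 - p)) has_integral (?F (eps + 1 * tau) / tau - ?F (eps + 0 * tau) / tau)) {0<..<1}"
    by (simp only: has_integral_Icc_iff_Ioo)
  then have "(LINT s:{0<..<1}|lborel. (eps + s * tau) powr (1 - p)) = ?F (eps + 1 * tau) / tau - ?F (eps + 0 * tau) / tau"
    using set_borel_integral_eq_integral(2)[OF int] by (simp add: integral_unique)
  then show "ring_weight p eps tau = (2 - p) * (tau * (LINT s:{0<..<1}|lborel. (eps + s * tau) powr (1 - p)))"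
    unfolding w using p ring by (simp add: right_diff_distrib)
qed

text \<open>Slenderness bounds eps*eta^2/tau. Conversely 1/N^2 <= 2*eta (from 2*sin >= (3/4)*(3/N)
  and 81/16 >= 4), so the bending term (eps/tau)/N^4 is at most 4*(19/100) < 1.\<close>

lemma mesh_error_bounded:
  fixes N :: nat
  assumes ring: "0 < eps" "0 < tau" "eps + tau <= 1" "2 <= N"
    and slender: "(eps + tau) * (1 - cos (pi / (2 * real N)))\<^sup>2 <= (19/100) * tau"
  shows "mesh_error eps tau N <= 3"
proof -
  define eta where "eta = 1 - cos (pi / (2 * real N))"
  note A = angle_bounds[OF ring(4), folded eta_def]
  have N: "2 <= real N" using ring by simp
  have "((3/4) * (3 / real N))\<^sup>2 <= (2 * sin (pi / (2 * real N)))\<^sup>2"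
  proof (rule power_mono)
    have "(3/4) * (3 / real N) <= (3/4) * (pi / real N)" using pi_gt3 by (intro mult_left_mono divide_right_mono) auto
    then show "(3/4) * (3 / real N) <= 2 * sin (pi / (2 * real N))" using A(8) by linarith
  qed simp
  also have "\<dots> = 4 * (eta * (2 - eta))" unfolding power_mult_distrib A(3) by simp
  also have "\<dots> <= 4 * (eta * 2)" using A(1) by (intro mult_left_mono) auto
  finally have "((3/4) * 3)\<^sup>2 * (1 / real N ^ 2) <= 8 * eta" by (simp add: power_divide)
  moreover have "4 * (1 / real N ^ 2) <= ((3/4) * 3)\<^sup>2 * (1 / real N ^ 2)"
    by (rule mult_right_mono) (simp_all add: power2_eq_square)
  ultimately have "1 / real N ^ 2 <= 2 * eta" by linarith
  then have "(1 / real N ^ 2)\<^sup>2 <= (2 * eta)\<^sup>2" by (rule power_mono) simp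
  then have N4: "1 / real N ^ 4 <= 4 * eta\<^sup>2" by (simp add: power_mult_distrib power_divide flip: power_mult)
  have "eps * eta\<^sup>2 <= (eps + tau) * eta\<^sup>2" using ring by (intro mult_right_mono) auto
  then have "eps * eta\<^sup>2 <= (19/100) * tau" using slender[folded eta_def] by linarith
  then have "eps / tau * eta\<^sup>2 <= 19/100" using ring by (simp add: divide_simps mult_ac)
  moreover have "eps / tau * (1 / real N ^ 4) <= eps / tau * (4 * eta\<^sup>2)" using N4 ring by (intro mult_left_mono) auto
  ultimately have "eps / tau * (1 / real N ^ 4) <= 1" by linarith
  moreover have "tau\<^sup>2 <= 1" using ring by (intro power_le_one) auto
  moreover have "1 / real N ^ 2 <= 1" using one_le_power[of "real N" 2] N by (simp add: divide_le_eq)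
  ultimately show ?thesis unfolding mesh_error_def by linarith
qed

section \<open>Structure of a layer\<close>

definition ring_cell :: "real => real => nat => elem set" where
  "ring_cell eps tau N = {elem_A eps tau N, elem_B eps tau N, elem_C eps tau N, elem_D eps tau N}"

text \<open>A layer is a set of node families, so summation over indices requires them to be
  distinct: the types are separated by the radii of their nodes, and the rotations of one type by
  the angle of N1 modulo 2*pi.\<close>

lemma rotated_cells_sum:
  fixes f :: "elem => real" and N :: nat
  assumes N: "0 < N" and fin: "finite Z" and f: "!!phi a. f (rot phi \<circ> a) = f a"
    and norms: "!!a b. a \<in> Z ==> b \<in> Z ==> (\<forall>i. norm (a i) = norm (b i)) ==> a = b"
    and axis: "!!a. a \<in> Z ==> \<exists>t>0. a N1 = polar t 0"
  shows "(\<Sum>a\<in>(\<Union>j<N. (%a. rot (off a + 2 * pi * real j / real N) \<circ> a) ` Z). f a) = real N * (\<Sum>a\<in>Z. f a)"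
proof -
  define F where "F = (%(j, a). rot (off a + 2 * pi * real j / real N) \<circ> a)"
  have img: "(\<Union>j<N. (%a. rot (off a + 2 * pi * real j / real N) \<circ> a) ` Z) = F ` ({..<N} \<times> Z)"
    by (auto simp: F_def image_iff)
  have "inj_on F ({..<N} \<times> Z)"
  proof (rule inj_onI, clarify)
    fix j k a b
    assume j: "j < N" and k: "k < N" and a: "a \<in> Z" and b: "b \<in> Z" and eq: "F (j, a) = F (k, b)"
    have "norm (a i) = norm (b i)" for i
      using fun_cong[OF eq, of i] by (simp add: F_def) (metis norm_rot)
    then have ab: "a = b" using norms[OF a b] by simp
    obtain t where t: "0 < t" "a N1 = polar t 0" using axis[OF a] by blast
    have "polar t (off a + 2 * pi * real j / real N) = polar t (off a + 2 * pi * real k / real N)"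
      using fun_cong[OF eq, of N1] t by (simp add: F_def ab[symmetric] rot_polar)
    then obtain n :: int where "off a + 2 * pi * real j / real N = off a + 2 * pi * real k / real N + 2 * pi * of_int n"
      using polar_inj t by blast
    then have "pi * (2 * real j) = pi * (2 * (real k + real_of_int n * real N))" using N by (simp add: field_simps)
    then have "2 * real j = 2 * (real k + real_of_int n * real N)" unfolding mult_cancel_left using pi_neq_zero by blast
    then have "real j = real k + real_of_int n * real N" unfolding distrib_left by linarith
    then have "real_of_int (int j) = real_of_int (int k + n * int N)" by simp
    then have "int j = int k + n * int N" by (simp only: of_int_eq_iff)
    then have "int j mod int N = int k mod int N" by simp
    then show "j = k & a = b" using j k ab by (simp flip: zmod_int)
  qed
  then have "(\<Sum>a\<in>F ` ({..<N} \<times> Z). f a) = (\<Sum>x\<in>{..<N} \<times> Z. f (F x))" by (simp add: sum.reindex)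
  also have "\<dots> = (\<Sum>(j, a)\<in>{..<N} \<times> Z. f a)" by (intro sum.cong) (auto simp: F_def f)
  also have "\<dots> = real N * (\<Sum>a\<in>Z. f a)" using fin by (simp add: sum.cartesian_product[symmetric])
  finally show ?thesis unfolding img .
qed

lemma ring_mesh_structure:
  assumes J: "ring_mesh J eps tau N"
  shows "finite J" "!!a. a \<in> J ==> \<exists>phi. \<exists>b\<in>ring_cell eps tau N. a = rot phi \<circ> b"
    "\<exists>phi. rot phi \<circ> elem_A eps tau N \<in> J"
    "\<exists>b. \<forall>f :: elem => real. (\<forall>phi a. f (rot phi \<circ> a) = f a) \<longrightarrow>
       (\<Sum>a\<in>J. f a) = real N * (f (elem_A eps tau N) + (if b then f (elem_B eps tau N) else f (elem_C eps tau N) + f (elem_D eps tau N)))"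
proof -
  let ?A = "elem_A eps tau N" and ?B = "elem_B eps tau N" and ?C = "elem_C eps tau N" and ?D = "elem_D eps tau N"
  have ring: "0 < eps" "0 < tau" "0 < N" using J by (auto simp: ring_mesh_def)
  obtain phi where "J = layer_AB eps tau N phi \<or> J = layer_ACD eps tau N phi" using J by (auto simp: ring_mesh_def)
  define off where "off a = (if a = ?A then phi else phi + pi / real N)" for a
  \<comment> \<open>The radii of the three vertices already separate the types within one
    layer.\<close>
  define n where "n a = (norm (a N1 :: real^2), norm (a N2 :: real^2), norm (a N3 :: real^2))" for a :: elem
  have ns: "n ?A = (eps, eps + tau, eps + tau)" "n ?B = (eps + tau, eps, eps)" "n ?C = (eps, eps + tau, eps)" "n ?D = (eps, eps, eps + tau)"
    using ring by (auto simp: n_def norm_polar)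
  have ne: "?A \<noteq> ?B" "?A \<noteq> ?C" "?A \<noteq> ?D" "?C \<noteq> ?D" "?B \<noteq> ?A" "?C \<noteq> ?A" "?D \<noteq> ?A" using ns ring by (metis less_add_same_cancel1 order_less_irrefl prod.inject)+
  define layer where "layer Z = (\<Union>j<N. (%a. rot (off a + 2 * pi * real j / real N) \<circ> a) ` Z)" for Z
  have "layer_AB eps tau N phi = layer {?A, ?B}" "layer_ACD eps tau N phi = layer {?A, ?C, ?D}"
    unfolding layer_AB_def layer_ACD_def layer_def using ne by (auto simp: off_def)
  then have JZ: "J = layer {?A, ?B} \<or> J = layer {?A, ?C, ?D}" using \<open>J = _ \<or> J = _\<close> by simp
  then show "finite J" by (auto simp: layer_def)
  show "\<exists>phi. \<exists>b\<in>ring_cell eps tau N. a = rot phi \<circ> b" if "a \<in> J" for a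
    using JZ that unfolding layer_def ring_cell_def by blast
  have "rot (off ?A + 2 * pi * real 0 / real N) \<circ> ?A \<in> J"
    using JZ ring(3) unfolding layer_def by blast
  then show "\<exists>phi. rot phi \<circ> ?A \<in> J" by blast
  have norms: "a = b" if "a \<in> {?A, ?C, ?D} & b \<in> {?A, ?C, ?D} \<or> a \<in> {?A, ?B} & b \<in> {?A, ?B}" "\<forall>i. norm (a i) = norm (b i)" for a b
  proof -
    have "n a = n b" using that(2) by (simp add: n_def)
    then show ?thesis using that(1) ring ns by auto
  qed
  have axis: "\<exists>t>0. a N1 = polar t 0" if "a \<in> {?A, ?B, ?C, ?D}" for a
    using that ring by (auto intro: exI[of _ eps] exI[of _ "eps + tau"])
  have sums: "(\<Sum>a\<in>layer {?A, ?B}. f a) = real N * (f ?A + f ?B)" "(\<Sum>a\<in>layer {?A, ?C, ?D}. f a) = real N * (f ?A + (f ?C + f ?D))"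
    if f: "\<forall>phi a. f (rot phi \<circ> a) = f a" for f :: "elem => real"
  proof -
    have "(\<Sum>a\<in>layer Z. f a) = real N * (\<Sum>a\<in>Z. f a)" if Z: "Z = {?A, ?B} \<or> Z = {?A, ?C, ?D}" for Z
      unfolding layer_def
    proof (rule rotated_cells_sum[OF ring(3)])
      show "finite Z" using Z by auto
      show "f (rot phi \<circ> a) = f a" for phi a using f by blast
      show "a = b" if "a \<in> Z" "b \<in> Z" "\<forall>i. norm (a i) = norm (b i)" for a b using norms[of a b] that Z by blast
      show "\<exists>t>0. a N1 = polar t 0" if "a \<in> Z" for a using axis[of a] that Z by blast
    qed
    then show "(\<Sum>a\<in>layer {?A, ?B}. f a) = real N * (f ?A + f ?B)" "(\<Sum>a\<in>layer {?A, ?C, ?D}. f a) = real N * (f ?A + (f ?C + f ?D))"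
      using ne by simp_all
  qed
  from JZ show "\<exists>b. \<forall>f :: elem => real. (\<forall>phi a. f (rot phi \<circ> a) = f a) \<longrightarrow>
       (\<Sum>a\<in>J. f a) = real N * (f ?A + (if b then f ?B else f ?C + f ?D))"
  proof
    assume "J = layer {?A, ?B}" then show ?thesis using sums(1) by (intro exI[of _ True]) simp
  next
    assume "J = layer {?A, ?C, ?D}" then show ?thesis using sums(2) by (intro exI[of _ False]) simp
  qed
qed

section \<open>Energies of one element\<close>

context cavity
begin

text \<open>Pulled-back energy densities on the reference triangle: the digit names the energy,
  \<open>v\<close> the interpolant and \<open>u\<close> the deformation. \<open>radial1\<close> and
  \<open>radial2\<close> are the corresponding ring densities including the factor t from polar
  coordinates.\<close>

definition "e1v p a x = estretch (cavity_map r) a x powr (p / 2) * edet a x powr (1 - p)"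
definition "e1u p a x = w1 p (norm (quad_map a x)) * edet a x"
definition "e2v g a x = g (evol (cavity_map r) a x / edet a x) * edet a x"
definition "e2u g a x = g (du (norm (quad_map a x))) * edet a x"

definition "radial1 p eps tau sg = w1 p (eps + sg * tau) * (eps + sg * tau)"
definition "radial2 g eps tau sg = g (du (eps + sg * tau)) * (eps + sg * tau)"

lemma density_continuous:
  assumes "volumetric_density g"
  shows "continuous_on {0<..1} (w1 p)" "continuous_on {0<..1} (%R. g (du R))"
proof -
  have pos: "0 < (r' R)\<^sup>2 + (r R / R)\<^sup>2" if "R \<in> {0<..1}" for R
    using r'_nonneg[OF that] by (simp add: add_pos_nonneg)
  show "continuous_on {0<..1} (w1 p)"
    unfolding w1_def[abs_def] by (intro continuous_intros profile_continuous) (use pos in force)+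
  have "continuous_on {0<..1} du"
    unfolding du_def[abs_def] by (intro continuous_intros profile_continuous) auto
  then show "continuous_on {0<..1} (%R. g (du R))"
  proof (rule continuous_on_compose2[OF volumetric_density_continuous[OF assms]])
    show "du ` {0<..1} \<subseteq> {0<..}" using du_bounds by (fastforce intro: less_le_trans)
  qed
qed

lemma radial_facts:
  assumes p: "1 < p" "p < 2" and g: "volumetric_density g" and ring: "0 < eps" "0 < tau" "eps + tau <= 1"
  shows "continuous_on {0<..<1} (radial1 p eps tau)" "continuous_on {0<..<1} (radial2 g eps tau)"
    "!!sg. sg \<in> {0<..<1} ==> 0 <= radial1 p eps tau sg" "!!sg. sg \<in> {0<..<1} ==> 0 <= radial2 g eps tau sg"
    "set_integrable lborel {0<..<1} (radial1 p eps tau)" "set_integrable lborel {0<..<1} (radial2 g eps tau)"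
    "!!sg. sg \<in> {0<..<1} ==> radial1 p eps tau sg <= (2 * B\<^sup>2) powr (p / 2) * (eps + sg * tau) powr (1 - p)"
proof -
  have im: "(%sg. eps + sg * tau) ` {0<..<1} \<subseteq> {0<..1}"
  proof clarify
    fix sg :: real assume "sg \<in> {0<..<1}"
    then have "0 < sg * tau" "sg * tau <= 1 * tau" using ring by (auto intro!: mult_right_mono)
    then show "eps + sg * tau \<in> {0<..1}" using ring unfolding greaterThanAtMost_iff mult_1 by linarith
  qed
  have c: "continuous_on {0<..<1} (%sg. eps + sg * tau)" by (intro continuous_intros)
  note dc = density_continuous[OF g]
  show c1: "continuous_on {0<..<1} (radial1 p eps tau)"
    unfolding radial1_def[abs_def] by (intro continuous_on_mult c continuous_on_compose2[OF dc(1) c im])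
  show c2: "continuous_on {0<..<1} (radial2 g eps tau)"
    unfolding radial2_def[abs_def] by (intro continuous_on_mult c continuous_on_compose2[OF dc(2) c im])
  have ab: "0 < m * c" "m * c <= M * B" using du_bounds[of 1] by auto
  obtain L U where LU: "0 < L" "0 < U" "!!x y. x \<in> {m * c..M * B} ==> y \<in> {m * c..M * B} ==> \<bar>g x - g y\<bar> <= L * \<bar>x - y\<bar>"
    "!!x. x \<in> {m * c..M * B} ==> 0 < g x & g x <= U"
    using volumetric_density_bounds[OF g ab] by metis
  have t: "eps + sg * tau \<in> {0<..1}" "eps <= eps + sg * tau" if "sg \<in> {0<..<1}" for sg
    using subsetD[OF im imageI[OF that]] that ring by simp_all
  have gU: "0 < g (du (eps + sg * tau)) & g (du (eps + sg * tau)) <= U" if "sg \<in> {0<..<1}" for sg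
    using du_bounds[OF t(1)[OF that]] by (intro LU(4)) auto
  show n1: "0 <= radial1 p eps tau sg" if "sg \<in> {0<..<1}" for sg using t[OF that] by (auto simp: radial1_def w1_def)
  show n2: "0 <= radial2 g eps tau sg" if "sg \<in> {0<..<1}" for sg using t[OF that] gU[OF that] by (auto simp: radial2_def)
  show b1: "radial1 p eps tau sg <= (2 * B\<^sup>2) powr (p / 2) * (eps + sg * tau) powr (1 - p)" if "sg \<in> {0<..<1}" for sg
  proof -
    let ?t = "eps + sg * tau"
    have "radial1 p eps tau sg <= ((2 * B\<^sup>2) powr (p / 2) * ?t powr (- p)) * ?t"
      unfolding radial1_def using w1_bounds(2)[OF t(1)[OF that], of p] p t[OF that] by (intro mult_right_mono) auto
    also have "\<dots> = (2 * B\<^sup>2) powr (p / 2) * ?t powr (1 - p)"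
      using powr_mult_base[of ?t "- p"] t(1)[OF that] by (simp add: mult_ac)
    finally show ?thesis .
  qed
  show "set_integrable lborel {0<..<1} (radial1 p eps tau)"
  proof (rule set_integrable_bounded_continuous[OF c1])
    fix sg :: real assume sg: "sg \<in> {0<..<1}"
    have "(eps + sg * tau) powr (1 - p) <= eps powr (1 - p)" using t(2)[OF sg] ring p by (intro powr_mono2') auto
    then have "(2 * B\<^sup>2) powr (p / 2) * (eps + sg * tau) powr (1 - p) <= (2 * B\<^sup>2) powr (p / 2) * eps powr (1 - p)" by (intro mult_left_mono) auto
    then show "\<bar>radial1 p eps tau sg\<bar> <= (2 * B\<^sup>2) powr (p / 2) * eps powr (1 - p)" using b1[OF sg] n1[OF sg] by linarith
  qed
  show "set_integrable lborel {0<..<1} (radial2 g eps tau)"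
  proof (rule set_integrable_bounded_continuous[OF c2])
    fix sg :: real assume sg: "sg \<in> {0<..<1}"
    have "radial2 g eps tau sg <= U * 1" unfolding radial2_def using gU[OF sg] t[OF sg] LU(2) by (intro mult_mono) auto
    then show "\<bar>radial2 g eps tau sg\<bar> <= U" using n2[OF sg] by linarith
  qed
qed

lemma quad_continuous:
  "continuous_on S (%x. dquad1 a x)" "continuous_on S (%x. dquad2 a x)"
  "continuous_on S (%x. wedge (dquad1 a x) (dquad2 a x))" "continuous_on S (edet a)" "continuous_on S (estretch u a)"
proof -
  show d: "continuous_on S (%x. dquad1 a x)" "continuous_on S (%x. dquad2 a x)" for a
    unfolding dquad1_def dquad2_def bary1_def by (intro continuous_intros)+
  show w: "continuous_on S (%x. wedge (dquad1 a x) (dquad2 a x))" for a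
    unfolding wedge_def by (intro continuous_intros d)
  show "continuous_on S (edet a)" unfolding edet_def[abs_def] by (intro continuous_intros w)
  show "continuous_on S (estretch u a)" unfolding estretch_def[abs_def] stretch_def by (intro continuous_intros d)
qed

lemma evol_over_edet: "edet a x \<noteq> 0 ==> evol u a x / edet a x = wedge (dquad1 (u \<circ> a) x) (dquad2 (u \<circ> a) x) / wedge (dquad1 a x) (dquad2 a x)"
  by (auto simp: evol_def edet_def sgn_if)

lemma energy_densities_continuous:
  assumes p: "1 < p" "p < 2" and g: "volumetric_density g"
    and pos: "!!x. x \<in> open_triangle ==> 0 < edet a x & norm (quad_map a x) \<in> {0<..1}"
  shows "continuous_on open_triangle (e1v p a)" "continuous_on open_triangle (e1u p a)" "continuous_on open_triangle (e2u g a)"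
    "continuous_on open_triangle (%x. evol u a x / edet a x)"
    "(!!x. x \<in> open_triangle ==> 0 < evol (cavity_map r) a x / edet a x) ==> continuous_on open_triangle (e2v g a)"
proof -
  have s0: "0 <= estretch (cavity_map r) a x" for x by (simp add: estretch_def stretch_nonneg)
  show "continuous_on open_triangle (e1v p a)"
    unfolding e1v_def[abs_def]
  proof (intro continuous_on_mult continuous_on_powr' quad_continuous continuous_on_const ballI)
    fix x assume "x \<in> open_triangle"
    then have "0 < edet a x" using pos by blast
    then show "0 <= edet a x & (edet a x = 0 \<longrightarrow> 0 < 1 - p)" by simp
  qed (use s0 p in auto)
  have nc: "continuous_on open_triangle (%x. norm (quad_map a x))" by (intro continuous_on_norm quad_map_continuous_on)
  have im: "(%x. norm (quad_map a x)) ` open_triangle \<subseteq> {0<..1}" using pos by auto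
  show "continuous_on open_triangle (e1u p a)" "continuous_on open_triangle (e2u g a)"
    unfolding e1u_def[abs_def] e2u_def[abs_def]
    by (intro continuous_on_mult quad_continuous continuous_on_compose2[OF density_continuous(1)[OF g] nc im]
        continuous_on_compose2[OF density_continuous(2)[OF g] nc im])+
  have nz: "wedge (dquad1 a x) (dquad2 a x) \<noteq> 0" if "x \<in> open_triangle" for x
    using pos[OF that] by (auto simp: edet_def)
  show q: "continuous_on open_triangle (%x. evol u a x / edet a x)" for u
  proof -
    have "continuous_on open_triangle (%x. wedge (dquad1 (u \<circ> a) x) (dquad2 (u \<circ> a) x) / wedge (dquad1 a x) (dquad2 a x))"
      by (intro continuous_on_divide quad_continuous) (use nz in blast)
    moreover have "evol u a x / edet a x = wedge (dquad1 (u \<circ> a) x) (dquad2 (u \<circ> a) x) / wedge (dquad1 a x) (dquad2 a x)"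
      if "x \<in> open_triangle" for x by (rule evol_over_edet) (use pos[OF that] in simp)
    ultimately show ?thesis by (simp cong: continuous_on_cong)
  qed
  show "continuous_on open_triangle (e2v g a)" if "!!x. x \<in> open_triangle ==> 0 < evol (cavity_map r) a x / edet a x"
    unfolding e2v_def[abs_def]
    by (intro continuous_on_mult quad_continuous continuous_on_compose2[OF volumetric_density_continuous[OF g] q]) (use that in auto)
qed

text \<open>The weight \<open>b\<close> is tied to the density of s: \<open>gam * b <= 2\<close>
  makes weighted errors integrate like unweighted ones, and the bound for t*b is what the volume
  error needs.\<close>

definition ring_element :: "real => real => real => nat => real => (real^2 => real) => (real => real) => (real => real) => elem => bool" where
  "ring_element K eps tau N n s gam b a \<longleftrightarrow> 0 < eps & 0 < tau & eps + tau <= 1 & 2 <= N & 3 <= K & mesh_error eps tau N <= 3 & 1 <= n & n <= 2 &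
     model_element K eps tau N n (%x. eps + s x * tau) (%x. b (s x)) a & coordinate_density s gam & continuous_on {0<..<1} b &
     (\<forall>sg\<in>{0<..<1}. 1 <= b sg & gam sg * b sg <= 2 & (eps + sg * tau) * b sg <= 2 * (eps + tau))"

lemma ring_elementD:
  assumes "ring_element K eps tau N n s gam b a"
  shows "0 < eps" "0 < tau" "eps + tau <= 1" "2 <= N" "3 <= K" "mesh_error eps tau N <= 3" "1 <= n" "n <= 2" "coordinate_density s gam"
    "0 < pi / real N * tau" "0 < mesh_error eps tau N" "mesh_error eps tau N <= K"
    and "!!x. x \<in> open_triangle ==> s x \<in> {0<..<1} & eps + s x * tau \<in> {0<..1} & norm (quad_map a x) \<in> {0<..1} & 1 <= b (s x) & (eps + s x * tau) * b (s x) <= 2 * (eps + tau)"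
    and "!!x. x \<in> open_triangle ==> eps <= eps + s x * tau & eps + s x * tau <= eps + tau & norm (quad_map a x) <= eps + tau & (eps + s x * tau) / K <= norm (quad_map a x) &
     \<bar>norm (quad_map a x) - (eps + s x * tau)\<bar> <= K * mesh_error eps tau N * (eps + s x * tau) & 0 < edet a x &
     \<bar>edet a x - n * (pi / real N * tau) * (eps + s x * tau)\<bar> <= K * (pi / real N * tau) * (eps + s x * tau) * mesh_error eps tau N * b (s x) &
     \<bar>estretch (cavity_map r) a x - (n * (pi / real N * tau))\<^sup>2 * Zr (eps + s x * tau)\<bar> <= K * (pi / real N * tau)\<^sup>2 * mesh_error eps tau N &
     \<bar>evol (cavity_map r) a x - n * (pi / real N * tau) * r' (eps + s x * tau) * r (eps + s x * tau)\<bar> <= K * (pi / real N * volume_error eps tau N)"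
proof -
  note h = assms[unfolded ring_element_def]
  show b: "0 < eps" "0 < tau" "eps + tau <= 1" "2 <= N" "3 <= K" "mesh_error eps tau N <= 3" "1 <= n" "n <= 2" "coordinate_density s gam"
    using h by blast+
  show "0 < pi / real N * tau" using b by simp
  show "0 < mesh_error eps tau N" by (rule error_bounds(5)[OF b(1-4)])
  show "mesh_error eps tau N <= K" using b by linarith
  have m: "model_element K eps tau N n (%x. eps + s x * tau) (%x. b (s x)) a" using h by blast
  show E: "eps <= eps + s x * tau & eps + s x * tau <= eps + tau & norm (quad_map a x) <= eps + tau & (eps + s x * tau) / K <= norm (quad_map a x) &
     \<bar>norm (quad_map a x) - (eps + s x * tau)\<bar> <= K * mesh_error eps tau N * (eps + s x * tau) & 0 < edet a x &
     \<bar>edet a x - n * (pi / real N * tau) * (eps + s x * tau)\<bar> <= K * (pi / real N * tau) * (eps + s x * tau) * mesh_error eps tau N * b (s x) &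
     \<bar>estretch (cavity_map r) a x - (n * (pi / real N * tau))\<^sup>2 * Zr (eps + s x * tau)\<bar> <= K * (pi / real N * tau)\<^sup>2 * mesh_error eps tau N &
     \<bar>evol (cavity_map r) a x - n * (pi / real N * tau) * r' (eps + s x * tau) * r (eps + s x * tau)\<bar> <= K * (pi / real N * volume_error eps tau N)"
    if "x \<in> open_triangle" for x using m that unfolding model_element_def by blast
  show "s x \<in> {0<..<1} & eps + s x * tau \<in> {0<..1} & norm (quad_map a x) \<in> {0<..1} & 1 <= b (s x) & (eps + s x * tau) * b (s x) <= 2 * (eps + tau)"
    if x: "x \<in> open_triangle" for x
  proof -
    have s: "s x \<in> {0<..<1}" using b(9) x unfolding coordinate_density_def by blast
    have t: "0 < eps + s x * tau" "eps + s x * tau <= 1" using E[OF x] b by linarith+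
    then have "0 < (eps + s x * tau) / K" using b by simp
    then have "0 < norm (quad_map a x)" "norm (quad_map a x) <= 1" using E[OF x] b by linarith+
    then show ?thesis using s t h by auto
  qed
qed

lemma ring_element_continuous:
  assumes "ring_element K eps tau N n s gam b a" "1 < p" "p < 2" "volumetric_density g"
  shows "continuous_on open_triangle (e1v p a)" "continuous_on open_triangle (e1u p a)" "continuous_on open_triangle (e2u g a)"
    "continuous_on open_triangle (%x. evol u a x / edet a x)"
    "(!!x. x \<in> open_triangle ==> 0 < evol (cavity_map r) a x / edet a x) ==> continuous_on open_triangle (e2v g a)"
proof -
  have "0 < edet a x & norm (quad_map a x) \<in> {0<..1}" if "x \<in> open_triangle" for x
    using ring_elementD(13,14)[OF assms(1) that] by blast
  note E = energy_densities_continuous[OF assms(2-4) this]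
  show "continuous_on open_triangle (e1v p a)" "continuous_on open_triangle (e1u p a)" "continuous_on open_triangle (e2u g a)"
    "continuous_on open_triangle (%x. evol u a x / edet a x)" by (rule E; assumption)+
  show "continuous_on open_triangle (e2v g a)" if "!!x. x \<in> open_triangle ==> 0 < evol (cavity_map r) a x / edet a x"
    by (rule E(5)[OF _ that])
qed

lemma error_density:
  assumes "ring_element K eps tau N n s gam b a" "1 < p" "p < 2"
  shows "continuous_on {0<..<1} (%sg. (eps + sg * tau) powr (1 - p) * b sg)"
    "!!sg. sg \<in> {0<..<1} ==> 0 <= (eps + sg * tau) powr (1 - p) * b sg"
    "set_integrable lborel {0<..<1} (%sg. (eps + sg * tau) powr (1 - p) * b sg)"
    "(LINT sg:{0<..<1}|lborel. gam sg * ((eps + sg * tau) powr (1 - p) * b sg)) <= 2 * (LINT sg:{0<..<1}|lborel. (eps + sg * tau) powr (1 - p))"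
proof -
  note h = ring_elementD[OF assms(1)]
  have b: "continuous_on {0<..<1} b" "!!sg. sg \<in> {0<..<1} ==> 1 <= b sg & gam sg * b sg <= 2 & (eps + sg * tau) * b sg <= 2 * (eps + tau)"
    using assms(1) unfolding ring_element_def by blast+
  have t: "eps <= eps + sg * tau" "0 < eps + sg * tau" if "sg \<in> {0<..<1}" for sg
    using that h(1,2) by (auto simp: add_pos_pos)
  show 1: "continuous_on {0<..<1} (%sg. (eps + sg * tau) powr (1 - p) * b sg)"
    by (intro continuous_intros b ballI) (metis t(2) less_irrefl)
  show 2: "0 <= (eps + sg * tau) powr (1 - p) * b sg" if "sg \<in> {0<..<1}" for sg using b(2)[OF that] by simp
  show 3: "set_integrable lborel {0<..<1} (%sg. (eps + sg * tau) powr (1 - p) * b sg)"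
  proof (rule set_integrable_bounded_continuous[OF 1])
    fix sg :: real assume sg: "sg \<in> {0<..<1}"
    have "eps * b sg <= (eps + sg * tau) * b sg" using t[OF sg] b(2)[OF sg] by (intro mult_right_mono) auto
    then have "eps * b sg <= 2 * (eps + tau)" using b(2)[OF sg] by linarith
    then have "b sg <= 2 * (eps + tau) / eps" using h(1) by (simp add: field_simps)
    moreover have "(eps + sg * tau) powr (1 - p) <= eps powr (1 - p)" using t[OF sg] h(1) assms by (intro powr_mono2') auto
    ultimately have "(eps + sg * tau) powr (1 - p) * b sg <= eps powr (1 - p) * (2 * (eps + tau) / eps)"
      using b(2)[OF sg] by (intro mult_mono) auto
    then show "\<bar>(eps + sg * tau) powr (1 - p) * b sg\<bar> <= eps powr (1 - p) * (2 * (eps + tau) / eps)" using 2[OF sg] by linarith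
  qed
  have i: "set_integrable lborel {0<..<1} (%sg. (eps + sg * tau) powr (1 - p))" by (rule ring_weight_eq(2)[OF assms(2,3) h(1,2)])
  have "(LINT sg:{0<..<1}|lborel. gam sg * ((eps + sg * tau) powr (1 - p) * b sg)) <= (LINT sg:{0<..<1}|lborel. 2 * (eps + sg * tau) powr (1 - p))"
  proof (rule set_integral_mono)
    show "set_integrable lborel {0<..<1} (%sg. gam sg * ((eps + sg * tau) powr (1 - p) * b sg))"
      using h(9) 1 2 3 unfolding coordinate_density_def by blast
    show "set_integrable lborel {0<..<1} (%sg. 2 * (eps + sg * tau) powr (1 - p))" using i by (auto intro: set_integrable_mult_right)
    fix sg :: real assume sg: "sg \<in> {0<..<1}"
    have "(gam sg * b sg) * (eps + sg * tau) powr (1 - p) <= 2 * (eps + sg * tau) powr (1 - p)" using b(2)[OF sg] by (intro mult_right_mono) auto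
    then show "gam sg * ((eps + sg * tau) powr (1 - p) * b sg) <= 2 * (eps + sg * tau) powr (1 - p)" by (simp add: mult_ac)
  qed
  then show "(LINT sg:{0<..<1}|lborel. gam sg * ((eps + sg * tau) powr (1 - p) * b sg)) <= 2 * (LINT sg:{0<..<1}|lborel. (eps + sg * tau) powr (1 - p))"
    by simp
qed

lemma element_energy_close:
  assumes R: "ring_element K eps tau N n s gam b a" and p: "1 < p" "p < 2" and C: "0 < C"
    and F: "continuous_on open_triangle F" and W: "continuous_on {0<..<1} W" "!!sg. sg \<in> {0<..<1} ==> 0 <= W sg" "set_integrable lborel {0<..<1} W"
    and le: "!!x. x \<in> open_triangle ==> \<bar>F x - n * (pi / real N * tau) * W (s x)\<bar> <= C * ((pi / real N * tau) * (eps + s x * tau) powr (1 - p) * mesh_error eps tau N * b (s x))"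
  shows "set_integrable lebesgue open_triangle F"
    "\<bar>(LINT x:open_triangle|lebesgue. F x) - n * (pi / real N * tau) * (LINT sg:{0<..<1}|lborel. gam sg * W sg)\<bar>
       <= 2 * C * ((pi / real N * tau) * mesh_error eps tau N * (LINT sg:{0<..<1}|lborel. (eps + sg * tau) powr (1 - p)))"
proof -
  note h = ring_elementD[OF R] and e = error_density[OF R p]
  let ?l = "C * ((pi / real N * tau) * mesh_error eps tau N)"
  have "\<bar>F x - n * (pi / real N * tau) * W (s x)\<bar> <= ?l * ((eps + s x * tau) powr (1 - p) * b (s x))" if "x \<in> open_triangle" for x
    using le[OF that] by (simp only: mult_ac)
  note c = pushforward_comparison[OF h(9) F W e(1-3) this]
  show "set_integrable lebesgue open_triangle F" by (rule c(1))
  have "?l * (LINT sg:{0<..<1}|lborel. gam sg * ((eps + sg * tau) powr (1 - p) * b sg)) <= ?l * (2 * (LINT sg:{0<..<1}|lborel. (eps + sg * tau) powr (1 - p)))"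
    by (rule mult_left_mono[OF e(4) less_imp_le[OF mult_pos_pos[OF C mult_pos_pos[OF h(10,11)]]]])
  also have "\<dots> = 2 * C * ((pi / real N * tau) * mesh_error eps tau N * (LINT sg:{0<..<1}|lborel. (eps + sg * tau) powr (1 - p)))" by (simp only: mult_ac)
  finally show "\<bar>(LINT x:open_triangle|lebesgue. F x) - n * (pi / real N * tau) * (LINT sg:{0<..<1}|lborel. gam sg * W sg)\<bar>
       <= 2 * C * ((pi / real N * tau) * mesh_error eps tau N * (LINT sg:{0<..<1}|lborel. (eps + sg * tau) powr (1 - p)))"
    using c(2) by linarith
qed

lemma nondegenerate_interpolant_energy:
  assumes p: "1 < p" "p < 2" and K: "3 <= K"
  obtains C where "0 < C" "!!eps tau N n s gam b a. ring_element K eps tau N n s gam b a ==> nondegenerate K eps tau N (%x. eps + s x * tau) a ==>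
    volumetric_density g ==> set_integrable lebesgue open_triangle (e1v p a) &
    \<bar>(LINT x:open_triangle|lebesgue. e1v p a x) - n * (pi / real N * tau) * (LINT sg:{0<..<1}|lborel. gam sg * radial1 p eps tau sg)\<bar>
       <= C * ((pi / real N * tau) * mesh_error eps tau N * (LINT sg:{0<..<1}|lborel. (eps + sg * tau) powr (1 - p)))"
proof -
  have K1: "1 <= K" using K by simp
  obtain C where C: "0 < C" "!!th n t bt Psi D X. 0 < th ==> 1 <= n ==> n <= 2 ==> t \<in> {0<..1} ==> 1 <= bt ==> 0 <= Psi ==>
      \<bar>D - n * th * t\<bar> <= K * th * t * Psi * bt ==> th * t / K <= D ==>
      0 <= X ==> \<bar>X - (n * th)\<^sup>2 * Zr t\<bar> <= K * th\<^sup>2 * Psi ==>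
      \<bar>X powr (p / 2) * D powr (1 - p) - n * th * (w1 p t * t)\<bar> <= C * (th * t powr (1 - p) * Psi * bt)"
    by (rule interpolant_density_close[OF p K1]) (rule that)
  show thesis
  proof (rule that[of "2 * C"])
    show "0 < 2 * C" using C by simp
    fix eps tau N n s gam b a
    assume R: "ring_element K eps tau N n s gam b a" and nd: "nondegenerate K eps tau N (%x. eps + s x * tau) a" and g: "volumetric_density g"
    note h = ring_elementD[OF R] and c = ring_element_continuous[OF R p g] and W = radial_facts[OF p g h(1-3)]
    have le: "\<bar>e1v p a x - n * (pi / real N * tau) * radial1 p eps tau (s x)\<bar>
        <= C * ((pi / real N * tau) * (eps + s x * tau) powr (1 - p) * mesh_error eps tau N * b (s x))" if x: "x \<in> open_triangle" for x
      unfolding e1v_def radial1_def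
      by (rule C(2)[OF h(10,7,8) _ _ less_imp_le[OF h(11)]])
        (use h(13,14)[OF x] nd[unfolded nondegenerate_def] x in \<open>auto simp: estretch_def stretch_nonneg\<close>)
    show "set_integrable lebesgue open_triangle (e1v p a) &
      \<bar>(LINT x:open_triangle|lebesgue. e1v p a x) - n * (pi / real N * tau) * (LINT sg:{0<..<1}|lborel. gam sg * radial1 p eps tau sg)\<bar>
       <= 2 * C * ((pi / real N * tau) * mesh_error eps tau N * (LINT sg:{0<..<1}|lborel. (eps + sg * tau) powr (1 - p)))"
      using element_energy_close[OF R p C(1) c(1) W(1,3,5) le] by blast
  qed
qed

lemma deformation_energy:
  assumes p: "1 < p" "p < 2" and K: "3 <= K" and g: "volumetric_density g"
  obtains C where "0 < C" "!!eps tau N n s gam b a. ring_element K eps tau N n s gam b a ==>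
    set_integrable lebesgue open_triangle (e1u p a) & set_integrable lebesgue open_triangle (e2u g a) &
    \<bar>(LINT x:open_triangle|lebesgue. e1u p a x) - n * (pi / real N * tau) * (LINT sg:{0<..<1}|lborel. gam sg * radial1 p eps tau sg)\<bar>
       <= C * ((pi / real N * tau) * mesh_error eps tau N * (LINT sg:{0<..<1}|lborel. (eps + sg * tau) powr (1 - p))) &
    \<bar>(LINT x:open_triangle|lebesgue. e2u g a x) - n * (pi / real N * tau) * (LINT sg:{0<..<1}|lborel. gam sg * radial2 g eps tau sg)\<bar>
       <= C * ((pi / real N * tau) * mesh_error eps tau N * (LINT sg:{0<..<1}|lborel. (eps + sg * tau) powr (1 - p)))"
proof -
  have K1: "1 <= K" using K by simp
  obtain C1 where C1: "0 < C1" "!!th n t rho bt Psi D. 0 < th ==> 1 <= n ==> n <= 2 ==> t \<in> {0<..1} ==> rho \<in> {0<..1} ==> 1 <= bt ==>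
      0 <= Psi ==> Psi <= K ==> \<bar>D - n * th * t\<bar> <= K * th * t * Psi * bt ==> t / K <= rho ==> \<bar>rho - t\<bar> <= K * Psi * t ==>
      \<bar>w1 p rho * D - n * th * (w1 p t * t)\<bar> <= C1 * (th * t powr (1 - p) * Psi * bt)"
    by (rule deformation_density_close[OF p K1]) (rule that)
  obtain C2 where C2: "0 < C2" "!!th n t rho bt Psi D. 0 < th ==> 1 <= n ==> n <= 2 ==> t \<in> {0<..1} ==> rho \<in> {0<..1} ==> 1 <= bt ==>
      0 <= Psi ==> Psi <= K ==> \<bar>D - n * th * t\<bar> <= K * th * t * Psi * bt ==> \<bar>rho - t\<bar> <= K * Psi * t ==>
      \<bar>g (du rho) * D - n * th * (g (du t) * t)\<bar> <= C2 * (th * t * Psi * bt)"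
    using volume_density_close[OF g K1 zero_less_one] by (metis (no_types, lifting))
  define C where "C = C1 + C2"
  have C: "0 < C" "C1 <= C" "C2 <= C" using C1 C2 by (auto simp: C_def)
  show thesis
  proof (rule that[of "2 * C"])
    show "0 < 2 * C" using C by simp
    fix eps tau N n s gam b a
    assume R: "ring_element K eps tau N n s gam b a"
    note h = ring_elementD[OF R] and c = ring_element_continuous[OF R p g] and W = radial_facts[OF p g h(1-3)]
    have nn: "0 <= (pi / real N * tau) * (eps + s x * tau) powr (1 - p) * mesh_error eps tau N * b (s x)" if "x \<in> open_triangle" for x
      using h(2,10,11) h(13)[OF that] by (intro mult_nonneg_nonneg) auto
    have le1: "\<bar>e1u p a x - n * (pi / real N * tau) * radial1 p eps tau (s x)\<bar>
        <= C * ((pi / real N * tau) * (eps + s x * tau) powr (1 - p) * mesh_error eps tau N * b (s x))" if x: "x \<in> open_triangle" for x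
    proof -
      have "\<bar>e1u p a x - n * (pi / real N * tau) * radial1 p eps tau (s x)\<bar>
          <= C1 * ((pi / real N * tau) * (eps + s x * tau) powr (1 - p) * mesh_error eps tau N * b (s x))"
        unfolding e1u_def radial1_def
        by (rule C1(2)[OF h(10,7,8) _ _ _ less_imp_le[OF h(11)] h(12)]) (use h(13,14)[OF x] in auto)
      also have "\<dots> <= C * ((pi / real N * tau) * (eps + s x * tau) powr (1 - p) * mesh_error eps tau N * b (s x))"
        by (rule mult_right_mono[OF C(2) nn[OF x]])
      finally show ?thesis .
    qed
    have le2: "\<bar>e2u g a x - n * (pi / real N * tau) * radial2 g eps tau (s x)\<bar>
        <= C * ((pi / real N * tau) * (eps + s x * tau) powr (1 - p) * mesh_error eps tau N * b (s x))" if x: "x \<in> open_triangle" for x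
    proof -
      have t: "eps + s x * tau \<in> {0<..1}" using h(13)[OF x] by blast
      have "(eps + s x * tau) powr 1 <= (eps + s x * tau) powr (1 - p)" using t p by (intro powr_mono') auto
      then have t1: "eps + s x * tau <= (eps + s x * tau) powr (1 - p)" using t by simp
      have "\<bar>e2u g a x - n * (pi / real N * tau) * radial2 g eps tau (s x)\<bar>
          <= C2 * ((pi / real N * tau) * (eps + s x * tau) * mesh_error eps tau N * b (s x))"
        unfolding e2u_def radial2_def
        by (rule C2(2)[OF h(10,7,8) _ _ _ less_imp_le[OF h(11)] h(12)]) (use h(13,14)[OF x] in auto)
      also have "\<dots> <= C2 * ((pi / real N * tau) * (eps + s x * tau) powr (1 - p) * mesh_error eps tau N * b (s x))"
        using t1 C2(1) h(2,10,11) h(13)[OF x] by (intro mult_left_mono mult_right_mono) auto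
      also have "\<dots> <= C * ((pi / real N * tau) * (eps + s x * tau) powr (1 - p) * mesh_error eps tau N * b (s x))"
        by (rule mult_right_mono[OF C(3) nn[OF x]])
      finally show ?thesis .
    qed
    show "set_integrable lebesgue open_triangle (e1u p a) & set_integrable lebesgue open_triangle (e2u g a) &
      \<bar>(LINT x:open_triangle|lebesgue. e1u p a x) - n * (pi / real N * tau) * (LINT sg:{0<..<1}|lborel. gam sg * radial1 p eps tau sg)\<bar>
         <= 2 * C * ((pi / real N * tau) * mesh_error eps tau N * (LINT sg:{0<..<1}|lborel. (eps + sg * tau) powr (1 - p))) &
      \<bar>(LINT x:open_triangle|lebesgue. e2u g a x) - n * (pi / real N * tau) * (LINT sg:{0<..<1}|lborel. gam sg * radial2 g eps tau sg)\<bar>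
         <= 2 * C * ((pi / real N * tau) * mesh_error eps tau N * (LINT sg:{0<..<1}|lborel. (eps + sg * tau) powr (1 - p)))"
      using element_energy_close[OF R p C(1) c(2) W(1,3,5) le1] element_energy_close[OF R p C(1) c(3) W(2,4,6) le2] by blast
  qed
qed

text \<open>The mesh error need not be small, so a lower bound cannot come from closeness to the
  model. It is read off pointwise from rho <= (1 + K*K)*t and the Jacobian bound; the density 1 - s
  favours small radii, where t^(1-p) is largest.\<close>

lemma deformation_energy_lower:
  assumes p: "1 < p" "p < 2" and K: "3 <= K" and g: "volumetric_density g"
  obtains C where "0 < C" "!!eps tau N n s b a. ring_element K eps tau N n s (%sg. 1 - sg) b a ==> nondegenerate K eps tau N (%x. eps + s x * tau) a ==>
    set_integrable lebesgue open_triangle (e1u p a) ==>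
    C * ((pi / real N * tau) * (LINT sg:{0<..<1}|lborel. (eps + sg * tau) powr (1 - p))) <= (LINT x:open_triangle|lebesgue. e1u p a x)"
proof (rule that[of "c powr p * (1 + K * K) powr (- p) / K / 2"])
  have "0 < 1 + K * K" by (simp add: add_pos_nonneg)
  then show "0 < c powr p * (1 + K * K) powr (- p) / K / 2" using c(1) K by simp
  fix eps tau :: real and N :: nat and n s b a
  assume R: "ring_element K eps tau N n s (%sg. 1 - sg) b a" and nd: "nondegenerate K eps tau N (%x. eps + s x * tau) a"
    and int: "set_integrable lebesgue open_triangle (e1u p a)"
  note h = ring_elementD[OF R]
  let ?phi = "%sg. (eps + sg * tau) powr (1 - p)"
  define k where "k = c powr p * (1 + K * K) powr (- p) / K * (pi / real N * tau)"
  have k0: "0 <= k"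
    unfolding k_def by (rule mult_nonneg_nonneg[OF divide_nonneg_nonneg less_imp_le[OF h(10)]]) (use K in auto)
  have t: "eps <= eps + sg * tau" "0 < eps + sg * tau" if "sg \<in> {0<..<1}" for sg
    using that h(1,2) by (auto simp: add_pos_pos)
  have phi: "continuous_on {0<..<1} ?phi" by (intro continuous_intros ballI) (metis t(2) less_irrefl)
  note i = ring_weight_eq(2)[OF p h(1,2)]
  have "k * ?phi (s x) <= e1u p a x" if x: "x \<in> open_triangle" for x
  proof -
    let ?t = "eps + s x * tau" and ?rho = "norm (quad_map a x)"
    have t: "?t \<in> {0<..1}" and rho: "?rho \<in> {0<..1}" using h(13)[OF x] by blast+
    have "K * mesh_error eps tau N * ?t <= K * K * ?t" using h(12) K t by (intro mult_right_mono mult_left_mono) auto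
    moreover have "\<bar>?rho - ?t\<bar> <= K * mesh_error eps tau N * ?t" using h(14)[OF x] by blast
    ultimately have "?rho <= ?t + K * K * ?t" by linarith
    then have "?rho <= (1 + K * K) * ?t" by (simp only: distrib_right mult_1)
    then have "((1 + K * K) * ?t) powr (- p) <= ?rho powr (- p)" using rho p by (intro powr_mono2') auto
    then have "(1 + K * K) powr (- p) * ?t powr (- p) <= ?rho powr (- p)" using t K by (simp add: powr_mult)
    then have "c powr p * ((1 + K * K) powr (- p) * ?t powr (- p)) <= c powr p * ?rho powr (- p)" by (rule mult_left_mono) simp
    then have w: "c powr p * ((1 + K * K) powr (- p) * ?t powr (- p)) <= w1 p ?rho" using w1_bounds(1)[OF rho, of p] p by linarith
    have D: "pi / real N * tau * ?t / K <= edet a x" using nd x unfolding nondegenerate_def by blast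
    have "k * ?phi (s x) = (c powr p * ((1 + K * K) powr (- p) * ?t powr (- p))) * (pi / real N * tau * ?t / K)"
      using powr_mult_base[of ?t "- p"] t by (simp add: k_def mult_ac)
    also have "\<dots> <= w1 p ?rho * edet a x"
      by (rule mult_mono[OF w D]) (use h(2,10) t K in \<open>auto simp: w1_def\<close>)
    finally show ?thesis by (simp add: e1u_def)
  qed
  then have "k * (LINT sg:{0<..<1}|lborel. (1 - sg) * ?phi sg) <= (LINT x:open_triangle|lebesgue. e1u p a x)"
    by (intro pushforward_lower_bound[OF h(9) int phi _ i]) auto
  moreover have "k * ((LINT sg:{0<..<1}|lborel. ?phi sg) / 2) <= k * (LINT sg:{0<..<1}|lborel. (1 - sg) * ?phi sg)"
  proof (rule mult_left_mono[OF _ k0], rule decreasing_first_moment[OF phi _ i])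
    fix s1 s2 :: real assume "0 < s1" "s1 <= s2" "s2 < 1"
    then show "?phi s2 <= ?phi s1" using t(2)[of s1] h(2) p by (intro powr_mono2') (auto intro: mult_right_mono)
  qed simp
  moreover have "k * ((LINT sg:{0<..<1}|lborel. ?phi sg) / 2) = c powr p * (1 + K * K) powr (- p) / K / 2 * ((pi / real N * tau) * (LINT sg:{0<..<1}|lborel. ?phi sg))"
    by (simp add: k_def)
  ultimately show "c powr p * (1 + K * K) powr (- p) / K / 2 * ((pi / real N * tau) * (LINT sg:{0<..<1}|lborel. ?phi sg)) <= (LINT x:open_triangle|lebesgue. e1u p a x)"
    by linarith
qed

text \<open>No pointwise closeness is claimed: the energy and its model value are each at most a
  constant times th*I, and 1 <= K * mesh_error. The energy is integrable because the Jacobian is at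
  least a multiple of x1*x2.\<close>

lemma degenerate_interpolant_energy:
  assumes p: "1 < p" "p < 2" and K: "3 <= K"
  obtains C where "0 < C" "!!eps tau N n s gam b a. ring_element K eps tau N n s gam b a ==> degenerate K eps tau N a ==>
    volumetric_density g ==> set_integrable lebesgue open_triangle (e1v p a) &
    \<bar>(LINT x:open_triangle|lebesgue. e1v p a x) - n * (pi / real N * tau) * (LINT sg:{0<..<1}|lborel. gam sg * radial1 p eps tau sg)\<bar>
       <= C * ((pi / real N * tau) * mesh_error eps tau N * (LINT sg:{0<..<1}|lborel. (eps + sg * tau) powr (1 - p)))"
proof -
  define H where "H = 8 * B\<^sup>2 + K * K"
  define H1 where "H1 = (2 * B\<^sup>2) powr (p / 2)"
  define L where "L = H powr (p / 2) * (1 / K) powr (1 - p)"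
  define C0 where "C0 = L * (1 / (1 + (1 - p))\<^sup>2) + 2 * H1"
  have H: "0 < H" using K B_pos by (simp add: H_def add_pos_pos)
  then have pos: "0 < H" "0 < L" "0 < H1" using K B_pos by (auto simp: L_def H1_def)
  have "0 <= L * (1 / (1 + (1 - p))\<^sup>2)" using pos by simp
  then have C0: "0 < C0" unfolding C0_def using pos by linarith
  show thesis
  proof (rule that[of "C0 * K"])
    show "0 < C0 * K" using C0 K by simp
    fix eps tau N n s gam b a
    assume R: "ring_element K eps tau N n s gam b a" and dg: "degenerate K eps tau N a" and g: "volumetric_density g"
    note h = ring_elementD[OF R] and cts = ring_element_continuous[OF R p g] and W = radial_facts[OF p g h(1-3)]
    define th where "th = pi / real N * tau"
    have th: "0 < th" using h(10) by (simp add: th_def)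
    let ?phi = "%sg. (eps + sg * tau) powr (1 - p)"
    define I where "I = (LINT sg:{0<..<1}|lborel. ?phi sg)"
    define q where "q = (eps + tau) powr (1 - p)"
    note i = ring_weight_eq(2)[OF p h(1,2)]
    have qI: "q <= I"
    proof -
      have "(LINT sg:{0<..<1::real}|lborel. q) <= I"
        unfolding I_def
      proof (rule set_integral_mono[OF _ i])
        show "set_integrable lborel {0<..<1} (%sg::real. q)" by (rule set_integrable_bounded_continuous[where C="\<bar>q\<bar>"]) auto
        fix sg :: real assume sg: "sg \<in> {0<..<1}"
        then have "sg * tau <= 1 * tau" "0 < sg * tau" using h(2) by (auto intro!: mult_right_mono)
        then show "q <= ?phi sg" unfolding q_def using h(1) p by (intro powr_mono2') auto
      qed
      then show ?thesis by (simp add: set_lebesgue_integral_def)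
    qed
    have q0: "0 < q" using h(1,2) by (simp add: q_def)
    have e: "\<bar>e1v p a x\<bar> <= (L * (th * q)) * (x$1 * x$2) powr (1 - p)" if x: "x \<in> open_triangle" for x
    proof -
      have x12: "0 < x$1 * x$2" using x by (simp add: open_triangle_def)
      have t: "eps + s x * tau \<in> {0<..1}" using h(13)[OF x] by blast
      have X: "\<bar>estretch (cavity_map r) a x - (n * th)\<^sup>2 * Zr (eps + s x * tau)\<bar> <= K * th\<^sup>2 * mesh_error eps tau N"
        using h(14)[OF x] unfolding th_def by blast
      have "n\<^sup>2 <= 2\<^sup>2" using h(7,8) by (intro power_mono) auto
      then have "n\<^sup>2 * Zr (eps + s x * tau) <= 2\<^sup>2 * (2 * B\<^sup>2)" using Zr_bounds[OF t] by (intro mult_mono) auto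
      then have "th\<^sup>2 * (n\<^sup>2 * Zr (eps + s x * tau)) <= th\<^sup>2 * (2\<^sup>2 * (2 * B\<^sup>2))" by (intro mult_left_mono) auto
      moreover have "K * th\<^sup>2 * mesh_error eps tau N <= K * th\<^sup>2 * K" using h(12) K by (intro mult_left_mono) auto
      moreover have "(n * th)\<^sup>2 * Zr (eps + s x * tau) = th\<^sup>2 * (n\<^sup>2 * Zr (eps + s x * tau))" by (simp add: power_mult_distrib)
      moreover have "th\<^sup>2 * H = th\<^sup>2 * (2\<^sup>2 * (2 * B\<^sup>2)) + K * th\<^sup>2 * K" by (simp add: H_def algebra_simps)
      ultimately have "estretch (cavity_map r) a x <= th\<^sup>2 * H" using X by linarith
      then have "estretch (cavity_map r) a x powr (p / 2) <= (th\<^sup>2 * H) powr (p / 2)"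
        using p by (intro powr_mono2) (auto simp: estretch_def stretch_nonneg)
      also have "\<dots> = th powr p * H powr (p / 2)"
      proof -
        have "(th\<^sup>2) powr (p / 2) = th powr p" using th by (simp add: powr_powr flip: powr_numeral)
        then show ?thesis using pos by (simp add: powr_mult)
      qed
      finally have 1: "estretch (cavity_map r) a x powr (p / 2) <= th powr p * H powr (p / 2)" .
      have d: "th * (eps + tau) * (x$1 * x$2) * (1 / K) <= edet a x" using dg x by (auto simp: degenerate_def th_def)
      have d0: "0 < th * (eps + tau) * (x$1 * x$2) * (1 / K)" using th h(1,2) x K by (intro mult_pos_pos) (auto simp: open_triangle_def)
      have "edet a x powr (1 - p) <= (th * (eps + tau) * (x$1 * x$2) * (1 / K)) powr (1 - p)"
        by (rule powr_mono2'[OF _ d0 d]) (use p in auto)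
      also have "\<dots> = th powr (1 - p) * q * (x$1 * x$2) powr (1 - p) * (1 / K) powr (1 - p)"
        using th h(1,2) x12 K by (simp only: powr_mult q_def)
      finally have 2: "edet a x powr (1 - p) <= th powr (1 - p) * q * (x$1 * x$2) powr (1 - p) * (1 / K) powr (1 - p)" .
      have "e1v p a x <= (th powr p * H powr (p / 2)) * (th powr (1 - p) * q * (x$1 * x$2) powr (1 - p) * (1 / K) powr (1 - p))"
        unfolding e1v_def by (rule mult_mono[OF 1 2]) auto
      also have "\<dots> = (th powr p * th powr (1 - p)) * (L * q * (x$1 * x$2) powr (1 - p))" unfolding L_def by (simp only: mult_ac)
      also have "th powr p * th powr (1 - p) = th" using th by (simp flip: powr_add)
      finally show ?thesis by (simp add: e1v_def mult_ac)
    qed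
    have b: "- 1 < 1 - p" "1 - p < 0" using p by auto
    note PI = product_integral_bound[OF b]
    have G: "set_integrable lebesgue open_triangle (%x. (L * (th * q)) * (x$1 * x$2) powr (1 - p))"
      using PI(1) by (auto intro: set_integrable_mult_right)
    note E = set_integrable_open_triangle[OF cts(1) G e]
    have "(LINT x:open_triangle|lebesgue. (L * (th * q)) * (x$1 * x$2) powr (1 - p)) = (L * (th * q)) * (LINT x:open_triangle|lebesgue. (x$1 * x$2) powr (1 - p))"
      by simp
    also have "\<dots> <= (L * (th * q)) * (1 / (1 + (1 - p))\<^sup>2)" using PI(2) pos th q0 by (intro mult_left_mono) auto
    also have "\<dots> <= (L * (th * I)) * (1 / (1 + (1 - p))\<^sup>2)" using pos th qI by (intro mult_right_mono mult_left_mono) auto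
    finally have E1: "\<bar>LINT x:open_triangle|lebesgue. e1v p a x\<bar> <= (L * (th * I)) * (1 / (1 + (1 - p))\<^sup>2)" using E(2) by linarith
    have gam: "!!sg. sg \<in> {0<..<1} ==> 0 <= gam sg & gam sg <= 1" "set_integrable lborel {0<..<1} (%sg. gam sg * radial1 p eps tau sg)"
      using h(9) W(1,3,5) unfolding coordinate_density_def by blast+
    have "(LINT sg:{0<..<1}|lborel. gam sg * radial1 p eps tau sg) <= (LINT sg:{0<..<1}|lborel. H1 * ?phi sg)"
    proof (rule set_integral_mono[OF gam(2)])
      show "set_integrable lborel {0<..<1} (%sg. H1 * ?phi sg)" using i by (auto intro: set_integrable_mult_right)
      fix sg :: real assume sg: "sg \<in> {0<..<1}"
      have "gam sg * radial1 p eps tau sg <= 1 * radial1 p eps tau sg" using gam(1)[OF sg] W(3)[OF sg] by (intro mult_right_mono) auto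
      then show "gam sg * radial1 p eps tau sg <= H1 * ?phi sg" using W(7)[OF sg] unfolding H1_def by linarith
    qed
    then have W1: "(LINT sg:{0<..<1}|lborel. gam sg * radial1 p eps tau sg) <= H1 * I" by (simp add: I_def)
    have W0: "0 <= (LINT sg:{0<..<1}|lborel. gam sg * radial1 p eps tau sg)"
      unfolding set_lebesgue_integral_def
      by (rule integral_nonneg_AE) (use gam(1) W(3) in \<open>auto simp: indicator_def\<close>)
    have "\<bar>n * th * (LINT sg:{0<..<1}|lborel. gam sg * radial1 p eps tau sg)\<bar> <= 2 * th * (H1 * I)"
    proof -
      have "n * th * (LINT sg:{0<..<1}|lborel. gam sg * radial1 p eps tau sg) <= 2 * th * (H1 * I)"
        by (rule mult_mono[OF mult_right_mono[OF h(8)] W1]) (use th W0 in auto)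
      moreover have "0 <= n * th * (LINT sg:{0<..<1}|lborel. gam sg * radial1 p eps tau sg)" using h(7) th W0 by simp
      ultimately show ?thesis by simp
    qed
    then have "\<bar>(LINT x:open_triangle|lebesgue. e1v p a x) - n * th * (LINT sg:{0<..<1}|lborel. gam sg * radial1 p eps tau sg)\<bar>
        <= (L * (th * I)) * (1 / (1 + (1 - p))\<^sup>2) + 2 * th * (H1 * I)" using E1 by linarith
    also have "\<dots> = C0 * (th * I) * 1" 
    proof -
      have "(L * (th * I)) * z + 2 * th * (H1 * I) = (L * z + 2 * H1) * (th * I) * 1" for z by (simp add: algebra_simps)
      then show ?thesis unfolding C0_def .
    qed
    also have "\<dots> <= C0 * (th * I) * (K * mesh_error eps tau N)"
    proof (rule mult_left_mono)
      have "1 / K <= mesh_error eps tau N" using dg by (simp add: degenerate_def)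
      then show "1 <= K * mesh_error eps tau N" using K by (simp add: field_simps)
      have "0 <= I" using q0 qI by linarith
      then show "0 <= C0 * (th * I)" using C0 th by simp
    qed
    also have "\<dots> = C0 * K * (th * mesh_error eps tau N * I)" by (simp only: mult_ac)
    finally show "set_integrable lebesgue open_triangle (e1v p a) &
      \<bar>(LINT x:open_triangle|lebesgue. e1v p a x) - n * (pi / real N * tau) * (LINT sg:{0<..<1}|lborel. gam sg * radial1 p eps tau sg)\<bar>
       <= C0 * K * ((pi / real N * tau) * mesh_error eps tau N * (LINT sg:{0<..<1}|lborel. ?phi sg))"
      unfolding th_def I_def using E(1) by blast
  qed
qed

text \<open>Both densities are compared pointwise at the same image point, so the ring integral does
  not enter. The bound t*b <= 2*(eps + tau) prevents a loss at the tip of A.\<close>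

lemma interpolant_volume:
  assumes g: "volumetric_density g" and K: "3 <= K" and kap: "0 < kap"
  obtains C where "0 < C" "!!eps tau N n s gam b a. ring_element K eps tau N n s gam b a ==>
    set_integrable lebesgue open_triangle (e2u g a) ==>
    (!!x. x \<in> open_triangle ==> evol (cavity_map r) a x / edet a x \<in> {kap..1 / kap}) ==>
    set_integrable lebesgue open_triangle (e2v g a) &
    \<bar>(LINT x:open_triangle|lebesgue. e2v g a x) - (LINT x:open_triangle|lebesgue. e2u g a x)\<bar> <= C * (pi / real N * volume_error eps tau N)"
proof -
  have K1: "1 <= K" using K by simp
  obtain C where C: "0 < C" "!!th n t rho bt Psi D V Phi. 0 < th ==> 1 <= n ==> n <= 2 ==> t \<in> {0<..1} ==> rho \<in> {0<..1} ==> 1 <= bt ==>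
      0 <= Psi ==> Psi <= K ==> \<bar>D - n * th * t\<bar> <= K * th * t * Psi * bt ==> \<bar>rho - t\<bar> <= K * Psi * t ==>
      0 < D ==> \<bar>V - n * th * r' t * r t\<bar> <= K * Phi ==> kap <= V / D ==> V / D <= 1 / kap ==>
      \<bar>g (V / D) * D - g (du rho) * D\<bar> <= C * (Phi + th * t * Psi * bt)"
    by (rule volume_density_close[OF g K1 kap]) (rule that)
  show thesis
  proof (rule that[of "3 * C"])
    show "0 < 3 * C" using C by simp
    fix eps tau N n s gam b a
    assume R: "ring_element K eps tau N n s gam b a" and int: "set_integrable lebesgue open_triangle (e2u g a)"
      and q: "!!x. x \<in> open_triangle ==> evol (cavity_map r) a x / edet a x \<in> {kap..1 / kap}"
    note h = ring_elementD[OF R]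
    \<comment> \<open>An admissible exponent with which to invoke the continuity facts; any value in
      (1,2) serves.\<close>
    have p: "1 < (3/2 :: real)" "(3/2 :: real) < 2" by auto
    note cts = ring_element_continuous[OF R p g]
    have pos: "0 < evol (cavity_map r) a x / edet a x" if "x \<in> open_triangle" for x using q[OF that] kap by auto
    define v where "v = volume_error eps tau N"
    have v0: "0 <= v" unfolding v_def by (rule error_bounds(7)[OF h(1-4)])
    \<comment> \<open>The mesh error times the area scale tau*(eps + tau) is a volume error, because
      eps + tau <= 1.\<close>
    have vol: "tau * ((eps + tau) * mesh_error eps tau N) <= v"
    proof -
      have "tau * ((eps + tau) * mesh_error eps tau N) = (eps + tau) * tau ^ 3 + (eps + tau) * tau * (1 / real N ^ 2) + ((eps + tau) * eps) * (1 / real N ^ 4)"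
      proof -
        have "tau * (q * (tau\<^sup>2 + X + eps / tau * Y)) = q * tau ^ 3 + q * tau * X + (q * eps) * Y" for q X Y
          using h(2) by (simp add: power2_eq_square power3_eq_cube field_simps)
        then show ?thesis unfolding mesh_error_def .
      qed
      moreover have "(eps + tau) * tau ^ 3 <= 1 * tau ^ 3" using h(1-3) by (intro mult_right_mono) auto
      moreover have "((eps + tau) * eps) * (1 / real N ^ 4) <= (1 * 1) * (1 / real N ^ 4)" using h(1-3) by (intro mult_right_mono mult_mono) auto
      ultimately show ?thesis unfolding v_def volume_error_def by linarith
    qed
    have h0: "0 <= pi / real N" by simp
    have le: "\<bar>e2v g a x - e2u g a x\<bar> <= 3 * C * (pi / real N * v)" if x: "x \<in> open_triangle" for x
    proof -
      let ?t = "eps + s x * tau"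
      have "\<bar>e2v g a x - e2u g a x\<bar> <= C * (pi / real N * v + (pi / real N * tau) * ?t * mesh_error eps tau N * b (s x))"
        unfolding e2v_def e2u_def v_def
        by (rule C(2)[OF h(10,7,8) _ _ _ less_imp_le[OF h(11)] h(12)]) (use h(13,14)[OF x] q[OF x] in auto)
      moreover have "(pi / real N * tau) * ?t * mesh_error eps tau N * b (s x) <= 2 * (pi / real N * v)"
      proof -
        have "(pi / real N * tau) * ?t * mesh_error eps tau N * b (s x) = ((pi / real N * tau) * mesh_error eps tau N) * (?t * b (s x))" by (simp only: mult_ac)
        also have "\<dots> <= ((pi / real N * tau) * mesh_error eps tau N) * (2 * (eps + tau))"
          by (rule mult_left_mono) (use h(13)[OF x] mult_pos_pos[OF h(10,11)] in auto)
        also have "\<dots> = 2 * (pi / real N * (tau * ((eps + tau) * mesh_error eps tau N)))" by (simp only: mult_ac)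
        also have "\<dots> <= 2 * (pi / real N * v)" using vol h0 by (intro mult_left_mono) auto
        finally show ?thesis .
      qed
      ultimately have "\<bar>e2v g a x - e2u g a x\<bar> <= C * (pi / real N * v + 2 * (pi / real N * v))"
        using C(1) by (elim order_trans) (intro mult_left_mono add_left_mono, auto)
      also have "\<dots> = 3 * C * (pi / real N * v)" by simp
      finally show ?thesis .
    qed
    have nn: "0 <= 3 * C * (pi / real N * v)" using C(1) v0 by simp
    note close = set_integral_open_triangle_close[OF cts(5)[OF pos] cts(3) int nn le]
    show "set_integrable lebesgue open_triangle (e2v g a) &
      \<bar>(LINT x:open_triangle|lebesgue. e2v g a x) - (LINT x:open_triangle|lebesgue. e2u g a x)\<bar> <= 3 * C * (pi / real N * volume_error eps tau N)"
      using close unfolding v_def by blast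
  qed
qed

lemma ring_elements:
  obtains K where "3 <= K" "!!eps tau (N::nat). 0 < eps ==> 0 < tau ==> eps + tau <= 1 ==> 0 < N ==>
      inj_on (quad_map (elem_A eps tau N)) ref_triangle ==>
      ring_element K eps tau N 2 (%x. x$1 + x$2) (%sg. sg) (%sg. 1 + (eps + tau) / (eps + sg * tau)) (elem_A eps tau N) &
      (nondegenerate K eps tau N (%x. eps + (x$1 + x$2) * tau) (elem_A eps tau N) \<or> degenerate K eps tau N (elem_A eps tau N)) &
      ring_element K eps tau N 2 (%x. 1 - (x$1 + x$2)) (%sg. 1 - sg) (%_. 1) (elem_B eps tau N) &
      nondegenerate K eps tau N (%x. eps + (1 - (x$1 + x$2)) * tau) (elem_B eps tau N) &
      ring_element K eps tau N 1 (%x. x$1) (%sg. 1 - sg) (%_. 1) (elem_C eps tau N) &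
      nondegenerate K eps tau N (%x. eps + x$1 * tau) (elem_C eps tau N) &
      ring_element K eps tau N 1 (%x. x$2) (%sg. 1 - sg) (%_. 1) (elem_D eps tau N) &
      nondegenerate K eps tau N (%x. eps + x$2 * tau) (elem_D eps tau N)"
proof (rule mesh_elements, goal_cases)
  case (1 K)
  show ?case
  proof (rule 1(1)[OF 1(2)])
    fix eps tau :: real and N :: nat
    assume ring: "0 < eps" "0 < tau" "eps + tau <= 1" "0 < N" and inj: "inj_on (quad_map (elem_A eps tau N)) ref_triangle"
    note M = 1(3)[OF ring inj] and I = elem_A_injective[OF ring inj]
    note err = mesh_error_bounded[OF ring(1-3) I(1,2)]
    note cd = coordinate_densities
    have t: "0 < eps + sg * tau" "eps + sg * tau <= eps + tau" if "sg \<in> {0<..<1}" for sg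
    proof -
      have "0 < sg * tau" "sg * tau <= 1 * tau" using that ring by (auto intro!: mult_right_mono)
      then show "0 < eps + sg * tau" "eps + sg * tau <= eps + tau" using ring by linarith+
    qed
    have one: "\<forall>sg\<in>{0<..<1}. 1 <= (1::real) & (1 - sg) * 1 <= 2 & (eps + sg * tau) * 1 <= 2 * (eps + tau)"
    proof
      fix sg :: real assume sg: "sg \<in> {0<..<1}"
      have "(eps + sg * tau) * 1 <= 2 * (eps + tau)" using t(2)[OF sg] ring unfolding mult_1_right distrib_left by linarith
      then show "1 <= (1::real) & (1 - sg) * 1 <= 2 & (eps + sg * tau) * 1 <= 2 * (eps + tau)" using sg by simp
    qed
    have bA: "\<forall>sg\<in>{0<..<1}. 1 <= 1 + (eps + tau) / (eps + sg * tau) & sg * (1 + (eps + tau) / (eps + sg * tau)) <= 2 &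
        (eps + sg * tau) * (1 + (eps + tau) / (eps + sg * tau)) <= 2 * (eps + tau)"
    proof
      fix sg :: real assume sg: "sg \<in> {0<..<1}"
      note t = t[OF sg]
      have "sg * eps <= 1 * eps" using sg ring by (intro mult_right_mono) auto
      \<comment> \<open>The density s cancels the growth of the weight at the tip of A.\<close>
      then have "sg * (eps + tau) <= 1 * (eps + sg * tau)" by (simp add: distrib_left)
      then have "sg * (eps + tau) / (eps + sg * tau) <= 1" using t by (simp add: divide_le_eq)
      moreover have "sg * (1 + (eps + tau) / (eps + sg * tau)) = sg + sg * (eps + tau) / (eps + sg * tau)" by (simp add: distrib_left)
      moreover have "(eps + sg * tau) * (1 + (eps + tau) / (eps + sg * tau)) = (eps + sg * tau) + (eps + tau)"
        unfolding distrib_left[of "eps + sg * tau" 1] using t by simp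
      moreover have "0 <= (eps + tau) / (eps + sg * tau)" using t ring by simp
      ultimately show "1 <= 1 + (eps + tau) / (eps + sg * tau) & sg * (1 + (eps + tau) / (eps + sg * tau)) <= 2 &
        (eps + sg * tau) * (1 + (eps + tau) / (eps + sg * tau)) <= 2 * (eps + tau)"
        using t sg unfolding mult_2 greaterThanLessThan_iff by (intro conjI) linarith+
    qed
    have cA: "continuous_on {0<..<1} (%sg. 1 + (eps + tau) / (eps + sg * tau))"
      by (intro continuous_intros ballI) (metis t(1) less_irrefl)
    have c1: "continuous_on {0<..<1::real} (%_. 1::real)" by (rule continuous_on_const)
    have n: "(1::real) <= 1" "(1::real) <= 2" "(2::real) <= 2" by auto
    show "ring_element K eps tau N 2 (%x. x$1 + x$2) (%sg. sg) (%sg. 1 + (eps + tau) / (eps + sg * tau)) (elem_A eps tau N) &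
      (nondegenerate K eps tau N (%x. eps + (x$1 + x$2) * tau) (elem_A eps tau N) \<or> degenerate K eps tau N (elem_A eps tau N)) &
      ring_element K eps tau N 2 (%x. 1 - (x$1 + x$2)) (%sg. 1 - sg) (%_. 1) (elem_B eps tau N) &
      nondegenerate K eps tau N (%x. eps + (1 - (x$1 + x$2)) * tau) (elem_B eps tau N) &
      ring_element K eps tau N 1 (%x. x$1) (%sg. 1 - sg) (%_. 1) (elem_C eps tau N) &
      nondegenerate K eps tau N (%x. eps + x$1 * tau) (elem_C eps tau N) &
      ring_element K eps tau N 1 (%x. x$2) (%sg. 1 - sg) (%_. 1) (elem_D eps tau N) &
      nondegenerate K eps tau N (%x. eps + x$2 * tau) (elem_D eps tau N)"
      unfolding ring_element_def using M ring(1-3) 1(2) err cd one bA cA c1 n by blast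
  qed
qed

text \<open>A contributes density 2*s; B, or C and D together, contribute 2*(1 - s). The cell gives
  2*th*L, and N cells give the ring integral 2*pi*tau*L.\<close>

lemma cell_sum_close:
  fixes fA fB fC fD e I J L th tau :: real and N :: nat
  assumes "0 < N" "th = pi / real N * tau" "\<bar>fA - 2 * th * I\<bar> <= e" "\<bar>fB - 2 * th * J\<bar> <= e" "\<bar>fC - 1 * th * J\<bar> <= e" "\<bar>fD - 1 * th * J\<bar> <= e"
    "I + J = L"
  shows "\<bar>real N * (fA + (if b then fB else fC + fD)) - 2 * pi * tau * L\<bar> <= real N * (3 * e)"
proof -
  have L: "2 * th * L = 2 * th * I + 2 * th * J" unfolding assms(7)[symmetric] by (simp add: distrib_left)
  have "0 <= e" using assms(3) by linarith
  then have "\<bar>(fA + (if b then fB else fC + fD)) - 2 * th * L\<bar> <= 3 * e" unfolding L using assms(3-6) by (cases b) auto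
  then have "real N * \<bar>(fA + (if b then fB else fC + fD)) - 2 * th * L\<bar> <= real N * (3 * e)" by (rule mult_left_mono) simp
  moreover have "real N * (fA + (if b then fB else fC + fD)) - 2 * pi * tau * L = real N * ((fA + (if b then fB else fC + fD)) - 2 * th * L)"
    using assms(1) by (simp add: assms(2) right_diff_distrib)
  ultimately show ?thesis by (simp add: abs_mult)
qed

end

section \<open>Energies of a ring\<close>

context cavity
begin

lemma element_energies_rot:
  "e1v p (rot phi \<circ> a) = e1v p a" "e1u p (rot phi \<circ> a) = e1u p a" "e2u g (rot phi \<circ> a) = e2u g a" "e2v g (rot phi \<circ> a) = e2v g a"
  by (simp_all add: fun_eq_iff e1v_def e1u_def e2u_def e2v_def rotated_element)

text \<open>All radial integrals are compared with that of t^(1-p). Since t <= 1 this power is at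
  least 1 and at least t, which yields the bound for \<open>radial2\<close> and (2 - p)*tau <=
  \<open>ring_weight\<close>; the latter turns an absolute error N^-4 into a relative one
  N^-4/tau.\<close>

lemma radial_bounds:
  assumes p: "1 < p" "p < 2" and g: "volumetric_density g"
  obtains C where "0 < C" "!!eps tau. 0 < eps ==> 0 < tau ==> eps + tau <= 1 ==>
    2 * pi * tau * (LINT sg:{0<..<1}|lborel. radial1 p eps tau sg) <= C * ring_weight p eps tau &
    ring_weight p eps tau <= C * (2 * pi * tau * (LINT sg:{0<..<1}|lborel. radial1 p eps tau sg)) &
    0 <= 2 * pi * tau * (LINT sg:{0<..<1}|lborel. radial2 g eps tau sg) &
    2 * pi * tau * (LINT sg:{0<..<1}|lborel. radial2 g eps tau sg) <= C * ring_weight p eps tau &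
    (2 - p) * tau <= ring_weight p eps tau"
proof -
  have ab: "0 < m * c" "m * c <= M * B" using du_bounds[of 1] by auto
  obtain L U where LU: "0 < L" "0 < U" "!!x y. x \<in> {m * c..M * B} ==> y \<in> {m * c..M * B} ==> \<bar>g x - g y\<bar> <= L * \<bar>x - y\<bar>"
    "!!x. x \<in> {m * c..M * B} ==> 0 < g x & g x <= U"
    using volumetric_density_bounds[OF g ab] by metis
  define H where "H = (2 * B\<^sup>2) powr (p / 2)"
  define C where "C = 2 * pi * H / (2 - p) + (2 - p) / (2 * pi * c powr p) + 2 * pi * U / (2 - p)"
  have H: "0 < H" using B_pos by (simp add: H_def)
  have parts: "0 < 2 * pi * H / (2 - p)" "0 < (2 - p) / (2 * pi * c powr p)" "0 < 2 * pi * U / (2 - p)"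
    using H p c(1) LU(2) by auto
  show thesis
  proof (rule that[of C])
    show "0 < C" unfolding C_def using parts by linarith
    fix eps tau :: real
    assume ring: "0 < eps" "0 < tau" "eps + tau <= 1"
    note W = radial_facts[OF p g ring] and w = ring_weight_eq[OF p ring(1,2)]
    let ?phi = "%sg. (eps + sg * tau) powr (1 - p)"
    define I where "I = (LINT sg:{0<..<1}|lborel. ?phi sg)"
    define I1 where "I1 = (LINT sg:{0<..<1}|lborel. radial1 p eps tau sg)"
    define I2 where "I2 = (LINT sg:{0<..<1}|lborel. radial2 g eps tau sg)"
    have A: "ring_weight p eps tau = (2 - p) * (tau * I)" unfolding I_def by (rule w(3))
    have t: "eps + sg * tau \<in> {0<..1}" if "sg \<in> {0<..<1}" for sg
    proof -
      have "0 < sg * tau" "sg * tau <= 1 * tau" using that ring by (auto intro!: mult_right_mono)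
      then show ?thesis using ring unfolding greaterThanAtMost_iff mult_1 by linarith
    qed
    have k: "set_integrable lborel {0<..<1} (%sg. k * ?phi sg)" "(LINT sg:{0<..<1}|lborel. k * ?phi sg) = k * I" for k
      using w(2) by (auto intro: set_integrable_mult_right simp: I_def)
    have t1: "eps + sg * tau <= ?phi sg" "1 <= ?phi sg" if "sg \<in> {0<..<1}" for sg
    proof -
      have "(eps + sg * tau) powr 1 <= ?phi sg" "(eps + sg * tau) powr 0 <= ?phi sg" using t[OF that] p by (intro powr_mono'; simp)+
      then show "eps + sg * tau <= ?phi sg" "1 <= ?phi sg" using t[OF that] by simp_all
    qed
    have 1: "I1 <= H * I"
      unfolding I1_def k(2)[symmetric] by (rule set_integral_mono[OF W(5) k(1)]) (use W(7) in \<open>simp add: H_def\<close>)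
    have 2: "c powr p * I <= I1"
      unfolding I1_def k(2)[symmetric]
    proof (rule set_integral_mono[OF k(1) W(5)])
      fix sg :: real assume sg: "sg \<in> {0<..<1}"
      have "(c powr p * (eps + sg * tau) powr (- p)) * (eps + sg * tau) <= radial1 p eps tau sg"
        unfolding radial1_def using w1_bounds(1)[OF t[OF sg], of p] p t[OF sg] by (intro mult_right_mono) auto
      then show "c powr p * ?phi sg <= radial1 p eps tau sg" using powr_mult_base[of "eps + sg * tau" "- p"] t[OF sg] by (simp add: mult_ac)
    qed
    have 3: "I2 <= U * I"
      unfolding I2_def k(2)[symmetric]
    proof (rule set_integral_mono[OF W(6) k(1)])
      fix sg :: real assume sg: "sg \<in> {0<..<1}"
      have "g (du (eps + sg * tau)) <= U" using du_bounds[OF t[OF sg]] LU(4)[of "du (eps + sg * tau)"] by auto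
      then show "radial2 g eps tau sg <= U * ?phi sg" unfolding radial2_def
        using t1(1)[OF sg] t[OF sg] LU(2) by (intro mult_mono) auto
    qed
    have 4: "0 <= I2"
      unfolding I2_def set_lebesgue_integral_def by (rule integral_nonneg_AE) (use W(4) in \<open>auto simp: indicator_def\<close>)
    have 5: "1 <= I"
    proof -
      have "(LINT sg:{0<..<1::real}|lborel. 1) <= I"
        unfolding I_def
        by (rule set_integral_mono[OF _ w(2)]) (use t1(2) in \<open>auto intro: set_integrable_bounded_continuous[where C=1]\<close>)
      then show ?thesis by (simp add: set_lebesgue_integral_def)
    qed
    have A0: "0 <= ring_weight p eps tau" unfolding A using p ring 5 by simp
    have C: "2 * pi * H / (2 - p) <= C" "(2 - p) / (2 * pi * c powr p) <= C" "2 * pi * U / (2 - p) <= C"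
      unfolding C_def using parts by linarith+
    have "2 * pi * tau * I1 <= 2 * pi * tau * (H * I)" using 1 ring by (intro mult_left_mono) auto
    also have "\<dots> = 2 * pi * H / (2 - p) * ring_weight p eps tau" using p by (simp add: A)
    also have "\<dots> <= C * ring_weight p eps tau" by (rule mult_right_mono[OF C(1) A0])
    finally have r1: "2 * pi * tau * I1 <= C * ring_weight p eps tau" .
    have I1: "0 <= I1" using 2 5 c(1) by (smt (verit) mult_nonneg_nonneg powr_ge_zero)
    have "ring_weight p eps tau = (2 - p) / (2 * pi * c powr p) * (2 * pi * tau * (c powr p * I))" using c(1) by (simp add: A)
    also have "\<dots> <= (2 - p) / (2 * pi * c powr p) * (2 * pi * tau * I1)" using 2 ring parts(2) by (intro mult_left_mono) auto
    also have "\<dots> <= C * (2 * pi * tau * I1)" by (rule mult_right_mono[OF C(2)]) (use I1 ring in simp)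
    finally have r2: "ring_weight p eps tau <= C * (2 * pi * tau * I1)" .
    have "2 * pi * tau * I2 <= 2 * pi * tau * (U * I)" using 3 ring by (intro mult_left_mono) auto
    also have "\<dots> = 2 * pi * U / (2 - p) * ring_weight p eps tau" using p by (simp add: A)
    also have "\<dots> <= C * ring_weight p eps tau" by (rule mult_right_mono[OF C(3) A0])
    finally have r3: "2 * pi * tau * I2 <= C * ring_weight p eps tau" .
    have "0 <= 2 * pi * tau * I2" using 4 ring by simp
    moreover have "(2 - p) * (tau * 1) <= (2 - p) * (tau * I)" using 5 p ring by (intro mult_left_mono) auto
    then have "(2 - p) * tau <= ring_weight p eps tau" by (simp only: A mult_1_right)
    ultimately show "2 * pi * tau * (LINT sg:{0<..<1}|lborel. radial1 p eps tau sg) <= C * ring_weight p eps tau &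
      ring_weight p eps tau <= C * (2 * pi * tau * (LINT sg:{0<..<1}|lborel. radial1 p eps tau sg)) &
      0 <= 2 * pi * tau * (LINT sg:{0<..<1}|lborel. radial2 g eps tau sg) &
      2 * pi * tau * (LINT sg:{0<..<1}|lborel. radial2 g eps tau sg) <= C * ring_weight p eps tau &
      (2 - p) * tau <= ring_weight p eps tau"
      using r1 r2 r3 unfolding I1_def I2_def by blast
  qed
qed

text \<open>Identifies the integrands of the energies, written with \<open>jacobian\<close>, with
  the closed forms. Rotations are removed by invariance, so the bounds are required for the four
  representatives only.\<close>

lemma mesh_densities:
  assumes J: "ring_mesh J eps tau N"
    and norms: "!!b x. b \<in> ring_cell eps tau N ==> x \<in> open_triangle ==> 0 < norm (quad_map b x) & norm (quad_map b x) <= eps + tau & 0 < edet b x"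
    and a: "a \<in> J" and x: "x \<in> open_triangle"
  defines "v == interpolant J (cavity_map r)"
  shows "\<bar>wedge (dquad1 a x) (dquad2 a x)\<bar> * norm (jacobian v (at (quad_map a x))) powr p = e1v p a x"
    "det (jacobian v (at (quad_map a x))) = evol (cavity_map r) a x / edet a x"
    "\<bar>wedge (dquad1 a x) (dquad2 a x)\<bar> * norm (jacobian (cavity_map r) (at (quad_map a x))) powr p = e1u p a x"
    "\<bar>wedge (dquad1 a x) (dquad2 a x)\<bar> * g (det (jacobian (cavity_map r) (at (quad_map a x)))) = e2u g a x"
    "\<bar>wedge (dquad1 a x) (dquad2 a x)\<bar> * g (det (jacobian v (at (quad_map a x)))) = e2v g a x"
proof -
  have tri: "triangulation J" and e1: "eps + tau <= 1" using J by (auto simp: ring_mesh_def)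
  have inj: "inj_on (quad_map a) ref_triangle" using tri a by (simp add: triangulation_def)
  obtain phi b where b: "b \<in> ring_cell eps tau N" "a = rot phi \<circ> b" using ring_mesh_structure(2)[OF J a] by blast
  note nb = norms[OF b(1)]
  have ed: "edet a x \<noteq> 0" using nb[OF x] by (simp add: b(2) rotated_element)
  then have w: "wedge (dquad1 a x) (dquad2 a x) \<noteq> 0" by (simp add: edet_def)
  obtain v' where v': "(v has_derivative v') (at (quad_map a x))"
    "v' (dquad1 a x) = dquad1 (cavity_map r \<circ> a) x" "v' (dquad2 a x) = dquad2 (cavity_map r \<circ> a) x"
    unfolding v_def by (rule interpolant_has_derivative[OF tri a x])
  note jc = jacobian_columns[OF v']
  have "norm (jacobian v (at (quad_map a x))) powr p * \<bar>wedge (dquad1 a x) (dquad2 a x)\<bar> = e1v p a x"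
    using jacobian_norm_powr[OF jc(2) w] by (simp add: e1v_def estretch_def edet_def)
  then show "\<bar>wedge (dquad1 a x) (dquad2 a x)\<bar> * norm (jacobian v (at (quad_map a x))) powr p = e1v p a x" by (simp only: mult.commute)
  show d: "det (jacobian v (at (quad_map a x))) = evol (cavity_map r) a x / edet a x"
    unfolding evol_over_edet[OF ed] using jc(1) w by (simp add: eq_divide_eq)
  show "\<bar>wedge (dquad1 a x) (dquad2 a x)\<bar> * g (det (jacobian v (at (quad_map a x)))) = e2v g a x"
    unfolding d e2v_def edet_def by (simp only: mult.commute)
  have "norm (quad_map a x) < eps + tau"
    by (rule quad_map_norm_less[OF inj _ x]) (use nb in \<open>simp add: b(2) rotated_element\<close>)
  then have rho: "0 < norm (quad_map a x)" "norm (quad_map a x) < 1" using e1 nb[OF x] by (auto simp: b(2) rotated_element)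
  have "(r has_real_derivative r' (norm (quad_map a x))) (at (norm (quad_map a x)) within {0<..<1})"
    by (rule DERIV_subset[OF deriv(1)]) (use rho in auto)
  then have "(r has_real_derivative r' (norm (quad_map a x))) (at (norm (quad_map a x)))"
    using rho by (simp add: at_within_open[where S="{0<..<1}"])
  note cj = cavity_map_jacobian[OF this]
  have nz: "quad_map a x \<noteq> 0" using rho by auto
  have "norm (jacobian (cavity_map r) (at (quad_map a x))) powr p = ((norm (jacobian (cavity_map r) (at (quad_map a x))))\<^sup>2) powr (p / 2)"
    by (cases "jacobian (cavity_map r) (at (quad_map a x)) = 0") (simp_all add: powr_powr flip: powr_numeral)
  then show "\<bar>wedge (dquad1 a x) (dquad2 a x)\<bar> * norm (jacobian (cavity_map r) (at (quad_map a x))) powr p = e1u p a x"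
    unfolding cj(2)[OF nz] e1u_def w1_def edet_def by (simp only: mult.commute)
  show "\<bar>wedge (dquad1 a x) (dquad2 a x)\<bar> * g (det (jacobian (cavity_map r) (at (quad_map a x)))) = e2u g a x"
    unfolding cj(1)[OF nz] e2u_def du_def edet_def by (simp only: mult.commute)
qed

lemma ring_energies:
  assumes p: "1 < p" "p < 2" and g: "volumetric_density g" and ring: "0 < eps" "0 < tau" "eps + tau <= 1"
  shows "finite_E1 p (cavity_map r) (ring_region eps tau)" "finite_E2 g (cavity_map r) (ring_region eps tau)"
    "E1 om p (cavity_map r) (ring_region eps tau) = om * (2 * pi * tau * (LINT sg:{0<..<1}|lborel. radial1 p eps tau sg))"
    "E2 g (cavity_map r) (ring_region eps tau) = 2 * pi * tau * (LINT sg:{0<..<1}|lborel. radial2 g eps tau sg)"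
proof -
  note W = radial_facts[OF p g ring] and dc = density_continuous[OF g]
  have t: "eps + sg * tau \<in> {0<..1}" if "sg \<in> {0<..<1}" for sg
  proof -
    have "0 < sg * tau" "sg * tau <= 1 * tau" using that ring by (auto intro!: mult_right_mono)
    then show ?thesis using ring unfolding greaterThanAtMost_iff mult_1 by linarith
  qed
  then have im: "(%sg. eps + sg * tau) ` {0<..<1} \<subseteq> {0<..1}" by blast
  have c: "continuous_on {0<..<1} (%sg. eps + sg * tau)" by (intro continuous_intros)
  have cj: "norm (jacobian (cavity_map r) (at x)) powr p = w1 p (norm x)" "det (jacobian (cavity_map r) (at x)) = du (norm x)"
    if "eps < norm x" "norm x < eps + tau" for x
  proof -
    have rho: "0 < norm x" "norm x < 1" using that ring by linarith+
    have "(r has_real_derivative r' (norm x)) (at (norm x) within {0<..<1})"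
      by (rule DERIV_subset[OF deriv(1)]) (use rho in auto)
    then have "(r has_real_derivative r' (norm x)) (at (norm x))"
      using rho by (simp add: at_within_open[where S="{0<..<1}"])
    note cj = cavity_map_jacobian[OF this]
    have nz: "x \<noteq> 0" using rho by auto
    have "norm (jacobian (cavity_map r) (at x)) powr p = ((norm (jacobian (cavity_map r) (at x)))\<^sup>2) powr (p / 2)"
      by (cases "jacobian (cavity_map r) (at x) = 0") (simp_all add: powr_powr flip: powr_numeral)
    then show "norm (jacobian (cavity_map r) (at x)) powr p = w1 p (norm x)" unfolding cj(2)[OF nz] w1_def .
    show "det (jacobian (cavity_map r) (at x)) = du (norm x)" unfolding cj(1)[OF nz] du_def ..
  qed
  have n1: "0 <= w1 p (eps + sg * tau)" for sg by (simp add: w1_def)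
  have n2: "0 <= g (du (eps + sg * tau))" if "sg \<in> {0<..<1}" for sg
    using W(4)[OF that] t[OF that] by (simp add: radial2_def zero_le_mult_iff)
  have R1: "set_integrable lebesgue (ring_region eps tau) (%x. norm (jacobian (cavity_map r) (at x)) powr p)"
    "(LINT x:ring_region eps tau|lebesgue. norm (jacobian (cavity_map r) (at x)) powr p) = 2 * pi * tau * (LINT s:{0<..<1}|lborel. w1 p (eps + s * tau) * (eps + s * tau))"
    by (rule ring_integral[OF ring(1,2) cj(1) continuous_on_compose2[OF dc(1) c im] n1 W(5)[unfolded radial1_def]]; assumption)+
  have R2: "set_integrable lebesgue (ring_region eps tau) (%x. g (det (jacobian (cavity_map r) (at x))))"
    "(LINT x:ring_region eps tau|lebesgue. g (det (jacobian (cavity_map r) (at x)))) = 2 * pi * tau * (LINT s:{0<..<1}|lborel. g (du (eps + s * tau)) * (eps + s * tau))"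
    by (rule ring_integral[OF ring(1,2) arg_cong[where f=g, OF cj(2)] continuous_on_compose2[OF dc(2) c im] n2 W(6)[unfolded radial2_def]]; assumption)+
  show "finite_E1 p (cavity_map r) (ring_region eps tau)" "finite_E2 g (cavity_map r) (ring_region eps tau)"
    "E1 om p (cavity_map r) (ring_region eps tau) = om * (2 * pi * tau * (LINT sg:{0<..<1}|lborel. radial1 p eps tau sg))"
    "E2 g (cavity_map r) (ring_region eps tau) = 2 * pi * tau * (LINT sg:{0<..<1}|lborel. radial2 g eps tau sg)"
    unfolding finite_E1_def finite_E2_def E1_def E2_def radial1_def radial2_def using R1 R2 by simp_all
qed

end

lemma relative_error:
  fixes x y k l A Psi :: real
  assumes "\<bar>x - y\<bar> <= k * (Psi * A)" "A <= l * y" "0 < A" "0 < l" "0 <= k" "0 <= Psi"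
  shows "\<exists>eta. \<bar>eta\<bar> <= k * l * Psi & x = y * (1 + eta)"
proof (intro exI conjI)
  have "0 < l * y" using assms by linarith
  then have y: "0 < y" using assms(4) by (simp add: zero_less_mult_iff)
  show "x = y * (1 + (x - y) / y)" using y by (simp add: field_simps)
  have "\<bar>(x - y) / y\<bar> = \<bar>x - y\<bar> / y" using y by simp
  also have "\<dots> <= (k * (Psi * (l * y))) / y"
  proof (rule divide_right_mono)
    have "k * (Psi * A) <= k * (Psi * (l * y))" using assms by (intro mult_left_mono) auto
    then show "\<bar>x - y\<bar> <= k * (Psi * (l * y))" using assms(1) by linarith
  qed (use y in simp)
  also have "\<dots> = k * l * Psi" using y by simp
  finally show "\<bar>(x - y) / y\<bar> <= k * l * Psi" .
qed

context cavity
begin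

text \<open>Interpolant and deformation are both compared with the exact ring integral, whose
  cellwise value is explicit; their mutual comparison follows by the triangle inequality.\<close>

lemma mesh_energies:
  assumes p: "1 < p" "p < 2" and g: "volumetric_density g"
  obtains K C where "3 <= K" "0 < C" "!!J eps tau N. ring_mesh J eps tau N ==>
    (\<forall>b\<in>ring_cell eps tau N. (\<exists>n s gam w. ring_element K eps tau N n s gam w b) & set_integrable lebesgue open_triangle (e1v p b) &
       set_integrable lebesgue open_triangle (e1u p b) & set_integrable lebesgue open_triangle (e2u g b)) &
    \<bar>(\<Sum>a\<in>J. LINT x:open_triangle|lebesgue. e1v p a x) - 2 * pi * tau * (LINT sg:{0<..<1}|lborel. radial1 p eps tau sg)\<bar> <= C * (mesh_error eps tau N * ring_weight p eps tau) &
    \<bar>(\<Sum>a\<in>J. LINT x:open_triangle|lebesgue. e1u p a x) - 2 * pi * tau * (LINT sg:{0<..<1}|lborel. radial1 p eps tau sg)\<bar> <= C * (mesh_error eps tau N * ring_weight p eps tau) &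
    \<bar>(\<Sum>a\<in>J. LINT x:open_triangle|lebesgue. e2u g a x) - 2 * pi * tau * (LINT sg:{0<..<1}|lborel. radial2 g eps tau sg)\<bar> <= C * (mesh_error eps tau N * ring_weight p eps tau) &
    ring_weight p eps tau <= C * (\<Sum>a\<in>J. LINT x:open_triangle|lebesgue. e1u p a x) &
    0 <= (\<Sum>a\<in>J. LINT x:open_triangle|lebesgue. e2u g a x) & 0 < mesh_error eps tau N & mesh_error eps tau N <= 3"
proof -
  obtain K where K: "3 <= K" and cell: "!!eps tau (N::nat). 0 < eps ==> 0 < tau ==> eps + tau <= 1 ==> 0 < N ==>
      inj_on (quad_map (elem_A eps tau N)) ref_triangle ==>
      ring_element K eps tau N 2 (%x. x$1 + x$2) (%sg. sg) (%sg. 1 + (eps + tau) / (eps + sg * tau)) (elem_A eps tau N) &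
      (nondegenerate K eps tau N (%x. eps + (x$1 + x$2) * tau) (elem_A eps tau N) \<or> degenerate K eps tau N (elem_A eps tau N)) &
      ring_element K eps tau N 2 (%x. 1 - (x$1 + x$2)) (%sg. 1 - sg) (%_. 1) (elem_B eps tau N) &
      nondegenerate K eps tau N (%x. eps + (1 - (x$1 + x$2)) * tau) (elem_B eps tau N) &
      ring_element K eps tau N 1 (%x. x$1) (%sg. 1 - sg) (%_. 1) (elem_C eps tau N) &
      nondegenerate K eps tau N (%x. eps + x$1 * tau) (elem_C eps tau N) &
      ring_element K eps tau N 1 (%x. x$2) (%sg. 1 - sg) (%_. 1) (elem_D eps tau N) &
      nondegenerate K eps tau N (%x. eps + x$2 * tau) (elem_D eps tau N)"
    by (rule ring_elements) (rule that)
  define I0 where "I0 eps tau = (LINT sg:{0<..<1}|lborel. (eps + sg * tau) powr (1 - p))" for eps tau :: real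
  obtain C1 where C1_lit: "0 < C1" "!!eps tau N n s gam b a. ring_element K eps tau N n s gam b a ==> nondegenerate K eps tau N (%x. eps + s x * tau) a ==>
    volumetric_density g ==> set_integrable lebesgue open_triangle (e1v p a) &
    \<bar>(LINT x:open_triangle|lebesgue. e1v p a x) - n * (pi / real N * tau) * (LINT sg:{0<..<1}|lborel. gam sg * radial1 p eps tau sg)\<bar>
       <= C1 * ((pi / real N * tau) * mesh_error eps tau N * (LINT sg:{0<..<1}|lborel. (eps + sg * tau) powr (1 - p)))"
    by (rule nondegenerate_interpolant_energy[OF p K]) (rule that)
  obtain C2 where C2_lit: "0 < C2" "!!eps tau N n s gam b a. ring_element K eps tau N n s gam b a ==> degenerate K eps tau N a ==>
    volumetric_density g ==> set_integrable lebesgue open_triangle (e1v p a) &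
    \<bar>(LINT x:open_triangle|lebesgue. e1v p a x) - n * (pi / real N * tau) * (LINT sg:{0<..<1}|lborel. gam sg * radial1 p eps tau sg)\<bar>
       <= C2 * ((pi / real N * tau) * mesh_error eps tau N * (LINT sg:{0<..<1}|lborel. (eps + sg * tau) powr (1 - p)))"
    by (rule degenerate_interpolant_energy[OF p K]) (rule that)
  obtain C3 where C3_lit: "0 < C3" "!!eps tau N n s gam b a. ring_element K eps tau N n s gam b a ==>
    set_integrable lebesgue open_triangle (e1u p a) & set_integrable lebesgue open_triangle (e2u g a) &
    \<bar>(LINT x:open_triangle|lebesgue. e1u p a x) - n * (pi / real N * tau) * (LINT sg:{0<..<1}|lborel. gam sg * radial1 p eps tau sg)\<bar>
       <= C3 * ((pi / real N * tau) * mesh_error eps tau N * (LINT sg:{0<..<1}|lborel. (eps + sg * tau) powr (1 - p))) &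
    \<bar>(LINT x:open_triangle|lebesgue. e2u g a x) - n * (pi / real N * tau) * (LINT sg:{0<..<1}|lborel. gam sg * radial2 g eps tau sg)\<bar>
       <= C3 * ((pi / real N * tau) * mesh_error eps tau N * (LINT sg:{0<..<1}|lborel. (eps + sg * tau) powr (1 - p)))"
    by (rule deformation_energy[OF p K g]) (rule that)
  obtain C4 where C4_lit: "0 < C4" "!!eps tau N n s b a. ring_element K eps tau N n s (%sg. 1 - sg) b a ==> nondegenerate K eps tau N (%x. eps + s x * tau) a ==>
    set_integrable lebesgue open_triangle (e1u p a) ==>
    C4 * ((pi / real N * tau) * (LINT sg:{0<..<1}|lborel. (eps + sg * tau) powr (1 - p))) <= (LINT x:open_triangle|lebesgue. e1u p a x)"
    by (rule deformation_energy_lower[OF p K g]) (rule that)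
  note C1 = C1_lit[folded I0_def] and C2 = C2_lit[folded I0_def] and C3 = C3_lit[folded I0_def] and C4 = C4_lit[folded I0_def]
  define C0 where "C0 = C1 + C2 + C3"
  have C0: "0 < C0" "C1 <= C0" "C2 <= C0" "C3 <= C0" using C1(1) C2(1) C3(1) by (auto simp: C0_def)
  define C where "C = 3 * pi * C0 / (2 - p) + (2 - p) / (C4 * pi)"
  have parts: "0 < 3 * pi * C0 / (2 - p)" "0 < (2 - p) / (C4 * pi)" using C0 C4(1) p by auto
  then have C: "0 < C" "3 * pi * C0 / (2 - p) <= C" "(2 - p) / (C4 * pi) <= C" unfolding C_def by linarith+
  show thesis
  proof (rule that[OF K C(1)])
    fix J eps tau N assume J: "ring_mesh J eps tau N"
    have ring: "0 < eps" "0 < tau" "eps + tau <= 1" "0 < N" and tri: "triangulation J" using J by (auto simp: ring_mesh_def)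
    note st = ring_mesh_structure[OF J]
    obtain phi where "rot phi \<circ> elem_A eps tau N \<in> J" using st(3) by blast
    then have "inj_on (quad_map (rot phi \<circ> elem_A eps tau N)) ref_triangle" using tri by (simp add: triangulation_def)
    then have inj: "inj_on (quad_map (elem_A eps tau N)) ref_triangle" by (rule inj_on_quad_map_rot)
    let ?A = "elem_A eps tau N" and ?B = "elem_B eps tau N" and ?C = "elem_C eps tau N" and ?D = "elem_D eps tau N"
    have EA: "ring_element K eps tau N 2 (%x. x$1 + x$2) (%sg. sg) (%sg. 1 + (eps + tau) / (eps + sg * tau)) ?A"
      and nA: "nondegenerate K eps tau N (%x. eps + (x$1 + x$2) * tau) ?A \<or> degenerate K eps tau N ?A"
      and EB: "ring_element K eps tau N 2 (%x. 1 - (x$1 + x$2)) (%sg. 1 - sg) (%_. 1) ?B"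
      and nB: "nondegenerate K eps tau N (%x. eps + (1 - (x$1 + x$2)) * tau) ?B"
      and EC: "ring_element K eps tau N 1 (%x. x$1) (%sg. 1 - sg) (%_. 1) ?C"
      and nC: "nondegenerate K eps tau N (%x. eps + x$1 * tau) ?C"
      and ED: "ring_element K eps tau N 1 (%x. x$2) (%sg. 1 - sg) (%_. 1) ?D"
      and nD: "nondegenerate K eps tau N (%x. eps + x$2 * tau) ?D"
      using cell[OF ring inj] by blast+
    note h = ring_elementD[OF EA]
    note W = radial_facts[OF p g ring(1-3)] and w = ring_weight_eq[OF p ring(1,2)]
    define th where "th = pi / real N * tau"
    define e where "e = C0 * (th * mesh_error eps tau N * I0 eps tau)"
    have I0: "0 <= I0 eps tau" unfolding I0_def set_lebesgue_integral_def by (rule integral_nonneg_AE) auto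
    have nn: "0 <= th * mesh_error eps tau N * I0 eps tau" "0 <= th * I0 eps tau"
      unfolding th_def
      by (rule mult_nonneg_nonneg[OF less_imp_le[OF mult_pos_pos[OF h(10,11)]] I0], rule mult_nonneg_nonneg[OF less_imp_le[OF h(10)] I0])
    have Ce: "C1 * (th * mesh_error eps tau N * I0 eps tau) <= e" "C2 * (th * mesh_error eps tau N * I0 eps tau) <= e" "C3 * (th * mesh_error eps tau N * I0 eps tau) <= e"
      unfolding e_def using C0 nn(1) by (intro mult_right_mono; simp)+
    have A: "ring_weight p eps tau = (2 - p) * (tau * I0 eps tau)" unfolding I0_def by (rule w(3))
    have A0: "0 <= ring_weight p eps tau" unfolding A using p ring I0 by simp
    have Ne: "real N * (3 * e) <= C * (mesh_error eps tau N * ring_weight p eps tau)"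
    proof -
      have "real N * (3 * e) = 3 * pi * C0 / (2 - p) * (mesh_error eps tau N * ring_weight p eps tau)"
        unfolding e_def A th_def using ring p by simp
      also have "\<dots> <= C * (mesh_error eps tau N * ring_weight p eps tau)" by (rule mult_right_mono[OF C(2)]) (use A0 h(11) in simp)
      finally show ?thesis .
    qed
    have split: "(LINT sg:{0<..<1}|lborel. sg * V sg) + (LINT sg:{0<..<1}|lborel. (1 - sg) * V sg) = (LINT sg:{0<..<1}|lborel. V sg)"
      if V: "continuous_on {0<..<1} V" "!!sg. sg \<in> {0<..<1} ==> 0 <= V sg" "set_integrable lborel {0<..<1} V" for V :: "real => real"
    proof -
      have "(LINT sg:{0<..<1}|lborel. sg * V sg) + (LINT sg:{0<..<1}|lborel. (1 - sg) * V sg) = (LINT sg:{0<..<1}|lborel. sg * V sg + (1 - sg) * V sg)"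
        by (rule set_integral_add(2)[OF triangle_integral(5,4)[OF V], symmetric])
      also have "\<dots> = (LINT sg:{0<..<1}|lborel. V sg)" by (simp add: algebra_simps)
      finally show ?thesis .
    qed
    have vA: "set_integrable lebesgue open_triangle (e1v p ?A)"
      "\<bar>(LINT x:open_triangle|lebesgue. e1v p ?A x) - 2 * th * (LINT sg:{0<..<1}|lborel. sg * radial1 p eps tau sg)\<bar> <= e"
      using nA C1(2)[OF EA _ g, folded th_def] C2(2)[OF EA _ g, folded th_def] Ce(1,2) by (blast intro: order_trans)+
    note vB = C1(2)[OF EB nB g, folded th_def] and vC = C1(2)[OF EC nC g, folded th_def] and vD = C1(2)[OF ED nD g, folded th_def]
    note uA = C3(2)[OF EA, folded th_def] and uB = C3(2)[OF EB, folded th_def] and uC = C3(2)[OF EC, folded th_def] and uD = C3(2)[OF ED, folded th_def]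
    obtain b where b: "!!f :: elem => real. (!!phi a. f (rot phi \<circ> a) = f a) ==>
       (\<Sum>a\<in>J. f a) = real N * (f ?A + (if b then f ?B else f ?C + f ?D))"
      using st(4) by blast
    have sums: "(\<Sum>a\<in>J. LINT x:open_triangle|lebesgue. F a x) = real N * ((LINT x:open_triangle|lebesgue. F ?A x) +
        (if b then LINT x:open_triangle|lebesgue. F ?B x else (LINT x:open_triangle|lebesgue. F ?C x) + (LINT x:open_triangle|lebesgue. F ?D x)))"
      if "!!phi a. F (rot phi \<circ> a) = F a" for F :: "elem => real^2 => real"
      by (rule b) (simp add: that)
    note s1v = sums[of "e1v p", OF element_energies_rot(1)] and s1u = sums[of "e1u p", OF element_energies_rot(2)]
      and s2u = sums[of "e2u g", OF element_energies_rot(3)]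
    have V1: "\<bar>(\<Sum>a\<in>J. LINT x:open_triangle|lebesgue. e1v p a x) - 2 * pi * tau * (LINT sg:{0<..<1}|lborel. radial1 p eps tau sg)\<bar> <= real N * (3 * e)"
      unfolding s1v
      by (rule cell_sum_close[OF ring(4) th_def vA(2) order_trans[OF conjunct2[OF vB] Ce(1)] order_trans[OF conjunct2[OF vC] Ce(1)]
          order_trans[OF conjunct2[OF vD] Ce(1)] split[OF W(1,3,5)]])
    have U1: "\<bar>(\<Sum>a\<in>J. LINT x:open_triangle|lebesgue. e1u p a x) - 2 * pi * tau * (LINT sg:{0<..<1}|lborel. radial1 p eps tau sg)\<bar> <= real N * (3 * e)"
      unfolding s1u
      by (rule cell_sum_close[OF ring(4) th_def order_trans[OF conjunct1[OF conjunct2[OF conjunct2[OF uA]]] Ce(3)] order_trans[OF conjunct1[OF conjunct2[OF conjunct2[OF uB]]] Ce(3)]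
          order_trans[OF conjunct1[OF conjunct2[OF conjunct2[OF uC]]] Ce(3)] order_trans[OF conjunct1[OF conjunct2[OF conjunct2[OF uD]]] Ce(3)] split[OF W(1,3,5)]])
    have U2: "\<bar>(\<Sum>a\<in>J. LINT x:open_triangle|lebesgue. e2u g a x) - 2 * pi * tau * (LINT sg:{0<..<1}|lborel. radial2 g eps tau sg)\<bar> <= real N * (3 * e)"
      unfolding s2u
      by (rule cell_sum_close[OF ring(4) th_def order_trans[OF conjunct2[OF conjunct2[OF conjunct2[OF uA]]] Ce(3)] order_trans[OF conjunct2[OF conjunct2[OF conjunct2[OF uB]]] Ce(3)]
          order_trans[OF conjunct2[OF conjunct2[OF conjunct2[OF uC]]] Ce(3)] order_trans[OF conjunct2[OF conjunct2[OF conjunct2[OF uD]]] Ce(3)] split[OF W(2,4,6)]])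
    have e1u0: "0 <= (LINT x:open_triangle|lebesgue. e1u p X x)" "0 <= (LINT x:open_triangle|lebesgue. e2u g X x)"
      if R: "ring_element K eps tau N n s gam w X" for n s gam w X
    proof -
      have "0 <= e1u p X x" "0 <= e2u g X x" if x: "x \<in> open_triangle" for x
      proof -
        have "0 <= edet X x" using ring_elementD(14)[OF R x] by linarith
        moreover have "norm (quad_map X x) \<in> {0<..1}" using ring_elementD(13)[OF R x] by blast
        then have "0 < du (norm (quad_map X x))" using du_bounds by (meson less_le_trans)
        then have "0 < g (du (norm (quad_map X x)))" using g by (simp add: volumetric_density_def)
        ultimately show "0 <= e1u p X x" "0 <= e2u g X x" by (simp_all add: e1u_def e2u_def w1_def)
      qed
      then show "0 <= (LINT x:open_triangle|lebesgue. e1u p X x)" "0 <= (LINT x:open_triangle|lebesgue. e2u g X x)"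
        unfolding set_lebesgue_integral_def by (auto intro!: integral_nonneg_AE simp: indicator_def)
    qed
    \<comment> \<open>The lower bound uses only B or C, which are never degenerate; the other
      elements contribute nonnegatively.\<close>
    have "C4 * (th * I0 eps tau) <= (LINT x:open_triangle|lebesgue. e1u p ?B x)" "C4 * (th * I0 eps tau) <= (LINT x:open_triangle|lebesgue. e1u p ?C x)"
      using C4(2)[OF EB nB, folded th_def] C4(2)[OF EC nC, folded th_def] uB uC by blast+
    then have "C4 * (th * I0 eps tau) <= (LINT x:open_triangle|lebesgue. e1u p ?A x) +
        (if b then LINT x:open_triangle|lebesgue. e1u p ?B x else (LINT x:open_triangle|lebesgue. e1u p ?C x) + (LINT x:open_triangle|lebesgue. e1u p ?D x))"
      using e1u0(1)[OF EA] e1u0(1)[OF ED] by (cases b) auto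
    then have "real N * (C4 * (th * I0 eps tau)) <= (\<Sum>a\<in>J. LINT x:open_triangle|lebesgue. e1u p a x)"
      unfolding s1u by (rule mult_left_mono) simp
    moreover have "real N * (C4 * (th * I0 eps tau)) = C4 * pi / (2 - p) * ring_weight p eps tau" unfolding A th_def using ring p by simp
    ultimately have low: "C4 * pi / (2 - p) * ring_weight p eps tau <= (\<Sum>a\<in>J. LINT x:open_triangle|lebesgue. e1u p a x)" by simp
    have "0 <= C4 * pi / (2 - p) * ring_weight p eps tau" using C4(1) p A0 by simp
    then have U0: "0 <= (\<Sum>a\<in>J. LINT x:open_triangle|lebesgue. e1u p a x)" using low by linarith
    have "ring_weight p eps tau = (2 - p) / (C4 * pi) * (C4 * pi / (2 - p) * ring_weight p eps tau)" using C4(1) p by simp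
    also have "\<dots> <= (2 - p) / (C4 * pi) * (\<Sum>a\<in>J. LINT x:open_triangle|lebesgue. e1u p a x)" using low parts(2) by (intro mult_left_mono) auto
    also have "\<dots> <= C * (\<Sum>a\<in>J. LINT x:open_triangle|lebesgue. e1u p a x)" by (rule mult_right_mono[OF C(3) U0])
    finally have AU: "ring_weight p eps tau <= C * (\<Sum>a\<in>J. LINT x:open_triangle|lebesgue. e1u p a x)" .
    have U20: "0 <= (\<Sum>a\<in>J. LINT x:open_triangle|lebesgue. e2u g a x)"
      unfolding s2u using e1u0(2)[OF EA] e1u0(2)[OF EB] e1u0(2)[OF EC] e1u0(2)[OF ED] by (cases b) auto
    have ints: "\<forall>b\<in>ring_cell eps tau N. (\<exists>n s gam w. ring_element K eps tau N n s gam w b) & set_integrable lebesgue open_triangle (e1v p b) &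
       set_integrable lebesgue open_triangle (e1u p b) & set_integrable lebesgue open_triangle (e2u g b)"
    proof
      fix X assume "X \<in> ring_cell eps tau N"
      then consider "X = ?A" | "X = ?B" | "X = ?C" | "X = ?D" by (auto simp: ring_cell_def)
      then show "(\<exists>n s gam w. ring_element K eps tau N n s gam w X) & set_integrable lebesgue open_triangle (e1v p X) &
       set_integrable lebesgue open_triangle (e1u p X) & set_integrable lebesgue open_triangle (e2u g X)"
      proof cases
        case 1 then show ?thesis using EA vA(1) uA by blast
      next
        case 2 then show ?thesis using EB vB uB by blast
      next
        case 3 then show ?thesis using EC vC uC by blast
      next
        case 4 then show ?thesis using ED vD uD by blast
      qed
    qed
    show "(\<forall>b\<in>ring_cell eps tau N. (\<exists>n s gam w. ring_element K eps tau N n s gam w b) & set_integrable lebesgue open_triangle (e1v p b) &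
       set_integrable lebesgue open_triangle (e1u p b) & set_integrable lebesgue open_triangle (e2u g b)) &
    \<bar>(\<Sum>a\<in>J. LINT x:open_triangle|lebesgue. e1v p a x) - 2 * pi * tau * (LINT sg:{0<..<1}|lborel. radial1 p eps tau sg)\<bar> <= C * (mesh_error eps tau N * ring_weight p eps tau) &
    \<bar>(\<Sum>a\<in>J. LINT x:open_triangle|lebesgue. e1u p a x) - 2 * pi * tau * (LINT sg:{0<..<1}|lborel. radial1 p eps tau sg)\<bar> <= C * (mesh_error eps tau N * ring_weight p eps tau) &
    \<bar>(\<Sum>a\<in>J. LINT x:open_triangle|lebesgue. e2u g a x) - 2 * pi * tau * (LINT sg:{0<..<1}|lborel. radial2 g eps tau sg)\<bar> <= C * (mesh_error eps tau N * ring_weight p eps tau) &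
    ring_weight p eps tau <= C * (\<Sum>a\<in>J. LINT x:open_triangle|lebesgue. e1u p a x) &
    0 <= (\<Sum>a\<in>J. LINT x:open_triangle|lebesgue. e2u g a x) & 0 < mesh_error eps tau N & mesh_error eps tau N <= 3"
      using ints order_trans[OF V1 Ne] order_trans[OF U1 Ne] order_trans[OF U2 Ne] AU U20 h(6,11) by blast
  qed
qed

text \<open>The volume energy of the interpolant is kept apart, since its constant depends on the
  orientation bound \<open>kap\<close>.\<close>

lemma deformed_ring_energies:
  assumes p: "1 < p" "p < 2" and g: "volumetric_density g"
  obtains C where "0 < C"
    "!!J eps tau N om. ring_mesh J eps tau N ==> 0 < om ==>
      finite_E1 p (interpolant J (cavity_map r)) (meshed_region J) & finite_E1 p (cavity_map r) (meshed_region J) &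
      finite_E2 g (cavity_map r) (meshed_region J) &
      (\<exists>V U R. E1 om p (interpolant J (cavity_map r)) (meshed_region J) = om * V & E1 om p (cavity_map r) (meshed_region J) = om * U &
         E1 om p (cavity_map r) (ring_region eps tau) = om * R &
         \<bar>V - R\<bar> <= C * (mesh_error eps tau N * ring_weight p eps tau) & \<bar>U - R\<bar> <= C * (mesh_error eps tau N * ring_weight p eps tau) &
         ring_weight p eps tau <= C * U & ring_weight p eps tau <= C * R & R <= C * ring_weight p eps tau) &
      \<bar>E2 g (cavity_map r) (meshed_region J) - E2 g (cavity_map r) (ring_region eps tau)\<bar> <= C * (mesh_error eps tau N * ring_weight p eps tau) &
      0 <= E2 g (cavity_map r) (meshed_region J) & 0 <= E2 g (cavity_map r) (ring_region eps tau) &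
      E2 g (cavity_map r) (ring_region eps tau) <= C * ring_weight p eps tau &
      0 < mesh_error eps tau N & mesh_error eps tau N <= 3 & (2 - p) * tau <= ring_weight p eps tau"
    "!!kap. 0 < kap ==> \<exists>C'>0. \<forall>J eps tau N. ring_mesh J eps tau N \<longrightarrow>
       uniformly_orientation_preserving kap (interpolant J (cavity_map r)) (meshed_region J) \<longrightarrow>
       finite_E2 g (interpolant J (cavity_map r)) (meshed_region J) &
       \<bar>E2 g (interpolant J (cavity_map r)) (meshed_region J) - E2 g (cavity_map r) (meshed_region J)\<bar> <= C' * volume_error eps tau N"
proof -
  obtain K C1 where K: "3 <= K" and C1: "0 < C1" and M: "!!J eps tau N. ring_mesh J eps tau N ==>
    (\<forall>b\<in>ring_cell eps tau N. (\<exists>n s gam w. ring_element K eps tau N n s gam w b) & set_integrable lebesgue open_triangle (e1v p b) &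
       set_integrable lebesgue open_triangle (e1u p b) & set_integrable lebesgue open_triangle (e2u g b)) &
    \<bar>(\<Sum>a\<in>J. LINT x:open_triangle|lebesgue. e1v p a x) - 2 * pi * tau * (LINT sg:{0<..<1}|lborel. radial1 p eps tau sg)\<bar> <= C1 * (mesh_error eps tau N * ring_weight p eps tau) &
    \<bar>(\<Sum>a\<in>J. LINT x:open_triangle|lebesgue. e1u p a x) - 2 * pi * tau * (LINT sg:{0<..<1}|lborel. radial1 p eps tau sg)\<bar> <= C1 * (mesh_error eps tau N * ring_weight p eps tau) &
    \<bar>(\<Sum>a\<in>J. LINT x:open_triangle|lebesgue. e2u g a x) - 2 * pi * tau * (LINT sg:{0<..<1}|lborel. radial2 g eps tau sg)\<bar> <= C1 * (mesh_error eps tau N * ring_weight p eps tau) &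
    ring_weight p eps tau <= C1 * (\<Sum>a\<in>J. LINT x:open_triangle|lebesgue. e1u p a x) &
    0 <= (\<Sum>a\<in>J. LINT x:open_triangle|lebesgue. e2u g a x) & 0 < mesh_error eps tau N & mesh_error eps tau N <= 3"
    by (rule mesh_energies[OF p g]) (rule that)
  obtain C2 where C2: "0 < C2" and R: "!!eps tau. 0 < eps ==> 0 < tau ==> eps + tau <= 1 ==>
    2 * pi * tau * (LINT sg:{0<..<1}|lborel. radial1 p eps tau sg) <= C2 * ring_weight p eps tau &
    ring_weight p eps tau <= C2 * (2 * pi * tau * (LINT sg:{0<..<1}|lborel. radial1 p eps tau sg)) &
    0 <= 2 * pi * tau * (LINT sg:{0<..<1}|lborel. radial2 g eps tau sg) &
    2 * pi * tau * (LINT sg:{0<..<1}|lborel. radial2 g eps tau sg) <= C2 * ring_weight p eps tau &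
    (2 - p) * tau <= ring_weight p eps tau"
    by (rule radial_bounds[OF p g]) (rule that)
  have re: "\<exists>n s gam w. ring_element K eps tau N n s gam w b" if "ring_mesh J eps tau N" "b \<in> ring_cell eps tau N" for J eps tau N b
    using M[OF that(1)] that(2) by blast
  have norms: "0 < norm (quad_map b x) & norm (quad_map b x) <= eps + tau & 0 < edet b x"
    if J: "ring_mesh J eps tau N" "b \<in> ring_cell eps tau N" and x: "x \<in> open_triangle" for J eps tau N b x
  proof -
    obtain n s gam w where "ring_element K eps tau N n s gam w b" using re[OF J] by blast
    from ring_elementD(13,14)[OF this x] show ?thesis by auto
  qed
  have ints: "set_integrable lebesgue open_triangle (e1v p a)" "set_integrable lebesgue open_triangle (e1u p a)" "set_integrable lebesgue open_triangle (e2u g a)"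
    if J: "ring_mesh J eps tau N" and a: "a \<in> J" for J eps tau N a
  proof -
    obtain phi b where b: "b \<in> ring_cell eps tau N" "a = rot phi \<circ> b" using ring_mesh_structure(2)[OF J a] by blast
    then show "set_integrable lebesgue open_triangle (e1v p a)" "set_integrable lebesgue open_triangle (e1u p a)" "set_integrable lebesgue open_triangle (e2u g a)"
      using M[OF J] unfolding b(2) element_energies_rot by blast+
  qed
  have densities: "\<bar>wedge (dquad1 a x) (dquad2 a x)\<bar> * norm (jacobian (interpolant J (cavity_map r)) (at (quad_map a x))) powr p = e1v p a x"
    "det (jacobian (interpolant J (cavity_map r)) (at (quad_map a x))) = evol (cavity_map r) a x / edet a x"
    "\<bar>wedge (dquad1 a x) (dquad2 a x)\<bar> * norm (jacobian (cavity_map r) (at (quad_map a x))) powr p = e1u p a x"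
    "\<bar>wedge (dquad1 a x) (dquad2 a x)\<bar> * g (det (jacobian (cavity_map r) (at (quad_map a x)))) = e2u g a x"
    "\<bar>wedge (dquad1 a x) (dquad2 a x)\<bar> * g (det (jacobian (interpolant J (cavity_map r)) (at (quad_map a x)))) = e2v g a x"
    if J: "ring_mesh J eps tau N" and ax: "a \<in> J" "x \<in> open_triangle" for J eps tau N a x
    by (rule mesh_densities[OF J _ ax]; rule norms[OF J]; assumption)+
  have mesh: "triangulation J" "finite J" if "ring_mesh J eps tau N" for J eps tau N
    using that ring_mesh_structure(1)[OF that] by (simp_all add: ring_mesh_def)
  have i1v: "set_integrable lebesgue (meshed_region J) (%x. norm (jacobian (interpolant J (cavity_map r)) (at x)) powr p)"
    "(LINT x:meshed_region J|lebesgue. norm (jacobian (interpolant J (cavity_map r)) (at x)) powr p) = (\<Sum>a\<in>J. LINT x:open_triangle|lebesgue. e1v p a x)"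
    if J: "ring_mesh J eps tau N" for J eps tau N
    by (rule mesh_integral[OF mesh[OF J]], rule densities(1)[OF J], assumption, assumption, rule ints(1)[OF J], assumption)+
  have i1u: "set_integrable lebesgue (meshed_region J) (%x. norm (jacobian (cavity_map r) (at x)) powr p)"
    "(LINT x:meshed_region J|lebesgue. norm (jacobian (cavity_map r) (at x)) powr p) = (\<Sum>a\<in>J. LINT x:open_triangle|lebesgue. e1u p a x)"
    if J: "ring_mesh J eps tau N" for J eps tau N
    by (rule mesh_integral[OF mesh[OF J]], rule densities(3)[OF J], assumption, assumption, rule ints(2)[OF J], assumption)+
  have i2u: "set_integrable lebesgue (meshed_region J) (%x. g (det (jacobian (cavity_map r) (at x))))"
    "(LINT x:meshed_region J|lebesgue. g (det (jacobian (cavity_map r) (at x)))) = (\<Sum>a\<in>J. LINT x:open_triangle|lebesgue. e2u g a x)"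
    if J: "ring_mesh J eps tau N" for J eps tau N
    by (rule mesh_integral[OF mesh[OF J]], rule densities(4)[OF J], assumption, assumption, rule ints(3)[OF J], assumption)+
  have i2v: "set_integrable lebesgue (meshed_region J) (%x. g (det (jacobian (interpolant J (cavity_map r)) (at x))))"
    "(LINT x:meshed_region J|lebesgue. g (det (jacobian (interpolant J (cavity_map r)) (at x)))) = (\<Sum>a\<in>J. LINT x:open_triangle|lebesgue. e2v g a x)"
    if J: "ring_mesh J eps tau N" and int: "!!a. a \<in> J ==> set_integrable lebesgue open_triangle (e2v g a)" for J eps tau N
    by (rule mesh_integral[OF mesh[OF J]], rule densities(5)[OF J], assumption, assumption, rule int, assumption)+
  show thesis
  proof (rule that[of "C1 + C2"])
    show "0 < C1 + C2" using C1 C2 by simp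
  next
    fix J eps tau N and om :: real assume J: "ring_mesh J eps tau N" and om: "0 < om"
    have ring: "0 < eps" "0 < tau" "eps + tau <= 1" and tri: "triangulation J" using J by (auto simp: ring_mesh_def)
    note E = ring_energies[OF p g ring]
    let ?A = "ring_weight p eps tau"
    define V where "V = (\<Sum>a\<in>J. LINT x:open_triangle|lebesgue. e1v p a x)"
    define U where "U = (\<Sum>a\<in>J. LINT x:open_triangle|lebesgue. e1u p a x)"
    define U2 where "U2 = (\<Sum>a\<in>J. LINT x:open_triangle|lebesgue. e2u g a x)"
    define R1 where "R1 = 2 * pi * tau * (LINT sg:{0<..<1}|lborel. radial1 p eps tau sg)"
    define R2 where "R2 = 2 * pi * tau * (LINT sg:{0<..<1}|lborel. radial2 g eps tau sg)"
    note m = M[OF J, folded V_def U_def U2_def R1_def R2_def] and rb = R[OF ring, folded R1_def R2_def]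
    have "0 < (2 - p) * tau" using p ring by simp
    then have A: "0 < ?A" using rb by linarith
    then have "0 < C1 * U" "0 < C2 * R1" using m rb by (blast intro: less_le_trans)+
    then have U0: "0 <= U" "0 <= R1" using C1 C2 by (simp_all add: zero_less_mult_iff)
    have me: "0 <= mesh_error eps tau N * ?A" using m A by simp
    have C: "C1 * (mesh_error eps tau N * ?A) <= (C1 + C2) * (mesh_error eps tau N * ?A)" "C1 * U <= (C1 + C2) * U" "C2 * R1 <= (C1 + C2) * R1"
      "C2 * ?A <= (C1 + C2) * ?A"
      using C1 C2 me U0 A by (intro mult_right_mono; simp)+
    have eqs: "E1 om p (interpolant J (cavity_map r)) (meshed_region J) = om * V" "E1 om p (cavity_map r) (meshed_region J) = om * U"
      "E1 om p (cavity_map r) (ring_region eps tau) = om * R1" "E2 g (cavity_map r) (meshed_region J) = U2" "E2 g (cavity_map r) (ring_region eps tau) = R2"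
      unfolding E(3)[folded R1_def] E(4)[folded R2_def]
      unfolding V_def U_def U2_def E1_def E2_def i1v(2)[OF J] i1u(2)[OF J] i2u(2)[OF J] by (rule refl)+
    have fins: "finite_E1 p (interpolant J (cavity_map r)) (meshed_region J)" "finite_E1 p (cavity_map r) (meshed_region J)"
      "finite_E2 g (cavity_map r) (meshed_region J)"
      using i1v(1)[OF J] i1u(1)[OF J] i2u(1)[OF J] by (simp_all add: finite_E1_def finite_E2_def)
    have VR: "\<bar>V - R1\<bar> <= (C1 + C2) * (mesh_error eps tau N * ?A) & \<bar>U - R1\<bar> <= (C1 + C2) * (mesh_error eps tau N * ?A) &
         ?A <= (C1 + C2) * U & ?A <= (C1 + C2) * R1 & R1 <= (C1 + C2) * ?A & \<bar>U2 - R2\<bar> <= (C1 + C2) * (mesh_error eps tau N * ?A) & R2 <= (C1 + C2) * ?A"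
      using m rb C by (blast intro: order_trans)
    show "finite_E1 p (interpolant J (cavity_map r)) (meshed_region J) & finite_E1 p (cavity_map r) (meshed_region J) &
      finite_E2 g (cavity_map r) (meshed_region J) &
      (\<exists>V U R. E1 om p (interpolant J (cavity_map r)) (meshed_region J) = om * V & E1 om p (cavity_map r) (meshed_region J) = om * U &
         E1 om p (cavity_map r) (ring_region eps tau) = om * R &
         \<bar>V - R\<bar> <= (C1 + C2) * (mesh_error eps tau N * ring_weight p eps tau) & \<bar>U - R\<bar> <= (C1 + C2) * (mesh_error eps tau N * ring_weight p eps tau) &
         ring_weight p eps tau <= (C1 + C2) * U & ring_weight p eps tau <= (C1 + C2) * R & R <= (C1 + C2) * ring_weight p eps tau) &
      \<bar>E2 g (cavity_map r) (meshed_region J) - E2 g (cavity_map r) (ring_region eps tau)\<bar> <= (C1 + C2) * (mesh_error eps tau N * ring_weight p eps tau) &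
      0 <= E2 g (cavity_map r) (meshed_region J) & 0 <= E2 g (cavity_map r) (ring_region eps tau) &
      E2 g (cavity_map r) (ring_region eps tau) <= (C1 + C2) * ring_weight p eps tau &
      0 < mesh_error eps tau N & mesh_error eps tau N <= 3 & (2 - p) * tau <= ring_weight p eps tau"
      unfolding eqs(4,5) using eqs(1-3) fins VR m rb by blast
  next
    fix kap :: real assume kap: "0 < kap"
    obtain C3 where C3: "0 < C3" and vol: "!!eps tau N n s gam b a. ring_element K eps tau N n s gam b a ==>
      set_integrable lebesgue open_triangle (e2u g a) ==>
      (!!x. x \<in> open_triangle ==> evol (cavity_map r) a x / edet a x \<in> {kap..1 / kap}) ==>
      set_integrable lebesgue open_triangle (e2v g a) &
      \<bar>(LINT x:open_triangle|lebesgue. e2v g a x) - (LINT x:open_triangle|lebesgue. e2u g a x)\<bar> <= C3 * (pi / real N * volume_error eps tau N)"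
    proof (rule interpolant_volume[OF g K kap], goal_cases)
      case (1 C)
      show ?case by (rule 1(1)[OF 1(2)], rule 1(3)) (assumption | blast)+
    qed
    have "finite_E2 g (interpolant J (cavity_map r)) (meshed_region J) &
       \<bar>E2 g (interpolant J (cavity_map r)) (meshed_region J) - E2 g (cavity_map r) (meshed_region J)\<bar> <= 3 * pi * C3 * volume_error eps tau N"
      if J: "ring_mesh J eps tau N" and op: "uniformly_orientation_preserving kap (interpolant J (cavity_map r)) (meshed_region J)" for J eps tau N
    proof -
      have ring: "0 < eps" "0 < tau" "eps + tau <= 1" "0 < N" and tri: "triangulation J" using J by (auto simp: ring_mesh_def)
      note st = ring_mesh_structure[OF J]
      \<comment> \<open>The pointwise form, on the open triangle, of the almost everywhere
        orientation bound; it is invariant under rotation.\<close>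
      define good where "good a \<longleftrightarrow> (\<forall>x\<in>open_triangle. evol (cavity_map r) a x / edet a x \<in> {kap..1 / kap})" for a
      have good_rot: "good (rot phi \<circ> a) = good a" for phi a by (simp add: good_def rotated_element)
      have good: "good a" if a: "a \<in> J" for a
        unfolding good_def
      proof
        fix x assume x: "x \<in> open_triangle"
        obtain phi b where b: "b \<in> ring_cell eps tau N" "a = rot phi \<circ> b" using st(2)[OF a] by blast
        obtain n s gam w where el: "ring_element K eps tau N n s gam w b" using re[OF J b(1)] by blast
        have cont: "continuous_on open_triangle (%x. evol (cavity_map r) a x / edet a x)"
          using ring_element_continuous(4)[OF el p g, of "cavity_map r"] unfolding b(2) rotated_element .
        have ae: "AE y\<in>meshed_region J in lebesgue. kap <= det (jacobian (interpolant J (cavity_map r)) (at y)) & det (jacobian (interpolant J (cavity_map r)) (at y)) <= 1 / kap"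
          using op by (simp add: uniformly_orientation_preserving_def)
        show "evol (cavity_map r) a x / edet a x \<in> {kap..1 / kap}"
        proof (rule AE_open_everywhere[OF ae _ _ _ cont closed_atLeastAtMost x])
          show "quad_map a ` open_triangle \<subseteq> meshed_region J"
            using a open_triangle_subset by (auto simp: meshed_region_def element_def)
          show "inj_on (quad_map a) ref_triangle" using tri a by (simp add: triangulation_def)
        qed (simp add: densities(2)[OF J a])
      qed
      have cell: "set_integrable lebesgue open_triangle (e2v g b) &
          \<bar>(LINT x:open_triangle|lebesgue. e2v g b x) - (LINT x:open_triangle|lebesgue. e2u g b x)\<bar> <= C3 * (pi / real N * volume_error eps tau N)"
        if bc: "b \<in> ring_cell eps tau N" and gb: "good b" for b
      proof -
        obtain n s gam w where "ring_element K eps tau N n s gam w b" using re[OF J bc] by blast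
        then show ?thesis using vol M[OF J] bc gb unfolding good_def by blast
      qed
      have int: "set_integrable lebesgue open_triangle (e2v g a)" if a: "a \<in> J" for a
      proof -
        obtain phi b where b: "b \<in> ring_cell eps tau N" "a = rot phi \<circ> b" using st(2)[OF a] by blast
        then have "good b" using good[OF a] good_rot by simp
        then show ?thesis using cell[OF b(1)] unfolding b(2) element_energies_rot by blast
      qed
      \<comment> \<open>A layer contains B or the pair C, D, and the orientation bound says nothing
        about a type that is absent. The value 0 off \<open>good\<close> lets the bound by q hold
        for all four representatives.\<close>
      define f where "f a = (if good a then \<bar>(LINT x:open_triangle|lebesgue. e2v g a x) - (LINT x:open_triangle|lebesgue. e2u g a x)\<bar> else 0)" for a
      define q where "q = C3 * (pi / real N * volume_error eps tau N)"
      have v0: "0 <= volume_error eps tau N" using ring by (simp add: volume_error_def)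
      then have q0: "0 <= q" using C3 by (simp add: q_def)
      have fq: "f b <= q" if "b \<in> ring_cell eps tau N" for b using cell[OF that] q0 by (auto simp: f_def q_def)
      have fr: "f (rot phi \<circ> a) = f a" for phi a by (simp only: f_def good_rot element_energies_rot)
      obtain b where b: "(\<Sum>a\<in>J. f a) = real N * (f (elem_A eps tau N) + (if b then f (elem_B eps tau N) else f (elem_C eps tau N) + f (elem_D eps tau N)))"
        using st(4) fr by blast
      have "f (elem_A eps tau N) <= q" "f (elem_B eps tau N) <= q" "f (elem_C eps tau N) <= q" "f (elem_D eps tau N) <= q"
        by (rule fq; simp add: ring_cell_def)+
      then have "f (elem_A eps tau N) + (if b then f (elem_B eps tau N) else f (elem_C eps tau N) + f (elem_D eps tau N)) <= 3 * q"
        using q0 by (cases b) auto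
      then have "(\<Sum>a\<in>J. f a) <= real N * (3 * q)" unfolding b by (rule mult_left_mono) simp
      also have "\<dots> = 3 * pi * C3 * volume_error eps tau N" using ring(4) by (simp add: q_def)
      finally have sf: "(\<Sum>a\<in>J. f a) <= 3 * pi * C3 * volume_error eps tau N" .
      have v2: "set_integrable lebesgue (meshed_region J) (%x. g (det (jacobian (interpolant J (cavity_map r)) (at x))))"
        "(LINT x:meshed_region J|lebesgue. g (det (jacobian (interpolant J (cavity_map r)) (at x)))) = (\<Sum>a\<in>J. LINT x:open_triangle|lebesgue. e2v g a x)"
        by (rule i2v[OF J], rule int, assumption)+
      have "E2 g (interpolant J (cavity_map r)) (meshed_region J) - E2 g (cavity_map r) (meshed_region J)
          = (\<Sum>a\<in>J. (LINT x:open_triangle|lebesgue. e2v g a x) - (LINT x:open_triangle|lebesgue. e2u g a x))"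
        unfolding E2_def v2(2) i2u(2)[OF J] by (simp add: sum_subtractf)
      also have "\<bar>\<dots>\<bar> <= (\<Sum>a\<in>J. \<bar>(LINT x:open_triangle|lebesgue. e2v g a x) - (LINT x:open_triangle|lebesgue. e2u g a x)\<bar>)" by (rule sum_abs)
      also have "\<dots> = (\<Sum>a\<in>J. f a)" by (rule sum.cong) (simp_all add: f_def good)
      finally show ?thesis using sf v2(1) by (simp add: finite_E2_def)
    qed
    then show "\<exists>C'>0. \<forall>J eps tau N. ring_mesh J eps tau N \<longrightarrow>
       uniformly_orientation_preserving kap (interpolant J (cavity_map r)) (meshed_region J) \<longrightarrow>
       finite_E2 g (interpolant J (cavity_map r)) (meshed_region J) &
       \<bar>E2 g (interpolant J (cavity_map r)) (meshed_region J) - E2 g (cavity_map r) (meshed_region J)\<bar> <= C' * volume_error eps tau N"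
      using C3 by (intro exI[of _ "3 * pi * C3"]) simp
  qed
qed

end

theorem theorem3p5:
  fixes \<omega> p :: real and g r :: "real \<Rightarrow> real"
  assumes "0 < \<omega>" and "1 < p" and "p < 2"
    and "volumetric_density g"
    and "cavity_profile r"
  shows
    "(\<exists>C>0. \<forall>J \<epsilon> \<tau> N. ring_mesh J \<epsilon> \<tau> N \<longrightarrow>
        (let u = cavity_map r; v = interpolant J u; S = meshed_region J; \<Omega> = ring_region \<epsilon> \<tau>;
             A = ring_weight p \<epsilon> \<tau>;
             \<Psi> = \<tau> ^ 2 + 1 / real N ^ 2 + \<epsilon> / \<tau> * (1 / real N ^ 4)
         in finite_E1 p v S \<and> finite_E1 p u S \<and> finite_E2 g u S \<and>
            finite_E1 p u \<Omega> \<and> finite_E2 g u \<Omega> \<and>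
            (\<exists>\<eta>. \<bar>\<eta>\<bar> \<le> C * \<Psi> \<and> E1 \<omega> p v S = E1 \<omega> p u S * (1 + \<eta>)) \<and>
            (\<exists>\<eta>. \<bar>\<eta>\<bar> \<le> C * \<Psi> \<and> energy \<omega> p g u S = energy \<omega> p g u \<Omega> * (1 + \<eta>)) \<and>
            A / C \<le> energy \<omega> p g u S \<and> energy \<omega> p g u S \<le> C * A \<and>
            A = (\<epsilon> + \<tau>) powr (2 - p) - \<epsilon> powr (2 - p)))
     \<and>
     (\<forall>\<kappa>>0. \<exists>C>0. \<forall>J \<epsilon> \<tau> N. ring_mesh J \<epsilon> \<tau> N \<longrightarrow>
        (let u = cavity_map r; v = interpolant J u; S = meshed_region J
         in uniformly_orientation_preserving \<kappa> v S \<longrightarrow>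
            finite_E2 g v S \<and>
            (\<exists>\<eta>. \<bar>\<eta>\<bar> \<le> C * (\<tau> ^ 3 + (\<epsilon> + \<tau>) * \<tau> * (1 / real N ^ 2) + 1 / real N ^ 4) \<and>
                 E2 g v S = E2 g u S + \<eta>) \<and>
            (\<exists>\<eta>. \<bar>\<eta>\<bar> \<le> C * (\<tau> ^ 2 + 1 / real N ^ 2 + 1 / real N ^ 4 / \<tau>) \<and>
                 energy \<omega> p g v S = energy \<omega> p g u S * (1 + \<eta>))))"
proof -
  note \<omega> = assms(1) and p = assms(2,3) and g = assms(4)
  obtain r' r'' r''' B c m M where cav: "cavity r r' r'' r''' B c m M" by (rule cavity_profileE[OF assms(5)])
  define u where "u = cavity_map r"
  note def_u = u_def[symmetric]
  obtain C0 where C0: "0 < C0"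
    and E_lit: "\<And>J \<epsilon> \<tau> N \<omega>. ring_mesh J \<epsilon> \<tau> N \<Longrightarrow> 0 < \<omega> \<Longrightarrow>
      finite_E1 p (interpolant J (cavity_map r)) (meshed_region J) \<and> finite_E1 p (cavity_map r) (meshed_region J) \<and>
      finite_E2 g (cavity_map r) (meshed_region J) \<and>
      (\<exists>V U R. E1 \<omega> p (interpolant J (cavity_map r)) (meshed_region J) = \<omega> * V \<and> E1 \<omega> p (cavity_map r) (meshed_region J) = \<omega> * U \<and>
         E1 \<omega> p (cavity_map r) (ring_region \<epsilon> \<tau>) = \<omega> * R \<and>
         \<bar>V - R\<bar> \<le> C0 * (mesh_error \<epsilon> \<tau> N * ring_weight p \<epsilon> \<tau>) \<and> \<bar>U - R\<bar> \<le> C0 * (mesh_error \<epsilon> \<tau> N * ring_weight p \<epsilon> \<tau>) \<and>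
         ring_weight p \<epsilon> \<tau> \<le> C0 * U \<and> ring_weight p \<epsilon> \<tau> \<le> C0 * R \<and> R \<le> C0 * ring_weight p \<epsilon> \<tau>) \<and>
      \<bar>E2 g (cavity_map r) (meshed_region J) - E2 g (cavity_map r) (ring_region \<epsilon> \<tau>)\<bar> \<le> C0 * (mesh_error \<epsilon> \<tau> N * ring_weight p \<epsilon> \<tau>) \<and>
      0 \<le> E2 g (cavity_map r) (meshed_region J) \<and> 0 \<le> E2 g (cavity_map r) (ring_region \<epsilon> \<tau>) \<and>
      E2 g (cavity_map r) (ring_region \<epsilon> \<tau>) \<le> C0 * ring_weight p \<epsilon> \<tau> \<and>
      0 < mesh_error \<epsilon> \<tau> N \<and> mesh_error \<epsilon> \<tau> N \<le> 3 \<and> (2 - p) * \<tau> \<le> ring_weight p \<epsilon> \<tau>"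
    and V_lit: "\<And>\<kappa>. 0 < \<kappa> \<Longrightarrow> \<exists>C'>0. \<forall>J \<epsilon> \<tau> N. ring_mesh J \<epsilon> \<tau> N \<longrightarrow>
       uniformly_orientation_preserving \<kappa> (interpolant J (cavity_map r)) (meshed_region J) \<longrightarrow>
       finite_E2 g (interpolant J (cavity_map r)) (meshed_region J) \<and>
       \<bar>E2 g (interpolant J (cavity_map r)) (meshed_region J) - E2 g (cavity_map r) (meshed_region J)\<bar> \<le> C' * volume_error \<epsilon> \<tau> N"
    by (rule cavity.deformed_ring_energies[OF cav p g]) (rule that)
  note E = E_lit[folded u_def] and V = V_lit[folded u_def]
  \<comment> \<open>One summand for each use: relative error of the first energy, relative error of
    the total energy, lower bound and upper bound by the ring weight. The 4 is 1 + 3, with 3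
    bounding the mesh error.\<close>
  define C where "C = 2 * C0 * C0 + (\<omega> + 1) * C0 * (C0 / \<omega>) + C0 / \<omega> + 4 * (\<omega> + 1) * C0"
  have parts: "0 < 2 * C0 * C0" "0 < (\<omega> + 1) * C0 * (C0 / \<omega>)" "0 < C0 / \<omega>" "0 < 4 * (\<omega> + 1) * C0"
    using C0 \<omega> by (simp_all add: add_pos_pos)
  have C: "0 < C" "2 * C0 * C0 \<le> C" "(\<omega> + 1) * C0 * (C0 / \<omega>) \<le> C" "C0 / \<omega> \<le> C" "4 * (\<omega> + 1) * C0 \<le> C"
    unfolding C_def using parts by linarith+
  have first: "finite_E1 p (interpolant J u) (meshed_region J) \<and> finite_E1 p u (meshed_region J) \<and> finite_E2 g u (meshed_region J) \<and>
      finite_E1 p u (ring_region \<epsilon> \<tau>) \<and> finite_E2 g u (ring_region \<epsilon> \<tau>) \<and>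
      (\<exists>\<eta>. \<bar>\<eta>\<bar> \<le> C * mesh_error \<epsilon> \<tau> N \<and> E1 \<omega> p (interpolant J u) (meshed_region J) = E1 \<omega> p u (meshed_region J) * (1 + \<eta>)) \<and>
      (\<exists>\<eta>. \<bar>\<eta>\<bar> \<le> C * mesh_error \<epsilon> \<tau> N \<and> energy \<omega> p g u (meshed_region J) = energy \<omega> p g u (ring_region \<epsilon> \<tau>) * (1 + \<eta>)) \<and>
      ring_weight p \<epsilon> \<tau> / C \<le> energy \<omega> p g u (meshed_region J) \<and> energy \<omega> p g u (meshed_region J) \<le> C * ring_weight p \<epsilon> \<tau> \<and>
      ring_weight p \<epsilon> \<tau> = (\<epsilon> + \<tau>) powr (2 - p) - \<epsilon> powr (2 - p) \<and>
      \<bar>E1 \<omega> p (interpolant J u) (meshed_region J) - E1 \<omega> p u (meshed_region J)\<bar> \<le> 2 * \<omega> * C0 * (mesh_error \<epsilon> \<tau> N * ring_weight p \<epsilon> \<tau>) \<and>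
      ring_weight p \<epsilon> \<tau> \<le> C0 / \<omega> * energy \<omega> p g u (meshed_region J) \<and> 0 < ring_weight p \<epsilon> \<tau>"
    if J: "ring_mesh J \<epsilon> \<tau> N" for J \<epsilon> \<tau> N
  proof -
    have ring: "0 < \<epsilon>" "0 < \<tau>" "\<epsilon> + \<tau> \<le> 1" using J by (auto simp: ring_mesh_def)
    let ?A = "ring_weight p \<epsilon> \<tau>" and ?\<Psi> = "mesh_error \<epsilon> \<tau> N"
    note e = E[OF J \<omega>]
    obtain V U R where VUR: "E1 \<omega> p (interpolant J u) (meshed_region J) = \<omega> * V" "E1 \<omega> p u (meshed_region J) = \<omega> * U"
         "E1 \<omega> p u (ring_region \<epsilon> \<tau>) = \<omega> * R"
         "\<bar>V - R\<bar> \<le> C0 * (?\<Psi> * ?A)" "\<bar>U - R\<bar> \<le> C0 * (?\<Psi> * ?A)" "?A \<le> C0 * U" "?A \<le> C0 * R" "R \<le> C0 * ?A"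
      using e by blast
    define U2 where "U2 = E2 g u (meshed_region J)"
    define R2 where "R2 = E2 g u (ring_region \<epsilon> \<tau>)"
    have e2: "\<bar>U2 - R2\<bar> \<le> C0 * (?\<Psi> * ?A)" "0 \<le> U2" "0 \<le> R2" "R2 \<le> C0 * ?A" "0 < ?\<Psi>" "?\<Psi> \<le> 3" "(2 - p) * \<tau> \<le> ?A"
      using e unfolding U2_def R2_def by blast+
    have "0 < (2 - p) * \<tau>" using p ring by simp
    then have A: "0 < ?A" using e2(7) by linarith
    have d1: "\<bar>\<omega> * V - \<omega> * U\<bar> \<le> 2 * \<omega> * C0 * (?\<Psi> * ?A)"
    proof -
      have "\<bar>V - U\<bar> \<le> 2 * (C0 * (?\<Psi> * ?A))" using VUR(4,5) by linarith
      then have "\<omega> * \<bar>V - U\<bar> \<le> \<omega> * (2 * (C0 * (?\<Psi> * ?A)))" using \<omega> by (intro mult_left_mono) auto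
      moreover have "\<bar>\<omega> * V - \<omega> * U\<bar> = \<omega> * \<bar>V - U\<bar>" using \<omega> by (simp add: abs_mult flip: right_diff_distrib)
      ultimately show ?thesis by simp
    qed
    have A1: "?A \<le> C0 / \<omega> * (\<omega> * U)" "?A \<le> C0 / \<omega> * (\<omega> * R)" using VUR(6,7) \<omega> by simp_all
    have Cw: "0 < C0 / \<omega>" using C0 \<omega> by simp
    have A2: "?A \<le> C0 / \<omega> * (\<omega> * U + U2)" "?A \<le> C0 / \<omega> * (\<omega> * R + R2)"
      using A1 mult_nonneg_nonneg[OF less_imp_le[OF Cw] e2(2)] mult_nonneg_nonneg[OF less_imp_le[OF Cw] e2(3)]
      unfolding distrib_left by linarith+
    have d2: "\<bar>(\<omega> * U + U2) - (\<omega> * R + R2)\<bar> \<le> (\<omega> + 1) * C0 * (?\<Psi> * ?A)"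
    proof -
      have "\<omega> * \<bar>U - R\<bar> \<le> \<omega> * (C0 * (?\<Psi> * ?A))" using \<omega> VUR(5) by (intro mult_left_mono) auto
      moreover have "\<bar>\<omega> * U - \<omega> * R\<bar> = \<omega> * \<bar>U - R\<bar>" using \<omega> by (simp add: abs_mult flip: right_diff_distrib)
      moreover have "(\<omega> + 1) * C0 * (?\<Psi> * ?A) = \<omega> * (C0 * (?\<Psi> * ?A)) + C0 * (?\<Psi> * ?A)" by (simp add: algebra_simps)
      ultimately show ?thesis using e2(1) by linarith
    qed
    have \<Psi>C: "k * ?\<Psi> \<le> C * ?\<Psi>" if "k \<le> C" for k using that e2(5) by (intro mult_right_mono) auto
    have r1: "\<exists>\<eta>. \<bar>\<eta>\<bar> \<le> C * ?\<Psi> \<and> \<omega> * V = \<omega> * U * (1 + \<eta>)"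
    proof -
      have "2 * \<omega> * C0 * (C0 / \<omega>) = 2 * C0 * C0" using \<omega> by simp
      moreover have "0 \<le> 2 * \<omega> * C0" using \<omega> C0 by simp
      ultimately show ?thesis
        using relative_error[OF d1 A1(1) A Cw _ less_imp_le[OF e2(5)]] order_trans[OF _ \<Psi>C[OF C(2)]] by metis
    qed
    have r2: "\<exists>\<eta>. \<bar>\<eta>\<bar> \<le> C * ?\<Psi> \<and> \<omega> * U + U2 = (\<omega> * R + R2) * (1 + \<eta>)"
    proof -
      have "0 \<le> (\<omega> + 1) * C0" using \<omega> C0 by simp
      from relative_error[OF d2 A2(2) A Cw this less_imp_le[OF e2(5)]]
      show ?thesis using order_trans[OF _ \<Psi>C[OF C(3)]] by blast
    qed
    have low: "?A / C \<le> \<omega> * U + U2"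
    proof -
      have "0 < C0 / \<omega> * (\<omega> * U + U2)" using A2(1) A by linarith
      then have "0 < \<omega> * U + U2" using Cw by (simp add: zero_less_mult_iff del: times_divide_eq_left)
      then have "C0 / \<omega> * (\<omega> * U + U2) \<le> C * (\<omega> * U + U2)" using C(4) by (intro mult_right_mono) auto
      then have "?A \<le> C * (\<omega> * U + U2)" using A2(1) by linarith
      then show ?thesis using C(1) by (simp add: divide_le_eq mult.commute)
    qed
    have up: "\<omega> * U + U2 \<le> C * ?A"
    proof -
      have "C0 * (?\<Psi> * ?A) \<le> C0 * (3 * ?A)" using C0 e2(6) A by (intro mult_left_mono mult_right_mono) auto
      then have "U \<le> 4 * (C0 * ?A)" "U2 \<le> 4 * (C0 * ?A)" using VUR(5,8) e2(1,4) by linarith+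
      then have "\<omega> * U + U2 \<le> \<omega> * (4 * (C0 * ?A)) + 4 * (C0 * ?A)" using \<omega> by (intro add_mono mult_left_mono) auto
      also have "\<dots> = 4 * (\<omega> + 1) * C0 * ?A" by (simp add: algebra_simps)
      also have "\<dots> \<le> C * ?A" using C(5) A by (intro mult_right_mono) auto
      finally show ?thesis .
    qed
    show ?thesis
      unfolding energy_def VUR(1-3) U2_def[symmetric] R2_def[symmetric]
      using e r1 r2 low up d1 A2(1) A cavity.ring_energies(1,2)[OF cav p g ring, folded u_def] ring_weight_eq(1)[OF p ring(1,2)] by blast
  qed
  have second: "\<exists>C>0. \<forall>J \<epsilon> \<tau> N. ring_mesh J \<epsilon> \<tau> N \<longrightarrow> uniformly_orientation_preserving \<kappa> (interpolant J u) (meshed_region J) \<longrightarrow>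
       finite_E2 g (interpolant J u) (meshed_region J) \<and>
       (\<exists>\<eta>. \<bar>\<eta>\<bar> \<le> C * (\<tau> ^ 3 + (\<epsilon> + \<tau>) * \<tau> * (1 / real N ^ 2) + 1 / real N ^ 4) \<and>
            E2 g (interpolant J u) (meshed_region J) = E2 g u (meshed_region J) + \<eta>) \<and>
       (\<exists>\<eta>. \<bar>\<eta>\<bar> \<le> C * (\<tau> ^ 2 + 1 / real N ^ 2 + 1 / real N ^ 4 / \<tau>) \<and>
            energy \<omega> p g (interpolant J u) (meshed_region J) = energy \<omega> p g u (meshed_region J) * (1 + \<eta>))"
    if \<kappa>: "0 < \<kappa>" for \<kappa>
  proof -
    obtain C1 where C1: "0 < C1" and VV: "\<And>J \<epsilon> \<tau> N. ring_mesh J \<epsilon> \<tau> N \<Longrightarrow>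
       uniformly_orientation_preserving \<kappa> (interpolant J u) (meshed_region J) \<Longrightarrow>
       finite_E2 g (interpolant J u) (meshed_region J) \<and>
       \<bar>E2 g (interpolant J u) (meshed_region J) - E2 g u (meshed_region J)\<bar> \<le> C1 * volume_error \<epsilon> \<tau> N"
      using V[OF \<kappa>] by blast
    \<comment> \<open>The first summand comes from the first energy. The second comes from the
      volume energy, by way of \<open>volume_error\<close> <= \<tau>*X and \<tau> <= ring weight/(2
      - p).\<close>
    define k where "k = 2 * \<omega> * C0 + C1 / (2 - p)"
    have k0: "0 < k" using C0 C1 \<omega> p by (simp add: k_def add_pos_pos)
    have kC: "0 < k * (C0 / \<omega>)" using k0 parts(3) by (rule mult_pos_pos)
    define C' where "C' = C1 + k * (C0 / \<omega>)"
    have C': "0 < C'" "C1 \<le> C'" "k * (C0 / \<omega>) \<le> C'" unfolding C'_def using C1 kC by linarith+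
    show ?thesis
    proof (rule exI[of _ C'], intro conjI allI impI C'(1))
      fix J \<epsilon> \<tau> N
      assume J: "ring_mesh J \<epsilon> \<tau> N" and op: "uniformly_orientation_preserving \<kappa> (interpolant J u) (meshed_region J)"
      have ring: "0 < \<epsilon>" "0 < \<tau>" "\<epsilon> + \<tau> \<le> 1" using J by (auto simp: ring_mesh_def)
      note vv = VV[OF J op] and f = first[OF J]
      let ?A = "ring_weight p \<epsilon> \<tau>" and ?\<Psi> = "mesh_error \<epsilon> \<tau> N" and ?v = "volume_error \<epsilon> \<tau> N"
      define X where "X = \<tau> ^ 2 + 1 / real N ^ 2 + 1 / real N ^ 4 / \<tau>"
      show "finite_E2 g (interpolant J u) (meshed_region J)" using vv by blast
      have v0: "0 \<le> ?v" using ring by (simp add: volume_error_def)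
      have "C1 * ?v \<le> C' * ?v" by (rule mult_right_mono[OF C'(2) v0])
      then show "\<exists>\<eta>. \<bar>\<eta>\<bar> \<le> C' * (\<tau> ^ 3 + (\<epsilon> + \<tau>) * \<tau> * (1 / real N ^ 2) + 1 / real N ^ 4) \<and>
            E2 g (interpolant J u) (meshed_region J) = E2 g u (meshed_region J) + \<eta>"
        using vv unfolding volume_error_def
        by (intro exI[of _ "E2 g (interpolant J u) (meshed_region J) - E2 g u (meshed_region J)"]) linarith
      have X0: "0 \<le> X" using ring by (simp add: X_def)
      have \<Psi>X: "?\<Psi> \<le> X"
      proof -
        have "\<epsilon> * (1 / real N ^ 4 / \<tau>) \<le> 1 * (1 / real N ^ 4 / \<tau>)" using ring by (intro mult_right_mono) auto
        then show ?thesis unfolding mesh_error_def X_def by (simp add: mult.commute)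
      qed
      have vX: "?v \<le> \<tau> * X"
      proof -
        have "(\<epsilon> + \<tau>) * (\<tau> * (1 / real N ^ 2)) \<le> 1 * (\<tau> * (1 / real N ^ 2))" using ring by (intro mult_right_mono) auto
        moreover have "\<tau> * X = \<tau> ^ 3 + \<tau> * (1 / real N ^ 2) + 1 / real N ^ 4"
          using ring by (simp add: X_def distrib_left power2_eq_square power3_eq_cube)
        ultimately show ?thesis unfolding volume_error_def by simp
      qed
      have A: "0 < ?A" "(2 - p) * \<tau> \<le> ?A" using f E[OF J \<omega>] by blast+
      then have \<tau>A: "\<tau> \<le> ?A / (2 - p)" using p by (simp add: pos_le_divide_eq mult.commute)
      have "C1 * ?v \<le> C1 * (?A / (2 - p) * X)"
        using C1 vX mult_right_mono[OF \<tau>A X0] by (intro mult_left_mono) auto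
      moreover have "2 * \<omega> * C0 * (?\<Psi> * ?A) \<le> 2 * \<omega> * C0 * (X * ?A)"
        using \<Psi>X \<omega> C0 A by (intro mult_left_mono mult_right_mono) auto
      moreover have "k * (X * ?A) = 2 * \<omega> * C0 * (X * ?A) + C1 * (?A / (2 - p) * X)" by (simp add: k_def algebra_simps)
      ultimately have d: "\<bar>energy \<omega> p g (interpolant J u) (meshed_region J) - energy \<omega> p g u (meshed_region J)\<bar> \<le> k * (X * ?A)"
        unfolding energy_def using vv f by linarith
      have "?A \<le> C0 / \<omega> * energy \<omega> p g u (meshed_region J)" using f by blast
      from relative_error[OF d this A(1) parts(3) less_imp_le[OF k0] X0]
      show "\<exists>\<eta>. \<bar>\<eta>\<bar> \<le> C' * (\<tau> ^ 2 + 1 / real N ^ 2 + 1 / real N ^ 4 / \<tau>) \<and>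
            energy \<omega> p g (interpolant J u) (meshed_region J) = energy \<omega> p g u (meshed_region J) * (1 + \<eta>)"
        using order_trans[OF _ mult_right_mono[OF C'(3) X0]] unfolding X_def by blast
    qed
  qed
  show ?thesis
    unfolding Let_def def_u
  proof (intro conjI)
    show "\<exists>C>0. \<forall>J \<epsilon> \<tau> N. ring_mesh J \<epsilon> \<tau> N \<longrightarrow> finite_E1 p (interpolant J u) (meshed_region J) \<and> finite_E1 p u (meshed_region J) \<and>
        finite_E2 g u (meshed_region J) \<and> finite_E1 p u (ring_region \<epsilon> \<tau>) \<and> finite_E2 g u (ring_region \<epsilon> \<tau>) \<and>
        (\<exists>\<eta>. \<bar>\<eta>\<bar> \<le> C * (\<tau> ^ 2 + 1 / real N ^ 2 + \<epsilon> / \<tau> * (1 / real N ^ 4)) \<and> E1 \<omega> p (interpolant J u) (meshed_region J) = E1 \<omega> p u (meshed_region J) * (1 + \<eta>)) \<and>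
        (\<exists>\<eta>. \<bar>\<eta>\<bar> \<le> C * (\<tau> ^ 2 + 1 / real N ^ 2 + \<epsilon> / \<tau> * (1 / real N ^ 4)) \<and> energy \<omega> p g u (meshed_region J) = energy \<omega> p g u (ring_region \<epsilon> \<tau>) * (1 + \<eta>)) \<and>
        ring_weight p \<epsilon> \<tau> / C \<le> energy \<omega> p g u (meshed_region J) \<and> energy \<omega> p g u (meshed_region J) \<le> C * ring_weight p \<epsilon> \<tau> \<and>
        ring_weight p \<epsilon> \<tau> = (\<epsilon> + \<tau>) powr (2 - p) - \<epsilon> powr (2 - p)"
      using first[unfolded mesh_error_def] C(1) by (intro exI[of _ C]) blast
    show "\<forall>\<kappa>>0. \<exists>C>0. \<forall>J \<epsilon> \<tau> N. ring_mesh J \<epsilon> \<tau> N \<longrightarrow> uniformly_orientation_preserving \<kappa> (interpolant J u) (meshed_region J) \<longrightarrow>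
       finite_E2 g (interpolant J u) (meshed_region J) \<and>
       (\<exists>\<eta>. \<bar>\<eta>\<bar> \<le> C * (\<tau> ^ 3 + (\<epsilon> + \<tau>) * \<tau> * (1 / real N ^ 2) + 1 / real N ^ 4) \<and>
            E2 g (interpolant J u) (meshed_region J) = E2 g u (meshed_region J) + \<eta>) \<and>
       (\<exists>\<eta>. \<bar>\<eta>\<bar> \<le> C * (\<tau> ^ 2 + 1 / real N ^ 2 + 1 / real N ^ 4 / \<tau>) \<and>
            energy \<omega> p g (interpolant J u) (meshed_region J) = energy \<omega> p g u (meshed_region J) * (1 + \<eta>))"
      using second by blast
  qed
qed

end
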